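(* Let $\mathbb{H}=\{(z_1,z_2)\in\mathbb{C}^2 : |z_1|<|z_2|<1\}$ be the Hartogs triangle and let $\mathcal{B}$ be its Bergman projection. For each integer $k\ge 0$ and each $p\in(4/3,4)$, $\mathcal{B}$ maps $W^{k,p}(\mathbb{H})$ continuously into $W^{k,p}(\mathbb{H},\delta^{kp})$; that is, there exists a constant $C_{k,p}>0$ such that $$\|\mathcal{B}(f)\|_{k,p,kp}\le C_{k,p}\,\|f\|_{k,p}$$ for every $f\in W^{k,p}(\mathbb{H})$.
   Context: The Bergman projection of $\mathbb{H}$ is the orthogonal projection $\mathcal{B}:L^2(\mathbb{H})\to A^2(\mathbb{H})$ onto the closed subspace $A^2(\mathbb{H})$ of square integrable holomorphic functions. It has the integral representation $\mathcal{B}(f)(z)=\int_{\mathbb{H}}B(z,\zeta)f(\zeta)\,d\zeta$, where $B$ is the Bergman kernel of $\mathbb{H}$ and $d\zeta$ is Lebesgue measure. For $f\in L^p(\mathbb{H})$ with $p\in(4/3,4)$, $\mathcal{B}(f)$ is understood as given by this same integral formula. For an integer $k\ge 0$, $s\in\mathbb{R}$ and $p\in(1,\infty)$, the weighted Sobolev space is $$W^{k,p}(\mathbb{H},\delta^{s})=\{f\in L^1_{\mathrm{loc}}(\mathbb{H}) : \|f\|_{k,p,s}<\infty\},\qquad \delta(z)=|z_2|,$$ with norm $$\|f\|_{k,p,s}=\Big(\int_{\mathbb{H}}\sum_{|\alpha|\le k}|D^{\alpha}_{z,\overline z}(f)(z)|^p\,|z_2|^s\,dz\Big)^{1/p},$$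 where $\alpha=(\alpha_1,\alpha_2,\alpha_3,\alpha_4)$ runs over multi-indices of nonnegative integers with $|\alpha|\le k$, $dz$ is Lebesgue measure, and $$D^{\alpha}_{z,\overline z}=\frac{\partial^{|\alpha|}}{\partial z_1^{\alpha_1}\partial z_2^{\alpha_2}\partial\overline z_1^{\alpha_3}\partial\overline z_2^{\alpha_4}}$$ (derivatives taken in the weak sense). The unweighted Sobolev space $W^{k,p}(\mathbb{H})$ is the case $s=0$, with norm $$\|f\|_{k,p}=\Big(\int_{\mathbb{H}}\sum_{|\alpha|\le k}|D^{\alpha}_{z,\overline z}(f)(z)|^p\,dz\Big)^{1/p}.$$ *)

theory Defs
  imports "HOL-Analysis.Analysis"
begin

definition hartogs_triangle :: "(complex \<times> complex) set" where
  "hartogs_triangle = {(z1, z2). cmod z1 < cmod z2 \<and> cmod z2 < 1}"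


section \<open>Bergman projection\<close>

text \<open>Holomorphy on an open subset of \<open>\<complex>\<^sup>2\<close>: a complex-linear derivative exists at every point.\<close>

definition holomorphic2_on :: "(complex \<times> complex \<Rightarrow> complex) \<Rightarrow> (complex \<times> complex) set \<Rightarrow> bool" where
  "holomorphic2_on f \<Omega> \<longleftrightarrow>
     (\<forall>z\<in>\<Omega>. \<exists>a b. (f has_derivative (\<lambda>h. a * fst h + b * snd h)) (at z))"

definition L2_space :: "(complex \<times> complex) set \<Rightarrow> (complex \<times> complex \<Rightarrow> complex) set" where
  "L2_space \<Omega> = {f. f \<in> borel_measurable (lebesgue_on \<Omega>) \<and>
                    integrable (lebesgue_on \<Omega>) (\<lambda>z. (cmod (f z))\<^sup>2)}"

definition bergman_space :: "(complex \<times> complex) set \<Rightarrow> (complex \<times> complex \<Rightarrow> complex) set" where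
  "bergman_space \<Omega> = {f \<in> L2_space \<Omega>. holomorphic2_on f \<Omega>}"

definition is_bergman_orthogonal_projection ::
  "(complex \<times> complex) set \<Rightarrow> (complex \<times> complex \<Rightarrow> complex) \<Rightarrow> (complex \<times> complex \<Rightarrow> complex) \<Rightarrow> bool" where
  "is_bergman_orthogonal_projection \<Omega> f g \<longleftrightarrow>
     g \<in> bergman_space \<Omega> \<and>
     (\<forall>h\<in>bergman_space \<Omega>. (LINT \<zeta>|lebesgue_on \<Omega>. (f \<zeta> - g \<zeta>) * cnj (h \<zeta>)) = 0)"

text \<open>The Bergman kernel is the integral kernel of the orthogonal projection of \<open>L\<^sup>2(\<Omega>)\<close> onto
  \<open>A\<^sup>2(\<Omega>)\<close> whose conjugate lies in \<open>A\<^sup>2(\<Omega>)\<close> in the second variable. Elements of \<open>A\<^sup>2(\<Omega>)\<close> are their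
  own projections, so this includes the reproducing property and determines the kernel on
  \<open>\<Omega> \<times> \<Omega>\<close>; the normalisation to zero elsewhere makes it unique as a total function.\<close>

definition bergman_kernel ::
  "(complex \<times> complex) set \<Rightarrow> complex \<times> complex \<Rightarrow> complex \<times> complex \<Rightarrow> complex" where
  "bergman_kernel \<Omega> = (THE K.
     (\<forall>z \<zeta>. z \<notin> \<Omega> \<or> \<zeta> \<notin> \<Omega> \<longrightarrow> K z \<zeta> = 0) \<and>
     (\<forall>z\<in>\<Omega>. (\<lambda>\<zeta>. cnj (K z \<zeta>)) \<in> bergman_space \<Omega>) \<and>
     (\<forall>f\<in>L2_space \<Omega>. \<forall>g. is_bergman_orthogonal_projection \<Omega> f g \<longrightarrow>
        (\<forall>z\<in>\<Omega>. g z = (LINT \<zeta>|lebesgue_on \<Omega>. K z \<zeta> * f \<zeta>))))"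

definition bergman_projection ::
  "(complex \<times> complex) set \<Rightarrow> (complex \<times> complex \<Rightarrow> complex) \<Rightarrow> complex \<times> complex \<Rightarrow> complex" where
  "bergman_projection \<Omega> f z = (LINT \<zeta>|lebesgue_on \<Omega>. bergman_kernel \<Omega> z \<zeta> * f \<zeta>)"


section \<open>Weak Wirtinger derivatives\<close>

primrec continuously_differentiable ::
  "nat \<Rightarrow> ('a::real_normed_vector \<Rightarrow> 'b::real_normed_vector) \<Rightarrow> bool" where
  "continuously_differentiable 0 f = continuous_on UNIV f"
| "continuously_differentiable (Suc n) f =
     ((\<forall>x. f differentiable (at x)) \<and>
      (\<forall>v. continuously_differentiable n (\<lambda>x. frechet_derivative f (at x) v)))"

definition test_function :: "(complex \<times> complex) set \<Rightarrow> (complex \<times> complex \<Rightarrow> complex) \<Rightarrow> bool" where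
  "test_function \<Omega> \<phi> \<longleftrightarrow>
     (\<forall>n. continuously_differentiable n \<phi>) \<and>
     compact (closure {z. \<phi> z \<noteq> 0}) \<and> closure {z. \<phi> z \<noteq> 0} \<subseteq> \<Omega>"

text \<open>For a coordinate direction \<open>e\<close>, i.e. \<open>(1, 0)\<close> or \<open>(0, 1)\<close>, the following are
  \<open>(\<partial>\<^sub>x - \<i> \<partial>\<^sub>y) / 2\<close> and \<open>(\<partial>\<^sub>x + \<i> \<partial>\<^sub>y) / 2\<close> in the corresponding complex coordinate.\<close>

definition wirtinger ::
  "complex \<times> complex \<Rightarrow> (complex \<times> complex \<Rightarrow> complex) \<Rightarrow> complex \<times> complex \<Rightarrow> complex" where
  "wirtinger e \<phi> z =
     (frechet_derivative \<phi> (at z) e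
      - \<i> * frechet_derivative \<phi> (at z) (\<i> * fst e, \<i> * snd e)) / 2"

definition wirtinger_bar ::
  "complex \<times> complex \<Rightarrow> (complex \<times> complex \<Rightarrow> complex) \<Rightarrow> complex \<times> complex \<Rightarrow> complex" where
  "wirtinger_bar e \<phi> z =
     (frechet_derivative \<phi> (at z) e
      + \<i> * frechet_derivative \<phi> (at z) (\<i> * fst e, \<i> * snd e)) / 2"

type_synonym multi_index = "nat \<times> nat \<times> nat \<times> nat"

fun multi_order :: "multi_index \<Rightarrow> nat" where
  "multi_order (a1, a2, a3, a4) = a1 + a2 + a3 + a4"

fun wirtinger_deriv ::
  "multi_index \<Rightarrow> (complex \<times> complex \<Rightarrow> complex) \<Rightarrow> complex \<times> complex \<Rightarrow> complex" where
  "wirtinger_deriv (a1, a2, a3, a4) \<phi> =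
     (wirtinger (1, 0) ^^ a1) ((wirtinger (0, 1) ^^ a2)
       ((wirtinger_bar (1, 0) ^^ a3) ((wirtinger_bar (0, 1) ^^ a4) \<phi>)))"

definition L1_loc :: "(complex \<times> complex) set \<Rightarrow> (complex \<times> complex \<Rightarrow> complex) set" where
  "L1_loc \<Omega> = {f. \<forall>K. compact K \<and> K \<subseteq> \<Omega> \<longrightarrow> f absolutely_integrable_on K}"

definition has_weak_deriv ::
  "(complex \<times> complex) set \<Rightarrow> multi_index \<Rightarrow> (complex \<times> complex \<Rightarrow> complex)
     \<Rightarrow> (complex \<times> complex \<Rightarrow> complex) \<Rightarrow> bool" where
  "has_weak_deriv \<Omega> \<alpha> f g \<longleftrightarrow>
     g \<in> L1_loc \<Omega> \<and>
     (\<forall>\<phi>. test_function \<Omega> \<phi> \<longrightarrow>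
        (LINT z|lebesgue_on \<Omega>. f z * wirtinger_deriv \<alpha> \<phi> z)
        = (-1) ^ multi_order \<alpha> * (LINT z|lebesgue_on \<Omega>. g z * \<phi> z))"

text \<open>Weak derivatives are unique only up to null sets; the norm below does not depend on the choice.\<close>

definition weak_deriv ::
  "(complex \<times> complex) set \<Rightarrow> multi_index \<Rightarrow> (complex \<times> complex \<Rightarrow> complex)
     \<Rightarrow> complex \<times> complex \<Rightarrow> complex" where
  "weak_deriv \<Omega> \<alpha> f = (SOME g. has_weak_deriv \<Omega> \<alpha> f g)"


section \<open>Sobolev spaces with weight \<open>\<bar>z\<^sub>2\<bar>\<^sup>s\<close>\<close>

text \<open>The unweighted case is \<open>s = 0\<close>. In Isabelle \<open>0 powr 0 = 0\<close>, which is harmless on domains such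
  as the Hartogs triangle, where \<open>z\<^sub>2 \<noteq> 0\<close>.\<close>

definition sobolev_integral ::
  "(complex \<times> complex) set \<Rightarrow> nat \<Rightarrow> real \<Rightarrow> real \<Rightarrow> (complex \<times> complex \<Rightarrow> complex) \<Rightarrow> ennreal" where
  "sobolev_integral \<Omega> k p s f =
     (\<integral>\<^sup>+ z. ennreal ((\<Sum>\<alpha> | multi_order \<alpha> \<le> k. cmod (weak_deriv \<Omega> \<alpha> f z) powr p)
                     * cmod (snd z) powr s) \<partial>lebesgue_on \<Omega>)"

definition sobolev_space ::
  "(complex \<times> complex) set \<Rightarrow> nat \<Rightarrow> real \<Rightarrow> real \<Rightarrow> (complex \<times> complex \<Rightarrow> complex) set" where
  "sobolev_space \<Omega> k p s =
     {f \<in> L1_loc \<Omega>. (\<forall>\<alpha>. multi_order \<alpha> \<le> k \<longrightarrow> (\<exists>g. has_weak_deriv \<Omega> \<alpha> f g))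
                   \<and> sobolev_integral \<Omega> k p s f < \<infinity>}"

definition sobolev_norm ::
  "(complex \<times> complex) set \<Rightarrow> nat \<Rightarrow> real \<Rightarrow> real \<Rightarrow> (complex \<times> complex \<Rightarrow> complex) \<Rightarrow> real" where
  "sobolev_norm \<Omega> k p s f = enn2real (sobolev_integral \<Omega> k p s f) powr (1 / p)"

lemma finite_multi_order_le: "finite {\<alpha>. multi_order \<alpha> \<le> k}"
  by (rule finite_subset[of _ "{..k} \<times> {..k} \<times> {..k} \<times> {..k}"]) auto

end

theory Submission
  imports Defs "HOL-Complex_Analysis.Complex_Analysis"
begin

text \<open>The Bergman kernel of the Hartogs triangle \<open>\<H>\<close> is explicit. In the fibre coordinates
  \<open>w = z\<^sub>1 / z\<^sub>2\<close> and \<open>t = z\<^sub>2\<close> the triangle becomes a product of the unit disc and the punctured unit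
  disc with volume element \<open>\<bar>t\<bar>\<^sup>2\<close>, so \<open>f \<mapsto> t f(w t, t)\<close> carries \<open>A\<^sup>2(\<H>)\<close> to square integrable
  holomorphic functions on this product. Square integrability removes the puncture, and the
  product of two disc kernels gives
  \<open>B(z, \<zeta>) = y / (\<pi>\<^sup>2 (y - x)\<^sup>2 (1 - y)\<^sup>2)\<close> with \<open>x = z\<^sub>1 \<zeta>\<^sub>1\<^sup>*\<close>, \<open>y = z\<^sub>2 \<zeta>\<^sub>2\<^sup>*\<close>, where \<open>*\<close> stands for
  complex conjugation (\<open>hartogs_kernel_reproducing\<close>, \<open>bergman_kernel_hartogs\<close>).

The case \<open>k = 0\<close> is Schur's test. The weight
  \<open>\<Theta>(z) = (\<bar>z\<^sub>2\<bar>\<^sup>2 - \<bar>z\<^sub>1\<bar>\<^sup>2) (1 - \<bar>z\<^sub>2\<bar>\<^sup>2) \<bar>z\<^sub>2\<bar>\<^sup>2\<close> satisfies \<open>\<integral> \<bar>B(z, \<zeta>)\<bar> \<Theta>(\<zeta>)\<^sup>-\<^sup>r d\<zeta> \<le> C \<Theta>(z)\<^sup>-\<^sup>r\<close> for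
  \<open>1/4 < r < 3/4\<close> (\<open>hartogs_Schur\<close>). Schur's test needs this for \<open>r = 1/p\<close> and \<open>r = 1 - 1/p\<close>, and both
  lie in that interval exactly when \<open>4/3 < p < 4\<close>.

For derivatives, let \<open>T\<^sub>j = \<zeta>\<^sub>j \<partial>\<^sub>j - \<zeta>\<^sub>j\<^sup>* \<partial>\<^sub>j\<^sup>*\<close> be the field that generates the rotations of the
  \<open>j\<close>-th coordinate. The kernel depends on \<open>\<zeta>\<close> through \<open>z\<^sub>j \<zeta>\<^sub>j\<^sup>*\<close> only, so \<open>z\<^sub>j \<partial>/\<partial>z\<^sub>j\<close> acts on it
  as \<open>-T\<^sub>j\<close> does in \<open>\<zeta>\<close>. The fields \<open>T\<^sub>j\<close> are tangential to the boundary of the triangle: they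
  annihilate cutoff functions that depend on \<open>\<bar>\<zeta>\<^sub>1\<bar>\<close> and \<open>\<bar>\<zeta>\<^sub>2\<bar>\<close> only, and so they can be moved from
  the kernel onto \<open>f\<close> by integration by parts without boundary terms, although \<open>f\<close> has no
  boundary values. Hence \<open>z\<^sub>1\<^sup>a z\<^sub>2\<^sup>b \<partial>\<^sub>1\<^sup>a \<partial>\<^sub>2\<^sup>b \<B>(f) = \<B>(G)\<close>, where \<open>G\<close> combines weak derivatives of \<open>f\<close> up
  to order \<open>a + b\<close> with bounded coefficients (\<open>weighted_derivative_eq_projection\<close>), and the case
  \<open>k = 0\<close> bounds the left side in \<open>L\<^sup>p\<close>.

The weight in the theorem allows the factor \<open>z\<^sub>2\<^sup>a\<^sup>+\<^sup>b\<close> but not \<open>z\<^sub>1\<^sup>a = w\<^sup>a z\<^sub>2\<^sup>a\<close>. On each fibre \<open>t\<close> the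
  function \<open>w \<mapsto> \<partial>\<^sub>1\<^sup>a \<partial>\<^sub>2\<^sup>b \<B>(f)(w t, t)\<close> is holomorphic in the unit disc, and dividing such a function
  by \<open>w\<^sup>a\<close> costs a constant only: near \<open>w = 0\<close> the Cauchy formula recovers it from its values on an
  annulus on which \<open>\<bar>w\<bar>\<close> is bounded below (\<open>hartogs_fibre_division\<close>). Derivatives in the conjugate
  variables vanish since \<open>\<B>(f)\<close> is holomorphic, and all derivatives of \<open>\<B>(f)\<close> are identified as
  integrals of \<open>f\<close> against derivatives of the kernel (\<open>projection_weak_deriv\<close>).\<close>

section \<open>Lebesgue measure on the complex plane in polar form\<close>

text \<open>Fubini's theorem for the two real coordinates of a complex variable starts from this
  description of Lebesgue measure.\<close>

lemma lborel_complex_eq_distr: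
  "(lborel :: complex measure) = distr (lborel \<Otimes>\<^sub>M lborel) borel (\<lambda>p. of_real (fst p) + \<i> * of_real (snd p))"
proof (rule lborel_eqI)
  fix l u :: complex
  assume lu: "\<And>b. b \<in> Basis \<Longrightarrow> l \<bullet> b \<le> u \<bullet> b"
  have le: "Re l \<le> Re u" "Im l \<le> Im u"
    using lu[of 1] lu[of \<i>] by (auto simp: Basis_complex_def)
  have "emeasure (distr (lborel \<Otimes>\<^sub>M lborel) borel (\<lambda>p. complex_of_real (fst p) + \<i> * of_real (snd p))) (box l u)
     = emeasure (lborel \<Otimes>\<^sub>M lborel) ((\<lambda>p. complex_of_real (fst p) + \<i> * of_real (snd p)) -` box l u \<inter> space (lborel \<Otimes>\<^sub>M lborel))"
    by (subst emeasure_distr) (auto simp: measurable_pair_measure_countable1)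
  also have "(\<lambda>p. complex_of_real (fst p) + \<i> * of_real (snd p)) -` box l u \<inter> space (lborel \<Otimes>\<^sub>M lborel)
      = {Re l<..<Re u} \<times> {Im l<..<Im u}"
    by (auto simp: space_pair_measure mem_box Basis_complex_def)
  also have "emeasure (lborel \<Otimes>\<^sub>M lborel) ({Re l<..<Re u} \<times> {Im l<..<Im u}) = ennreal (Re u - Re l) * ennreal (Im u - Im l)"
    using le by (subst lborel.emeasure_pair_measure_Times) auto
  also have "\<dots> = ennreal (\<Prod>b\<in>Basis. (u - l) \<bullet> b)"
    using le by (simp add: Basis_complex_def ennreal_mult)
  finally show "emeasure (distr (lborel \<Otimes>\<^sub>M lborel) borel (\<lambda>p. complex_of_real (fst p) + \<i> * of_real (snd p))) (box l u)
     = ennreal (\<Prod>b\<in>Basis. (u - l) \<bullet> b)" .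
qed auto

lemma nn_integral_complex_iterated:
  fixes F :: "complex \<Rightarrow> ennreal"
  assumes [measurable]: "F \<in> borel_measurable borel"
  shows "(\<integral>\<^sup>+z. F z \<partial>lborel) = (\<integral>\<^sup>+y. \<integral>\<^sup>+x. F (of_real x + \<i> * of_real y) \<partial>lborel \<partial>lborel)"
    and "(\<integral>\<^sup>+z. F z \<partial>lborel) = (\<integral>\<^sup>+x. \<integral>\<^sup>+y. F (of_real x + \<i> * of_real y) \<partial>lborel \<partial>lborel)"
proof -
  have *: "(\<integral>\<^sup>+z. F z \<partial>lborel) = (\<integral>\<^sup>+p. F (of_real (fst p) + \<i> * of_real (snd p)) \<partial>(lborel \<Otimes>\<^sub>M lborel))"
    by (subst lborel_complex_eq_distr, subst nn_integral_distr) auto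
  show "(\<integral>\<^sup>+z. F z \<partial>lborel) = (\<integral>\<^sup>+y. \<integral>\<^sup>+x. F (of_real x + \<i> * of_real y) \<partial>lborel \<partial>lborel)"
    unfolding * by (subst lborel_pair.nn_integral_snd[symmetric]) (auto simp: split_beta')
  show "(\<integral>\<^sup>+z. F z \<partial>lborel) = (\<integral>\<^sup>+x. \<integral>\<^sup>+y. F (of_real x + \<i> * of_real y) \<partial>lborel \<partial>lborel)"
    unfolding * by (subst lborel.nn_integral_fst[symmetric]) (auto simp: split_beta')
qed

text \<open>Multiplication by \<open>a + \<i> b\<close> with \<open>a \<noteq> 0\<close> is a composition of two shears and scalings, each acting
  on one real coordinate, with scaling factors \<open>a\<close> and \<open>(a\<^sup>2 + b\<^sup>2) / a\<close>.\<close>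

lemma nn_integral_complex_mult_aux:
  fixes F :: "complex \<Rightarrow> ennreal"
  assumes [measurable]: "F \<in> borel_measurable borel" and c: "Re c \<noteq> 0"
  shows "ennreal ((cmod c)\<^sup>2) * (\<integral>\<^sup>+z. F (c * z) \<partial>lborel) = (\<integral>\<^sup>+z. F z \<partial>lborel)"
proof -
  define a b where "a = Re c" and "b = Im c"
  have a: "a \<noteq> 0" and cab: "c = of_real a + \<i> * of_real b" using c by (auto simp: a_def b_def complex_eq_iff)
  \<comment> \<open>the scaling factor of the second shear, acting on the imaginary part\<close>
  define s where "s = (a\<^sup>2 + b\<^sup>2) / a"
  have s: "s \<noteq> 0" using a by (auto simp: s_def sum_power2_eq_zero_iff)
  have "ennreal \<bar>a\<bar> * (\<integral>\<^sup>+z. F (c * z) \<partial>lborel)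
    = (\<integral>\<^sup>+y. ennreal \<bar>a\<bar> * (\<integral>\<^sup>+x. F (c * (of_real x + \<i> * of_real y)) \<partial>lborel) \<partial>lborel)"
    by (subst nn_integral_complex_iterated(1)) (auto simp: nn_integral_cmult)
  also have "\<dots> = (\<integral>\<^sup>+y. (\<integral>\<^sup>+x. F (of_real x + \<i> * of_real (b / a * x + s * y)) \<partial>lborel) \<partial>lborel)"
  proof (intro nn_integral_cong)
    fix y :: real
    have "(\<integral>\<^sup>+x. F (of_real x + \<i> * of_real (b / a * x + s * y)) \<partial>lborel)
      = ennreal \<bar>a\<bar> * (\<integral>\<^sup>+x. F (of_real (- b * y + a * x) + \<i> * of_real (b / a * (- b * y + a * x) + s * y)) \<partial>lborel)"
      using a by (subst nn_integral_real_affine[where c=a and t="- b * y"]) auto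
    also have "(\<lambda>x. complex_of_real (- b * y + a * x) + \<i> * of_real (b / a * (- b * y + a * x) + s * y))
       = (\<lambda>x. c * (of_real x + \<i> * of_real y))"
      using a by (auto simp: fun_eq_iff complex_eq_iff cab s_def field_simps power2_eq_square)
    finally show "ennreal \<bar>a\<bar> * (\<integral>\<^sup>+x. F (c * (of_real x + \<i> * of_real y)) \<partial>lborel) =
      (\<integral>\<^sup>+x. F (of_real x + \<i> * of_real (b / a * x + s * y)) \<partial>lborel)" by (simp add: fun_eq_iff)
  qed
  also have "\<dots> = (\<integral>\<^sup>+x. (\<integral>\<^sup>+y. F (of_real x + \<i> * of_real (b / a * x + s * y)) \<partial>lborel) \<partial>lborel)"
    by (rule lborel_pair.Fubini') (auto simp: split_beta')
  finally have 1: "ennreal \<bar>a\<bar> * (\<integral>\<^sup>+z. F (c * z) \<partial>lborel)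
      = (\<integral>\<^sup>+x. (\<integral>\<^sup>+y. F (of_real x + \<i> * of_real (b / a * x + s * y)) \<partial>lborel) \<partial>lborel)" .
  have "ennreal \<bar>s\<bar> * \<dots> = (\<integral>\<^sup>+x. ennreal \<bar>s\<bar> * (\<integral>\<^sup>+y. F (of_real x + \<i> * of_real (b / a * x + s * y)) \<partial>lborel) \<partial>lborel)"
    by (auto simp: nn_integral_cmult)
  also have "\<dots> = (\<integral>\<^sup>+x. \<integral>\<^sup>+y. F (of_real x + \<i> * of_real y) \<partial>lborel \<partial>lborel)"
  proof (intro nn_integral_cong)
    fix x :: real
    show "ennreal \<bar>s\<bar> * (\<integral>\<^sup>+y. F (of_real x + \<i> * of_real (b / a * x + s * y)) \<partial>lborel)
       = (\<integral>\<^sup>+y. F (of_real x + \<i> * of_real y) \<partial>lborel)"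
      using s by (subst (2) nn_integral_real_affine[where c=s and t="b / a * x"]) auto
  qed
  also have "\<dots> = (\<integral>\<^sup>+z. F z \<partial>lborel)"
    by (rule nn_integral_complex_iterated(2)[symmetric]) simp
  finally have "ennreal \<bar>s\<bar> * (ennreal \<bar>a\<bar> * (\<integral>\<^sup>+z. F (c * z) \<partial>lborel)) = (\<integral>\<^sup>+z. F z \<partial>lborel)"
    unfolding 1 .
  moreover have "\<bar>s\<bar> * \<bar>a\<bar> = (cmod c)\<^sup>2"
    using a by (simp add: s_def cab cmod_power2)
  ultimately show ?thesis
    by (simp add: mult.assoc[symmetric] ennreal_mult[symmetric])
qed

lemma nn_integral_complex_mult:
  fixes F :: "complex \<Rightarrow> ennreal"
  assumes [measurable]: "F \<in> borel_measurable borel" and c: "c \<noteq> 0"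
  shows "ennreal ((cmod c)\<^sup>2) * (\<integral>\<^sup>+z. F (c * z) \<partial>lborel) = (\<integral>\<^sup>+z. F z \<partial>lborel)"
proof (cases "Re c = 0")
  case False then show ?thesis by (intro nn_integral_complex_mult_aux) auto
next
  case True
  \<comment> \<open>a purely imaginary number is the product of \<open>1 + \<i>\<close> and a number \<open>d\<close> with nonzero real part\<close>
  define d where "d = of_real (Im c) * (1 + \<i>) / 2"
  have dc: "c = (1 + \<i>) * d" using True by (auto simp: d_def complex_eq_iff)
  have d: "Re d \<noteq> 0" using c True by (auto simp: d_def complex_eq_iff)
  have "ennreal ((cmod d)\<^sup>2) * (\<integral>\<^sup>+z. F ((1 + \<i>) * (d * z)) \<partial>lborel) = (\<integral>\<^sup>+z. F ((1 + \<i>) * z) \<partial>lborel)"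
    by (rule nn_integral_complex_mult_aux[where F="\<lambda>z. F ((1 + \<i>) * z)"]) (use d in auto)
  moreover have "ennreal ((cmod (1 + \<i>))\<^sup>2) * (\<integral>\<^sup>+z. F ((1 + \<i>) * z) \<partial>lborel) = (\<integral>\<^sup>+z. F z \<partial>lborel)"
    by (rule nn_integral_complex_mult_aux) auto
  ultimately have "ennreal ((cmod (1 + \<i>))\<^sup>2) * (ennreal ((cmod d)\<^sup>2) * (\<integral>\<^sup>+z. F ((1 + \<i>) * (d * z)) \<partial>lborel))
    = (\<integral>\<^sup>+z. F z \<partial>lborel)" by simp
  then show ?thesis
    by (simp only: mult.assoc[symmetric] ennreal_mult[symmetric] zero_le_power2 norm_mult power_mult_distrib dc)
qed

lemma distr_lborel_rotation:
  assumes "cmod c = 1" shows "distr lborel borel (\<lambda>z. c * z) = (lborel :: complex measure)"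
proof (rule measure_eqI)
  fix A assume "A \<in> sets (distr lborel borel (\<lambda>z. c * z))"
  then have A[measurable]: "A \<in> sets borel" by simp
  have c0: "c \<noteq> 0" using assms by auto
  have "emeasure (distr lborel borel (\<lambda>z. c * z)) A = (\<integral>\<^sup>+z. indicator A z \<partial>distr lborel borel (\<lambda>z. c * z))"
    by (subst nn_integral_indicator) auto
  also have "\<dots> = (\<integral>\<^sup>+z. indicator A (c * z) \<partial>lborel)"
    by (subst nn_integral_distr) auto
  also have "\<dots> = (\<integral>\<^sup>+z. indicator A z \<partial>lborel)"
    using nn_integral_complex_mult[of "indicator A" c] assms c0 by simp
  finally show "emeasure (distr lborel borel (\<lambda>z. c * z)) A = emeasure lborel A" by simp
qed simp

text \<open>Averages over the unit circle are integrals over the parameter in the unit interval; they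
  replace the angular integral of polar coordinates.\<close>

definition circle_param :: "real \<Rightarrow> complex" where
  "circle_param t = exp (2 * of_real pi * \<i> * of_real t)"

abbreviation unit_interval :: "real measure" where
  "unit_interval \<equiv> restrict_space lborel {0..1}"

lemma prob_space_unit_interval: "finite_measure unit_interval" "emeasure unit_interval (space unit_interval) = 1"
  by (auto intro!: finite_measureI simp: emeasure_restrict_space space_restrict_space)

interpretation unit_interval: finite_measure unit_interval
  by (rule prob_space_unit_interval)

interpretation pair_unit_interval: pair_sigma_finite "lborel :: complex measure" unit_interval
  ..

lemma circle_param_measurable[measurable]: "circle_param \<in> borel_measurable borel"
  unfolding circle_param_def by measurable

lemma circle_param_measurable'[measurable]: "circle_param \<in> borel_measurable unit_interval"
  by (intro measurable_restrict_space1) simp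

lemma norm_circle_param[simp]: "cmod (circle_param t) = 1"
  by (simp add: circle_param_def norm_exp_eq_Re)

lemma circle_param_nonzero[simp]: "circle_param t \<noteq> 0"
  by (simp add: circle_param_def)

text \<open>Rotations preserve Lebesgue measure, so each of them may be applied to the integrand, and
  the average over all of them is the angular part of polar coordinates.\<close>

lemma nn_integral_rotation_average:
  fixes F :: "complex \<Rightarrow> ennreal"
  assumes [measurable]: "F \<in> borel_measurable borel"
  shows "(\<integral>\<^sup>+z. F z \<partial>lborel) = (\<integral>\<^sup>+z. (\<integral>\<^sup>+t. F (circle_param t * z) \<partial>unit_interval) \<partial>lborel)"
proof -
  have "(\<integral>\<^sup>+z. F z \<partial>lborel) = (\<integral>\<^sup>+t. (\<integral>\<^sup>+z. F z \<partial>lborel) \<partial>unit_interval)"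
    using prob_space_unit_interval(2) by simp
  also have "\<dots> = (\<integral>\<^sup>+t. (\<integral>\<^sup>+z. F (circle_param t * z) \<partial>lborel) \<partial>unit_interval)"
  proof (rule nn_integral_cong)
    fix t
    show "(\<integral>\<^sup>+z. F z \<partial>lborel) = (\<integral>\<^sup>+z. F (circle_param t * z) \<partial>lborel)"
      using nn_integral_distr[of "\<lambda>z. circle_param t * z" lborel borel F] by (simp add: distr_lborel_rotation)
  qed
  also have "\<dots> = (\<integral>\<^sup>+z. (\<integral>\<^sup>+t. F (circle_param t * z) \<partial>unit_interval) \<partial>lborel)"
    by (rule pair_unit_interval.Fubini') (auto simp: split_beta')
  finally show ?thesis .
qed

lemma integral_rotation_average:
  fixes F :: "complex \<Rightarrow> complex"
  assumes int: "integrable lborel F"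
  shows "(LINT z|lborel. F z) = (LINT z|lborel. (LINT t|unit_interval. F (circle_param t * z)))"
proof -
  have [measurable]: "F \<in> borel_measurable borel" using int by auto
  have int2: "integrable (lborel \<Otimes>\<^sub>M unit_interval) (\<lambda>(z, t). F (circle_param t * z))"
  proof (rule integrableI_bounded)
    have "(\<integral>\<^sup>+x. ennreal (norm (case x of (z, t) \<Rightarrow> F (circle_param t * z))) \<partial>(lborel \<Otimes>\<^sub>M unit_interval))
       = (\<integral>\<^sup>+z. (\<integral>\<^sup>+t. ennreal (norm (F (circle_param t * z))) \<partial>unit_interval) \<partial>lborel)"
      by (subst unit_interval.nn_integral_fst[symmetric]) (auto simp: split_beta')
    also have "\<dots> = (\<integral>\<^sup>+z. ennreal (norm (F z)) \<partial>lborel)"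
      by (rule nn_integral_rotation_average[symmetric]) simp
    also have "\<dots> < \<infinity>" using int by (auto simp: integrable_iff_bounded)
    finally show "(\<integral>\<^sup>+x. ennreal (norm (case x of (z, t) \<Rightarrow> F (circle_param t * z))) \<partial>(lborel \<Otimes>\<^sub>M unit_interval)) < \<infinity>" .
  qed (auto simp: split_beta')
  have "(LINT z|lborel. F z) = (LINT t|unit_interval. (LINT z|lborel. F z))"
    using prob_space_unit_interval by (simp add: measure_def)
  also have "\<dots> = (LINT t|unit_interval. (LINT z|lborel. F (circle_param t * z)))"
  proof (rule Bochner_Integration.integral_cong[OF refl])
    fix t
    show "(LINT z|lborel. F z) = (LINT z|lborel. F (circle_param t * z))"
      using integral_distr[of "\<lambda>z. circle_param t * z" lborel borel F] by (simp add: distr_lborel_rotation)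
  qed
  also have "\<dots> = (LINT z|lborel. (LINT t|unit_interval. F (circle_param t * z)))"
    by (rule pair_unit_interval.Fubini_integral[OF int2])
  finally show ?thesis .
qed

text \<open>This turns averages over the circle into contour integrals, which Cauchy's theorem evaluates.\<close>

lemma circle_average_contour:
  assumes cont: "continuous_on (sphere 0 1) g"
    and I: "((\<lambda>u. g u / u) has_contour_integral 2 * of_real pi * \<i> * A) (circlepath 0 1)"
  shows "(LINT t|unit_interval. g (circle_param t)) = A"
proof -
  have "continuous_on {0..1} circle_param"
    unfolding circle_param_def by (intro continuous_intros)
  then have ct: "continuous_on {0..1} (\<lambda>t. g (circle_param t))"
    by (intro continuous_on_compose2[OF cont]) auto
  have "((\<lambda>t. g (circle_param t)) has_integral A) {0..1}"
  proof -
    have "((\<lambda>x. (g (circle_param x) / circle_param x) * (2 * pi * \<i> * circle_param x)) has_integral 2 * of_real pi * \<i> * A) {0..1}"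
      using I unfolding has_contour_integral_def
      by (rule has_integral_eq[rotated])
         (simp add: vector_derivative_circlepath01, simp add: circle_param_def circlepath algebra_simps)
    then have "((\<lambda>x. (1 / (2 * pi * \<i>)) * ((g (circle_param x) / circle_param x) * (2 * pi * \<i> * circle_param x)))
       has_integral (1 / (2 * pi * \<i>)) * (2 * of_real pi * \<i> * A)) {0..1}"
      by (rule has_integral_mult_right)
    then show ?thesis by (simp)
  qed
  then have 1: "integral {0..1} (\<lambda>t. g (circle_param t)) = A" by (rule integral_unique)
  have "set_integrable lborel {0..1} (\<lambda>t. g (circle_param t))"
    unfolding set_integrable_def
    by (rule borel_integrable_compact) (auto intro: ct)
  from set_borel_integral_eq_integral(2)[OF this] 1
  have "(LINT t:{0..1}|lborel. g (circle_param t)) = A" by simp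
  then show ?thesis
    by (subst integral_restrict_space) (auto simp: set_lebesgue_integral_def)
qed

text \<open>The area of the part of the disc outside the circle of radius \<open>\<surd>x\<close> is \<open>\<pi> (1 - x)\<close>. Hence the squared modulus
  has constant density, and integrals of radial functions over the disc become one-dimensional.\<close>

lemma distr_disc_square:
  "distr (restrict_space lborel (ball (0::complex) 1)) borel (\<lambda>z. (cmod z)\<^sup>2)
    = density lborel (\<lambda>x. ennreal pi * indicator {0<..<1} x)"
proof (rule measure_eqI_lessThan)
  have *: "emeasure (distr (restrict_space lborel (ball (0::complex) 1)) borel (\<lambda>z. (cmod z)\<^sup>2)) {x<..}
     = ennreal pi * (if x < 0 then 1 else if x < 1 then ennreal (1 - x) else 0)" for x
  proof -
    have "emeasure (distr (restrict_space lborel (ball (0::complex) 1)) borel (\<lambda>z. (cmod z)\<^sup>2)) {x<..}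
        = emeasure lborel ({z. x < (cmod z)\<^sup>2 \<and> cmod z < 1})"
      by (subst emeasure_distr)
         (auto simp: emeasure_restrict_space space_restrict_space intro!: arg_cong[where f="emeasure lborel"] measurable_restrict_space1)
    also have "{z::complex. x < (cmod z)\<^sup>2 \<and> cmod z < 1} = ball 0 1 - (if x < 0 then {} else cball 0 (sqrt x))"
    proof -
      have "x < (cmod z)\<^sup>2 \<longleftrightarrow> x < 0 \<or> sqrt x < cmod z" for z :: complex
      proof (cases "x < 0")
        case False
        have "sqrt x < cmod z \<longleftrightarrow> sqrt x < sqrt ((cmod z)\<^sup>2)" by simp
        also have "\<dots> \<longleftrightarrow> x < (cmod z)\<^sup>2" by (rule real_sqrt_less_iff)
        finally show ?thesis using False by simp
      next
        case True
        then have "x < (cmod z)\<^sup>2" using zero_le_power2[of "cmod z"] by linarith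
        with True show ?thesis by simp
      qed
      then show ?thesis by (auto simp: not_le)
    qed
    also have "emeasure lborel \<dots> = ennreal pi * (if x < 0 then 1 else if x < 1 then ennreal (1 - x) else 0)"
    proof (cases "0 \<le> x \<and> x < 1")
      case True
      then have "sqrt x < 1" by simp
      then have "emeasure lborel (ball 0 1 - cball (0::complex) (sqrt x)) = emeasure lborel (ball (0::complex) 1) - emeasure lborel (cball (0::complex) (sqrt x))"
        using True \<open>sqrt x < 1\<close> by (intro emeasure_Diff) (auto simp: emeasure_cball subset_iff simp del: real_sqrt_lt_1_iff)
      also have "\<dots> = ennreal (pi - pi * x)"
        using True by (subst ennreal_minus[symmetric]) (auto simp: emeasure_ball emeasure_cball unit_ball_vol_2)
      finally show ?thesis using True by (simp add: ennreal_mult[symmetric] algebra_simps)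
    next
      case False
      show ?thesis
      proof (cases "x < 0")
        case True then show ?thesis by (simp add: emeasure_ball unit_ball_vol_2)
      next
        case F2: False
        have "ball 0 1 - cball (0::complex) (sqrt x) = {}"
        proof -
          have "1 \<le> sqrt x" using False F2 by simp
          then show ?thesis
            by (auto intro!: order.trans[OF less_imp_le \<open>1 \<le> sqrt x\<close>] simp del: real_sqrt_ge_1_iff)
        qed
        then have "emeasure lborel (ball 0 1 - cball (0::complex) (sqrt x)) = 0"
          by (simp only: emeasure_empty)
        then show ?thesis using False F2 by simp
      qed
    qed
    finally show ?thesis .
  qed
  fix x
  show "emeasure (distr (restrict_space lborel (ball (0::complex) 1)) borel (\<lambda>z. (cmod z)\<^sup>2)) {x<..} < \<infinity>"
    unfolding * by (auto simp: ennreal_mult_less_top)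
  have "emeasure (density lborel (\<lambda>x. ennreal pi * indicator {0<..<1} x)) {x<..}
      = ennreal pi * emeasure lborel ({0<..<1} \<inter> {x<..})"
    by (subst emeasure_density)
       (auto simp: nn_integral_cmult mult.assoc indicator_inter_arith[symmetric] simp flip: nn_integral_indicator)
  also have "{0<..<1} \<inter> {x<..} = {max 0 x<..<1}" by auto
  also have "emeasure lborel {max 0 x<..<1} = (if x < 0 then 1 else if x < 1 then ennreal (1 - x) else 0)"
    by (auto simp: max_def)
  finally show "emeasure (distr (restrict_space lborel (ball (0::complex) 1)) borel (\<lambda>z. (cmod z)\<^sup>2)) {x<..}
     = emeasure (density lborel (\<lambda>x. ennreal pi * indicator {0<..<1} x)) {x<..}"
    unfolding * by simp
qed auto

lemma nn_integral_disc_radial: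
  assumes [measurable]: "\<phi> \<in> borel_measurable borel"
  shows "(\<integral>\<^sup>+z. \<phi> ((cmod z)\<^sup>2) * indicator (ball 0 1) z \<partial>lborel) = ennreal pi * (\<integral>\<^sup>+x. \<phi> x * indicator {0<..<1} x \<partial>lborel)"
proof -
  have "(\<integral>\<^sup>+z. \<phi> ((cmod z)\<^sup>2) * indicator (ball 0 1) z \<partial>lborel) = (\<integral>\<^sup>+x. \<phi> x \<partial>distr (restrict_space lborel (ball (0::complex) 1)) borel (\<lambda>z. (cmod z)\<^sup>2))"
    by (subst nn_integral_distr) (auto simp: nn_integral_restrict_space intro!: measurable_restrict_space1)
  also have "\<dots> = ennreal pi * (\<integral>\<^sup>+x. \<phi> x * indicator {0<..<1} x \<partial>lborel)"
    unfolding distr_disc_square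
    by (subst nn_integral_density) (auto simp: nn_integral_cmult[symmetric] ac_simps)
  finally show ?thesis .
qed

lemma integral_disc_radial:
  fixes \<phi> :: "real \<Rightarrow> complex"
  assumes [measurable]: "\<phi> \<in> borel_measurable borel"
  shows "(LINT z|lborel. indicator (ball 0 1) z *\<^sub>R \<phi> ((cmod z)\<^sup>2)) = pi * (LINT x|lborel. indicator {0<..<1} x *\<^sub>R \<phi> x)"
proof -
  have "(LINT z|lborel. indicator (ball 0 1) z *\<^sub>R \<phi> ((cmod z)\<^sup>2)) = (LINT x|distr (restrict_space lborel (ball (0::complex) 1)) borel (\<lambda>z. (cmod z)\<^sup>2). \<phi> x)"
    by (subst integral_distr) (auto simp: integral_restrict_space intro!: measurable_restrict_space1)
  also have "\<dots> = (LINT x|density lborel (\<lambda>x. ennreal (pi * indicator {0<..<1} x)). \<phi> x)"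
    unfolding distr_disc_square by (simp add: ennreal_mult ennreal_indicator)
  also have "\<dots> = (LINT x|lborel. (pi * indicator {0<..<1} x) *\<^sub>R \<phi> x)"
    by (subst integral_density) auto
  also have "\<dots> = pi * (LINT x|lborel. indicator {0<..<1} x *\<^sub>R \<phi> x)"
    by (subst integral_mult_right_zero[symmetric]) (simp add: scaleR_conv_of_real mult.assoc)
  finally show ?thesis .
qed

section \<open>Smooth functions\<close>

definition smooth :: "('a::real_normed_vector \<Rightarrow> 'b::real_normed_vector) \<Rightarrow> bool" where
  "smooth f \<longleftrightarrow> (\<forall>n. continuously_differentiable n f)"

lemma continuously_differentiable_imp_continuous:
  "continuously_differentiable n f \<Longrightarrow> continuous_on UNIV f"
  by (cases n) (auto intro!: differentiable_imp_continuous_on simp: differentiable_on_def)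

lemma continuously_differentiable_Suc_D:
  "continuously_differentiable (Suc n) f \<Longrightarrow> continuously_differentiable n f"
proof (induction n arbitrary: f)
  case 0
  then show ?case using continuously_differentiable_imp_continuous[OF 0] by simp
next
  case (Suc n)
  show ?case
    using Suc.prems Suc.IH
    unfolding continuously_differentiable.simps(2)[of "Suc n" f] continuously_differentiable.simps(2)[of n f]
    by blast
qed

lemma smooth_continuous: "smooth f \<Longrightarrow> continuous_on UNIV f"
  unfolding smooth_def using continuously_differentiable_imp_continuous by blast

lemma smooth_differentiable: "smooth f \<Longrightarrow> f differentiable (at x)"
  unfolding smooth_def using continuously_differentiable.simps(2)[of 0 f] by blast

lemma smooth_has_derivative: "smooth f \<Longrightarrow> (f has_derivative frechet_derivative f (at x)) (at x)"
  using smooth_differentiable frechet_derivative_works by blast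

lemma smooth_frechet: "smooth f \<Longrightarrow> smooth (\<lambda>x. frechet_derivative f (at x) v)"
  unfolding smooth_def using continuously_differentiable.simps(2)[of _ f] by blast

text \<open>It suffices to exhibit a class of functions that is closed under differentiation, because by
  induction each of its members is \<open>n\<close> times continuously differentiable for every \<open>n\<close>.\<close>

lemma smooth_coinduct:
  assumes "P f"
    and step: "\<And>f. P f \<Longrightarrow> \<exists>f'. (\<forall>x. (f has_derivative f' x) (at x)) \<and> (\<forall>v. P (\<lambda>x. f' x v))"
  shows "smooth f"
proof -
  have "continuously_differentiable n f" if "P f" for n f
    using that
  proof (induction n arbitrary: f)
    case 0
    then obtain f' where f': "\<forall>x. (f has_derivative f' x) (at x)" using step by blast
    then have "continuous_on UNIV f"
      by (intro continuous_at_imp_continuous_on ballI) (metis has_derivative_continuous)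
    then show ?case by simp
  next
    case (Suc n)
    then obtain f' where f': "\<forall>x. (f has_derivative f' x) (at x)" "\<forall>v. P (\<lambda>x. f' x v)" using step by blast
    then have "frechet_derivative f (at x) = f' x" for x
      using f'(1) by (intro frechet_derivative_at[symmetric]) auto
    with f' Suc.IH show ?case by (auto simp: differentiable_def)
  qed
  then show ?thesis using assms(1) by (simp add: smooth_def)
qed

lemma continuously_differentiable_add:
  assumes "continuously_differentiable n f" "continuously_differentiable n g"
  shows "continuously_differentiable n (\<lambda>x. f x + g x)"
  using assms
proof (induction n arbitrary: f g)
  case 0 then show ?case by (auto intro: continuous_intros)
next
  case (Suc n)
  have "frechet_derivative (\<lambda>x. f x + g x) (at x) = (\<lambda>v. frechet_derivative f (at x) v + frechet_derivative g (at x) v)" for x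
    using Suc.prems by (intro frechet_derivative_at[symmetric] has_derivative_add) (auto simp: frechet_derivative_works)
  then show ?case using Suc by auto
qed

lemma continuously_differentiable_mult:
  fixes f g :: "'a::real_normed_vector \<Rightarrow> 'b::real_normed_algebra"
  assumes "continuously_differentiable n f" "continuously_differentiable n g"
  shows "continuously_differentiable n (\<lambda>x. f x * g x)"
  using assms
proof (induction n arbitrary: f g)
  case 0 then show ?case by (auto intro: continuous_intros)
next
  case (Suc n)
  have *: "((\<lambda>x. f x * g x) has_derivative (\<lambda>v. f x * frechet_derivative g (at x) v + frechet_derivative f (at x) v * g x)) (at x)" for x
    using Suc.prems by (intro has_derivative_mult) (auto simp: frechet_derivative_works)
  have "frechet_derivative (\<lambda>x. f x * g x) (at x) = (\<lambda>v. f x * frechet_derivative g (at x) v + frechet_derivative f (at x) v * g x)" for x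
    by (rule frechet_derivative_at[OF *, symmetric])
  moreover have "(\<lambda>x. f x * g x) differentiable at x" for x
    using * differentiable_def by blast
  moreover have "continuously_differentiable n (\<lambda>x. f x * frechet_derivative g (at x) v + frechet_derivative f (at x) v * g x)" for v
    using Suc.prems Suc.prems[THEN continuously_differentiable_Suc_D]
    by (intro continuously_differentiable_add Suc.IH) auto
  ultimately show ?case by simp
qed

lemma smooth_add: "smooth f \<Longrightarrow> smooth g \<Longrightarrow> smooth (\<lambda>x. f x + g x)"
  by (simp add: smooth_def continuously_differentiable_add)

lemma smooth_mult:
  fixes f g :: "'a::real_normed_vector \<Rightarrow> 'b::real_normed_algebra"
  shows "smooth f \<Longrightarrow> smooth g \<Longrightarrow> smooth (\<lambda>x. f x * g x)"
  by (simp add: smooth_def continuously_differentiable_mult)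

lemma smooth_const: "smooth (\<lambda>x. c)"
  by (rule smooth_coinduct[where P="\<lambda>f. \<exists>c. f = (\<lambda>x. c)"])
     (auto intro!: exI[of _ "\<lambda>_ _. 0"] derivative_intros)

lemma smooth_bounded_linear:
  assumes "bounded_linear L" shows "smooth L"
proof (rule smooth_coinduct[where P="\<lambda>f. (\<exists>c. f = (\<lambda>x. c)) \<or> bounded_linear f"])
  fix f :: "'a \<Rightarrow> 'b" assume "(\<exists>c. f = (\<lambda>x. c)) \<or> bounded_linear f"
  then show "\<exists>f'. (\<forall>x. (f has_derivative f' x) (at x)) \<and>
              (\<forall>v. (\<exists>c. (\<lambda>x. f' x v) = (\<lambda>x. c)) \<or> bounded_linear (\<lambda>x. f' x v))"
  proof
    assume "\<exists>c. f = (\<lambda>x. c)" then show ?thesis by (auto intro!: exI[of _ "\<lambda>_ _. 0"] derivative_intros)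
  next
    assume "bounded_linear f" then show ?thesis
      by (intro exI[of _ "\<lambda>_. f"]) (auto intro: bounded_linear_imp_has_derivative)
  qed
qed (use assms in auto)

lemma smooth_bounded_linear_compose:
  assumes L: "bounded_linear L" and f: "smooth f" shows "smooth (\<lambda>x. L (f x))"
proof (rule smooth_coinduct[where P="\<lambda>h. \<exists>f. smooth f \<and> h = (\<lambda>x. L (f x))"])
  fix h assume "\<exists>f. smooth f \<and> h = (\<lambda>x. L (f x))"
  then obtain f where f: "smooth f" "h = (\<lambda>x. L (f x))" by blast
  show "\<exists>f'. (\<forall>x. (h has_derivative f' x) (at x)) \<and> (\<forall>v. \<exists>f. smooth f \<and> (\<lambda>x. f' x v) = (\<lambda>x. L (f x)))"
    using f
    by (intro exI[of _ "\<lambda>x v. L (frechet_derivative f (at x) v)"])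
       (auto intro!: bounded_linear.has_derivative[OF L] smooth_has_derivative smooth_frechet)
qed (use f in auto)

lemmas smooth_of_real = smooth_bounded_linear_compose[OF bounded_linear_of_real]
lemmas smooth_Re = smooth_bounded_linear_compose[OF bounded_linear_Re]
lemmas smooth_Im = smooth_bounded_linear_compose[OF bounded_linear_Im]
lemmas smooth_cnj = smooth_bounded_linear_compose[OF bounded_linear_cnj]
lemmas smooth_fst = smooth_bounded_linear[OF bounded_linear_fst]
lemmas smooth_snd = smooth_bounded_linear[OF bounded_linear_snd]

lemma smooth_cmult:
  fixes f :: "'a::real_normed_vector \<Rightarrow> 'b::real_normed_algebra"
  shows "smooth f \<Longrightarrow> smooth (\<lambda>x. c * f x)"
  by (intro smooth_mult smooth_const)

lemma smooth_diff:
  fixes f g :: "'a::real_normed_vector \<Rightarrow> 'b::real_normed_algebra_1"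
  assumes "smooth f" "smooth g" shows "smooth (\<lambda>x. f x - g x)"
  using smooth_add[OF assms(1) smooth_cmult[OF assms(2), of "-1"]] by simp

lemmas smooth_intros = smooth_add smooth_mult smooth_const smooth_of_real smooth_Re smooth_Im smooth_cnj
  smooth_fst smooth_snd smooth_diff

section \<open>A flat function\<close>

text \<open>These functions vanish to infinite order at \<open>0\<close>. The polynomial factor makes the family closed
  under differentiation.\<close>

definition flat :: "real poly \<Rightarrow> real \<Rightarrow> real" where
  "flat P s = (if 0 < s then poly P (1 / s) * exp (- 1 / s) else 0)"

lemma poly_times_exp_tendsto_0:
  fixes P :: "real poly"
  shows "((\<lambda>x. poly P x * exp (- x)) \<longlongrightarrow> 0) at_top"
proof -
  have "((\<lambda>x. \<Sum>i\<le>degree P. coeff P i * (x ^ i / exp x)) \<longlongrightarrow> (\<Sum>i\<le>degree P. coeff P i * 0)) at_top"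
    by (intro tendsto_intros tendsto_power_div_exp_0)
  then show ?thesis
    by (simp add: poly_altdef sum_distrib_right exp_minus field_simps sum_divide_distrib)
qed

text \<open>For positive \<open>s\<close> this is the product rule with \<open>(1/s)' = - (1/s)\<^sup>2\<close>. At \<open>0\<close> the difference quotient tends to
  \<open>0\<close> since the exponential decays faster than every power of \<open>1/s\<close> grows.\<close>

lemma flat_has_real_derivative:
  "(flat P has_real_derivative flat ([:0, 0, 1:] * (P - pderiv P)) s) (at s)"
proof (cases "s = 0")
  case False
  show ?thesis
  proof (cases "s > 0")
    case True
    have "((\<lambda>s. poly P (1 / s) * exp (- 1 / s)) has_real_derivative flat ([:0, 0, 1:] * (P - pderiv P)) s) (at s)"
      using True
      by (auto intro!: derivative_eq_intros poly_DERIV[THEN DERIV_chain2] simp: flat_def field_simps power2_eq_square)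
    then show ?thesis
      by (rule has_field_derivative_transform_within_open[where S="{0<..}"]) (use True in \<open>auto simp: flat_def\<close>)
  next
    case F2: False
    have "((\<lambda>s. 0) has_real_derivative flat ([:0, 0, 1:] * (P - pderiv P)) s) (at s)"
      using F2 by (auto simp: flat_def)
    then show ?thesis
      by (rule has_field_derivative_transform_within_open[where S="{..<0}"]) (use F2 False in \<open>auto simp: flat_def\<close>)
  qed
next
  case True
  have "((\<lambda>h. flat P h / h) \<longlongrightarrow> 0) (at_right 0)"
  proof -
    have "((\<lambda>h. poly (pCons 0 P) (inverse h) * exp (- inverse h)) \<longlongrightarrow> 0) (at_right 0)"
      by (rule filterlim_compose[OF poly_times_exp_tendsto_0 filterlim_inverse_at_top_right])
    then show ?thesis
      by (rule filterlim_cong[THEN iffD1, OF refl refl, rotated])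
         (auto simp: eventually_at_filter flat_def field_simps)
  qed
  moreover have "((\<lambda>h. flat P h / h) \<longlongrightarrow> 0) (at_left 0)"
    by (rule tendsto_eventually) (auto simp: eventually_at_filter flat_def)
  ultimately have "((\<lambda>h. flat P h / h) \<longlongrightarrow> 0) (at 0)"
    by (rule filterlim_split_at[rotated])
  then show ?thesis using True by (simp add: DERIV_def flat_def)
qed

lemma smooth_flat_compose:
  fixes q :: "'a::real_normed_vector \<Rightarrow> real"
  assumes q: "smooth q" shows "smooth (\<lambda>x. flat P (q x))"
proof -
  have "continuously_differentiable n (\<lambda>x. flat P (q x))" for n
  proof (induction n arbitrary: P)
    case 0
    have "continuous_on UNIV (flat P)"
      using flat_has_real_derivative by (intro DERIV_continuous_on) (auto intro: has_field_derivative_at_within)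
    then show ?case using smooth_continuous[OF q] by (auto intro: continuous_on_compose2)
  next
    case (Suc n)
    have *: "((\<lambda>x. flat P (q x)) has_derivative (\<lambda>v. flat ([:0, 0, 1:] * (P - pderiv P)) (q x) * frechet_derivative q (at x) v)) (at x)" for x
      using has_derivative_compose[OF smooth_has_derivative[OF q] flat_has_real_derivative[unfolded has_field_derivative_def]]
      by (simp add: o_def)
    have "frechet_derivative (\<lambda>x. flat P (q x)) (at x) = (\<lambda>v. flat ([:0, 0, 1:] * (P - pderiv P)) (q x) * frechet_derivative q (at x) v)" for x
      by (rule frechet_derivative_at[OF *, symmetric])
    moreover have "(\<lambda>x. flat P (q x)) differentiable at x" for x
      using * differentiable_def by blast
    moreover have "continuously_differentiable n (\<lambda>x. flat ([:0, 0, 1:] * (P - pderiv P)) (q x) * frechet_derivative q (at x) v)" for v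
      using smooth_frechet[OF q] by (intro continuously_differentiable_mult Suc.IH) (simp add: smooth_def)
    ultimately show ?case by simp
  qed
  then show ?thesis by (simp add: smooth_def)
qed

section \<open>Symmetry of second derivatives\<close>

lemma smooth_line_derivative:
  assumes "smooth f"
  shows "((\<lambda>s. f (x + s *\<^sub>R u)) has_derivative (\<lambda>h. h *\<^sub>R frechet_derivative f (at (x + s *\<^sub>R u)) u)) (at s within S)"
proof -
  have "((\<lambda>s. x + s *\<^sub>R u) has_derivative (\<lambda>h. h *\<^sub>R u)) (at s within S)"
    by (auto intro!: derivative_eq_intros)
  from has_derivative_compose[OF this smooth_has_derivative[OF assms]]
  show ?thesis
    using linear_scale[OF has_derivative_linear[OF smooth_has_derivative[OF assms]]] by simp
qed

text \<open>The mean value inequality is applied once in each of the two directions.\<close>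

lemma second_difference_bound:
  fixes f :: "'a::real_normed_vector \<Rightarrow> 'b::real_normed_vector"
  assumes f: "smooth f" and h: "h > 0"
    and bd: "\<And>s t. s \<in> {0..h} \<Longrightarrow> t \<in> {0..h} \<Longrightarrow>
      norm (frechet_derivative (\<lambda>x. frechet_derivative f (at x) u) (at (x + s *\<^sub>R u + t *\<^sub>R v)) v - L) \<le> e"
  shows "norm (f (x + h *\<^sub>R u + h *\<^sub>R v) - f (x + h *\<^sub>R u) - f (x + h *\<^sub>R v) + f x - (h * h) *\<^sub>R L) \<le> e * h * h"
proof -
  define g where "g = (\<lambda>x. frechet_derivative f (at x) u)"
  have g: "smooth g" unfolding g_def using f by (rule smooth_frechet)
  have 1: "norm (g (x + s *\<^sub>R u + h *\<^sub>R v) - g (x + s *\<^sub>R u) - h *\<^sub>R L) \<le> e * h" if s: "s \<in> {0..h}" for s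
  proof -
    have "norm ((g (x + s *\<^sub>R u + h *\<^sub>R v) - h *\<^sub>R L) - (g (x + s *\<^sub>R u + 0 *\<^sub>R v) - 0 *\<^sub>R L)) \<le> e * norm (h - 0)"
    proof (rule differentiable_bound[where S="{0..h}"])
      fix t assume t: "t \<in> {0..h}"
      show "((\<lambda>t. g (x + s *\<^sub>R u + t *\<^sub>R v) - t *\<^sub>R L) has_derivative
         (\<lambda>k. k *\<^sub>R frechet_derivative g (at (x + s *\<^sub>R u + t *\<^sub>R v)) v - k *\<^sub>R L)) (at t within {0..h})"
        by (intro has_derivative_diff smooth_line_derivative g) (auto intro!: derivative_eq_intros)
      show "onorm (\<lambda>k. k *\<^sub>R frechet_derivative g (at (x + s *\<^sub>R u + t *\<^sub>R v)) v - k *\<^sub>R L) \<le> e"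
        using bd[OF s t] by (intro onorm_le) (simp add: scaleR_diff_right[symmetric] mult.commute[of e] mult_left_mono g_def)
    qed (use h in auto)
    then show ?thesis using h by (simp add: algebra_simps)
  qed
  have "norm ((f (x + h *\<^sub>R u + h *\<^sub>R v) - f (x + h *\<^sub>R u) - h *\<^sub>R h *\<^sub>R L) - (f (x + 0 *\<^sub>R u + h *\<^sub>R v) - f (x + 0 *\<^sub>R u) - 0 *\<^sub>R h *\<^sub>R L)) \<le> (e * h) * norm (h - 0)"
  proof (rule differentiable_bound[where S="{0..h}"])
    fix s assume s: "s \<in> {0..h}"
    have "((\<lambda>s. f ((x + h *\<^sub>R v) + s *\<^sub>R u)) has_derivative
        (\<lambda>k. k *\<^sub>R g ((x + h *\<^sub>R v) + s *\<^sub>R u))) (at s within {0..h})"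
      unfolding g_def by (rule smooth_line_derivative[OF f])
    then have "((\<lambda>s. f (x + s *\<^sub>R u + h *\<^sub>R v)) has_derivative
        (\<lambda>k. k *\<^sub>R g (x + s *\<^sub>R u + h *\<^sub>R v))) (at s within {0..h})"
      by (simp add: add_ac)
    then show "((\<lambda>s. f (x + s *\<^sub>R u + h *\<^sub>R v) - f (x + s *\<^sub>R u) - s *\<^sub>R h *\<^sub>R L) has_derivative
        (\<lambda>k. k *\<^sub>R g (x + s *\<^sub>R u + h *\<^sub>R v) - k *\<^sub>R g (x + s *\<^sub>R u) - k *\<^sub>R h *\<^sub>R L)) (at s within {0..h})"
      unfolding g_def by (intro has_derivative_diff smooth_line_derivative[OF f]) (auto intro!: derivative_eq_intros)
    show "onorm (\<lambda>k. k *\<^sub>R g (x + s *\<^sub>R u + h *\<^sub>R v) - k *\<^sub>R g (x + s *\<^sub>R u) - k *\<^sub>R h *\<^sub>R L) \<le> e * h"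
      using 1[OF s] by (intro onorm_le) (simp only: scaleR_diff_right[symmetric] norm_scaleR mult.commute[of "e * h"], simp add: mult_left_mono)
  qed (use h in auto)
  then show ?thesis using h by (simp add: algebra_simps)
qed

lemma smooth_second_derivative_limit:
  fixes f :: "'a::real_normed_vector \<Rightarrow> 'b::real_normed_vector"
  assumes f: "smooth f" and e: "e > 0"
  shows "\<exists>d>0. \<forall>h. 0 < h \<and> h < d \<longrightarrow> norm (f (x + h *\<^sub>R u + h *\<^sub>R v) - f (x + h *\<^sub>R u) - f (x + h *\<^sub>R v) + f x
      - (h * h) *\<^sub>R frechet_derivative (\<lambda>x. frechet_derivative f (at x) u) (at x) v) \<le> e * h * h"
proof -
  define G where "G = (\<lambda>y. frechet_derivative (\<lambda>x. frechet_derivative f (at x) u) (at y) v)"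
  have "continuous_on UNIV G" unfolding G_def by (intro smooth_continuous smooth_frechet f)
  then have "isCont G x" by (simp add: continuous_on_eq_continuous_at)
  then obtain r where r: "r > 0" "\<And>y. dist y x < r \<Longrightarrow> dist (G y) (G x) < e"
  proof -
    have "eventually (\<lambda>y. dist (G y) (G x) < e) (at x)"
      using \<open>isCont G x\<close> e unfolding isCont_def by (rule tendstoD)
    then obtain r where r: "r > 0" "\<And>y. y \<noteq> x \<Longrightarrow> dist y x < r \<Longrightarrow> dist (G y) (G x) < e"
      unfolding eventually_at by auto
    have "dist (G y) (G x) < e" if "dist y x < r" for y
      using r(2)[of y] that e by (cases "y = x") auto
    with r(1) that show ?thesis by blast
  qed
  define d where "d = r / (norm u + norm v + 1)"
  have n: "norm u + norm v + 1 > 0" by (smt (verit) norm_ge_zero)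
  have d: "d > 0" using r n by (simp add: d_def)
  show ?thesis
  proof (intro exI conjI allI impI)
    show "d > 0" by fact
    fix h assume h: "0 < h \<and> h < d"
    show "norm (f (x + h *\<^sub>R u + h *\<^sub>R v) - f (x + h *\<^sub>R u) - f (x + h *\<^sub>R v) + f x
      - (h * h) *\<^sub>R frechet_derivative (\<lambda>x. frechet_derivative f (at x) u) (at x) v) \<le> e * h * h"
    proof (rule second_difference_bound[OF f])
      fix s t assume s: "s \<in> {0..h}" and t: "t \<in> {0..h}"
      have "norm (s *\<^sub>R u + t *\<^sub>R v) \<le> s * norm u + t * norm v"
        using s t by (intro order.trans[OF norm_triangle_ineq]) auto
      also have "\<dots> \<le> h * norm u + h * norm v"
        using s t by (intro add_mono mult_right_mono) auto
      also have "\<dots> < h * (norm u + norm v + 1)" using h by (simp add: algebra_simps)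
      also have "\<dots> < d * (norm u + norm v + 1)" using h n by simp
      also have "\<dots> = r" using n by (simp add: d_def)
      finally have "dist (x + s *\<^sub>R u + t *\<^sub>R v) x < r" by (simp add: dist_norm add.assoc)
      from r(2)[OF this] show "norm (frechet_derivative (\<lambda>x. frechet_derivative f (at x) u) (at (x + s *\<^sub>R u + t *\<^sub>R v)) v
          - frechet_derivative (\<lambda>x. frechet_derivative f (at x) u) (at x) v) \<le> e"
        by (simp add: G_def dist_norm)
    qed (use h in auto)
  qed
qed

text \<open>Both mixed derivatives are limits of the same second difference divided by \<open>h\<^sup>2\<close>.\<close>

lemma smooth_second_derivative_symmetric:
  fixes f :: "'a::real_normed_vector \<Rightarrow> 'b::real_normed_vector"
  assumes f: "smooth f"
  shows "frechet_derivative (\<lambda>x. frechet_derivative f (at x) u) (at x) v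
       = frechet_derivative (\<lambda>x. frechet_derivative f (at x) v) (at x) u" (is "?A = ?B")
proof -
  have bound: "norm (?A - ?B) \<le> 0 + e" if e: "e > 0" for e
  proof -
    obtain d1 where d1: "d1 > 0" "\<And>h. 0 < h \<Longrightarrow> h < d1 \<Longrightarrow> norm (f (x + h *\<^sub>R u + h *\<^sub>R v) - f (x + h *\<^sub>R u) - f (x + h *\<^sub>R v) + f x - (h * h) *\<^sub>R ?A) \<le> e/2 * h * h"
      using smooth_second_derivative_limit[OF f, of "e/2" x u v] e by auto
    obtain d2 where d2: "d2 > 0" "\<And>h. 0 < h \<Longrightarrow> h < d2 \<Longrightarrow> norm (f (x + h *\<^sub>R v + h *\<^sub>R u) - f (x + h *\<^sub>R v) - f (x + h *\<^sub>R u) + f x - (h * h) *\<^sub>R ?B) \<le> e/2 * h * h"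
      using smooth_second_derivative_limit[OF f, of "e/2" x v u] e by auto
    define h where "h = min d1 d2 / 2"
    have h: "h > 0" "h < d1" "h < d2" using d1 d2 by (auto simp: h_def)
    define \<Delta> where "\<Delta> = f (x + h *\<^sub>R u + h *\<^sub>R v) - f (x + h *\<^sub>R u) - f (x + h *\<^sub>R v) + f x"
    have "norm (\<Delta> - (h * h) *\<^sub>R ?A) \<le> e/2 * h * h" using d1(2) h by (simp add: \<Delta>_def)
    moreover have "norm (\<Delta> - (h * h) *\<^sub>R ?B) \<le> e/2 * h * h" using d2(2)[of h] h by (simp add: \<Delta>_def algebra_simps)
    ultimately have "norm ((\<Delta> - (h * h) *\<^sub>R ?B) - (\<Delta> - (h * h) *\<^sub>R ?A)) \<le> e/2 * h * h + e/2 * h * h"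
      by (intro order.trans[OF norm_triangle_ineq4]) auto
    then have "(h * h) * norm (?A - ?B) \<le> (h * h) * e"
    proof -
      assume *: "norm ((\<Delta> - (h * h) *\<^sub>R ?B) - (\<Delta> - (h * h) *\<^sub>R ?A)) \<le> e/2 * h * h + e/2 * h * h"
      have "(\<Delta> - (h * h) *\<^sub>R ?B) - (\<Delta> - (h * h) *\<^sub>R ?A) = (h * h) *\<^sub>R (?A - ?B)"
        by (simp add: scaleR_diff_right)
      with * have "norm ((h * h) *\<^sub>R (?A - ?B)) \<le> e/2 * h * h + e/2 * h * h" by simp
      also have "\<dots> = (h * h) * e" by simp
      finally show ?thesis by simp
    qed
    then show ?thesis using h by simp
  qed
  have "norm (?A - ?B) \<le> 0" by (rule field_le_epsilon) (rule bound)
  then show ?thesis by (simp only: norm_le_zero_iff right_minus_eq)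
qed

section \<open>Integrals of derivatives vanish\<close>

lemma smooth_compact_support_bounded:
  fixes f :: "'a::euclidean_space \<Rightarrow> 'b::real_normed_vector"
  assumes "continuous_on UNIV f" "compact K" "\<And>x. x \<notin> K \<Longrightarrow> f x = 0"
  shows "\<exists>B\<ge>0. \<forall>x. norm (f x) \<le> B"
proof -
  have "compact (f ` K)" by (intro compact_continuous_image continuous_on_subset[OF assms(1)] assms(2)) auto
  then obtain B where B: "\<forall>y\<in>f ` K. norm y \<le> B" using compact_imp_bounded bounded_iff by blast
  have "norm (f x) \<le> max B 0" for x using B assms(3)[of x] by (cases "x \<in> K") (auto simp: le_max_iff_disj)
  then show ?thesis by (intro exI[of _ "max B 0"]) auto
qed

lemma continuous_compact_support_integrable:
  fixes f :: "'a::euclidean_space \<Rightarrow> 'b::euclidean_space"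
  assumes "continuous_on UNIV f" "compact K" "\<And>x. x \<notin> K \<Longrightarrow> f x = 0"
  shows "integrable lborel f"
proof -
  have "integrable lborel (\<lambda>x. indicator K x *\<^sub>R f x)"
    by (intro borel_integrable_compact continuous_on_subset[OF assms(1)] assms(2)) auto
  also have "(\<lambda>x. indicator K x *\<^sub>R f x) = f" using assms(3) by (auto simp: fun_eq_iff indicator_def)
  finally show ?thesis .
qed

text \<open>Translation invariance makes the integral of every difference quotient vanish, and dominated
  convergence carries this over to the derivative.\<close>

lemma integral_derivative_compact_support_eq_0:
  fixes f :: "'a::euclidean_space \<Rightarrow> complex"
  assumes f: "smooth f" and K: "compact K" "\<And>x. x \<notin> K \<Longrightarrow> f x = 0"
  shows "(LINT x|lborel. frechet_derivative f (at x) v) = 0"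
proof -
  define g where "g = (\<lambda>x. frechet_derivative f (at x) v)"
  have cf: "continuous_on UNIV f" and cg: "continuous_on UNIV g"
    unfolding g_def using f by (auto intro: smooth_continuous smooth_frechet)
  have intf: "integrable lborel f" by (rule continuous_compact_support_integrable[OF cf K])
  have g0: "g x = 0" if "x \<notin> K" for x
  proof -
    have "((\<lambda>x. 0) has_derivative (\<lambda>_. 0)) (at x)" by simp
    then have "(f has_derivative (\<lambda>_. 0)) (at x)"
      by (rule has_derivative_transform_within_open[where s="- K"]) (use K that compact_imp_closed in \<open>auto simp: open_Compl\<close>)
    then show ?thesis by (simp add: g_def frechet_derivative_at[symmetric])
  qed
  obtain B where B: "B \<ge> 0" "\<And>x. norm (g x) \<le> B"
    using smooth_compact_support_bounded[OF cg K(1) g0] by auto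
  \<comment> \<open>difference quotients with steps at most \<open>1\<close> are supported in \<open>K' \<union> K\<close>\<close>
  define K' where "K' = (\<lambda>p. fst p - snd p *\<^sub>R v) ` (K \<times> {0..1})"
  have K': "compact K'" unfolding K'_def
    by (intro compact_continuous_image compact_Times K) (auto intro!: continuous_intros)
  define q where "q = (\<lambda>n x. real (Suc n) *\<^sub>R (f (x + (1 / real (Suc n)) *\<^sub>R v) - f x))"
  have "(\<lambda>n. LINT x|lborel. q n x) \<longlonglongrightarrow> (LINT x|lborel. g x)"
  proof (rule integral_dominated_convergence[where w="\<lambda>x. B * indicator (K' \<union> K) x"])
    show "g \<in> borel_measurable lborel" using cg by (simp add: borel_measurable_continuous_onI)
    show "q n \<in> borel_measurable lborel" for n unfolding q_def
      using borel_measurable_continuous_onI[OF cf] by (auto intro!: borel_measurable_scaleR borel_measurable_diff)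
    show "integrable lborel (\<lambda>x. B * indicator (K' \<union> K) x)"
    proof (intro integrable_mult_right integrable_real_indicator)
      show "emeasure lborel (K' \<union> K) < \<infinity>"
        by (intro emeasure_bounded_finite compact_imp_bounded compact_Un K' K)
    qed (use K' K in \<open>auto intro: borel_compact\<close>)
    show "AE x in lborel. (\<lambda>n. q n x) \<longlonglongrightarrow> g x"
    proof (rule AE_I2)
      fix x
      have "((\<lambda>s. f (x + s *\<^sub>R v)) has_vector_derivative g x) (at 0)"
        using smooth_line_derivative[OF f, of x v 0 UNIV] by (simp add: has_vector_derivative_def g_def)
      then have "((\<lambda>h. norm (f (x + h *\<^sub>R v) - f x - h *\<^sub>R g x) / norm h) \<longlongrightarrow> 0) (at 0)"
        by (simp add: has_vector_derivative_def has_derivative_at)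
      moreover have "norm (f (x + h *\<^sub>R v) - f x - h *\<^sub>R g x) / norm h = norm ((f (x + h *\<^sub>R v) - f x) /\<^sub>R h - g x)"
        if "h \<noteq> 0" for h :: real
      proof -
        have "f (x + h *\<^sub>R v) - f x - h *\<^sub>R g x = h *\<^sub>R ((f (x + h *\<^sub>R v) - f x) /\<^sub>R h - g x)"
          using that by (simp add: scaleR_diff_right)
        then show ?thesis using that by simp
      qed
      ultimately have "((\<lambda>h. norm ((f (x + h *\<^sub>R v) - f x) /\<^sub>R h - g x)) \<longlongrightarrow> 0) (at 0)"
        by (subst tendsto_cong[of _ "\<lambda>h. norm (f (x + h *\<^sub>R v) - f x - h *\<^sub>R g x) / norm h"])
           (auto simp: eventually_at_filter)
      then have "((\<lambda>h. (f (x + h *\<^sub>R v) - f x) /\<^sub>R h) \<longlongrightarrow> g x) (at 0)"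
        by (simp add: tendsto_norm_zero_iff LIM_zero_iff)
      moreover have "filterlim (\<lambda>n. 1 / real (Suc n)) (at 0) sequentially"
        unfolding filterlim_at using LIMSEQ_inverse_real_of_nat by (simp add: inverse_eq_divide)
      ultimately show "(\<lambda>n. q n x) \<longlonglongrightarrow> g x"
        by (auto dest: filterlim_compose simp: q_def)
    qed
    show "AE x in lborel. norm (q n x) \<le> B * indicator (K' \<union> K) x" for n
    proof (rule AE_I2)
      fix x
      show "norm (q n x) \<le> B * indicator (K' \<union> K) x"
      proof (cases "x \<in> K' \<union> K")
        case True
        have "norm (f (x + (1 / real (Suc n)) *\<^sub>R v) - f (x + 0 *\<^sub>R v)) \<le> B * norm (1 / real (Suc n) - 0)"
          by (rule differentiable_bound[where S=UNIV, OF _ smooth_line_derivative[OF f]])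
             (auto intro!: onorm_le simp: mult.commute[of B] mult_left_mono B(2)[unfolded g_def])
        then have "real (Suc n) * norm (f (x + (1 / real (Suc n)) *\<^sub>R v) - f x) \<le> B"
          by (simp add: field_simps)
        then show ?thesis using True by (simp add: q_def)
      next
        case False
        have "x + (1 / real (Suc n)) *\<^sub>R v \<notin> K"
        proof
          assume "x + (1 / real (Suc n)) *\<^sub>R v \<in> K"
          then have "x \<in> K'" unfolding K'_def
            by (intro image_eqI[of _ _ "(x + (1 / real (Suc n)) *\<^sub>R v, 1 / real (Suc n))"]) auto
          with False show False by simp
        qed
        then show ?thesis using False K by (simp add: q_def)
      qed
    qed
  qed
  moreover have "(LINT x|lborel. q n x) = 0" for n
  proof -
    have tr: "(LINT x|lborel. f (c + x)) = (LINT x|lborel. f x)" "integrable lborel (\<lambda>x. f (c + x))" for c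
      using intf cf integral_distr[of "\<lambda>x. c + x" lborel borel f] integrable_distr_eq[of "\<lambda>x. c + x" lborel borel f]
      by (auto simp: lborel_distr_plus borel_measurable_continuous_onI)
    show ?thesis unfolding q_def
      using tr[of "(1 / real (Suc n)) *\<^sub>R v"] intf
      by (subst integral_scaleR_right) (auto simp: add.commute)
  qed
  ultimately show ?thesis by (simp add: g_def LIMSEQ_const_iff)
qed

section \<open>Wirtinger operators on smooth functions\<close>

text \<open>The four Wirtinger derivatives are numbered in the order in which multi-indices list them, so that
  iterated derivatives are words over \<open>{0, 1, 2, 3}\<close>. The cases \<open>j\<close> and \<open>j + 2\<close> are conjugate to each
  other.\<close>

definition wirt :: "nat \<Rightarrow> (complex \<times> complex \<Rightarrow> complex) \<Rightarrow> complex \<times> complex \<Rightarrow> complex" where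
  "wirt i = (if i = 0 then wirtinger (1, 0) else if i = 1 then wirtinger (0, 1)
           else if i = 2 then wirtinger_bar (1, 0) else wirtinger_bar (0, 1))"

text \<open>Every Wirtinger derivative is a complex combination of two directional derivatives; smoothness,
  symmetry and vanishing integrals carry over from these.\<close>

lemma wirt_conv_frechet:
  obtains u v c where
    "wirt i = (\<lambda>\<phi> z. (frechet_derivative \<phi> (at z) u + c * frechet_derivative \<phi> (at z) v) / 2)"
proof -
  have "wirt i \<in> range wirtinger \<union> range wirtinger_bar" unfolding wirt_def by auto
  then obtain e where e: "wirt i = wirtinger e \<or> wirt i = wirtinger_bar e" by auto
  show ?thesis
  proof (cases "wirt i = wirtinger e")
    case True
    then have "wirt i = (\<lambda>\<phi> z. (frechet_derivative \<phi> (at z) e + (- \<i>) * frechet_derivative \<phi> (at z) (\<i> * fst e, \<i> * snd e)) / 2)"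
      by (simp add: fun_eq_iff wirtinger_def)
    then show ?thesis by (rule that)
  next
    case False
    with e have w: "wirt i = wirtinger_bar e" by blast
    have "wirt i = (\<lambda>\<phi> z. (frechet_derivative \<phi> (at z) e + \<i> * frechet_derivative \<phi> (at z) (\<i> * fst e, \<i> * snd e)) / 2)"
      unfolding w by (simp add: fun_eq_iff wirtinger_bar_def)
    then show ?thesis by (rule that)
  qed
qed

lemma has_derivative_imp_wirt:
  assumes "(f has_derivative f') (at z)" "(g has_derivative g') (at z)" "(h has_derivative h') (at z)"
    and "\<And>v. h' v = a * f' v + b * g' v"
  shows "wirt i h z = a * wirt i f z + b * wirt i g z"
proof -
  obtain u v c where wirt: "wirt i = (\<lambda>\<phi> z. (frechet_derivative \<phi> (at z) u + c * frechet_derivative \<phi> (at z) v) / 2)"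
    by (rule wirt_conv_frechet)
  show ?thesis
    unfolding wirt frechet_derivative_at[OF assms(1), symmetric] frechet_derivative_at[OF assms(2), symmetric]
      frechet_derivative_at[OF assms(3), symmetric] assms(4)
    by (simp add: field_simps)
qed

lemma wirt_mult:
  assumes "f differentiable (at z)" "g differentiable (at z)"
  shows "wirt i (\<lambda>z. f z * g z) z = wirt i f z * g z + f z * wirt i g z"
proof -
  have f: "(f has_derivative frechet_derivative f (at z)) (at z)" and g: "(g has_derivative frechet_derivative g (at z)) (at z)"
    using assms frechet_derivative_works by blast+
  show ?thesis
    using has_derivative_imp_wirt[OF f g has_derivative_mult[OF f g], of "g z" "f z"] by (simp add: algebra_simps)
qed

lemma wirt_cmult:
  assumes "f differentiable (at z)"
  shows "wirt i (\<lambda>z. c * f z) z = c * wirt i f z"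
proof -
  have f: "(f has_derivative frechet_derivative f (at z)) (at z)"
    using assms frechet_derivative_works by blast
  show ?thesis
    using has_derivative_imp_wirt[OF f f has_derivative_mult_right[OF f], of c 0] by simp
qed

lemma frechet_derivative_cong_open:
  assumes "open S" "z \<in> S" "\<And>x. x \<in> S \<Longrightarrow> f x = g x"
  shows "frechet_derivative f (at z) = frechet_derivative g (at z)"
proof -
  have "(f has_derivative D) (at z) \<longleftrightarrow> (g has_derivative D) (at z)" for D
    using assms has_derivative_transform_within_open[of f D z UNIV S g] has_derivative_transform_within_open[of g D z UNIV S f]
    by auto
  then show ?thesis by (simp add: frechet_derivative_def)
qed

lemma wirt_cong_open:
  assumes "open S" "z \<in> S" "\<And>x. x \<in> S \<Longrightarrow> f x = g x"
  shows "wirt i f z = wirt i g z"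
proof -
  obtain u v c where wirt: "wirt i = (\<lambda>\<phi> z. (frechet_derivative \<phi> (at z) u + c * frechet_derivative \<phi> (at z) v) / 2)"
    by (rule wirt_conv_frechet)
  show ?thesis by (simp only: wirt frechet_derivative_cong_open[OF assms])
qed

lemma wirt_holomorphic:
  assumes "(f has_derivative (\<lambda>h. a * fst h + b * snd h)) (at z)"
  shows "wirt 0 f z = a" "wirt (Suc 0) f z = b" "wirt 2 f z = 0" "wirt 3 f z = 0"
  by (simp_all add: wirt_def wirtinger_def wirtinger_bar_def frechet_derivative_at[OF assms, symmetric] field_simps)

lemma wirt_antiholomorphic:
  assumes "(f has_derivative (\<lambda>h. a * cnj (fst h) + b * cnj (snd h))) (at z)"
  shows "wirt 0 f z = 0" "wirt (Suc 0) f z = 0" "wirt 2 f z = a" "wirt 3 f z = b"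
  by (simp_all add: wirt_def wirtinger_def wirtinger_bar_def frechet_derivative_at[OF assms, symmetric] field_simps)

lemma wirt_smooth:
  assumes "smooth f" shows "smooth (wirt i f)"
proof -
  obtain u v c where wirt: "wirt i = (\<lambda>\<phi> z. (frechet_derivative \<phi> (at z) u + c * frechet_derivative \<phi> (at z) v) / 2)"
    by (rule wirt_conv_frechet)
  have "smooth (\<lambda>z. (frechet_derivative f (at z) u + c * frechet_derivative f (at z) v) * (1/2))"
    by (intro smooth_intros smooth_frechet assms)
  then show ?thesis unfolding wirt by simp
qed

lemma wirt_commute:
  assumes f: "smooth f" shows "wirt i (wirt j f) = wirt j (wirt i f)"
proof
  fix z
  obtain u v c where wi: "wirt i = (\<lambda>\<phi> z. (frechet_derivative \<phi> (at z) u + c * frechet_derivative \<phi> (at z) v) / 2)"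
    by (rule wirt_conv_frechet)
  obtain u' v' c' where wj: "wirt j = (\<lambda>\<phi> z. (frechet_derivative \<phi> (at z) u' + c' * frechet_derivative \<phi> (at z) v') / 2)"
    by (rule wirt_conv_frechet)
  have *: "frechet_derivative (\<lambda>z. (frechet_derivative f (at z) u + c * frechet_derivative f (at z) v) / 2) (at z) w
     = (frechet_derivative (\<lambda>z. frechet_derivative f (at z) u) (at z) w
       + c * frechet_derivative (\<lambda>z. frechet_derivative f (at z) v) (at z) w) / 2" for u c v w
  proof -
    have "((\<lambda>z. (frechet_derivative f (at z) u + c * frechet_derivative f (at z) v) * (1/2)) has_derivative
        (\<lambda>w. (frechet_derivative (\<lambda>z. frechet_derivative f (at z) u) (at z) w
       + c * frechet_derivative (\<lambda>z. frechet_derivative f (at z) v) (at z) w) * (1/2))) (at z)"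
      by (intro has_derivative_mult_left has_derivative_mult_right has_derivative_add smooth_has_derivative smooth_frechet f)
    then show ?thesis by (simp add: frechet_derivative_at[symmetric])
  qed
  show "wirt i (wirt j f) z = wirt j (wirt i f) z"
    unfolding wi wj *
    by (simp add: smooth_second_derivative_symmetric[OF f, of u'] smooth_second_derivative_symmetric[OF f, of v'] algebra_simps add_divide_distrib)
qed

lemma wirtinger_deriv_eq_wirt:
  "wirtinger_deriv (a1, a2, a3, a4) \<phi> = (wirt 0 ^^ a1) ((wirt (Suc 0) ^^ a2) ((wirt 2 ^^ a3) ((wirt 3 ^^ a4) \<phi>)))"
  by (simp add: wirt_def)

lemma smooth_funpow_wirt: "smooth \<phi> \<Longrightarrow> smooth ((wirt i ^^ n) \<phi>)"
  by (induction n) (auto intro: wirt_smooth)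

lemma wirt_funpow_commute: "smooth \<phi> \<Longrightarrow> wirt i ((wirt j ^^ n) \<phi>) = (wirt j ^^ n) (wirt i \<phi>)"
  by (induction n) (simp_all add: wirt_commute[of _ i j, OF smooth_funpow_wirt])

definition wirt_word :: "nat list \<Rightarrow> (complex \<times> complex \<Rightarrow> complex) \<Rightarrow> complex \<times> complex \<Rightarrow> complex" where
  "wirt_word l = foldr wirt l"

lemma wirt_word_simps[simp]: "wirt_word [] \<phi> = \<phi>" "wirt_word (i # l) \<phi> = wirt i (wirt_word l \<phi>)" "wirt_word (l @ l') \<phi> = wirt_word l (wirt_word l' \<phi>)"
  by (auto simp: wirt_word_def)

lemma smooth_wirt_word: "smooth \<phi> \<Longrightarrow> smooth (wirt_word l \<phi>)"
  by (induction l) (auto intro: wirt_smooth)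

definition multi_index_of :: "nat list \<Rightarrow> multi_index" where
  "multi_index_of l = (count_list l 0, count_list l 1, count_list l 2, count_list l 3)"

lemma multi_order_multi_index_of: "set l \<subseteq> {..<4} \<Longrightarrow> multi_order (multi_index_of l) = length l"
  by (induction l) (auto simp: multi_index_of_def)

text \<open>Derivatives of smooth functions commute, so a word may be sorted into the order of a multi-index.\<close>

lemma wirt_word_eq_wirtinger_deriv:
  assumes "smooth \<phi>" "set l \<subseteq> {..<4}"
  shows "wirt_word l \<phi> = wirtinger_deriv (multi_index_of l) \<phi>"
  using assms(2)
proof (induction l)
  case Nil then show ?case by (simp add: multi_index_of_def)
next
  case (Cons i l)
  then have IH: "wirt_word l \<phi> = wirtinger_deriv (multi_index_of l) \<phi>" and i: "i < 4" by auto
  from i have "i = 0 \<or> i = Suc 0 \<or> i = 2 \<or> i = 3" by auto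
  then show ?case using assms(1)
    by (auto simp: IH multi_index_of_def wirtinger_deriv_eq_wirt wirt_funpow_commute smooth_funpow_wirt simp del: wirtinger_deriv.simps)
qed

section \<open>Test functions\<close>

lemma test_function_iff: "test_function \<Omega> \<phi> \<longleftrightarrow> smooth \<phi> \<and> compact (closure {z. \<phi> z \<noteq> 0}) \<and> closure {z. \<phi> z \<noteq> 0} \<subseteq> \<Omega>"
  by (simp add: test_function_def smooth_def)

lemma test_functionI:
  assumes "smooth \<phi>" "compact K" "K \<subseteq> \<Omega>" "\<And>z. z \<notin> K \<Longrightarrow> \<phi> z = 0"
  shows "test_function \<Omega> \<phi>"
proof -
  have "closure {z. \<phi> z \<noteq> 0} \<subseteq> K"
    using assms compact_imp_closed by (intro closure_minimal) auto
  then show ?thesis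
    using assms compact_Int_closed[OF assms(2) closed_closure[of "{z. \<phi> z \<noteq> 0}"]]
    by (auto simp: test_function_iff Int_absorb1)
qed

lemma test_functionE:
  assumes "test_function \<Omega> \<phi>"
  obtains K where "smooth \<phi>" "compact K" "K \<subseteq> \<Omega>" "\<And>z. z \<notin> K \<Longrightarrow> \<phi> z = 0"
proof (rule that)
  show "\<phi> z = 0" if "z \<notin> closure {z. \<phi> z \<noteq> 0}" for z
    using that closure_subset[of "{z. \<phi> z \<noteq> 0}"] by blast
qed (use assms in \<open>simp_all add: test_function_iff\<close>)

lemma test_function_wirt:
  assumes "test_function \<Omega> \<phi>" shows "test_function \<Omega> (wirt i \<phi>)"
proof -
  obtain K where K: "smooth \<phi>" "compact K" "K \<subseteq> \<Omega>" "\<And>z. z \<notin> K \<Longrightarrow> \<phi> z = 0"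
    using assms by (rule test_functionE) auto
  show ?thesis
  proof (rule test_functionI)
    fix z assume "z \<notin> K"
    then have "wirt i \<phi> z = wirt i (\<lambda>z. 0) z"
      using K by (intro wirt_cong_open[of "- K"] open_Compl compact_imp_closed) auto
    then show "wirt i \<phi> z = 0"
      using wirt_cmult[of "\<lambda>z. 0" z i 0] by simp
  qed (use K wirt_smooth in auto)
qed

lemma test_function_wirt_word: "test_function \<Omega> \<phi> \<Longrightarrow> test_function \<Omega> (wirt_word l \<phi>)"
  by (induction l) (auto intro: test_function_wirt)

lemma test_function_mult:
  assumes "smooth g" "test_function \<Omega> \<phi>" shows "test_function \<Omega> (\<lambda>z. g z * \<phi> z)"
proof -
  obtain K where K: "smooth \<phi>" "compact K" "K \<subseteq> \<Omega>" "\<And>z. z \<notin> K \<Longrightarrow> \<phi> z = 0"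
    using assms by (auto elim: test_functionE)
  then show ?thesis using assms by (intro test_functionI[of _ K] smooth_mult) auto
qed

lemma test_function_add:
  assumes "test_function \<Omega> \<psi>" "test_function \<Omega> \<phi>" shows "test_function \<Omega> (\<lambda>z. \<psi> z + \<phi> z)"
proof -
  obtain K where K: "smooth \<phi>" "compact K" "K \<subseteq> \<Omega>" "\<And>z. z \<notin> K \<Longrightarrow> \<phi> z = 0"
    using assms(2) by (auto elim: test_functionE)
  obtain K' where K': "smooth \<psi>" "compact K'" "K' \<subseteq> \<Omega>" "\<And>z. z \<notin> K' \<Longrightarrow> \<psi> z = 0"
    using assms(1) by (auto elim: test_functionE)
  show ?thesis using K K' by (intro test_functionI[of _ "K \<union> K'"] smooth_add) auto
qed

lemma test_function_smooth: "test_function \<Omega> \<phi> \<Longrightarrow> smooth \<phi>"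
  by (simp add: test_function_iff)

lemma test_function_outside: "test_function \<Omega> \<phi> \<Longrightarrow> z \<notin> \<Omega> \<Longrightarrow> \<phi> z = 0"
  by (erule test_functionE) blast

lemma test_function_continuous: "test_function \<Omega> \<phi> \<Longrightarrow> continuous_on UNIV \<phi>"
  by (intro smooth_continuous test_function_smooth)

lemma test_function_bounded: "test_function \<Omega> \<phi> \<Longrightarrow> \<exists>B\<ge>0. \<forall>z. cmod (\<phi> z) \<le> B"
  by (erule test_functionE) (rule smooth_compact_support_bounded[OF smooth_continuous])

lemma test_function_measurable[measurable (raw)]: "test_function \<Omega> \<phi> \<Longrightarrow> \<phi> \<in> borel_measurable borel"
  by (intro borel_measurable_continuous_onI test_function_continuous)

text \<open>Smoothness on an open set, expressed coinductively: \<open>h\<close> belongs to a class of functions that is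
  differentiable on the set and closed under taking directional derivatives there.\<close>

definition smooth_on :: "(complex \<times> complex) set \<Rightarrow> (complex \<times> complex \<Rightarrow> complex) \<Rightarrow> bool" where
  "smooth_on S h \<longleftrightarrow> (\<exists>Q. Q h \<and> (\<forall>h. Q h \<longrightarrow>
     (\<exists>h'. (\<forall>x\<in>S. (h has_derivative h' x) (at x)) \<and> (\<forall>v. Q (\<lambda>x. h' x v)))))"

lemma smooth_on_differentiable: "smooth_on S h \<Longrightarrow> z \<in> S \<Longrightarrow> h differentiable (at z)"
  unfolding smooth_on_def differentiable_def by blast

text \<open>Outside the support of \<open>\<theta>\<close> the product vanishes identically, so the values of \<open>h\<close> off the set do not
  matter. The sums of products of this form are closed under differentiation.\<close>

lemma test_function_mult_local:
  assumes S: "open S" and \<theta>: "test_function S \<theta>" and h: "smooth_on S h"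
  shows "test_function S (\<lambda>z. \<theta> z * h z)"
proof -
  from h obtain Q where Q: "Q h" and step: "\<And>h. Q h \<Longrightarrow>
     \<exists>h'. (\<forall>x\<in>S. (h has_derivative h' x) (at x)) \<and> (\<forall>v. Q (\<lambda>x. h' x v))"
    unfolding smooth_on_def by blast
  have step': "\<exists>h'. (\<forall>z. ((\<lambda>z. \<theta> z * h z) has_derivative (\<lambda>v. \<theta> z * h' z v + frechet_derivative \<theta> (at z) v * h z)) (at z))
      \<and> (\<forall>v. Q (\<lambda>x. h' x v)) \<and> (\<forall>v. test_function S (\<lambda>z. frechet_derivative \<theta> (at z) v))"
    if \<theta>: "test_function S \<theta>" and Qh: "Q h" for \<theta> h
  proof -
    obtain K where K: "smooth \<theta>" "compact K" "K \<subseteq> S" "\<And>z. z \<notin> K \<Longrightarrow> \<theta> z = 0"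
      using \<theta> by (auto elim: test_functionE)
    from step[OF Qh] obtain h' where h': "\<And>x. x \<in> S \<Longrightarrow> (h has_derivative h' x) (at x)" "\<And>v. Q (\<lambda>x. h' x v)"
      by blast
    have fr: "test_function S (\<lambda>z. frechet_derivative \<theta> (at z) v)" for v
    proof (rule test_functionI[OF smooth_frechet[OF K(1)] K(2,3)])
      fix z assume "z \<notin> K"
      then have "frechet_derivative \<theta> (at z) = frechet_derivative (\<lambda>z. 0) (at z)"
        using K by (intro frechet_derivative_cong_open[of "- K"] open_Compl compact_imp_closed) auto
      then show "frechet_derivative \<theta> (at z) v = 0" by simp
    qed
    have der: "((\<lambda>z. \<theta> z * h z) has_derivative (\<lambda>v. \<theta> z * h' z v + frechet_derivative \<theta> (at z) v * h z)) (at z)" for z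
    proof (cases "z \<in> S")
      case True
      then show ?thesis by (intro has_derivative_mult smooth_has_derivative K h')
    next
      case False
      then have z: "z \<notin> K" using K by auto
      then have "frechet_derivative \<theta> (at z) v = 0" "\<theta> z = 0" for v
        using test_function_outside[OF fr False] K by auto
      moreover have "((\<lambda>z. \<theta> z * h z) has_derivative (\<lambda>v. 0)) (at z)"
        by (rule has_derivative_transform_within_open[OF has_derivative_const[of 0] , where s="- K"])
          (use K z in \<open>auto intro!: open_Compl compact_imp_closed\<close>)
      ultimately show ?thesis by simp
    qed
    show ?thesis using der h' fr by blast
  qed
  have main: "test_function S \<theta> \<Longrightarrow> Q h \<Longrightarrow> continuously_differentiable n (\<lambda>z. \<theta> z * h z)" for n \<theta> h
  proof (induction n arbitrary: \<theta> h)
    case 0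
    from step'[OF 0] have "continuous_on UNIV (\<lambda>z. \<theta> z * h z)"
      by (intro continuous_at_imp_continuous_on ballI) (metis has_derivative_continuous)
    then show ?case by simp
  next
    case (Suc n)
    from step'[OF Suc.prems] obtain h' where
      der: "\<And>z. ((\<lambda>z. \<theta> z * h z) has_derivative (\<lambda>v. \<theta> z * h' z v + frechet_derivative \<theta> (at z) v * h z)) (at z)"
      and h': "\<And>v. Q (\<lambda>x. h' x v)" and fr: "\<And>v. test_function S (\<lambda>z. frechet_derivative \<theta> (at z) v)" by blast
    have "frechet_derivative (\<lambda>z. \<theta> z * h z) (at z) = (\<lambda>v. \<theta> z * h' z v + frechet_derivative \<theta> (at z) v * h z)" for z
      by (rule frechet_derivative_at[OF der, symmetric])
    moreover have "(\<lambda>z. \<theta> z * h z) differentiable (at z)" for z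
      using der differentiable_def by blast
    moreover have "continuously_differentiable n (\<lambda>z. \<theta> z * h' z v + frechet_derivative \<theta> (at z) v * h z)" for v
      by (intro continuously_differentiable_add Suc.IH Suc.prems fr h')
    ultimately show ?case by simp
  qed
  obtain K where K: "smooth \<theta>" "compact K" "K \<subseteq> S" "\<And>z. z \<notin> K \<Longrightarrow> \<theta> z = 0"
    using \<theta> by (auto elim: test_functionE)
  show ?thesis
    by (rule test_functionI[OF _ K(2,3)]) (use K main[OF \<theta> Q] in \<open>auto simp: smooth_def\<close>)
qed

section \<open>Integration by parts\<close>

lemma integral_lebesgue_on_eq_lborel:
  fixes F :: "'a::euclidean_space \<Rightarrow> 'b::{banach, second_countable_topology}"
  assumes F: "F \<in> borel_measurable borel" and S: "S \<in> sets borel" and 0: "\<And>z. z \<notin> S \<Longrightarrow> F z = 0"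
  shows "(LINT z|lebesgue_on S. F z) = (LINT z|lborel. F z)"
    and "integrable (lebesgue_on S) F \<longleftrightarrow> integrable lborel F"
proof -
  have eq: "(\<lambda>x. indicat_real S x *\<^sub>R F x) = F" using 0 by (auto simp: fun_eq_iff indicator_def)
  have [measurable]: "S \<in> sets lebesgue" using S by simp
  have Fl: "F \<in> borel_measurable lborel" using F by simp
  show "(LINT z|lebesgue_on S. F z) = (LINT z|lborel. F z)"
    by (subst integral_restrict_space) (auto simp: eq integral_completion[OF Fl])
  show "integrable (lebesgue_on S) F \<longleftrightarrow> integrable lborel F"
    by (subst integrable_restrict_space) (auto simp: eq integrable_completion[OF Fl])
qed

lemma test_function_integrable:
  assumes "test_function \<Omega> \<phi>" shows "integrable lborel \<phi>"
  by (rule test_functionE[OF assms]) (rule continuous_compact_support_integrable[OF smooth_continuous])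

lemma integral_wirt_test_function:
  assumes "test_function \<Omega> \<phi>" shows "(LINT z|lborel. wirt i \<phi> z) = 0"
proof -
  obtain K where K: "smooth \<phi>" "compact K" "K \<subseteq> \<Omega>" "\<And>z. z \<notin> K \<Longrightarrow> \<phi> z = 0"
    using assms by (auto elim: test_functionE)
  obtain u v c where wirt: "wirt i = (\<lambda>\<phi> z. (frechet_derivative \<phi> (at z) u + c * frechet_derivative \<phi> (at z) v) / 2)"
    by (rule wirt_conv_frechet)
  have fr: "integrable lborel (\<lambda>z. frechet_derivative \<phi> (at z) v)" for v
  proof (rule continuous_compact_support_integrable[OF smooth_continuous[OF smooth_frechet[OF K(1)]] K(2)])
    fix z assume "z \<notin> K"
    then have "frechet_derivative \<phi> (at z) = frechet_derivative (\<lambda>z. 0) (at z)"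
      using K by (intro frechet_derivative_cong_open[of "- K"] open_Compl compact_imp_closed) auto
    then show "frechet_derivative \<phi> (at z) v = 0" by simp
  qed
  have 0: "(LINT z|lborel. frechet_derivative \<phi> (at z) v) = 0" for v
    by (rule integral_derivative_compact_support_eq_0[OF K(1,2,4)])
  show ?thesis unfolding wirt using fr 0 by simp
qed

text \<open>The product \<open>h \<psi>\<close> is a test function, and the integral of its derivative vanishes.\<close>

lemma integration_by_parts_wirt:
  assumes S: "open S" and h: "smooth_on S h" and \<psi>: "test_function S \<psi>"
  shows "(LINT z|lebesgue_on S. h z * wirt i \<psi> z) = - (LINT z|lebesgue_on S. wirt i h z * \<psi> z)"
proof -
  have t1: "test_function S (\<lambda>z. wirt i \<psi> z * h z)"
    by (intro test_function_mult_local S h test_function_wirt \<psi>)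
  have t2: "test_function S (\<lambda>z. \<psi> z * h z)"
    by (intro test_function_mult_local S h \<psi>)
  have eq: "wirt i h z * \<psi> z = wirt i (\<lambda>z. \<psi> z * h z) z - wirt i \<psi> z * h z" for z
  proof (cases "z \<in> S")
    case True
    then show ?thesis
      by (subst wirt_mult) (auto intro!: smooth_differentiable test_function_smooth[OF \<psi>] smooth_on_differentiable[OF h])
  next
    case False
    then show ?thesis
      using test_function_outside[OF \<psi>] test_function_outside[OF test_function_wirt[OF t2]] test_function_outside[OF t1] by auto
  qed
  have "(LINT z|lebesgue_on S. wirt i h z * \<psi> z) = (LINT z|lborel. wirt i (\<lambda>z. \<psi> z * h z) z - wirt i \<psi> z * h z)"
    unfolding eq using S test_function_outside[OF test_function_wirt[OF t2]] test_function_outside[OF t1]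
    by (intro integral_lebesgue_on_eq_lborel borel_measurable_diff test_function_measurable[OF t1] test_function_measurable[OF test_function_wirt[OF t2]]) auto
  also have "\<dots> = - (LINT z|lborel. wirt i \<psi> z * h z)"
    by (subst Bochner_Integration.integral_diff)
       (auto intro: test_function_integrable[OF t1] test_function_integrable[OF test_function_wirt[OF t2]] simp: integral_wirt_test_function[OF t2])
  also have "(LINT z|lborel. wirt i \<psi> z * h z) = (LINT z|lebesgue_on S. wirt i \<psi> z * h z)"
    using S test_function_outside[OF t1] by (intro integral_lebesgue_on_eq_lborel(1)[symmetric] test_function_measurable[OF t1]) auto
  finally show ?thesis by (simp add: mult.commute)
qed

section \<open>The fundamental lemma of the calculus of variations\<close>

text \<open>The sets over which \<open>U\<close> integrates to \<open>0\<close> form a Dynkin system, and the boxes are a generator of the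
  Borel sets that is closed under intersections. So the integral over every Borel set vanishes.\<close>

lemma integral_boxes_zero_imp_AE_zero_real:
  fixes U :: "'a::euclidean_space \<Rightarrow> real"
  assumes U: "integrable lebesgue U" and box: "\<And>a b. (LINT x:box a b|lebesgue. U x) = 0"
  shows "AE x in lebesgue. U x = 0"
proof -
  have si: "set_integrable lebesgue A U" if "A \<in> sets lebesgue" for A
    unfolding set_integrable_def using integrable_mult_indicator[OF that U] .
  have univ: "(LINT x:UNIV|lebesgue. U x) = 0"
  proof -
    define A where "A = (\<lambda>n::nat. box (- (real n *\<^sub>R One)) (real n *\<^sub>R One) :: 'a set)"
    have "(\<lambda>n. LINT x:A n|lebesgue. U x) \<longlonglongrightarrow> (LINT x:(\<Union>n. A n)|lebesgue. U x)"
    proof (rule set_integral_cont_up)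
      show "incseq A" unfolding A_def incseq_def
      proof (intro allI impI subsetI)
        fix m n :: nat and t :: 'a assume mn: "m \<le> n" and t: "t \<in> box (- (real m *\<^sub>R One)) (real m *\<^sub>R One)"
        have "One \<bullet> i = 1" if "i \<in> Basis" for i :: 'a using that by (simp add: inner_sum_left inner_Basis)
        then show "t \<in> box (- (real n *\<^sub>R One)) (real n *\<^sub>R One)"
          using mn t unfolding mem_box by (auto simp del: inner_sum_left_Basis)
      qed
      show "set_integrable lebesgue (\<Union>n. A n) U" by (rule si) (auto simp: A_def)
    qed (auto simp: A_def)
    moreover have "(\<Union>n. A n) = UNIV" unfolding A_def by (rule UN_box_eq_UNIV)
    ultimately show ?thesis using box by (simp add: A_def LIMSEQ_const_iff)
  qed
  have borel: "(LINT x:A|lebesgue. U x) = 0" if A: "A \<in> sets borel" for A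
  proof -
    have st: "Int_stable (range (\<lambda>(a, b). box a b::'a set))"
      by (auto simp: Int_stable_def box_Int_box)
    have sg: "sets (borel :: 'a measure) = sigma_sets UNIV (range (\<lambda>(a, b). box a b::'a set))"
      by (simp add: borel_eq_box)
    have "range (\<lambda>(a, b). box a b::'a set) \<subseteq> Pow UNIV" "A \<in> sigma_sets UNIV (range (\<lambda>(a, b). box a b))"
      using A sg by auto
    with st show ?thesis
    proof (induct rule: sigma_sets_induct_disjoint)
      case (compl B)
      then have B: "B \<in> sets borel" by (simp add: sg)
      then have "(LINT x:(B \<union> (UNIV - B))|lebesgue. U x) = (LINT x:B|lebesgue. U x) + (LINT x:(UNIV - B)|lebesgue. U x)"
        by (intro set_integral_Un si) auto
      then show ?case using compl univ by simp
    next
      case (union B)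
      have B: "B i \<in> sets borel" for i using union(2) sg by auto
      have "(LINT x:(\<Union>i. B i)|lebesgue. U x) = (\<Sum>i. (LINT x:(B i)|lebesgue. U x))"
      proof (rule lebesgue_integral_countable_add)
        show "set_integrable lebesgue (\<Union> (range B)) U" using B by (intro si) auto
      qed (use B union(1) in \<open>auto simp: disjoint_family_on_def\<close>)
      then show ?case using union(3) by simp
    qed (use box in \<open>auto simp: set_lebesgue_integral_def\<close>)
  qed
  obtain V where V[measurable]: "V \<in> borel_measurable lborel" and UV: "AE x in lborel. U x = V x"
    using completion_ex_borel_measurable_real[OF borel_measurable_integrable[OF U]] by auto
  have UV': "AE x in lebesgue. U x = V x" using AE_completion[OF UV] .
  have intV: "integrable lborel V"
    using integrable_cong_AE_imp[OF U measurable_completion[OF V] UV'] by (simp add: integrable_completion)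
  have V0: "(LINT x|lborel. indicator A x * V x) = 0" if A: "A \<in> sets borel" for A
  proof -
    have "(LINT x|lborel. indicator A x * V x) = (LINT x|lebesgue. indicator A x * V x)"
      using A by (subst integral_completion) auto
    also have "\<dots> = (LINT x:A|lebesgue. U x)"
      unfolding set_lebesgue_integral_def
    proof (rule integral_cong_AE)
      show "(\<lambda>x. indicator A x * V x) \<in> borel_measurable lebesgue"
        using A by (intro measurable_completion) auto
      show "(\<lambda>x. indicat_real A x *\<^sub>R U x) \<in> borel_measurable lebesgue"
        using integrable_mult_indicator[OF _ U, of A] A by (intro borel_measurable_integrable) auto
      show "AE x in lebesgue. indicator A x * V x = indicat_real A x *\<^sub>R U x"
        using UV' by eventually_elim simp
    qed
    finally show ?thesis using borel[OF A] by simp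
  qed
  have half: "AE x in lborel. \<not> c * V x > 0" if c: "c = 1 \<or> c = -1" for c :: real
  proof -
    define A where "A = {x. c * V x > 0}"
    have A: "A \<in> sets borel" unfolding A_def by measurable
    have "(LINT x|lborel. c * (indicator A x * V x)) = 0"
      using V0[OF A] by simp
    moreover have "integrable lborel (\<lambda>x. c * (indicator A x * V x))"
      using integrable_mult_indicator[OF _ intV, of A] A by simp
    ultimately have "AE x in lborel. c * (indicator A x * V x) = 0"
      by (subst (asm) integral_nonneg_eq_0_iff_AE) (auto simp: A_def indicator_def)
    then show ?thesis by eventually_elim (auto simp: A_def indicator_def split: if_splits)
  qed
  have "AE x in lborel. V x = 0"
    using half[of 1] half[of "-1"] by (auto elim: eventually_elim2)
  then have "AE x in lborel. U x = 0" using UV by eventually_elim simp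
  then show ?thesis by (rule AE_completion)
qed

lemma integral_boxes_zero_imp_AE_zero:
  fixes U :: "'a::euclidean_space \<Rightarrow> complex"
  assumes U: "integrable lebesgue U" and box: "\<And>a b. (LINT x:box a b|lebesgue. U x) = 0"
  shows "AE x in lebesgue. U x = 0"
proof -
  have si: "set_integrable lebesgue (box a b) U" for a b
    unfolding set_integrable_def using integrable_mult_indicator[OF _ U] by simp
  have "AE x in lebesgue. Re (U x) = 0"
  proof (rule integral_boxes_zero_imp_AE_zero_real)
    show "(LINT x:box a b|lebesgue. Re (U x)) = 0" for a b
      using integral_Re[OF si[of a b, unfolded set_integrable_def]] box[of a b] by (simp add: set_lebesgue_integral_def)
  qed (use U in auto)
  moreover have "AE x in lebesgue. Im (U x) = 0"
  proof (rule integral_boxes_zero_imp_AE_zero_real)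
    show "(LINT x:box a b|lebesgue. Im (U x)) = 0" for a b
      using integral_Im[OF si[of a b, unfolded set_integrable_def]] box[of a b] by (simp add: set_lebesgue_integral_def)
  qed (use U in auto)
  ultimately show ?thesis by eventually_elim (simp add: complex_eq_iff)
qed

lemma smooth_prod:
  fixes f :: "'i \<Rightarrow> 'a::real_normed_vector \<Rightarrow> 'b::{real_normed_algebra, comm_ring_1}"
  assumes "\<And>i. i \<in> I \<Longrightarrow> smooth (f i)"
  shows "smooth (\<lambda>x. \<Prod>i\<in>I. f i x)"
  using assms by (induction I rule: infinite_finite_induct) (auto intro: smooth_intros)

lemma flat_1_tendsto:
  assumes "s > 0" shows "(\<lambda>n. flat 1 (real n * s - c)) \<longlonglongrightarrow> 1"
proof -
  have lim: "filterlim (\<lambda>n. real n * s - c) at_top sequentially"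
    using assms by real_asymp
  have "((\<lambda>y. exp (- 1 / y)) \<longlongrightarrow> (1::real)) at_top" by real_asymp
  from filterlim_compose[OF this lim] have "(\<lambda>n. exp (- 1 / (real n * s - c))) \<longlonglongrightarrow> 1" .
  moreover have "\<forall>\<^sub>F n in sequentially. real n * s - c > 0"
    using filterlim_at_top_dense[THEN iffD1, OF lim, rule_format, of 0] .
  then have "\<forall>\<^sub>F n in sequentially. exp (- 1 / (real n * s - c)) = flat 1 (real n * s - c)"
    by eventually_elim (simp add: flat_def)
  ultimately show ?thesis by (rule Lim_transform_eventually)
qed

lemma flat_1_bounds: "0 \<le> flat 1 s" "flat 1 s \<le> 1"
  by (auto simp: flat_def)

text \<open>Products of flat functions of \<open>n (z - a)\<close> and \<open>n (b - z)\<close> in the real coordinates are test functions that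
  increase to the indicator of the open box.\<close>

lemma fundamental_lemma_box:
  fixes u :: "complex \<times> complex \<Rightarrow> complex"
  assumes \<Omega>: "open \<Omega>" and u: "u \<in> L1_loc \<Omega>"
    and 0: "\<And>\<phi>. test_function \<Omega> \<phi> \<Longrightarrow> (LINT z|lebesgue_on \<Omega>. u z * \<phi> z) = 0"
    and ab: "cbox a b \<subseteq> \<Omega>"
  shows "(LINT z:box a b|lebesgue. u z) = 0"
proof -
  define \<phi> where "\<phi> = (\<lambda>n z. complex_of_real (\<Prod>i\<in>Basis. flat 1 (real n * ((z - a) \<bullet> i) - 0) * flat 1 (real n * ((b - z) \<bullet> i) - 0)))"
  have inner: "smooth (\<lambda>z::complex \<times> complex. real n * ((z - a) \<bullet> i) - 0)" "smooth (\<lambda>z::complex \<times> complex. real n * ((b - z) \<bullet> i) - 0)" for n i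
    unfolding inner_diff_left by (intro smooth_intros smooth_bounded_linear[OF bounded_linear_inner_left])+
  have z0: "\<phi> n z = 0" if "z \<notin> box a b" for n z
  proof -
    from that obtain i where "i \<in> Basis" "\<not> (a \<bullet> i < z \<bullet> i \<and> z \<bullet> i < b \<bullet> i)" by (auto simp: mem_box)
    then have "flat 1 (real n * ((z - a) \<bullet> i) - 0) * flat 1 (real n * ((b - z) \<bullet> i) - 0) = 0"
      by (auto simp: flat_def inner_diff_left zero_less_mult_iff)
    with \<open>i \<in> Basis\<close> show ?thesis unfolding \<phi>_def by (auto simp: prod_zero_iff)
  qed
  have test: "test_function \<Omega> (\<phi> n)" for n
  proof (rule test_functionI[OF _ _ ab])
    show "smooth (\<phi> n)" unfolding \<phi>_def
      by (intro smooth_of_real smooth_prod smooth_mult smooth_flat_compose inner)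
    show "\<phi> n z = 0" if "z \<notin> cbox a b" for z
      using z0[of z n] that box_subset_cbox[of a b] by blast
  qed auto
  have ui: "set_integrable lebesgue (cbox a b) u" using u ab by (auto simp: L1_loc_def)
  have "(\<lambda>n. LINT z|lebesgue. (indicator (cbox a b) z *\<^sub>R u z) * \<phi> n z) \<longlonglongrightarrow> (LINT z|lebesgue. indicator (box a b) z *\<^sub>R u z)"
  proof (rule integral_dominated_convergence[where w="\<lambda>z. norm (indicator (cbox a b) z *\<^sub>R u z)"])
    show "(\<lambda>z. indicator (box a b) z *\<^sub>R u z) \<in> borel_measurable lebesgue"
      using set_integrable_subset[OF ui, of "box a b"] by (auto simp: set_integrable_def box_subset_cbox)
    show "(\<lambda>z. indicator (cbox a b) z *\<^sub>R u z * \<phi> n z) \<in> borel_measurable lebesgue" for n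
      by (intro borel_measurable_times measurable_completion borel_measurable_integrable[OF ui[unfolded set_integrable_def]])
         (simp add: test_function_measurable[OF test])
    show "integrable lebesgue (\<lambda>z. norm (indicator (cbox a b) z *\<^sub>R u z))"
      by (rule integrable_norm[OF ui[unfolded set_integrable_def]])
    show "AE z in lebesgue. (\<lambda>n. indicator (cbox a b) z *\<^sub>R u z * \<phi> n z) \<longlonglongrightarrow> indicator (box a b) z *\<^sub>R u z"
    proof (rule AE_I2)
      fix z
      show "(\<lambda>n. indicator (cbox a b) z *\<^sub>R u z * \<phi> n z) \<longlonglongrightarrow> indicator (box a b) z *\<^sub>R u z"
      proof (cases "z \<in> box a b")
        case True
        then have "(\<lambda>n. \<phi> n z) \<longlonglongrightarrow> of_real (\<Prod>i\<in>(Basis::(complex\<times>complex) set). 1 * 1)" unfolding \<phi>_def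
          by (intro tendsto_intros tendsto_prod flat_1_tendsto) (auto simp: mem_box inner_diff_left)
        then have "(\<lambda>n. indicator (cbox a b) z *\<^sub>R u z * \<phi> n z) \<longlonglongrightarrow> indicator (cbox a b) z *\<^sub>R u z * 1"
          by (intro tendsto_intros) simp
        moreover have "z \<in> cbox a b" using True box_subset_cbox by blast
        ultimately show ?thesis using True by simp
      next
        case False then show ?thesis by (simp add: z0)
      qed
    qed
    show "AE z in lebesgue. norm (indicator (cbox a b) z *\<^sub>R u z * \<phi> n z) \<le> norm (indicator (cbox a b) z *\<^sub>R u z)" for n
    proof (rule AE_I2)
      fix z
      have "norm (\<phi> n z) = (\<Prod>i\<in>Basis. \<bar>flat 1 (real n * ((z - a) \<bullet> i) - 0) * flat 1 (real n * ((b - z) \<bullet> i) - 0)\<bar>)"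
        unfolding \<phi>_def norm_of_real by (rule abs_prod)
      also have "\<dots> \<le> (\<Prod>i\<in>(Basis::(complex\<times>complex) set). 1)"
        by (intro prod_mono) (auto simp: abs_mult flat_1_bounds intro!: mult_le_one)
      finally have "norm (\<phi> n z) \<le> 1" by simp
      then show "norm (indicator (cbox a b) z *\<^sub>R u z * \<phi> n z) \<le> norm (indicator (cbox a b) z *\<^sub>R u z)"
        unfolding norm_mult by (intro mult_left_le) auto
    qed
  qed
  moreover have "(LINT z|lebesgue. (indicator (cbox a b) z *\<^sub>R u z) * \<phi> n z) = 0" for n
  proof -
    have "(LINT z|lebesgue. (indicator (cbox a b) z *\<^sub>R u z) * \<phi> n z) = (LINT z|lebesgue. indicator \<Omega> z *\<^sub>R (u z * \<phi> n z))"
    proof (rule Bochner_Integration.integral_cong[OF refl])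
      fix z
      show "indicator (cbox a b) z *\<^sub>R u z * \<phi> n z = indicator \<Omega> z *\<^sub>R (u z * \<phi> n z)"
        using ab z0[of z n] box_subset_cbox[of a b] by (cases "z \<in> box a b") (auto simp: indicator_def)
    qed
    also have "\<dots> = (LINT z|lebesgue_on \<Omega>. u z * \<phi> n z)"
      using \<Omega> by (subst integral_restrict_space) auto
    finally show ?thesis using 0[OF test] by simp
  qed
  ultimately show ?thesis by (simp add: set_lebesgue_integral_def LIMSEQ_const_iff)
qed

lemma fundamental_lemma:
  fixes u :: "complex \<times> complex \<Rightarrow> complex"
  assumes \<Omega>: "open \<Omega>" and u: "u \<in> L1_loc \<Omega>"
    and 0: "\<And>\<phi>. test_function \<Omega> \<phi> \<Longrightarrow> (LINT z|lebesgue_on \<Omega>. u z * \<phi> z) = 0"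
  shows "AE z in lebesgue_on \<Omega>. u z = 0"
proof -
  have on_box: "AE z in lebesgue. z \<in> box c d \<longrightarrow> u z = 0" if cd: "cbox c d \<subseteq> \<Omega>" for c d
  proof -
    have ui: "set_integrable lebesgue (box c d) u"
      using u cd set_integrable_subset[of lebesgue "cbox c d" u "box c d"] by (auto simp: L1_loc_def box_subset_cbox)
    have "AE z in lebesgue. indicator (box c d) z *\<^sub>R u z = 0"
    proof (rule integral_boxes_zero_imp_AE_zero)
      fix a b
      obtain l r where lr: "box a b \<inter> box c d = box l r" using box_Int_box by blast
      have "(LINT z:box a b|lebesgue. indicator (box c d) z *\<^sub>R u z) = (LINT z:box l r|lebesgue. u z)"
        unfolding set_lebesgue_integral_def lr[symmetric] by (simp add: indicator_inter_arith)
      also have "\<dots> = 0"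
      proof (cases "box l r = {}")
        case True then show ?thesis by (simp add: set_lebesgue_integral_def)
      next
        case False
        have "cbox l r = closure (box l r)" using False by simp
        also have "\<dots> \<subseteq> closure (box c d)" using lr by (intro closure_mono) auto
        also have "\<dots> \<subseteq> cbox c d" by (intro closure_minimal box_subset_cbox) auto
        finally show ?thesis using cd by (intro fundamental_lemma_box[OF \<Omega> u 0]) auto
      qed
      finally show "(LINT z:box a b|lebesgue. indicator (box c d) z *\<^sub>R u z) = 0" .
    qed (use ui in \<open>simp add: set_integrable_def\<close>)
    then show ?thesis by eventually_elim (auto simp: indicator_def)
  qed
  obtain D where D: "countable D" "\<And>X. X \<in> D \<Longrightarrow> \<exists>a b. X = box a b \<and> cbox a b \<subseteq> \<Omega>" "\<Union>D = \<Omega>"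
  proof -
    define B where "B = {(a, b). cbox a b \<subseteq> \<Omega>}"
    have op: "\<And>X. X \<in> (\<lambda>(a, b). box a b) ` B \<Longrightarrow> open X" by auto
    obtain D' where D': "D' \<subseteq> (\<lambda>(a, b). box a b) ` B" "countable D'" "\<Union>D' = \<Union>((\<lambda>(a, b). box a b) ` B)"
      using Lindelof[OF op] by metis
    have un: "\<Union>((\<lambda>(a, b). box a b) ` B) = \<Omega>"
    proof
      show "\<Union>((\<lambda>(a, b). box a b) ` B) \<subseteq> \<Omega>" using box_subset_cbox by (fastforce simp: B_def)
      show "\<Omega> \<subseteq> \<Union>((\<lambda>(a, b). box a b) ` B)"
      proof
        fix x assume "x \<in> \<Omega>"
        then obtain e where "e > 0" "ball x e \<subseteq> \<Omega>" using \<Omega> openE by blast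
        then obtain a b where "x \<in> box a b" "cbox a b \<subseteq> ball x e"
        proof -
          have "cball x (e/2) \<subseteq> ball x e" using \<open>e > 0\<close> by auto
          moreover obtain a b where "x \<in> box a b" "box a b \<subseteq> ball x (e/2)"
            using rational_boxes[of "e/2" x] \<open>e > 0\<close> by auto
          moreover from this have "cbox a b \<subseteq> cball x (e/2)"
          proof -
            have "cbox a b = closure (box a b)" using \<open>x \<in> box a b\<close> by (subst closure_box) auto
            also have "\<dots> \<subseteq> cball x (e/2)"
              using \<open>box a b \<subseteq> ball x (e/2)\<close> by (intro closure_minimal) (auto intro: order.trans[OF _ ball_subset_cball])
            finally show ?thesis .
          qed
          ultimately show ?thesis using that by blast
        qed
        then have "(a, b) \<in> B" using \<open>ball x e \<subseteq> \<Omega>\<close> by (auto simp: B_def simp del: cbox_Pair_eq)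
        then show "x \<in> \<Union>((\<lambda>(a, b). box a b) ` B)" using \<open>x \<in> box a b\<close> by blast
      qed
    qed
    show ?thesis
    proof (rule that)
      show "countable D'" "\<Union>D' = \<Omega>" using D' un by simp_all
      show "\<exists>a b. X = box a b \<and> cbox a b \<subseteq> \<Omega>" if "X \<in> D'" for X
      proof -
        from D'(1) that obtain ab where "ab \<in> B" "X = (case ab of (a, b) \<Rightarrow> box a b)" by blast
        then have "X = box (fst ab) (snd ab) \<and> cbox (fst ab) (snd ab) \<subseteq> \<Omega>"
          unfolding B_def by (simp add: split_beta)
        then show ?thesis by blast
      qed
    qed
  qed
  have "AE z in lebesgue. \<forall>X\<in>D. z \<in> X \<longrightarrow> u z = 0"
  proof (subst AE_ball_countable[OF D(1)], rule ballI)
    fix X assume "X \<in> D"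
    then obtain a b where "X = box a b" "cbox a b \<subseteq> \<Omega>" using D(2) by blast
    then show "AE z in lebesgue. z \<in> X \<longrightarrow> u z = 0" using on_box by simp
  qed
  then have "AE z in lebesgue. z \<in> \<Omega> \<longrightarrow> u z = 0"
    by eventually_elim (use D(3) in blast)
  moreover have "\<Omega> \<inter> space lebesgue \<in> sets lebesgue" using \<Omega> by simp
  ultimately show ?thesis by (subst AE_restrict_space_iff) auto
qed

section \<open>Geometry of the Hartogs triangle\<close>

abbreviation (input) "HT \<equiv> hartogs_triangle"

lemma hartogs_iff: "z \<in> HT \<longleftrightarrow> cmod (fst z) < cmod (snd z) \<and> cmod (snd z) < 1"
  by (auto simp: hartogs_triangle_def split: prod.splits)

lemma open_hartogs: "open HT"
proof -
  have "HT = {z. cmod (fst z) < cmod (snd z)} \<inter> {z. cmod (snd z) < 1}" by (auto simp: hartogs_iff)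
  also have "open \<dots>" by (intro open_Int open_Collect_less continuous_intros)
  finally show ?thesis .
qed

lemma hartogs_measurable[measurable, simp]: "HT \<in> sets borel" "HT \<in> sets lebesgue"
  using open_hartogs by auto

lemma hartogs_snd_nonzero: "z \<in> HT \<Longrightarrow> snd z \<noteq> 0" by (auto simp: hartogs_iff)

lemma hartogs_mult:
  assumes "z \<in> HT" "cmod (fst c) \<le> cmod (snd c)" "cmod (snd c) \<le> 1" "snd c \<noteq> 0"
  shows "(fst z * fst c, snd z * snd c) \<in> HT"
proof -
  have "cmod (fst z) * cmod (fst c) \<le> cmod (fst z) * cmod (snd c)" using assms by (intro mult_left_mono) auto
  also have "\<dots> < cmod (snd z) * cmod (snd c)" using assms by (intro mult_strict_right_mono) (auto simp: hartogs_iff)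
  finally have 1: "cmod (fst z) * cmod (fst c) < cmod (snd z) * cmod (snd c)" .
  have "cmod (snd z) * cmod (snd c) \<le> cmod (snd z) * 1" using assms by (intro mult_left_mono) auto
  also have "\<dots> < 1" using assms by (auto simp: hartogs_iff)
  finally show ?thesis using 1 by (simp add: hartogs_iff norm_mult)
qed

text \<open>The continuous positive function \<open>min (\<bar>z\<^sub>2\<bar> - \<bar>z\<^sub>1\<bar>) (1 - \<bar>z\<^sub>2\<bar>)\<close> attains a positive minimum on the compact set.\<close>

lemma hartogs_compact_margin:
  assumes "compact K" "K \<subseteq> HT"
  shows "\<exists>d. 0 < d \<and> d < 1 \<and> (\<forall>z\<in>K. cmod (fst z) \<le> (1 - d) * cmod (snd z) \<and> cmod (snd z) \<le> 1 - d \<and> d \<le> cmod (snd z))"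
proof (cases "K = {}")
  case True then show ?thesis by (intro exI[of _ "1/2"]) auto
next
  case False
  define m where "m = (\<lambda>z::complex \<times> complex. min (cmod (snd z) - cmod (fst z)) (1 - cmod (snd z)))"
  have "continuous_on K m" unfolding m_def by (intro continuous_intros)
  then obtain z0 where z0: "z0 \<in> K" "\<And>z. z \<in> K \<Longrightarrow> m z0 \<le> m z"
    using continuous_attains_inf[OF assms(1) False] by blast
  have m0: "m z0 > 0" using z0 assms by (auto simp: m_def hartogs_iff)
  have "m z0 \<le> cmod (snd z0)" "m z0 \<le> 1 - cmod (snd z0)" by (auto simp: m_def min_le_iff_disj)
  with m0 have m1: "m z0 < 1" using z0(1) assms(2) hartogs_iff[of z0] by (auto dest!: subsetD)
  show ?thesis
  proof (intro exI[of _ "m z0"] conjI ballI m0 m1)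
    fix z assume z: "z \<in> K"
    have b: "m z0 \<le> cmod (snd z) - cmod (fst z)" "m z0 \<le> 1 - cmod (snd z)"
      using z0(2)[OF z] by (auto simp: m_def)
    have h: "cmod (snd z) < 1" using z assms hartogs_iff by blast
    have "m z0 * cmod (snd z) \<le> m z0" using m0 h by (simp add: mult_left_le)
    then show "cmod (fst z) \<le> (1 - m z0) * cmod (snd z)" using b by (simp add: algebra_simps)
    show "cmod (snd z) \<le> 1 - m z0" "m z0 \<le> cmod (snd z)" using b norm_ge_zero[of "fst z"] by linarith+
  qed
qed

section \<open>A class of rational functions on the Hartogs triangle\<close>

text \<open>Sums of \<open>y\<^sup>i / ((y - x)\<^sup>m (1 - y)\<^sup>l)\<close> in the variables \<open>q = (x, y)\<close>. The parameter \<open>d\<close> is a lower bound for the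
  degree \<open>i - m\<close> of homogeneity at the origin; it controls the growth there and drops by one with each
  derivative. All derivatives of the Bergman kernel have this form.\<close>

inductive kernel_class :: "int \<Rightarrow> (complex \<times> complex \<Rightarrow> complex) \<Rightarrow> bool" where
  mono: "d + int m \<le> int i \<Longrightarrow>
    kernel_class d (\<lambda>q. c * snd q ^ i * inverse (snd q - fst q) ^ m * inverse (1 - snd q) ^ l)"
| add: "kernel_class d f \<Longrightarrow> kernel_class d g \<Longrightarrow> kernel_class d (\<lambda>q. f q + g q)"

lemma kernel_class_cmult:
  assumes "kernel_class d h" shows "kernel_class d (\<lambda>q. c * h q)"
  using assms
proof induction
  case (mono d m i c' l)
  from kernel_class.mono[OF mono, of "c * c'" l] show ?case by (simp add: mult.assoc)
next
  case (add d f g)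
  then show ?case by (auto simp: ring_distribs intro: kernel_class.add)
qed

lemma kernel_class_measurable[measurable (raw)]: "kernel_class d h \<Longrightarrow> h \<in> borel_measurable borel"
  by (induction rule: kernel_class.induct) (simp_all add: borel_prod[symmetric])

text \<open>A complex-linear derivative with the two partial derivatives \<open>a\<close> and \<open>b\<close>.\<close>

definition has_cderiv :: "(complex \<times> complex \<Rightarrow> complex) \<Rightarrow> complex \<Rightarrow> complex \<Rightarrow> complex \<times> complex \<Rightarrow> bool" where
  "has_cderiv f a b q \<longleftrightarrow> (f has_derivative (\<lambda>v. a * fst v + b * snd v)) (at q)"

lemma has_cderiv_eqI: "has_cderiv f a b q \<Longrightarrow> a = a' \<Longrightarrow> b = b' \<Longrightarrow> has_cderiv f a' b' q" by simp

lemma has_cderiv_mult: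
  "has_cderiv f a b q \<Longrightarrow> has_cderiv g a' b' q \<Longrightarrow> has_cderiv (\<lambda>q. f q * g q) (a * g q + f q * a') (b * g q + f q * b') q"
  unfolding has_cderiv_def by (drule (1) has_derivative_mult) (simp add: algebra_simps)

lemma has_cderiv_add:
  "has_cderiv f a b q \<Longrightarrow> has_cderiv g a' b' q \<Longrightarrow> has_cderiv (\<lambda>q. f q + g q) (a + a') (b + b') q"
  unfolding has_cderiv_def by (drule (1) has_derivative_add) (simp add: algebra_simps)

lemma has_cderiv_const: "has_cderiv (\<lambda>q. c) 0 0 q"
  unfolding has_cderiv_def by simp

lemma has_cderiv_power:
  assumes "has_cderiv f a b q"
  shows "has_cderiv (\<lambda>q. f q ^ n) (of_nat n * f q ^ (n - 1) * a) (of_nat n * f q ^ (n - 1) * b) q"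
proof (induction n)
  case 0 then show ?case by (simp add: has_cderiv_const)
next
  case (Suc n)
  have "has_cderiv (\<lambda>q. f q * f q ^ n) (a * f q ^ n + f q * (of_nat n * f q ^ (n - 1) * a)) (b * f q ^ n + f q * (of_nat n * f q ^ (n - 1) * b)) q"
    by (rule has_cderiv_mult[OF assms Suc])
  then show ?case by (cases n) (auto elim!: has_cderiv_eqI simp: algebra_simps)
qed

lemma has_cderiv_inverse:
  assumes "has_cderiv f a b q" "f q \<noteq> 0"
  shows "has_cderiv (\<lambda>q. inverse (f q)) (- (a * inverse (f q) ^ 2)) (- (b * inverse (f q) ^ 2)) q"
  using Deriv.has_derivative_inverse[OF assms(2) assms(1)[unfolded has_cderiv_def]]
  unfolding has_cderiv_def by (simp add: algebra_simps power2_eq_square)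

lemma kernel_class_derivative:
  assumes "kernel_class d h"
  shows "\<exists>hx hy. kernel_class (d - 1) hx \<and> kernel_class (d - 1) hy \<and> (\<forall>q\<in>HT. has_cderiv h (hx q) (hy q) q)"
  using assms
proof induction
  case (mono d m i c l)
  define hx where "hx = (\<lambda>q::complex\<times>complex. (c * of_nat m) * snd q ^ i * inverse (snd q - fst q) ^ (m + 1) * inverse (1 - snd q) ^ l)"
  define h1 where "h1 = (\<lambda>q::complex\<times>complex. (c * of_nat i) * snd q ^ (i - 1) * inverse (snd q - fst q) ^ m * inverse (1 - snd q) ^ l)"
  define h2 where "h2 = (\<lambda>q::complex\<times>complex. (- (c * of_nat m)) * snd q ^ i * inverse (snd q - fst q) ^ (m + 1) * inverse (1 - snd q) ^ l)"
  define h3 where "h3 = (\<lambda>q::complex\<times>complex. (c * of_nat l) * snd q ^ i * inverse (snd q - fst q) ^ m * inverse (1 - snd q) ^ (l + 1))"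
  have "kernel_class (d - 1) hx" "kernel_class (d - 1) h1" "kernel_class (d - 1) h2" "kernel_class (d - 1) h3"
    unfolding hx_def h1_def h2_def h3_def using mono by (intro kernel_class.mono; simp)+
  moreover from this have "kernel_class (d - 1) (\<lambda>q. (h1 q + h2 q) + h3 q)" by (intro kernel_class.add)
  moreover have "has_cderiv (\<lambda>q. c * snd q ^ i * inverse (snd q - fst q) ^ m * inverse (1 - snd q) ^ l) (hx q) ((h1 q + h2 q) + h3 q) q"
    if q: "q \<in> HT" for q
  proof -
    have nz: "snd q - fst q \<noteq> 0" "1 - snd q \<noteq> 0" using q by (auto simp: hartogs_iff)
    have A: "has_cderiv snd 0 1 q" unfolding has_cderiv_def by (auto intro!: derivative_eq_intros)
    have B: "has_cderiv (\<lambda>q. snd q - fst q) (-1) 1 q" unfolding has_cderiv_def by (auto intro!: derivative_eq_intros)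
    have E: "has_cderiv (\<lambda>q. 1 - snd q) 0 (-1) q" unfolding has_cderiv_def by (auto intro!: derivative_eq_intros)
    have pm: "of_nat m * inverse w ^ (m - 1) * inverse w ^ 2 = of_nat m * inverse w ^ (m + 1)" for w :: complex
      by (cases m) (auto simp: power2_eq_square)
    have pl: "of_nat l * inverse w ^ (l - 1) * inverse w ^ 2 = of_nat l * inverse w ^ (l + 1)" for w :: complex
      by (cases l) (auto simp: power2_eq_square)
    have Bm: "has_cderiv (\<lambda>q. inverse (snd q - fst q) ^ m) (of_nat m * inverse (snd q - fst q) ^ (m + 1)) (- (of_nat m * inverse (snd q - fst q) ^ (m + 1))) q"
      by (rule has_cderiv_eqI[OF has_cderiv_power[OF has_cderiv_inverse[OF B nz(1)]]]) (simp_all only: pm[symmetric], simp_all)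
    have El: "has_cderiv (\<lambda>q. inverse (1 - snd q) ^ l) 0 (of_nat l * inverse (1 - snd q) ^ (l + 1)) q"
      by (rule has_cderiv_eqI[OF has_cderiv_power[OF has_cderiv_inverse[OF E nz(2)]]]) (simp_all only: pl[symmetric], simp_all)
    show ?thesis
      by (rule has_cderiv_eqI[OF has_cderiv_mult[OF has_cderiv_mult[OF has_cderiv_mult[OF has_cderiv_const has_cderiv_power[OF A]] Bm] El]])
         (simp_all add: hx_def h1_def h2_def h3_def ring_distribs)
  qed
  ultimately show ?case by blast
next
  case (add d f g)
  then obtain fx fy gx gy where "kernel_class (d - 1) fx" "kernel_class (d - 1) fy" "kernel_class (d - 1) gx" "kernel_class (d - 1) gy"
    "\<And>q. q \<in> HT \<Longrightarrow> has_cderiv f (fx q) (fy q) q" "\<And>q. q \<in> HT \<Longrightarrow> has_cderiv g (gx q) (gy q) q" by blast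
  then show ?case
    by (intro exI[of _ "\<lambda>q. fx q + gx q"] exI[of _ "\<lambda>q. fy q + gy q"]) (auto intro!: kernel_class.add has_cderiv_add)
qed

text \<open>If \<open>x\<close> and \<open>y\<close> keep a relative distance \<open>d\<close> from \<open>\<bar>x\<bar> = \<bar>y\<bar>\<close> and \<open>\<bar>y\<bar> = 1\<close>, then \<open>\<bar>y - x\<bar> \<ge> d \<bar>y\<bar>\<close> and
  \<open>\<bar>1 - y\<bar> \<ge> d\<close>, so only the homogeneity at the origin contributes.\<close>

lemma kernel_class_bound:
  assumes "kernel_class e h" "0 < d"
  shows "\<exists>C\<ge>0. \<forall>q\<in>HT. cmod (fst q) \<le> (1 - d) * cmod (snd q) \<longrightarrow> cmod (snd q) \<le> 1 - d \<longrightarrow>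
     cmod (h q) \<le> C * cmod (snd q) powi e"
  using assms(1)
proof induction
  case (mono e m i c l)
  show ?case
  proof (intro exI[of _ "cmod c * inverse d ^ m * inverse d ^ l"] conjI ballI impI)
    show "0 \<le> cmod c * inverse d ^ m * inverse d ^ l" using assms(2) by simp
    fix q assume q: "q \<in> HT" "cmod (fst q) \<le> (1 - d) * cmod (snd q)" "cmod (snd q) \<le> 1 - d"
    define r where "r = cmod (snd q)"
    have r: "0 < r" "r \<le> 1" using q by (auto simp: r_def hartogs_iff)
    have "d * r \<le> cmod (snd q) - cmod (fst q)" using q by (simp add: r_def algebra_simps)
    also have "\<dots> \<le> cmod (snd q - fst q)" by (rule norm_triangle_ineq2)
    finally have "inverse (cmod (snd q - fst q)) \<le> inverse (d * r)" using assms(2) r by (intro le_imp_inverse_le) auto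
    then have 1: "inverse (cmod (snd q - fst q)) ^ m \<le> inverse (d * r) ^ m" by (intro power_mono) auto
    have "d \<le> cmod 1 - cmod (snd q)" using q by simp
    also have "\<dots> \<le> cmod (1 - snd q)" by (rule norm_triangle_ineq2)
    finally have "inverse (cmod (1 - snd q)) \<le> inverse d" using assms(2) by (intro le_imp_inverse_le) auto
    then have 2: "inverse (cmod (1 - snd q)) ^ l \<le> inverse d ^ l" by (intro power_mono) auto
    have "cmod (c * snd q ^ i * inverse (snd q - fst q) ^ m * inverse (1 - snd q) ^ l)
        = cmod c * r ^ i * inverse (cmod (snd q - fst q)) ^ m * inverse (cmod (1 - snd q)) ^ l"
      by (simp add: norm_mult norm_power norm_inverse r_def)
    also have "\<dots> \<le> cmod c * r ^ i * inverse (d * r) ^ m * inverse d ^ l"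
      using 1 2 r assms(2) by (intro mult_mono mult_left_mono) auto
    also have "\<dots> = cmod c * inverse d ^ m * inverse d ^ l * (r powi (int i - int m))"
      using r by (simp add: power_int_diff power_mult_distrib field_simps)
    also have "r powi (int i - int m) \<le> r powi e"
      using r mono by (intro power_int_decreasing) auto
    finally show "cmod (c * snd q ^ i * inverse (snd q - fst q) ^ m * inverse (1 - snd q) ^ l)
        \<le> cmod c * inverse d ^ m * inverse d ^ l * cmod (snd q) powi e"
      using assms(2) by (simp add: r_def mult_left_mono)
  qed
next
  case (add e f g)
  then obtain C C' where C: "C \<ge> 0" "C' \<ge> 0"
    "\<And>q. q \<in> HT \<Longrightarrow> cmod (fst q) \<le> (1 - d) * cmod (snd q) \<Longrightarrow> cmod (snd q) \<le> 1 - d \<Longrightarrow> cmod (f q) \<le> C * cmod (snd q) powi e"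
    "\<And>q. q \<in> HT \<Longrightarrow> cmod (fst q) \<le> (1 - d) * cmod (snd q) \<Longrightarrow> cmod (snd q) \<le> 1 - d \<Longrightarrow> cmod (g q) \<le> C' * cmod (snd q) powi e"
    by blast
  show ?case
  proof (intro exI[of _ "C + C'"] conjI ballI impI)
    fix q assume q: "q \<in> HT" "cmod (fst q) \<le> (1 - d) * cmod (snd q)" "cmod (snd q) \<le> 1 - d"
    show "cmod (f q + g q) \<le> (C + C') * cmod (snd q) powi e"
      using C(3)[OF q] C(4)[OF q] norm_triangle_ineq[of "f q" "g q"] by (simp add: ring_distribs)
  qed (use C in auto)
qed

section \<open>The kernel and its derivatives\<close>

text \<open>The Bergman kernel as a function of \<open>x = z\<^sub>1 \<zeta>\<^sub>1\<^sup>*\<close> and \<open>y = z\<^sub>2 \<zeta>\<^sub>2\<^sup>*\<close>, with the factors arranged as in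
  \<open>kernel_class\<close>.\<close>

definition base_kernel :: "complex \<times> complex \<Rightarrow> complex" where
  "base_kernel q = (1 / of_real (pi ^ 2)) * snd q ^ 1 * inverse (snd q - fst q) ^ 2 * inverse (1 - snd q) ^ 2"

lemma kernel_class_base_kernel: "kernel_class (-1) base_kernel"
  unfolding base_kernel_def by (rule kernel_class.mono) simp

text \<open>A pair of partial derivatives inside the class \<open>kernel_class\<close>. Choosing it there, instead of writing
  the derivatives out, keeps the bounds of the class for all orders.\<close>

definition der_pair :: "int \<Rightarrow> (complex \<times> complex \<Rightarrow> complex) \<Rightarrow> (complex \<times> complex \<Rightarrow> complex) \<times> (complex \<times> complex \<Rightarrow> complex)" where
  "der_pair d h = (SOME p. kernel_class (d - 1) (fst p) \<and> kernel_class (d - 1) (snd p) \<and> (\<forall>q\<in>HT. has_cderiv h (fst p q) (snd p q) q))"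

lemma der_pair:
  assumes "kernel_class d h"
  shows "kernel_class (d - 1) (fst (der_pair d h)) \<and> kernel_class (d - 1) (snd (der_pair d h))
    \<and> (\<forall>q\<in>HT. has_cderiv h (fst (der_pair d h) q) (snd (der_pair d h) q) q)"
proof -
  obtain hx hy where "kernel_class (d - 1) hx" "kernel_class (d - 1) hy" "\<forall>q\<in>HT. has_cderiv h (hx q) (hy q) q"
    using kernel_class_derivative[OF assms] by blast
  then show ?thesis
    unfolding der_pair_def
    by (intro someI[where P="\<lambda>p. kernel_class (d - 1) (fst p) \<and> kernel_class (d - 1) (snd p) \<and> (\<forall>q\<in>HT. has_cderiv h (fst p q) (snd p q) q)"
          and x="(hx, hy)"]) simp
qed

primrec base_kernel_dx :: "nat \<Rightarrow> complex \<times> complex \<Rightarrow> complex" where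
  "base_kernel_dx 0 = base_kernel" | "base_kernel_dx (Suc a) = fst (der_pair (-1 - int a) (base_kernel_dx a))"

text \<open>The partial derivative of order \<open>a\<close> in \<open>x\<close> and then \<open>b\<close> in \<open>y\<close>.\<close>

primrec base_kernel_d :: "nat \<Rightarrow> nat \<Rightarrow> complex \<times> complex \<Rightarrow> complex" where
  "base_kernel_d a 0 = base_kernel_dx a" | "base_kernel_d a (Suc b) = snd (der_pair (-1 - int a - int b) (base_kernel_d a b))"

lemma kernel_class_base_kernel_dx: "kernel_class (-1 - int a) (base_kernel_dx a)"
proof (induction a)
  case (Suc a) then show ?case using der_pair[OF Suc] by (simp add: algebra_simps)
qed (simp add: kernel_class_base_kernel)

lemma kernel_class_base_kernel_d: "kernel_class (-1 - int a - int b) (base_kernel_d a b)"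
proof (induction b)
  case (Suc b) then show ?case using der_pair[OF Suc] by (simp add: algebra_simps)
qed (simp add: kernel_class_base_kernel_dx)

lemma base_kernel_d_derivative_fst: "\<exists>c. \<forall>q\<in>HT. has_cderiv (base_kernel_d a 0) (base_kernel_d (Suc a) 0 q) (c q) q"
  using der_pair[OF kernel_class_base_kernel_dx[of a]] by auto

lemma base_kernel_d_derivative_snd: "\<exists>c. \<forall>q\<in>HT. has_cderiv (base_kernel_d a b) (c q) (base_kernel_d a (Suc b) q) q"
  using der_pair[OF kernel_class_base_kernel_d[of a b]] by auto

text \<open>The kernel is a function of these two products. They stay in the Hartogs triangle, since the triangle
  is closed under coordinatewise multiplication and conjugation.\<close>

definition conj_prod :: "complex \<times> complex \<Rightarrow> complex \<times> complex \<Rightarrow> complex \<times> complex" where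
  "conj_prod z \<zeta> = (fst z * cnj (fst \<zeta>), snd z * cnj (snd \<zeta>))"

lemma conj_prod_hartogs: "z \<in> HT \<Longrightarrow> \<zeta> \<in> HT \<Longrightarrow> conj_prod z \<zeta> \<in> HT"
  using hartogs_mult[of z "(cnj (fst \<zeta>), cnj (snd \<zeta>))"] hartogs_snd_nonzero[of \<zeta>]
  by (simp add: conj_prod_def hartogs_iff[of \<zeta>])

lemma fst_conj_prod[simp]: "fst (conj_prod z \<zeta>) = fst z * cnj (fst \<zeta>)" and snd_conj_prod[simp]: "snd (conj_prod z \<zeta>) = snd z * cnj (snd \<zeta>)"
  by (simp_all add: conj_prod_def)

lemma has_cderiv_imp_conj_prod_left:
  assumes "has_cderiv h a b (conj_prod z \<zeta>)"
  shows "((\<lambda>z. h (conj_prod z \<zeta>)) has_derivative (\<lambda>v. a * cnj (fst \<zeta>) * fst v + b * cnj (snd \<zeta>) * snd v)) (at z)"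
proof -
  have "((\<lambda>z. conj_prod z \<zeta>) has_derivative (\<lambda>v. (fst v * cnj (fst \<zeta>), snd v * cnj (snd \<zeta>)))) (at z)"
    unfolding conj_prod_def by (auto intro!: derivative_eq_intros)
  from has_derivative_compose[OF this assms[unfolded has_cderiv_def]]
  show ?thesis by (simp add: ac_simps)
qed

lemma has_cderiv_imp_conj_prod_right:
  assumes "has_cderiv h a b (conj_prod z \<zeta>)"
  shows "((\<lambda>\<zeta>. h (conj_prod z \<zeta>)) has_derivative (\<lambda>v. a * fst z * cnj (fst v) + b * snd z * cnj (snd v))) (at \<zeta>)"
proof -
  have "((\<lambda>\<zeta>. conj_prod z \<zeta>) has_derivative (\<lambda>v. (fst z * cnj (fst v), snd z * cnj (snd v)))) (at \<zeta>)"
    unfolding conj_prod_def by (auto intro!: derivative_eq_intros)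
  from has_derivative_compose[OF this assms[unfolded has_cderiv_def]]
  show ?thesis by (simp add: ac_simps)
qed

lemma smooth_on_conj_prod_left:
  assumes "kernel_class d h" "\<zeta> \<in> HT" shows "smooth_on HT (\<lambda>z. h (conj_prod z \<zeta>))"
  unfolding smooth_on_def
proof (intro exI[of _ "\<lambda>f. \<exists>d h. kernel_class d h \<and> f = (\<lambda>z. h (conj_prod z \<zeta>))"] conjI allI impI)
  fix f assume "\<exists>d h. kernel_class d h \<and> f = (\<lambda>z. h (conj_prod z \<zeta>))"
  then obtain d h where h: "kernel_class d h" "f = (\<lambda>z. h (conj_prod z \<zeta>))" by blast
  obtain hx hy where hx: "kernel_class (d - 1) hx" "kernel_class (d - 1) hy" "\<forall>q\<in>HT. has_cderiv h (hx q) (hy q) q"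
    using kernel_class_derivative[OF h(1)] by blast
  show "\<exists>f'. (\<forall>z\<in>HT. (f has_derivative f' z) (at z)) \<and> (\<forall>v. \<exists>d h. kernel_class d h \<and> (\<lambda>z. f' z v) = (\<lambda>z. h (conj_prod z \<zeta>)))"
  proof (intro exI[of _ "\<lambda>z v. hx (conj_prod z \<zeta>) * cnj (fst \<zeta>) * fst v + hy (conj_prod z \<zeta>) * cnj (snd \<zeta>) * snd v"] conjI ballI allI)
    fix z assume "z \<in> HT"
    then show "(f has_derivative (\<lambda>v. hx (conj_prod z \<zeta>) * cnj (fst \<zeta>) * fst v + hy (conj_prod z \<zeta>) * cnj (snd \<zeta>) * snd v)) (at z)"
      unfolding h(2) using hx(3) conj_prod_hartogs[OF _ assms(2)] by (intro has_cderiv_imp_conj_prod_left) auto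
  next
    fix v
    show "\<exists>d h. kernel_class d h \<and> (\<lambda>z. hx (conj_prod z \<zeta>) * cnj (fst \<zeta>) * fst v + hy (conj_prod z \<zeta>) * cnj (snd \<zeta>) * snd v) = (\<lambda>z. h (conj_prod z \<zeta>))"
      by (intro exI[of _ "d - 1"] exI[of _ "\<lambda>q. (cnj (fst \<zeta>) * fst v) * hx q + (cnj (snd \<zeta>) * snd v) * hy q"] conjI kernel_class.add kernel_class_cmult hx)
         (auto simp: algebra_simps)
  qed
qed (use assms in blast)

lemma smooth_on_conj_prod_right:
  assumes "kernel_class d h" "z \<in> HT" shows "smooth_on HT (\<lambda>\<zeta>. h (conj_prod z \<zeta>))"
  unfolding smooth_on_def
proof (intro exI[of _ "\<lambda>f. \<exists>d h. kernel_class d h \<and> f = (\<lambda>\<zeta>. h (conj_prod z \<zeta>))"] conjI allI impI)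
  fix f assume "\<exists>d h. kernel_class d h \<and> f = (\<lambda>\<zeta>. h (conj_prod z \<zeta>))"
  then obtain d h where h: "kernel_class d h" "f = (\<lambda>\<zeta>. h (conj_prod z \<zeta>))" by blast
  obtain hx hy where hx: "kernel_class (d - 1) hx" "kernel_class (d - 1) hy" "\<forall>q\<in>HT. has_cderiv h (hx q) (hy q) q"
    using kernel_class_derivative[OF h(1)] by blast
  show "\<exists>f'. (\<forall>\<zeta>\<in>HT. (f has_derivative f' \<zeta>) (at \<zeta>)) \<and> (\<forall>v. \<exists>d h. kernel_class d h \<and> (\<lambda>\<zeta>. f' \<zeta> v) = (\<lambda>\<zeta>. h (conj_prod z \<zeta>)))"
  proof (intro exI[of _ "\<lambda>\<zeta> v. hx (conj_prod z \<zeta>) * fst z * cnj (fst v) + hy (conj_prod z \<zeta>) * snd z * cnj (snd v)"] conjI ballI allI)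
    fix \<zeta> assume "\<zeta> \<in> HT"
    then show "(f has_derivative (\<lambda>v. hx (conj_prod z \<zeta>) * fst z * cnj (fst v) + hy (conj_prod z \<zeta>) * snd z * cnj (snd v))) (at \<zeta>)"
      unfolding h(2) using hx(3) conj_prod_hartogs[OF assms(2)] by (intro has_cderiv_imp_conj_prod_right) auto
  next
    fix v
    show "\<exists>d h. kernel_class d h \<and> (\<lambda>\<zeta>. hx (conj_prod z \<zeta>) * fst z * cnj (fst v) + hy (conj_prod z \<zeta>) * snd z * cnj (snd v)) = (\<lambda>\<zeta>. h (conj_prod z \<zeta>))"
      by (intro exI[of _ "d - 1"] exI[of _ "\<lambda>q. (fst z * cnj (fst v)) * hx q + (snd z * cnj (snd v)) * hy q"] conjI kernel_class.add kernel_class_cmult hx)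
         (auto simp: algebra_simps)
  qed
qed (use assms in blast)

text \<open>The derivative \<open>\<partial>\<^sub>1\<^sup>a \<partial>\<^sub>2\<^sup>b\<close> of the kernel in \<open>z\<close>; the powers of \<open>\<zeta>\<^sup>*\<close> are inner derivatives.\<close>

definition kernel_deriv :: "nat \<Rightarrow> nat \<Rightarrow> complex \<times> complex \<Rightarrow> complex \<times> complex \<Rightarrow> complex" where
  "kernel_deriv a b z \<zeta> = cnj (fst \<zeta>) ^ a * cnj (snd \<zeta>) ^ b * base_kernel_d a b (conj_prod z \<zeta>)"

lemma kernel_deriv_measurable[measurable]: "(\<lambda>p. kernel_deriv a b (fst p) (snd p)) \<in> borel_measurable (borel \<Otimes>\<^sub>M borel)"
proof -
  have [measurable]: "base_kernel_d a b \<in> borel_measurable (borel \<Otimes>\<^sub>M borel)" using kernel_class_measurable[OF kernel_class_base_kernel_d] by (simp add: borel_prod)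
  have [measurable]: "cnj \<in> borel_measurable borel" by (intro borel_measurable_continuous_onI continuous_intros)
  have [measurable]: "fst \<in> borel_measurable (borel :: (complex \<times> complex) measure)" "snd \<in> borel_measurable (borel :: (complex \<times> complex) measure)"
    by (auto intro!: borel_measurable_continuous_onI continuous_intros)
  show ?thesis unfolding kernel_deriv_def conj_prod_def by measurable
qed

text \<open>For \<open>z\<close> in a compact set the derivative of order \<open>(a, b)\<close> has homogeneity \<open>-1 - a - b\<close> in \<open>\<zeta>\<^sub>2\<close>, and the inner
  derivatives contribute \<open>\<zeta>\<^sub>1\<^sup>a \<zeta>\<^sub>2\<^sup>b\<close>, of modulus at most \<open>\<bar>\<zeta>\<^sub>2\<bar>\<^sup>a\<^sup>+\<^sup>b\<close>. Thus the singularity does not get worse with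
  the order.\<close>

lemma kernel_deriv_bound:
  assumes "compact K" "K \<subseteq> HT"
  shows "\<exists>C\<ge>0. \<forall>z\<in>K. \<forall>\<zeta>\<in>HT. cmod (kernel_deriv a b z \<zeta>) \<le> C / cmod (snd \<zeta>)"
proof -
  obtain d where d: "0 < d" "d < 1" "\<And>z. z \<in> K \<Longrightarrow> cmod (fst z) \<le> (1 - d) * cmod (snd z)"
    "\<And>z. z \<in> K \<Longrightarrow> cmod (snd z) \<le> 1 - d" "\<And>z. z \<in> K \<Longrightarrow> d \<le> cmod (snd z)"
    using hartogs_compact_margin[OF assms] by blast
  obtain C where C: "C \<ge> 0" "\<And>q. q \<in> HT \<Longrightarrow> cmod (fst q) \<le> (1 - d) * cmod (snd q) \<Longrightarrow> cmod (snd q) \<le> 1 - d \<Longrightarrow>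
     cmod (base_kernel_d a b q) \<le> C * cmod (snd q) powi (-1 - int a - int b)"
    using kernel_class_bound[OF kernel_class_base_kernel_d[of a b] d(1)] by blast
  show ?thesis
  proof (intro exI[of _ "C * inverse d ^ (1 + a + b)"] conjI ballI)
    show "0 \<le> C * inverse d ^ (1 + a + b)" using C d by simp
    fix z \<zeta> assume z: "z \<in> K" and \<zeta>: "\<zeta> \<in> HT"
    define r where "r = cmod (snd \<zeta>)"
    define t where "t = cmod (snd z)"
    have r: "0 < r" "r < 1" "cmod (fst \<zeta>) \<le> r" using \<zeta> by (auto simp: r_def hartogs_iff)
    have t: "d \<le> t" "0 < t" "t \<le> 1 - d" using d(4)[OF z] d(5)[OF z] d(1) unfolding t_def by linarith+
    have "cmod (fst z) * cmod (fst \<zeta>) \<le> ((1 - d) * t) * r"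
      using d(2) d(3)[OF z] r t by (intro mult_mono) (auto simp: t_def)
    moreover have "t * r \<le> 1 - d" using mult_mono[of t "1 - d" r 1] t r d by auto
    ultimately have "cmod (base_kernel_d a b (conj_prod z \<zeta>)) \<le> C * (t * r) powi (-1 - int a - int b)"
      using C(2)[OF conj_prod_hartogs[OF _ \<zeta>], of z] z assms(2) by (auto simp: norm_mult t_def r_def mult.assoc)
    also have "(t * r) powi (-1 - int a - int b) = inverse (t * r) ^ (1 + a + b)"
      using t r by (simp add: power_int_def nat_add_distrib algebra_simps)
    finally have 1: "cmod (base_kernel_d a b (conj_prod z \<zeta>)) \<le> C * (inverse t ^ (1 + a + b) * inverse r ^ (1 + a + b))"
      by (simp add: power_mult_distrib power_inverse ac_simps)
    have 2: "cmod (fst \<zeta>) ^ a \<le> r ^ a" using r by (intro power_mono) auto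
    have "inverse t \<le> inverse d" using t d by (intro le_imp_inverse_le) auto
    then have 3: "inverse t ^ (1 + a + b) \<le> inverse d ^ (1 + a + b)" using t by (intro power_mono) auto
    have "cmod (kernel_deriv a b z \<zeta>) = cmod (fst \<zeta>) ^ a * r ^ b * cmod (base_kernel_d a b (conj_prod z \<zeta>))"
      by (simp add: kernel_deriv_def norm_mult norm_power r_def)
    also have "\<dots> \<le> r ^ a * r ^ b * (C * (inverse d ^ (1 + a + b) * inverse r ^ (1 + a + b)))"
      using 1 2 3 r C
      by (intro mult_mono order.trans[OF 1] mult_left_mono mult_right_mono) auto
    also have "\<dots> = C * inverse d ^ (1 + a + b) / r"
      using r by (simp add: field_simps power_add)
    finally show "cmod (kernel_deriv a b z \<zeta>) \<le> C * inverse d ^ (1 + a + b) / cmod (snd \<zeta>)" by (simp add: r_def)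
  qed
qed

lemma wirt_kernel_deriv:
  assumes "z \<in> HT" "\<zeta> \<in> HT"
  shows "wirt 0 (\<lambda>z. kernel_deriv a 0 z \<zeta>) z = kernel_deriv (Suc a) 0 z \<zeta>"
    and "wirt (Suc 0) (\<lambda>z. kernel_deriv a b z \<zeta>) z = kernel_deriv a (Suc b) z \<zeta>"
    and "wirt 2 (\<lambda>z. kernel_deriv a b z \<zeta>) z = 0" "wirt 3 (\<lambda>z. kernel_deriv a b z \<zeta>) z = 0"
proof -
  let ?c = "\<lambda>a b. cnj (fst \<zeta>) ^ a * cnj (snd \<zeta>) ^ b"
  have *: "((\<lambda>z. kernel_deriv a b z \<zeta>) has_derivative (\<lambda>v. (?c a b * (p * cnj (fst \<zeta>))) * fst v + (?c a b * (q * cnj (snd \<zeta>))) * snd v)) (at z)"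
    if "has_cderiv (base_kernel_d a b) p q (conj_prod z \<zeta>)" for p q a b
    unfolding kernel_deriv_def using has_derivative_mult_right[OF has_cderiv_imp_conj_prod_left[OF that], of "?c a b"]
    by (simp add: algebra_simps)
  note h = conj_prod_hartogs[OF assms]
  obtain c where "has_cderiv (base_kernel_d a 0) (base_kernel_d (Suc a) 0 (conj_prod z \<zeta>)) (c (conj_prod z \<zeta>)) (conj_prod z \<zeta>)" using base_kernel_d_derivative_fst h by blast
  from wirt_holomorphic(1)[OF *[OF this]] show "wirt 0 (\<lambda>z. kernel_deriv a 0 z \<zeta>) z = kernel_deriv (Suc a) 0 z \<zeta>"
    by (simp add: kernel_deriv_def ac_simps del: base_kernel_d.simps)
  obtain c where c: "has_cderiv (base_kernel_d a b) (c (conj_prod z \<zeta>)) (base_kernel_d a (Suc b) (conj_prod z \<zeta>)) (conj_prod z \<zeta>)" using base_kernel_d_derivative_snd h by blast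
  from wirt_holomorphic(2)[OF *[OF c]] show "wirt (Suc 0) (\<lambda>z. kernel_deriv a b z \<zeta>) z = kernel_deriv a (Suc b) z \<zeta>"
    by (simp add: kernel_deriv_def ac_simps del: base_kernel_d.simps)
  from wirt_holomorphic(3,4)[OF *[OF c]] show "wirt 2 (\<lambda>z. kernel_deriv a b z \<zeta>) z = 0" "wirt 3 (\<lambda>z. kernel_deriv a b z \<zeta>) z = 0"
    by auto
qed

lemma smooth_on_kernel_deriv:
  assumes "\<zeta> \<in> HT" shows "smooth_on HT (\<lambda>z. kernel_deriv a b z \<zeta>)"
  using smooth_on_conj_prod_left[OF kernel_class_cmult[OF kernel_class_base_kernel_d[of a b], of "cnj (fst \<zeta>) ^ a * cnj (snd \<zeta>) ^ b"] assms]
  by (simp add: kernel_deriv_def)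

text \<open>The value \<open>0\<close> off the triangle matches the normalisation of \<open>bergman_kernel\<close>.\<close>

definition hartogs_kernel :: "complex \<times> complex \<Rightarrow> complex \<times> complex \<Rightarrow> complex" where
  "hartogs_kernel z \<zeta> = (if z \<in> HT \<and> \<zeta> \<in> HT then base_kernel (conj_prod z \<zeta>) else 0)"

lemma hartogs_kernel_eq_kernel_deriv: "z \<in> HT \<Longrightarrow> \<zeta> \<in> HT \<Longrightarrow> hartogs_kernel z \<zeta> = kernel_deriv 0 0 z \<zeta>"
  by (simp add: hartogs_kernel_def kernel_deriv_def)

lemma base_kernel_cnj: "base_kernel (conj_prod \<zeta> z) = cnj (base_kernel (conj_prod z \<zeta>))"
  by (simp add: base_kernel_def mult.commute)

lemma hartogs_kernel_cnj: "hartogs_kernel \<zeta> z = cnj (hartogs_kernel z \<zeta>)"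
  by (simp add: hartogs_kernel_def base_kernel_cnj[of z \<zeta>])

lemma hartogs_kernel_measurable[measurable]: "(\<lambda>p. hartogs_kernel (fst p) (snd p)) \<in> borel_measurable (borel \<Otimes>\<^sub>M borel)"
proof -
  have "(\<lambda>p. if fst p \<in> HT \<and> snd p \<in> HT then kernel_deriv 0 0 (fst p) (snd p) else 0) \<in> borel_measurable (borel \<Otimes>\<^sub>M borel)"
    by measurable
  then show ?thesis by (rule measurable_cong[THEN iffD1, rotated]) (auto simp: hartogs_kernel_def kernel_deriv_def)
qed

section \<open>Hoelder's inequality and Schur's test\<close>

lemma Holder_nn_integral:
  fixes f g :: "'a \<Rightarrow> real"
  assumes pq: "p > 1" "q > 1" "1 / p + 1 / q = 1"
    and [measurable]: "f \<in> borel_measurable M" "g \<in> borel_measurable M"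
    and nn: "\<And>x. x \<in> space M \<Longrightarrow> 0 \<le> f x" "\<And>x. x \<in> space M \<Longrightarrow> 0 \<le> g x"
    and A: "A > 0" "(\<integral>\<^sup>+x. ennreal (f x powr p) \<partial>M) \<le> ennreal (A powr p)"
    and B: "B > 0" "(\<integral>\<^sup>+x. ennreal (g x powr q) \<partial>M) \<le> ennreal (B powr q)"
  shows "(\<integral>\<^sup>+x. ennreal (f x * g x) \<partial>M) \<le> ennreal (A * B)"
proof -
  have young: "f x * g x \<le> A * B * ((f x / A) powr p / p + (g x / B) powr q / q)" if "x \<in> space M" for x
  proof -
    have "(f x / A) * (g x / B) \<le> (f x / A) powr p / p + (g x / B) powr q / q"
      using nn[OF that] A B pq by (intro Youngs_inequality) auto
    then have "A * B * ((f x / A) * (g x / B)) \<le> A * B * ((f x / A) powr p / p + (g x / B) powr q / q)"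
      using A B by (intro mult_left_mono) auto
    then show ?thesis using A B by simp
  qed
  have eq: "A * B * ((f x / A) powr p / p + (g x / B) powr q / q)
      = (A * B / (p * A powr p)) * f x powr p + (A * B / (q * B powr q)) * g x powr q" if "x \<in> space M" for x
    using A B nn[OF that] by (simp add: powr_divide field_simps)
  have "(\<integral>\<^sup>+x. ennreal (f x * g x) \<partial>M) \<le> (\<integral>\<^sup>+x. ennreal (A * B / (p * A powr p)) * ennreal (f x powr p) + ennreal (A * B / (q * B powr q)) * ennreal (g x powr q) \<partial>M)"
  proof (rule nn_integral_mono)
    fix x assume x: "x \<in> space M"
    have "ennreal (f x * g x) \<le> ennreal ((A * B / (p * A powr p)) * f x powr p + (A * B / (q * B powr q)) * g x powr q)"
      using young[OF x] unfolding eq[OF x] by (rule ennreal_leI)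
    also have "\<dots> = ennreal (A * B / (p * A powr p)) * ennreal (f x powr p) + ennreal (A * B / (q * B powr q)) * ennreal (g x powr q)"
      using A B pq by (simp add: ennreal_mult[symmetric] flip: ennreal_plus)
    finally show "ennreal (f x * g x) \<le> \<dots>" .
  qed
  also have "\<dots> = ennreal (A * B / (p * A powr p)) * (\<integral>\<^sup>+x. ennreal (f x powr p) \<partial>M) + ennreal (A * B / (q * B powr q)) * (\<integral>\<^sup>+x. ennreal (g x powr q) \<partial>M)"
    by (subst nn_integral_add) (auto simp: nn_integral_cmult)
  also have "\<dots> \<le> ennreal (A * B / (p * A powr p)) * ennreal (A powr p) + ennreal (A * B / (q * B powr q)) * ennreal (B powr q)"
    using A B by (intro add_mono mult_left_mono) auto
  also have "\<dots> = ennreal (A * B / p + A * B / q)"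
    using A B pq by (simp add: ennreal_mult[symmetric] ennreal_plus[symmetric] del: ennreal_plus)
  also have "A * B / p + A * B / q = A * B * (1 / p + 1 / q)" by (simp add: field_simps)
  finally show ?thesis using pq by simp
qed

text \<open>A form of Hoelder's inequality that bounds a number \<open>c\<close> below an integral of a product, raised to
  the power \<open>p\<close>; the integral of \<open>f\<^sup>p\<close> may be infinite.\<close>

lemma Holder_powr:
  fixes f g :: "'a \<Rightarrow> real"
  assumes pq: "p > 1" "q > 1" "1 / p + 1 / q = 1"
    and [measurable]: "f \<in> borel_measurable M" "g \<in> borel_measurable M"
    and nn: "\<And>x. x \<in> space M \<Longrightarrow> 0 \<le> f x" "\<And>x. x \<in> space M \<Longrightarrow> 0 \<le> g x"
    and B: "B > 0" "(\<integral>\<^sup>+x. ennreal (g x powr q) \<partial>M) \<le> ennreal (B powr q)"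
    and c: "0 \<le> c" "ennreal c \<le> (\<integral>\<^sup>+x. ennreal (f x * g x) \<partial>M)"
  shows "ennreal (c powr p) \<le> ennreal (B powr p) * (\<integral>\<^sup>+x. ennreal (f x powr p) \<partial>M)"
proof (rule ccontr)
  define J where "J = (\<integral>\<^sup>+x. ennreal (f x powr p) \<partial>M)"
  assume "\<not> ennreal (c powr p) \<le> ennreal (B powr p) * (\<integral>\<^sup>+x. ennreal (f x powr p) \<partial>M)"
  then have less: "ennreal (B powr p) * J < ennreal (c powr p)" by (simp add: J_def not_le)
  then have "J \<noteq> \<infinity>" using B by (auto simp: ennreal_mult_top)
  then obtain j where j: "J = ennreal j" "j \<ge> 0" by (cases J) auto
  have Bj: "B powr p * j < c powr p" using less j by (simp add: ennreal_mult[symmetric] ennreal_less_iff)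
  have c0: "c > 0"
  proof (rule ccontr)
    assume "\<not> c > 0"
    then have "B powr p * j < 0" using Bj c by simp
    moreover have "0 \<le> B powr p * j" using j by simp
    ultimately show False by simp
  qed
  define A where "A = max (j powr (1 / p)) (c / (2 * B))"
  have A0: "A > 0" using c0 B by (auto simp: A_def less_max_iff_disj)
  have "j = (j powr (1 / p)) powr p" using j pq by (simp add: powr_powr)
  also have "\<dots> \<le> A powr p" using pq by (intro powr_mono2) (auto simp: A_def)
  finally have "j \<le> A powr p" .
  then have "(\<integral>\<^sup>+x. ennreal (f x * g x) \<partial>M) \<le> ennreal (A * B)"
    using j by (intro Holder_nn_integral[OF pq _ _ nn A0 _ B]) (auto simp: J_def[symmetric] intro!: ennreal_leI)
  with c have "c \<le> A * B" using A0 B by (metis order.trans ennreal_le_iff mult_nonneg_nonneg less_imp_le)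
  moreover have "A * B < c"
  proof -
    have *: "(j powr (1 / p) * B) powr p < c powr p"
      using Bj j pq B by (simp add: powr_mult powr_powr mult.commute)
    have "j powr (1 / p) * B < c"
    proof (rule ccontr)
      assume "\<not> j powr (1 / p) * B < c"
      then have "c powr p \<le> (j powr (1 / p) * B) powr p" using c0 pq by (intro powr_mono2) auto
      with * show False by simp
    qed
    then show ?thesis using B c0 by (auto simp: A_def max_def)
  qed
  ultimately show False by simp
qed

text \<open>Hoelder's inequality for the product of \<open>k\<^sup>1\<^sup>/\<^sup>p G \<Theta>\<^sup>1\<^sup>/\<^sup>p\<^sup>q\<close> and \<open>k\<^sup>1\<^sup>/\<^sup>q \<Theta>\<^sup>-\<^sup>1\<^sup>/\<^sup>p\<^sup>q\<close> gives a pointwise bound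
  for \<open>u\<^sup>p\<close> by the first condition on \<open>\<Theta>\<close>. After exchanging the integrals the second condition bounds
  what remains.\<close>

lemma Schur_test:
  fixes k :: "'a \<Rightarrow> 'a \<Rightarrow> real" and G u \<Theta> :: "'a \<Rightarrow> real"
  assumes "sigma_finite_measure M"
    and pq: "p > 1" "q > 1" "1 / p + 1 / q = 1"
    and k[measurable]: "(\<lambda>x. k (fst x) (snd x)) \<in> borel_measurable (M \<Otimes>\<^sub>M M)" and k0: "\<And>x y. 0 \<le> k x y"
    and \<Theta>[measurable]: "\<Theta> \<in> borel_measurable M" and \<Theta>0: "\<And>x. x \<in> space M \<Longrightarrow> 0 < \<Theta> x"
    and C: "C > 0"
    and s1: "\<And>x. x \<in> space M \<Longrightarrow> (\<integral>\<^sup>+y. ennreal (k x y * \<Theta> y powr (- 1 / p)) \<partial>M) \<le> ennreal (C * \<Theta> x powr (- 1 / p))"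
    and s2: "\<And>y. y \<in> space M \<Longrightarrow> (\<integral>\<^sup>+x. ennreal (k x y * \<Theta> x powr (- 1 / q)) \<partial>M) \<le> ennreal (C * \<Theta> y powr (- 1 / q))"
    and G[measurable]: "G \<in> borel_measurable M" and G0: "\<And>x. 0 \<le> G x"
    and u: "\<And>x. x \<in> space M \<Longrightarrow> 0 \<le> u x" "\<And>x. x \<in> space M \<Longrightarrow> ennreal (u x) \<le> (\<integral>\<^sup>+y. ennreal (k x y * G y) \<partial>M)"
  shows "(\<integral>\<^sup>+x. ennreal (u x powr p) \<partial>M) \<le> ennreal (C powr p) * (\<integral>\<^sup>+x. ennreal (G x powr p) \<partial>M)"
proof -
  interpret sigma_finite_measure M by fact
  interpret P: pair_sigma_finite M M ..
  have k2[measurable]: "(\<lambda>y. k x y) \<in> borel_measurable M" if "x \<in> space M" for x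
    using measurable_compose[OF measurable_Pair1'[OF that] k] by simp
  have k3[measurable]: "(\<lambda>x. k x y) \<in> borel_measurable M" if "y \<in> space M" for y
    using measurable_compose[OF measurable_Pair2'[OF that] k] by simp
  have pt: "ennreal (u x powr p) \<le> ennreal (C powr (p / q) * \<Theta> x powr (- 1 / q)) * (\<integral>\<^sup>+y. ennreal (k x y * \<Theta> y powr (1 / q) * G y powr p) \<partial>M)"
    if x: "x \<in> space M" for x
  proof -
    note [measurable] = k2[OF x]
    define f where "f = (\<lambda>y. k x y powr (1 / p) * \<Theta> y powr (1 / (p * q)) * G y)"
    define g where "g = (\<lambda>y. k x y powr (1 / q) * \<Theta> y powr (- 1 / (p * q)))"
    have [measurable]: "f \<in> borel_measurable M" "g \<in> borel_measurable M" unfolding f_def g_def by measurable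
    define B where "B = (C * \<Theta> x powr (- 1 / p)) powr (1 / q)"
    have Bp: "B > 0" using C \<Theta>0[OF x] by (auto simp: B_def)
    have fg: "f y * g y = k x y * G y" if y: "y \<in> space M" for y
    proof -
      have 1: "k x y powr (1 / p) * k x y powr (1 / q) = k x y"
        using pq k0 by (simp add: powr_add[symmetric])
      have 2: "\<Theta> y powr (1 / (p * q)) * \<Theta> y powr (- 1 / (p * q)) = 1"
        using \<Theta>0[OF y] by (simp add: powr_add[symmetric])
      have "f y * g y = (k x y powr (1 / p) * k x y powr (1 / q)) * (\<Theta> y powr (1 / (p * q)) * \<Theta> y powr (- 1 / (p * q))) * G y"
        unfolding f_def g_def by (simp only: ac_simps)
      then show ?thesis unfolding 1 2 by simp
    qed
    have fp: "f y powr p = k x y * \<Theta> y powr (1 / q) * G y powr p" if "y \<in> space M" for y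
      using pq G0 k0 \<Theta>0[OF that] by (simp add: f_def powr_mult powr_powr)
    have gq: "g y powr q = k x y * \<Theta> y powr (- 1 / p)" if "y \<in> space M" for y
      using pq k0 \<Theta>0[OF that] by (simp add: g_def powr_mult powr_powr)
    have Bq: "B powr q = C * \<Theta> x powr (- 1 / p)"
      using pq C \<Theta>0[OF x] by (simp add: B_def powr_powr)
    have "(\<integral>\<^sup>+y. ennreal (g y powr q) \<partial>M) \<le> ennreal (B powr q)"
      unfolding Bq using s1[OF x] by (subst nn_integral_cong[OF arg_cong[where f=ennreal, OF gq]])
    moreover have "ennreal (u x) \<le> (\<integral>\<^sup>+y. ennreal (f y * g y) \<partial>M)"
      using u(2)[OF x] by (subst nn_integral_cong[OF arg_cong[where f=ennreal, OF fg]])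
    ultimately have "ennreal (u x powr p) \<le> ennreal (B powr p) * (\<integral>\<^sup>+y. ennreal (f y powr p) \<partial>M)"
      using Bp u(1)[OF x] G0 by (intro Holder_powr[OF pq, of f M g]) (auto simp: f_def g_def)
    moreover have "B powr p = C powr (p / q) * \<Theta> x powr (- 1 / q)"
      using pq C \<Theta>0[OF x] by (simp add: B_def powr_powr powr_mult)
    ultimately show ?thesis by (simp add: nn_integral_cong[OF arg_cong[where f=ennreal, OF fp]])
  qed
  have "(\<integral>\<^sup>+x. ennreal (u x powr p) \<partial>M)
    \<le> (\<integral>\<^sup>+x. (\<integral>\<^sup>+y. ennreal (C powr (p / q) * \<Theta> x powr (- 1 / q)) * ennreal (k x y * \<Theta> y powr (1 / q) * G y powr p) \<partial>M) \<partial>M)"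
  proof (rule nn_integral_mono)
    fix x assume x: "x \<in> space M"
    note [measurable] = k2[OF x]
    show "ennreal (u x powr p) \<le> (\<integral>\<^sup>+y. ennreal (C powr (p / q) * \<Theta> x powr (- 1 / q)) * ennreal (k x y * \<Theta> y powr (1 / q) * G y powr p) \<partial>M)"
      using pt[OF x] by (subst nn_integral_cmult) auto
  qed
  also have "\<dots> = (\<integral>\<^sup>+y. (\<integral>\<^sup>+x. ennreal (C powr (p / q) * \<Theta> x powr (- 1 / q)) * ennreal (k x y * \<Theta> y powr (1 / q) * G y powr p) \<partial>M) \<partial>M)"
    by (rule P.Fubini'[symmetric]) (simp add: split_beta')
  also have "\<dots> \<le> (\<integral>\<^sup>+y. ennreal (C powr p) * ennreal (G y powr p) \<partial>M)"
  proof (rule nn_integral_mono)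
    fix y assume y: "y \<in> space M"
    note [measurable] = k3[OF y]
    have "(\<integral>\<^sup>+x. ennreal (C powr (p / q) * \<Theta> x powr (- 1 / q)) * ennreal (k x y * \<Theta> y powr (1 / q) * G y powr p) \<partial>M)
      = (\<integral>\<^sup>+x. ennreal (C powr (p / q) * \<Theta> y powr (1 / q) * G y powr p) * ennreal (k x y * \<Theta> x powr (- 1 / q)) \<partial>M)"
      using k0 G0 by (intro nn_integral_cong) (simp add: ennreal_mult[symmetric] ac_simps)
    also have "\<dots> = ennreal (C powr (p / q) * \<Theta> y powr (1 / q) * G y powr p) * (\<integral>\<^sup>+x. ennreal (k x y * \<Theta> x powr (- 1 / q)) \<partial>M)"
      by (rule nn_integral_cmult) measurable
    also have "\<dots> \<le> ennreal (C powr (p / q) * \<Theta> y powr (1 / q) * G y powr p) * ennreal (C * \<Theta> y powr (- 1 / q))"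
      by (intro mult_left_mono s2 y) auto
    also have "\<dots> = ennreal ((C powr (p / q) * C) * (\<Theta> y powr (1 / q) * \<Theta> y powr (- 1 / q)) * G y powr p)"
      using C by (simp add: ennreal_mult[symmetric] ac_simps)
    also have "C powr (p / q) * C = C powr p"
    proof -
      have "C powr (p / q) * C = C powr (p / q + 1)" using C by (simp add: powr_add)
      also have "p / q + 1 = p * (1 / p + 1 / q)" using pq by (simp add: field_simps)
      finally show ?thesis using pq by simp
    qed
    also have "\<Theta> y powr (1 / q) * \<Theta> y powr (- 1 / q) = 1" using \<Theta>0[OF y] by (simp add: powr_add[symmetric])
    finally show "(\<integral>\<^sup>+x. ennreal (C powr (p / q) * \<Theta> x powr (- 1 / q)) * ennreal (k x y * \<Theta> y powr (1 / q) * G y powr p) \<partial>M)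
        \<le> ennreal (C powr p) * ennreal (G y powr p)" by (simp add: ennreal_mult)
  qed
  also have "\<dots> = ennreal (C powr p) * (\<integral>\<^sup>+x. ennreal (G x powr p) \<partial>M)"
    by (rule nn_integral_cmult) measurable
  finally show ?thesis .
qed

lemma ball_measurable[measurable]: "ball (c::'a::metric_space) r \<in> sets borel"
  by (rule borel_open) simp

section \<open>Mean values of holomorphic functions\<close>

lemma circle_mean_value:
  assumes F: "F holomorphic_on ball c R" and \<zeta>: "cmod \<zeta> < R"
  shows "(LINT t|unit_interval. F (c + circle_param t * \<zeta>)) = F c"
proof (rule circle_average_contour[where g="\<lambda>u. F (c + u * \<zeta>)"])
  have sub: "(\<lambda>u. c + u * \<zeta>) ` cball 0 1 \<subseteq> ball c R"
  proof (rule image_subsetI)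
    fix u :: complex assume "u \<in> cball 0 1"
    then have "cmod (u * \<zeta>) \<le> cmod \<zeta>" by (simp add: norm_mult mult_left_le_one_le)
    then show "c + u * \<zeta> \<in> ball c R" using \<zeta> by (simp add: dist_norm)
  qed
  have hol: "(\<lambda>u. F (c + u * \<zeta>)) holomorphic_on ball 0 1"
    by (rule holomorphic_on_compose_gen[OF _ F, unfolded o_def]) (use sub in \<open>auto intro!: holomorphic_intros dest!: image_subset_iff[THEN iffD1]\<close>)
  have cont: "continuous_on (cball 0 1) (\<lambda>u. F (c + u * \<zeta>))"
    by (rule continuous_on_compose2[OF holomorphic_on_imp_continuous_on[OF F]]) (use sub in \<open>auto intro!: continuous_intros\<close>)
  show "continuous_on (sphere 0 1) (\<lambda>u. F (c + u * \<zeta>))"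
    using cont by (rule continuous_on_subset) auto
  show "((\<lambda>u. F (c + u * \<zeta>) / u) has_contour_integral 2 * complex_of_real pi * \<i> * F c) (circlepath 0 1)"
    using Cauchy_integral_circlepath[OF cont hol, of 0] by simp
qed

lemma holomorphic_circle_measurable:
  assumes F: "continuous_on (ball c R) F" and \<zeta>: "cmod \<zeta> < R"
  shows "(\<lambda>t. F (c + circle_param t * \<zeta>)) \<in> borel_measurable unit_interval"
proof -
  have "continuous_on UNIV circle_param" unfolding circle_param_def by (intro continuous_intros)
  then have "continuous_on UNIV (\<lambda>t. F (c + circle_param t * \<zeta>))"
    by (intro continuous_on_compose2[OF F]) (use \<zeta> in \<open>auto intro!: continuous_intros simp: norm_mult dist_norm\<close>)
  then show ?thesis by (intro measurable_restrict_space1) (simp add: borel_measurable_continuous_onI)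
qed

text \<open>The mean value property followed by the inequality of Cauchy and Schwarz on the circle.\<close>

lemma square_mean_value:
  assumes F: "F holomorphic_on ball c R" and \<zeta>: "cmod \<zeta> < R"
  shows "ennreal ((cmod (F c))\<^sup>2) \<le> (\<integral>\<^sup>+t. ennreal ((cmod (F (c + circle_param t * \<zeta>)))\<^sup>2) \<partial>unit_interval)"
proof -
  note [measurable] = holomorphic_circle_measurable[OF holomorphic_on_imp_continuous_on[OF F] \<zeta>]
  have "ennreal (cmod (F c)) \<le> (\<integral>\<^sup>+t. ennreal (cmod (F (c + circle_param t * \<zeta>))) \<partial>unit_interval)"
    unfolding circle_mean_value[OF F \<zeta>, symmetric]
    by (cases "integrable unit_interval (\<lambda>t. F (c + circle_param t * \<zeta>))")
       (auto intro: integral_norm_bound_ennreal simp: not_integrable_integral_eq)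
  then have "ennreal (cmod (F c) powr 2) \<le> ennreal (1 powr 2) * (\<integral>\<^sup>+t. ennreal (cmod (F (c + circle_param t * \<zeta>)) powr 2) \<partial>unit_interval)"
    using prob_space_unit_interval(2) by (intro Holder_powr[where q=2 and g="\<lambda>_. 1"]) auto
  then show ?thesis by (simp add: powr_numeral)
qed

lemma area_square_mean_value:
  assumes F: "F holomorphic_on ball c R" and r: "0 < r" "r \<le> R" and [measurable]: "F' \<in> borel_measurable borel"
    and F': "\<And>x. x \<in> ball c R \<Longrightarrow> F' x = F x"
  shows "ennreal (pi * r\<^sup>2 * (cmod (F c))\<^sup>2) \<le> (\<integral>\<^sup>+z. ennreal (indicator (ball c r) z * (cmod (F' z))\<^sup>2) \<partial>lborel)"
proof -
  have "ennreal (pi * r\<^sup>2 * (cmod (F c))\<^sup>2) = (\<integral>\<^sup>+z. ennreal ((cmod (F c))\<^sup>2) * indicator (ball (0::complex) r) z \<partial>lborel)"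
    using r by (subst nn_integral_cmult_indicator) (auto simp: emeasure_ball unit_ball_vol_2 ennreal_mult[symmetric] mult.commute)
  also have "\<dots> \<le> (\<integral>\<^sup>+z. (\<integral>\<^sup>+t. ennreal (indicator (ball 0 r) (circle_param t * z) * (cmod (F' (c + circle_param t * z)))\<^sup>2) \<partial>unit_interval) \<partial>lborel)"
  proof (rule nn_integral_mono)
    fix z :: complex
    show "ennreal ((cmod (F c))\<^sup>2) * indicator (ball 0 r) z \<le> (\<integral>\<^sup>+t. ennreal (indicator (ball 0 r) (circle_param t * z) * (cmod (F' (c + circle_param t * z)))\<^sup>2) \<partial>unit_interval)"
    proof (cases "cmod z < r")
      case True
      then have "F' (c + circle_param t * z) = F (c + circle_param t * z)" for t
        using r by (intro F') (auto simp: norm_mult dist_norm)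
      then show ?thesis using square_mean_value[OF F, of z] True r by (simp add: norm_mult)
    qed auto
  qed
  also have "\<dots> = (\<integral>\<^sup>+z. ennreal (indicator (ball 0 r) z * (cmod (F' (c + z)))\<^sup>2) \<partial>lborel)"
    by (rule nn_integral_rotation_average[symmetric]) measurable
  also have "\<dots> = (\<integral>\<^sup>+z. ennreal (indicator (ball c r) (c + z) * (cmod (F' (c + z)))\<^sup>2) \<partial>lborel)"
    by (intro nn_integral_cong) (auto simp: indicator_def dist_norm)
  also have "\<dots> = (\<integral>\<^sup>+z. ennreal (indicator (ball c r) z * (cmod (F' z))\<^sup>2) \<partial>distr lborel borel (\<lambda>z. c + z))"
    by (subst nn_integral_distr) auto
  finally show ?thesis by (simp add: lborel_distr_plus)
qed

text \<open>The mean value inequality on the disc of radius \<open>\<bar>s\<bar> / 2\<close> about \<open>s\<close> bounds \<open>\<bar>s F(s)\<bar>\<^sup>2\<close> by a multiple of the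
  integral of \<open>\<bar>F\<bar>\<^sup>2\<close> near the puncture, which tends to \<open>0\<close>. By Riemann's theorem the singularity is removable.\<close>

lemma square_integrable_punctured_extends:
  assumes F: "F holomorphic_on ball 0 1 - {0}" and [measurable]: "F' \<in> borel_measurable borel"
    and F': "\<And>x. x \<in> ball 0 1 - {0} \<Longrightarrow> F' x = F x"
    and fin: "(\<integral>\<^sup>+z. ennreal (indicator (ball 0 1) z * (cmod (F' z))\<^sup>2) \<partial>lborel) < \<infinity>"
  obtains G where "G holomorphic_on ball 0 1" "\<And>z. z \<in> ball 0 1 - {0} \<Longrightarrow> G z = F z"
proof -
  define E where "E = (\<lambda>\<rho>. (LINT z|lborel. indicator (ball 0 \<rho>) z * (indicator (ball 0 1) z * (cmod (F' z))\<^sup>2)))"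
  have int: "integrable lborel (\<lambda>z. indicator (ball 0 1) z * (cmod (F' z))\<^sup>2)"
  proof (rule integrableI_bounded)
    show "(\<lambda>z. indicator (ball 0 1) z * (cmod (F' z))\<^sup>2) \<in> borel_measurable lborel" by measurable
    show "(\<integral>\<^sup>+z. ennreal (norm (indicator (ball 0 1) z * (cmod (F' z))\<^sup>2)) \<partial>lborel) < \<infinity>"
      using fin by simp
  qed
  have intb: "integrable lborel (\<lambda>z. indicator (ball 0 \<rho>) z * (indicator (ball 0 1) z * (cmod (F' z))\<^sup>2))" for \<rho>
    using integrable_mult_indicator[OF _ int, of "ball 0 \<rho>"] by simp
  have Elim: "(\<lambda>n. E (X n)) \<longlonglongrightarrow> 0" if X: "X \<longlonglongrightarrow> 0" for X
  proof -
    have "(\<lambda>n. E (X n)) \<longlonglongrightarrow> (LINT z|(lborel::complex measure). 0)" unfolding E_def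
    proof (rule integral_dominated_convergence[OF _ _ int])
      show "AE z in lborel. (\<lambda>n. indicator (ball 0 (X n)) z * (indicator (ball 0 1) z * (cmod (F' z))\<^sup>2)) \<longlonglongrightarrow> 0"
        using AE_lborel_singleton[of "0::complex"]
      proof eventually_elim
        case (elim z)
        then have "eventually (\<lambda>n. X n < cmod z) sequentially" using X by (intro order_tendstoD) auto
        then have "eventually (\<lambda>n. indicator (ball 0 (X n)) z * (indicator (ball 0 1) z * (cmod (F' z))\<^sup>2) = 0) sequentially"
          by eventually_elim (auto simp: indicator_def)
        then show ?case by (rule tendsto_eventually)
      qed
    qed (auto simp: indicator_def)
    then show ?thesis by simp
  qed
  have bound: "pi * (cmod (s * F s))\<^sup>2 \<le> 4 * E (2 * cmod s)" if s: "s \<noteq> 0" "cmod s < 1 / 2" for s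
  proof -
    \<comment> \<open>the disc of radius \<open>r\<close> about \<open>s\<close> avoids the puncture and lies within \<open>2 \<bar>s\<bar>\<close> of it\<close>
    define r where "r = cmod s / 2"
    have r: "r > 0" using s by (simp add: r_def)
    have in_ball: "cmod x < 2 * cmod s \<and> x \<noteq> 0 \<and> cmod x < 1" if "x \<in> ball s r" for x
    proof -
      have d: "cmod (s - x) < cmod s / 2" using that by (simp add: dist_norm r_def)
      have "cmod x \<le> cmod s + cmod (s - x)" using norm_triangle_ineq4[of s "s - x"] by simp
      moreover have "cmod s > 0" using s by simp
      ultimately have 1: "cmod x < 2 * cmod s" "cmod x < 1" using d s by linarith+
      have "x \<noteq> 0" using d s by auto
      then show ?thesis using 1 by simp
    qed
    then have sub: "ball s r \<subseteq> ball 0 1 - {0}" and sub2: "ball s r \<subseteq> ball 0 (2 * cmod s)"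
      by (force simp: dist_norm)+
    have "ennreal (pi * r\<^sup>2 * (cmod (F s))\<^sup>2) \<le> (\<integral>\<^sup>+z. ennreal (indicator (ball s r) z * (cmod (F' z))\<^sup>2) \<partial>lborel)"
    proof (rule area_square_mean_value[where R=r])
      show "F' x = F x" if "x \<in> ball s r" for x using that sub F' by blast
    qed (use r holomorphic_on_subset[OF F sub] in auto)
    also have "\<dots> \<le> (\<integral>\<^sup>+z. ennreal (indicator (ball 0 (2 * cmod s)) z * (indicator (ball 0 1) z * (cmod (F' z))\<^sup>2)) \<partial>lborel)"
      using sub sub2 by (intro nn_integral_mono ennreal_leI) (auto simp: indicator_def)
    also have "\<dots> = ennreal (E (2 * cmod s))"
      unfolding E_def by (rule nn_integral_eq_integral[OF intb]) (auto simp: indicator_def)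
    finally have "pi * r\<^sup>2 * (cmod (F s))\<^sup>2 \<le> E (2 * cmod s)"
      by (subst (asm) ennreal_le_iff) (auto simp: E_def intro!: integral_nonneg_AE)
    then show ?thesis by (simp add: r_def norm_mult power_mult_distrib power_divide field_simps)
  qed
  have "((\<lambda>s. (s - 0) * F s) \<longlongrightarrow> 0) (at 0)"
    unfolding tendsto_at_iff_sequentially
  proof (intro allI impI, unfold o_def)
    fix X :: "nat \<Rightarrow> complex" assume X: "\<forall>i. X i \<in> UNIV - {0}" "X \<longlonglongrightarrow> 0"
    have "(\<lambda>n. 2 * cmod (X n)) \<longlonglongrightarrow> 2 * cmod 0" by (intro tendsto_intros X)
    then have lim: "(\<lambda>n. 2 * cmod (X n)) \<longlonglongrightarrow> 0" by simp
    have E0: "(\<lambda>n. 4 * E (2 * cmod (X n)) / pi) \<longlonglongrightarrow> 0"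
      using tendsto_mult_left_zero[OF Elim[OF lim], of "4 / pi"] by (simp add: mult.commute)
    have "eventually (\<lambda>n. cmod (X n) < 1 / 2) sequentially"
      using tendsto_norm[OF X(2)] by (intro order_tendstoD) auto
    then have ev: "eventually (\<lambda>n. norm ((cmod ((X n - 0) * F (X n)))\<^sup>2) \<le> 4 * E (2 * cmod (X n)) / pi) sequentially"
    proof eventually_elim
      case (elim n)
      have "X n \<noteq> 0" using X by auto
      from bound[OF this elim] show ?case by (simp add: field_simps)
    qed
    from tendsto_real_sqrt[OF Lim_null_comparison[OF ev E0]]
    have "(\<lambda>n. cmod ((X n - 0) * F (X n))) \<longlonglongrightarrow> 0" by simp
    then show "(\<lambda>n. (X n - 0) * F (X n)) \<longlonglongrightarrow> 0" by (rule tendsto_norm_zero_cancel)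
  qed
  then have "\<exists>g. g holomorphic_on ball 0 1 \<and> (\<forall>z\<in>ball 0 1 - {0}. g z = F z)"
    using holomorphic_on_extend_lim[OF F, of] by simp
  then show ?thesis using that by blast
qed

section \<open>The Bergman kernel of the unit disc\<close>

lemma one_minus_norm_le: "cmod w < 1 \<Longrightarrow> cmod \<eta> < 1 \<Longrightarrow> 1 - cmod w \<le> cmod (1 - w * cnj \<eta>)"
proof -
  assume "cmod w < 1" "cmod \<eta> < 1"
  then have "cmod (w * cnj \<eta>) \<le> cmod w" by (simp add: norm_mult mult_left_le)
  moreover have "cmod 1 - cmod (w * cnj \<eta>) \<le> cmod (1 - w * cnj \<eta>)" by (rule norm_triangle_ineq2)
  ultimately show ?thesis by simp
qed

text \<open>Averaging over rotations reduces the integral to contour integrals over circles. With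
  \<open>f(u) = u F(u \<eta>) / \<pi>\<close> the average over the circle through \<open>\<eta>\<close> is \<open>f'(w \<eta>\<^sup>*)\<close> by Cauchy's formula for
  the derivative. In \<open>x = \<bar>\<eta>\<bar>\<^sup>2\<close> this is the derivative of \<open>x F(w x) / \<pi>\<close>, and the radial integral is its increment
  from \<open>0\<close> to \<open>1\<close>.\<close>

lemma disc_reproducing:
  assumes F: "F holomorphic_on ball 0 1" and int: "integrable lborel (\<lambda>\<eta>. indicator (ball 0 1) \<eta> *\<^sub>R F \<eta>)"
    and w: "cmod w < 1"
  shows "(LINT \<eta>|lborel. indicator (ball 0 1) \<eta> *\<^sub>R (F \<eta> / (pi * (1 - w * cnj \<eta>)\<^sup>2))) = F w"
proof -
  define I where "I = (\<lambda>\<eta>. indicator (ball 0 1) \<eta> *\<^sub>R (F \<eta> / (pi * (1 - w * cnj \<eta>)\<^sup>2)))"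
  have Ieq: "I = (\<lambda>\<eta>. (indicator (ball 0 1) \<eta> *\<^sub>R F \<eta>) * (1 / (pi * (1 - w * cnj \<eta>)\<^sup>2)))"
    by (auto simp: I_def fun_eq_iff scaleR_conv_of_real)
  have [measurable]: "cnj \<in> borel_measurable borel" by (intro borel_measurable_continuous_onI continuous_intros)
  have intI: "integrable lborel I"
  proof (rule Bochner_Integration.integrable_bound[where f="\<lambda>\<eta>. (1 / (pi * (1 - cmod w)\<^sup>2)) * cmod (indicator (ball 0 1) \<eta> *\<^sub>R F \<eta>)"])
    show "integrable lborel (\<lambda>\<eta>. (1 / (pi * (1 - cmod w)\<^sup>2)) * cmod (indicator (ball 0 1) \<eta> *\<^sub>R F \<eta>))"
      using int by (intro integrable_mult_right integrable_norm)
    show "I \<in> borel_measurable lborel" unfolding Ieq using borel_measurable_integrable[OF int] by (intro borel_measurable_times) auto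
    show "AE \<eta> in lborel. norm (I \<eta>) \<le> norm ((1 / (pi * (1 - cmod w)\<^sup>2)) * cmod (indicator (ball 0 1) \<eta> *\<^sub>R F \<eta>))"
    proof (rule AE_I2)
      fix \<eta>
      show "norm (I \<eta>) \<le> norm ((1 / (pi * (1 - cmod w)\<^sup>2)) * cmod (indicator (ball 0 1) \<eta> *\<^sub>R F \<eta>))"
      proof (cases "cmod \<eta> < 1")
        case True
        have "(1 - cmod w)\<^sup>2 \<le> (cmod (1 - w * cnj \<eta>))\<^sup>2"
          using one_minus_norm_le[OF w True] w by (intro power_mono) auto
        moreover have "(1 - cmod w)\<^sup>2 > 0" using w by simp
        ultimately have "cmod (F \<eta>) / (pi * (cmod (1 - w * cnj \<eta>))\<^sup>2) \<le> cmod (F \<eta>) / (pi * (1 - cmod w)\<^sup>2)"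
          by (intro divide_left_mono mult_pos_pos mult_left_mono) auto
        then show ?thesis using True by (simp add: I_def norm_divide norm_mult norm_power)
      qed (simp add: I_def)
    qed
  qed
  define \<psi> where "\<psi> = (\<lambda>x::real. (F (w * x) + w * x * deriv F (w * x)) / pi)"
  have dF: "deriv F holomorphic_on ball 0 1" by (intro holomorphic_deriv F) auto
  have wx: "w * of_real x \<in> ball 0 1" if "x \<in> {0..1}" for x
  proof -
    have "cmod (w * of_real x) \<le> cmod w" using that by (simp add: norm_mult mult_left_le)
    then show ?thesis using w by simp
  qed
  have c\<psi>: "continuous_on {0..1} \<psi>" unfolding \<psi>_def
    by (intro continuous_intros continuous_on_compose2[OF holomorphic_on_imp_continuous_on[OF F]]
        continuous_on_compose2[OF holomorphic_on_imp_continuous_on[OF dF]]) (use wx in auto)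
  define \<psi>' where "\<psi>' = (\<lambda>x. indicator {0..1} x *\<^sub>R \<psi> x)"
  have [measurable]: "\<psi>' \<in> borel_measurable borel" unfolding \<psi>'_def
    using borel_integrable_compact[OF _ c\<psi>] borel_measurable_integrable by auto
  have avg: "(LINT t|unit_interval. I (circle_param t * \<eta>)) = indicator (ball 0 1) \<eta> *\<^sub>R \<psi>' ((cmod \<eta>)\<^sup>2)" for \<eta>
  proof (cases "cmod \<eta> < 1")
    case False then show ?thesis by (simp add: I_def norm_mult)
  next
    case True
    define f where "f = (\<lambda>u. F (u * \<eta>) * u / pi)"
    have sub: "u * \<eta> \<in> ball 0 1" if "cmod u \<le> 1" for u
      using that True mult_left_le_one_le[of "cmod \<eta>" "cmod u"] by (auto simp: norm_mult intro: le_less_trans)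
    have sub2: "(\<lambda>u. u * \<eta>) ` ball 0 1 \<subseteq> ball 0 1" using sub by auto
    have holf: "f holomorphic_on ball 0 1" unfolding f_def
      by (intro holomorphic_intros holomorphic_on_compose_gen[OF _ F sub2, unfolded o_def]) auto
    have contf: "continuous_on (cball 0 1) f" unfolding f_def
      by (intro continuous_intros continuous_on_compose2[OF holomorphic_on_imp_continuous_on[OF F]]) (use sub in auto)
    have wb: "w * cnj \<eta> \<in> ball 0 1"
    proof -
      have "cmod (w * cnj \<eta>) \<le> cmod w" using True by (simp add: norm_mult mult_left_le)
      then show ?thesis using w by simp
    qed
    have nz: "1 - w * cnj (u * \<eta>) \<noteq> 0" if "cmod u = 1" for u
    proof
      assume "1 - w * cnj (u * \<eta>) = 0"
      then have "w * cnj (u * \<eta>) = 1" by simp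
      then have "cmod (w * cnj (u * \<eta>)) = 1" by simp
      then have "cmod w * cmod \<eta> = 1" using that by (simp add: norm_mult)
      then show False using w True mult_strict_mono'[of "cmod w" 1 "cmod \<eta>" 1] by simp
    qed
    have dz: "(f has_field_derivative \<psi>' ((cmod \<eta>)\<^sup>2)) (at (w * cnj \<eta>))"
    proof -
      have e: "w * cnj \<eta> * \<eta> = w * of_real ((cmod \<eta>)\<^sup>2)" by (simp only: mult.assoc mult.commute[of "cnj \<eta>"] complex_norm_square)
      have le1: "(cmod \<eta>)\<^sup>2 \<le> 1" using True by (simp add: power_le_one)
      have "(F has_field_derivative deriv F (w * cnj \<eta> * \<eta>)) (at (w * cnj \<eta> * \<eta>))"
        unfolding e using wx[of "(cmod \<eta>)\<^sup>2"] le1 by (intro holomorphic_derivI[OF F]) auto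
      then have "((\<lambda>u. F (u * \<eta>)) has_field_derivative deriv F (w * cnj \<eta> * \<eta>) * \<eta>) (at (w * cnj \<eta>))"
        by (rule DERIV_chain2) (auto intro!: derivative_eq_intros)
      then have "(f has_field_derivative (deriv F (w * cnj \<eta> * \<eta>) * \<eta> * (w * cnj \<eta>) + F (w * cnj \<eta> * \<eta>)) / pi) (at (w * cnj \<eta>))"
        unfolding f_def by (auto intro!: derivative_eq_intros)
      also have "(deriv F (w * cnj \<eta> * \<eta>) * \<eta> * (w * cnj \<eta>) + F (w * cnj \<eta> * \<eta>)) / pi = \<psi>' ((cmod \<eta>)\<^sup>2)"
      proof -
        have "deriv F (w * cnj \<eta> * \<eta>) * \<eta> * (w * cnj \<eta>) = w * of_real ((cmod \<eta>)\<^sup>2) * deriv F (w * of_real ((cmod \<eta>)\<^sup>2))"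
          unfolding e[symmetric] by (simp add: ac_simps)
        then show ?thesis using le1 by (simp only: e) (simp add: \<psi>'_def \<psi>_def)
      qed
      finally show ?thesis .
    qed
    have "((\<lambda>u. f u / (u - w * cnj \<eta>) ^ Suc 1) has_contour_integral (2 * pi * \<i>) / fact 1 * (deriv ^^ 1) f (w * cnj \<eta>)) (circlepath 0 1)"
      using Cauchy_has_contour_integral_higher_derivative_circlepath[OF contf holf wb] .
    then have ci: "((\<lambda>u. f u / (u - w * cnj \<eta>)\<^sup>2) has_contour_integral (2 * complex_of_real pi * \<i> * \<psi>' ((cmod \<eta>)\<^sup>2))) (circlepath 0 1)"
      using DERIV_imp_deriv[OF dz] by (simp add: numeral_2_eq_2)
    have "(LINT t|unit_interval. F (circle_param t * \<eta>) / (pi * (1 - w * cnj (circle_param t * \<eta>))\<^sup>2)) = \<psi>' ((cmod \<eta>)\<^sup>2)"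
    proof (rule circle_average_contour[where g="\<lambda>u. F (u * \<eta>) / (pi * (1 - w * cnj (u * \<eta>))\<^sup>2)"])
      show "continuous_on (sphere 0 1) (\<lambda>u. F (u * \<eta>) / (pi * (1 - w * cnj (u * \<eta>))\<^sup>2))"
        by (intro continuous_intros continuous_on_compose2[OF holomorphic_on_imp_continuous_on[OF F]]) (use sub nz in auto)
      show "((\<lambda>u. F (u * \<eta>) / (pi * (1 - w * cnj (u * \<eta>))\<^sup>2) / u) has_contour_integral 2 * complex_of_real pi * \<i> * \<psi>' ((cmod \<eta>)\<^sup>2)) (circlepath 0 1)"
      proof (rule has_contour_integral_eq[OF ci])
        fix u assume "u \<in> path_image (circlepath 0 1)"
        then have u: "cmod u = 1" by simp
        then have u0: "u \<noteq> 0" by auto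
        have cu: "cnj u = 1 / u" using u u0 by (simp add: divide_conv_cnj)
        have "u - w * cnj \<eta> = u * (1 - w * cnj (u * \<eta>))" using u0 by (simp add: cu field_simps)
        then show "f u / (u - w * cnj \<eta>)\<^sup>2 = F (u * \<eta>) / (pi * (1 - w * cnj (u * \<eta>))\<^sup>2) / u"
        proof -
          assume eq: "u - w * cnj \<eta> = u * (1 - w * cnj (u * \<eta>))"
          have gen: "A * u / of_real pi / (u * D)\<^sup>2 = A / (of_real pi * D\<^sup>2) / u" if "D \<noteq> 0" for A D :: complex
            using u0 that by (simp add: field_simps power2_eq_square)
          show ?thesis unfolding f_def eq by (rule gen[OF nz[OF u]])
        qed
      qed
    qed
    then show ?thesis using True by (simp add: I_def norm_mult)
  qed
  have "(LINT \<eta>|lborel. I \<eta>) = (LINT \<eta>|lborel. indicator (ball 0 1) \<eta> *\<^sub>R \<psi>' ((cmod \<eta>)\<^sup>2))"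
    unfolding integral_rotation_average[OF intI] avg ..
  also have "\<dots> = pi * (LINT x|lborel. indicator {0<..<1} x *\<^sub>R \<psi>' x)"
    by (rule integral_disc_radial) simp
  also have "(LINT x|lborel. indicator {0<..<1} x *\<^sub>R \<psi>' x) = (LINT x|lborel. \<psi>' x)"
  proof (rule integral_cong_AE)
    show "AE x in lborel. indicator {0<..<1} x *\<^sub>R \<psi>' x = \<psi>' x"
      using AE_lborel_singleton[of "0::real"] AE_lborel_singleton[of "1::real"]
      by eventually_elim (auto simp: \<psi>'_def indicator_def)
  qed auto
  also have "\<dots> = integral {0..1} \<psi>"
    unfolding \<psi>'_def using set_borel_integral_eq_integral(2)[of "{0..1}" \<psi>] borel_integrable_compact[OF _ c\<psi>]
    by (simp add: set_lebesgue_integral_def set_integrable_def)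
  also have "(\<psi> has_integral (of_real 1 * F (w * of_real 1) / pi - of_real 0 * F (w * of_real 0) / pi)) {0..1}"
  proof (rule fundamental_theorem_of_calculus)
    fix x :: real assume x: "x \<in> {0..1}"
    have "((\<lambda>y. y * F (w * y) / pi) has_field_derivative (F (w * x) + x * (deriv F (w * x) * w)) / pi) (at (of_real x))"
      by (auto intro!: derivative_eq_intros DERIV_chain2[OF holomorphic_derivI[OF F]] simp: wx[OF x, simplified])
    from has_vector_derivative_real_field[OF this]
    show "((\<lambda>x. complex_of_real x * F (w * complex_of_real x) / pi) has_vector_derivative \<psi> x) (at x within {0..1})"
      by (simp add: \<psi>_def ac_simps)
  qed simp
  then have "integral {0..1} \<psi> = F w / pi" by (simp add: integral_unique)
  finally show "(LINT \<eta>|lborel. indicator (ball 0 1) \<eta> *\<^sub>R (F \<eta> / (pi * (1 - w * cnj \<eta>)\<^sup>2))) = F w"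
    by (simp add: I_def)
qed

section \<open>Fibre coordinates on the Hartogs triangle\<close>

text \<open>Fibre coordinates: \<open>(w, t)\<close> in the product of the disc and the punctured disc stands for \<open>(w t, t)\<close> in the
  triangle.\<close>

definition \<Psi> :: "complex \<times> complex \<Rightarrow> complex \<times> complex" where "\<Psi> p = (fst p * snd p, snd p)"

text \<open>The Jacobian of the fibre coordinates, cut off to their domain.\<close>

definition \<rho> :: "complex \<times> complex \<Rightarrow> real" where
  "\<rho> p = (cmod (snd p))\<^sup>2 * indicator (ball 0 1) (fst p) * indicator (ball 0 1 - {0}) (snd p)"

lemma fst_snd_measurable_borel[measurable]:
  "fst \<in> borel_measurable (borel :: (complex \<times> complex) measure)" "snd \<in> borel_measurable (borel :: (complex \<times> complex) measure)"
  by (auto intro!: borel_measurable_continuous_onI continuous_intros)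

lemma cnj_measurable[measurable]: "cnj \<in> borel_measurable borel"
  by (intro borel_measurable_continuous_onI continuous_intros)

lemma \<Psi>_measurable[measurable]: "\<Psi> \<in> borel \<rightarrow>\<^sub>M borel"
  unfolding \<Psi>_def by (intro borel_measurable_continuous_onI continuous_intros)

lemma \<rho>_measurable[measurable]: "\<rho> \<in> borel_measurable borel"
proof -
  have eq: "\<rho> = (\<lambda>p. (cmod (snd p))\<^sup>2 * indicator (ball 0 1 \<times> (ball 0 1 - {0})) p)"
    by (auto simp: \<rho>_def fun_eq_iff indicator_def)
  have [measurable]: "ball 0 1 \<times> (ball 0 1 - {0}) \<in> sets (borel :: (complex \<times> complex) measure)"
    by (intro borel_open open_Times open_delete) auto
  show ?thesis unfolding eq by measurable
qed

lemma \<rho>_nonneg: "0 \<le> \<rho> p" by (simp add: \<rho>_def)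

lemma \<Psi>_hartogs: "\<rho> p \<noteq> 0 \<Longrightarrow> \<Psi> p \<in> HT"
  by (auto simp: \<rho>_def \<Psi>_def hartogs_iff norm_mult indicator_def split: if_splits)

text \<open>For fixed \<open>t\<close> the substitution \<open>z\<^sub>1 = w t\<close> scales Lebesgue measure by \<open>\<bar>t\<bar>\<^sup>2\<close>.\<close>

lemma nn_integral_hartogs:
  fixes F :: "complex \<times> complex \<Rightarrow> ennreal"
  assumes F: "F \<in> borel_measurable borel"
  shows "(\<integral>\<^sup>+z. F z * indicator HT z \<partial>lborel) = (\<integral>\<^sup>+t. \<integral>\<^sup>+w. F (\<Psi> (w, t)) * ennreal (\<rho> (w, t)) \<partial>lborel \<partial>lborel)"
proof -
  have Fp[measurable]: "F \<in> borel_measurable (borel \<Otimes>\<^sub>M borel)" using F by (simp add: borel_prod)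
  have [measurable]: "HT \<in> sets (borel \<Otimes>\<^sub>M borel)" unfolding borel_prod by (rule hartogs_measurable)
  have "(\<integral>\<^sup>+z. F z * indicator HT z \<partial>lborel) = (\<integral>\<^sup>+p. F p * indicator HT p \<partial>(lborel \<Otimes>\<^sub>M lborel))"
    by (simp add: lborel_prod)
  also have "\<dots> = (\<integral>\<^sup>+t. \<integral>\<^sup>+x. F (x, t) * indicator HT (x, t) \<partial>lborel \<partial>lborel)"
    by (subst lborel_pair.nn_integral_snd[symmetric]) auto
  also have "\<dots> = (\<integral>\<^sup>+t. \<integral>\<^sup>+w. F (\<Psi> (w, t)) * ennreal (\<rho> (w, t)) \<partial>lborel \<partial>lborel)"
  proof (rule nn_integral_cong)
    fix t :: complex
    show "(\<integral>\<^sup>+x. F (x, t) * indicator HT (x, t) \<partial>lborel) = (\<integral>\<^sup>+w. F (\<Psi> (w, t)) * ennreal (\<rho> (w, t)) \<partial>lborel)"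
    proof (cases "t \<in> ball 0 1 - {0}")
      case True
      have "(\<integral>\<^sup>+x. F (x, t) * indicator HT (x, t) \<partial>lborel) = ennreal ((cmod t)\<^sup>2) * (\<integral>\<^sup>+w. F (t * w, t) * indicator HT (t * w, t) \<partial>lborel)"
        by (rule nn_integral_complex_mult[symmetric]) (use True in auto)
      also have "\<dots> = (\<integral>\<^sup>+w. ennreal ((cmod t)\<^sup>2) * (F (t * w, t) * indicator HT (t * w, t)) \<partial>lborel)"
        by (rule nn_integral_cmult[symmetric]) auto
      also have "\<dots> = (\<integral>\<^sup>+w. F (\<Psi> (w, t)) * ennreal (\<rho> (w, t)) \<partial>lborel)"
        using True by (intro nn_integral_cong) (auto simp: \<Psi>_def \<rho>_def hartogs_iff norm_mult indicator_def mult.commute)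
      finally show ?thesis .
    next
      case False
      have "(\<integral>\<^sup>+x. F (x, t) * indicator HT (x, t) \<partial>lborel) = (\<integral>\<^sup>+x. 0 \<partial>(lborel :: complex measure))"
        using False by (intro nn_integral_cong) (auto simp: hartogs_iff indicator_def)
      also have "\<dots> = (\<integral>\<^sup>+w. F (\<Psi> (w, t)) * ennreal (\<rho> (w, t)) \<partial>lborel)"
        using False by (intro nn_integral_cong) (auto simp: \<rho>_def indicator_def)
      finally show ?thesis .
    qed
  qed
  finally show ?thesis .
qed

lemma distr_hartogs:
  "distr (density (lborel \<Otimes>\<^sub>M lborel) (\<lambda>p. ennreal (\<rho> p))) borel \<Psi> = density lborel (indicator HT)"
proof (rule measure_eqI)
  fix A assume "A \<in> sets (distr (density (lborel \<Otimes>\<^sub>M lborel) (\<lambda>p. ennreal (\<rho> p))) borel \<Psi>)"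
  then have A[measurable]: "A \<in> sets borel" by simp
  have [measurable]: "\<Psi> \<in> (borel \<Otimes>\<^sub>M borel) \<rightarrow>\<^sub>M borel" "\<rho> \<in> borel_measurable (borel \<Otimes>\<^sub>M borel)"
    using \<Psi>_measurable \<rho>_measurable by (simp_all add: borel_prod)
  have m: "(\<lambda>p. ennreal (\<rho> p)) \<in> borel_measurable (lborel \<Otimes>\<^sub>M lborel)" by measurable
  have "emeasure (distr (density (lborel \<Otimes>\<^sub>M lborel) (\<lambda>p. ennreal (\<rho> p))) borel \<Psi>) A
      = (\<integral>\<^sup>+z. indicator A z \<partial>distr (density (lborel \<Otimes>\<^sub>M lborel) (\<lambda>p. ennreal (\<rho> p))) borel \<Psi>)"
    by (subst nn_integral_indicator) auto
  also have "\<dots> = (\<integral>\<^sup>+p. indicator A (\<Psi> p) \<partial>density (lborel \<Otimes>\<^sub>M lborel) (\<lambda>p. ennreal (\<rho> p)))"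
    by (subst nn_integral_distr) auto
  also have "\<dots> = (\<integral>\<^sup>+p. ennreal (\<rho> p) * indicator A (\<Psi> p) \<partial>(lborel \<Otimes>\<^sub>M lborel))"
    by (subst nn_integral_density[OF m]) auto
  also have "\<dots> = (\<integral>\<^sup>+t. \<integral>\<^sup>+w. ennreal (\<rho> (w, t)) * indicator A (\<Psi> (w, t)) \<partial>lborel \<partial>lborel)"
    by (subst lborel_pair.nn_integral_snd[symmetric]) auto
  also have "\<dots> = (\<integral>\<^sup>+z. indicator A z * indicator HT z \<partial>lborel)"
    by (subst nn_integral_hartogs) (auto simp: mult.commute)
  also have "\<dots> = emeasure (density lborel (indicator HT)) A"
    by (subst emeasure_density) (auto simp: mult.commute)
  finally show "emeasure (distr (density (lborel \<Otimes>\<^sub>M lborel) (\<lambda>p. ennreal (\<rho> p))) borel \<Psi>) A = emeasure (density lborel (indicator HT)) A" .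
qed simp

lemma integral_hartogs:
  fixes F :: "complex \<times> complex \<Rightarrow> complex"
  assumes F: "integrable lborel F" and F0: "\<And>z. z \<notin> HT \<Longrightarrow> F z = 0"
  shows "integrable (lborel \<Otimes>\<^sub>M lborel) (\<lambda>(w, t). \<rho> (w, t) *\<^sub>R F (\<Psi> (w, t)))"
    and "(LINT z|lborel. F z) = (LINT t|lborel. LINT w|lborel. \<rho> (w, t) *\<^sub>R F (\<Psi> (w, t)))"
proof -
  have Fm[measurable]: "F \<in> borel_measurable borel" using borel_measurable_integrable[OF F] by simp
  have eq: "(\<lambda>z. indicat_real HT z *\<^sub>R F z) = F" using F0 by (auto simp: fun_eq_iff indicator_def)
  have [measurable]: "\<Psi> \<in> (borel \<Otimes>\<^sub>M borel) \<rightarrow>\<^sub>M borel" "\<rho> \<in> borel_measurable (borel \<Otimes>\<^sub>M borel)"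
    using \<Psi>_measurable \<rho>_measurable by (simp_all add: borel_prod)
  have d: "density lborel (indicator HT) = density lborel (\<lambda>x. ennreal (indicat_real HT x))"
    by (simp add: ennreal_indicator)
  have i1: "integrable (density lborel (indicator HT)) F \<longleftrightarrow> integrable lborel F"
    unfolding d by (subst integrable_density) (auto simp: eq)
  have i2: "(LINT z|density lborel (indicator HT). F z) = (LINT z|lborel. F z)"
    unfolding d by (subst integral_density) (auto simp: eq)
  have "integrable (density (lborel \<Otimes>\<^sub>M lborel) (\<lambda>p. ennreal (\<rho> p))) (\<lambda>p. F (\<Psi> p))"
    using F unfolding i1[symmetric] distr_hartogs[symmetric] by (subst (asm) integrable_distr_eq) auto
  then have int: "integrable (lborel \<Otimes>\<^sub>M lborel) (\<lambda>p. \<rho> p *\<^sub>R F (\<Psi> p))"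
    by (subst (asm) integrable_density) (auto simp: \<rho>_nonneg)
  then show int': "integrable (lborel \<Otimes>\<^sub>M lborel) (\<lambda>(w, t). \<rho> (w, t) *\<^sub>R F (\<Psi> (w, t)))"
    by (simp add: split_beta')
  have "(LINT z|lborel. F z) = (LINT p|density (lborel \<Otimes>\<^sub>M lborel) (\<lambda>p. ennreal (\<rho> p)). F (\<Psi> p))"
    unfolding i2[symmetric] distr_hartogs[symmetric] by (subst integral_distr) auto
  also have "\<dots> = (LINT p|(lborel \<Otimes>\<^sub>M lborel). \<rho> p *\<^sub>R F (\<Psi> p))"
    by (subst integral_density) (auto simp: \<rho>_nonneg)
  also have "\<dots> = (LINT t|lborel. LINT w|lborel. \<rho> (w, t) *\<^sub>R F (\<Psi> (w, t)))"
    using lborel_pair.integral_snd[OF int'] by (simp add: split_beta')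
  finally show "(LINT z|lborel. F z) = (LINT t|lborel. LINT w|lborel. \<rho> (w, t) *\<^sub>R F (\<Psi> (w, t)))" .
qed

text \<open>In fibre coordinates the kernel is a product of two disc kernels.\<close>

lemma hartogs_kernel_fibre:
  fixes z :: "complex \<times> complex" and w t :: complex
  assumes z: "z \<in> HT" and w: "cmod w < 1" and t: "cmod t < 1" "t \<noteq> 0"
  shows "hartogs_kernel z (w * t, t) = 1 / ((of_real pi)\<^sup>2 * snd z * cnj t * (1 - fst z / snd z * cnj w)\<^sup>2 * (1 - snd z * cnj t)\<^sup>2)"
proof -
  have z0: "snd z \<noteq> 0" using hartogs_snd_nonzero[OF z] .
  have h: "(w * t, t) \<in> HT" using w t by (simp add: hartogs_iff norm_mult)
  have e: "snd z * cnj t - fst z * cnj (w * t) = (snd z * cnj t) * (1 - fst z / snd z * cnj w)"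
    using z0 by (simp add: field_simps)
  have gen: "(1 / of_real (pi\<^sup>2)) * y ^ 1 * inverse (y * P) ^ 2 * inverse Q ^ 2 = 1 / ((of_real pi)\<^sup>2 * y * P\<^sup>2 * Q\<^sup>2)" if "y \<noteq> 0" for y P Q :: complex
    using that by (cases "P = 0"; cases "Q = 0") (simp_all add: field_simps power2_eq_square)
  have "hartogs_kernel z (w * t, t) = (1 / of_real (pi\<^sup>2)) * (snd z * cnj t) ^ 1 * inverse ((snd z * cnj t) * (1 - fst z / snd z * cnj w)) ^ 2 * inverse (1 - snd z * cnj t) ^ 2"
    using z h by (simp only: hartogs_kernel_def base_kernel_def fst_conj_prod snd_conj_prod fst_conv snd_conv e) simp
  also have "\<dots> = 1 / ((of_real pi)\<^sup>2 * (snd z * cnj t) * (1 - fst z / snd z * cnj w)\<^sup>2 * (1 - snd z * cnj t)\<^sup>2)"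
    using z0 t by (intro gen) auto
  finally show ?thesis by (simp add: mult.assoc)
qed

section \<open>Radial integrals\<close>

lemma nn_integral_powr_unit:
  fixes \<sigma> :: real
  assumes "\<sigma> > -1"
  shows "(\<integral>\<^sup>+x. ennreal (x powr \<sigma>) * indicator {0<..<1} x \<partial>lborel) = ennreal (1 / (\<sigma> + 1))"
proof -
  have "(\<integral>\<^sup>+x. ennreal (x powr \<sigma>) * indicator {0<..<1} x \<partial>lborel) = (\<integral>\<^sup>+x. ennreal (indicator {0..1} x * x powr \<sigma>) \<partial>lborel)"
  proof (rule nn_integral_cong_AE)
    show "AE x in lborel. ennreal (x powr \<sigma>) * indicator {0<..<1} x = ennreal (indicator {0..1} x * x powr \<sigma>)"
      using AE_lborel_singleton[of "0::real"] AE_lborel_singleton[of "1::real"]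
      by eventually_elim (auto simp: indicator_def)
  qed
  also have "\<dots> = ennreal (1 powr (\<sigma> + 1) / (\<sigma> + 1))"
    using nn_integral_has_integral_lebesgue[OF _ has_integral_powr_from_0[OF assms, of 1]] by (simp add: mult.commute)
  finally show ?thesis by simp
qed

text \<open>With \<open>a = 1 - \<tau>\<close> the denominator is at least \<open>a\<close> and at least \<open>1 - x\<close>. For \<open>x \<le> 1/2\<close> the integrand is of order
  \<open>x\<^sup>\<sigma>\<close>. For \<open>x > 1/2\<close> the first bound is used when \<open>1 - x \<le> a\<close> and the second when \<open>1 - x > a\<close>; both
  parts integrate to a multiple of \<open>a\<^sup>-\<^sup>r\<close>.\<close>

lemma radial_Schur:
  fixes \<sigma> r :: real
  assumes \<sigma>: "\<sigma> > -1" and r: "0 < r" "r < 1"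
  shows "\<exists>C>0. \<forall>\<tau>. 0 \<le> \<tau> \<longrightarrow> \<tau> < 1 \<longrightarrow>
    (\<integral>\<^sup>+x. ennreal (x powr \<sigma> * (1 - x) powr (- r) / (1 - \<tau> * x)) * indicator {0<..<1} x \<partial>lborel) \<le> ennreal (C * (1 - \<tau>) powr (- r))"
proof (intro exI conjI allI impI)
  \<comment> \<open>bounds \<open>x powr \<sigma>\<close> for \<open>1/2 < x < 1\<close> whatever the sign of \<open>\<sigma>\<close>\<close>
  define m where "m = 2 powr \<bar>\<sigma>\<bar>"
  have m: "m > 0" by (simp add: m_def)
  show "0 < 4 / (\<sigma> + 1) + m * (1 / (1 - r) + 1 / r)"
  proof -
    have "0 < 4 / (\<sigma> + 1)" using \<sigma> by simp
    moreover have "0 < m * (1 / (1 - r) + 1 / r)" using m r by (intro mult_pos_pos add_pos_pos) auto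
    ultimately show ?thesis by linarith
  qed
  fix \<tau> :: real assume \<tau>: "0 \<le> \<tau>" "\<tau> < 1"
  define a where "a = 1 - \<tau>"
  have a: "0 < a" "a \<le> 1" using \<tau> by (auto simp: a_def)
  have am: "1 \<le> a powr (- r)" using a r powr_mono'[of "-r" 0 a] by simp
  define g1 where "g1 = (\<lambda>y::real. indicator {0..a} y * y powr (- r))"
  define g2 where "g2 = (\<lambda>y::real. indicator {a..} y * y powr (- r - 1))"
  have pt: "x powr \<sigma> * (1 - x) powr (- r) / (1 - \<tau> * x) \<le> (4 * a powr (- r)) * x powr \<sigma> + (m / a) * g1 (1 - x) + m * g2 (1 - x)"
    if x: "0 < x" "x < 1" for x
  proof -
    have d1: "1 - \<tau> * x \<ge> 1 - x" using x \<tau> by (simp add: mult_left_le_one_le)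
    have d2: "1 - \<tau> * x \<ge> a" using x \<tau> by (simp add: a_def mult_left_le)
    have g: "0 \<le> (4 * a powr (- r)) * x powr \<sigma>" "0 \<le> (m / a) * g1 (1 - x)" "0 \<le> m * g2 (1 - x)"
      using m a by (auto simp: g1_def g2_def)
    show ?thesis
    proof (cases "x \<le> 1 / 2")
      case True
      have "(1 - x) powr (- r) \<le> (1 / 2) powr (- r)" using True x r by (intro powr_mono2') auto
      also have "\<dots> = 2 powr r" by (simp add: powr_minus powr_divide)
      also have "\<dots> \<le> 2 powr 1" using r by (intro powr_mono) auto
      finally have "(1 - x) powr (- r) \<le> 2" by simp
      moreover have "1 / 2 \<le> 1 - \<tau> * x" using d1 True by linarith
      ultimately have "x powr \<sigma> * (1 - x) powr (- r) / (1 - \<tau> * x) \<le> x powr \<sigma> * 2 / (1 / 2)"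
        by (intro frac_le mult_left_mono) auto
      also have "\<dots> \<le> (4 * a powr (- r)) * x powr \<sigma>" using am mult_right_mono[of 1 "a powr (- r)" "4 * x powr \<sigma>"] by simp
      finally show ?thesis using g by linarith
    next
      case False
      have xm: "x powr \<sigma> \<le> m"
      proof (cases "\<sigma> \<ge> 0")
        case True
        then have "x powr \<sigma> \<le> 1" using x by (simp add: powr_le1)
        also have "1 \<le> m" using True by (simp add: m_def ge_one_powr_ge_zero)
        finally show ?thesis .
      next
        case F: False
        then have "x powr \<sigma> \<le> (1 / 2) powr \<sigma>" using False x by (intro powr_mono2') auto
        also have "\<dots> = m" using F by (simp add: m_def powr_divide powr_minus_divide[symmetric])
        finally show ?thesis .
      qed
      have "x powr \<sigma> * (1 - x) powr (- r) / (1 - \<tau> * x) \<le> m * (1 - x) powr (- r) / (1 - \<tau> * x)"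
        using xm d2 a by (intro divide_right_mono mult_right_mono) auto
      also have "\<dots> \<le> (m / a) * g1 (1 - x) + m * g2 (1 - x)"
      proof (cases "1 - x \<le> a")
        case True
        have "m * (1 - x) powr (- r) / (1 - \<tau> * x) \<le> m * (1 - x) powr (- r) / a"
          using d2 a m by (intro divide_left_mono mult_pos_pos) auto
        also have "\<dots> = (m / a) * g1 (1 - x)" using True x by (simp add: g1_def)
        finally show ?thesis using g by linarith
      next
        case F: False
        have "m * (1 - x) powr (- r) / (1 - \<tau> * x) \<le> m * (1 - x) powr (- r) / (1 - x)"
          using d1 x m d2 a by (intro divide_left_mono mult_pos_pos) auto
        also have "\<dots> = m * g2 (1 - x)" using F x by (simp add: g2_def powr_diff)
        finally show ?thesis using g by linarith
      qed
      finally show ?thesis using g by linarith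
    qed
  qed
  have refl: "(\<integral>\<^sup>+x. ennreal (g (1 - x)) \<partial>lborel) = (\<integral>\<^sup>+y. ennreal (g y) \<partial>lborel)" if [measurable]: "g \<in> borel_measurable borel" for g :: "real \<Rightarrow> real"
    using nn_integral_real_affine[of "\<lambda>y. ennreal (g y)" "-1" 1] by simp
  have [measurable]: "g1 \<in> borel_measurable borel" "g2 \<in> borel_measurable borel" by (auto simp: g1_def g2_def)
  have g1i: "(\<integral>\<^sup>+x. ennreal (g1 (1 - x)) \<partial>lborel) = ennreal (a powr (1 - r) / (1 - r))"
    unfolding refl[of g1, simplified] unfolding g1_def
    using nn_integral_has_integral_lebesgue[OF _ has_integral_powr_from_0[of "- r" a]] r a by (simp add: mult.commute add.commute)
  have g2i: "(\<integral>\<^sup>+x. ennreal (g2 (1 - x)) \<partial>lborel) = ennreal (a powr (- r) / r)"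
    unfolding refl[of g2, simplified] unfolding g2_def
    using nn_integral_has_integral_lebesgue[OF _ has_integral_powr_to_inf[of "- r - 1" a]] r a by (simp add: mult.commute)
  have "(\<integral>\<^sup>+x. ennreal (x powr \<sigma> * (1 - x) powr (- r) / (1 - \<tau> * x)) * indicator {0<..<1} x \<partial>lborel)
     \<le> (\<integral>\<^sup>+x. ennreal (4 * a powr (- r)) * (ennreal (x powr \<sigma>) * indicator {0<..<1} x) + (ennreal (m / a) * ennreal (g1 (1 - x)) + ennreal m * ennreal (g2 (1 - x))) \<partial>lborel)"
  proof (rule nn_integral_mono)
    fix x :: real
    show "ennreal (x powr \<sigma> * (1 - x) powr (- r) / (1 - \<tau> * x)) * indicator {0<..<1} x
      \<le> ennreal (4 * a powr (- r)) * (ennreal (x powr \<sigma>) * indicator {0<..<1} x) + (ennreal (m / a) * ennreal (g1 (1 - x)) + ennreal m * ennreal (g2 (1 - x)))"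
    proof (cases "0 < x \<and> x < 1")
      case True
      have g: "0 \<le> g1 (1 - x)" "0 \<le> g2 (1 - x)" "0 \<le> m / a" "0 \<le> m" using m a by (auto simp: g1_def g2_def)
      have "ennreal (x powr \<sigma> * (1 - x) powr (- r) / (1 - \<tau> * x)) \<le> ennreal ((4 * a powr (- r)) * x powr \<sigma> + ((m / a) * g1 (1 - x) + m * g2 (1 - x)))"
        using pt[of x] True by (intro ennreal_leI) simp
      also have "\<dots> = ennreal ((4 * a powr (- r)) * x powr \<sigma>) + (ennreal ((m / a) * g1 (1 - x)) + ennreal (m * g2 (1 - x)))"
        using g mult_nonneg_nonneg[OF g(3,1)] mult_nonneg_nonneg[OF g(4,2)]
        by (simp only: ennreal_plus add_nonneg_nonneg mult_nonneg_nonneg powr_ge_zero zero_le_numeral)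
      also have "\<dots> = ennreal (4 * a powr (- r)) * ennreal (x powr \<sigma>) + (ennreal (m / a) * ennreal (g1 (1 - x)) + ennreal m * ennreal (g2 (1 - x)))"
        using g by (simp add: ennreal_mult[symmetric] del: ennreal_plus)
      finally show ?thesis using True by simp
    qed auto
  qed
  also have "\<dots> = ennreal (4 * a powr (- r)) * ennreal (1 / (\<sigma> + 1)) + (ennreal (m / a) * ennreal (a powr (1 - r) / (1 - r)) + ennreal m * ennreal (a powr (- r) / r))"
    by (simp add: nn_integral_add nn_integral_cmult nn_integral_powr_unit[OF \<sigma>] g1i g2i)
  also have "\<dots> = ennreal ((4 * a powr (- r)) * (1 / (\<sigma> + 1)) + ((m / a) * (a powr (1 - r) / (1 - r)) + m * (a powr (- r) / r)))"
    using a m r \<sigma> by (simp add: ennreal_mult[symmetric] flip: ennreal_plus)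
  also have "(4 * a powr (- r)) * (1 / (\<sigma> + 1)) + ((m / a) * (a powr (1 - r) / (1 - r)) + m * (a powr (- r) / r)) = (4 / (\<sigma> + 1) + m * (1 / (1 - r) + 1 / r)) * a powr (- r)"
  proof -
    have "a powr (1 - r) = a * a powr (- r)" using a by (simp add: powr_diff powr_minus divide_inverse)
    then show ?thesis using a by (simp add: field_simps)
  qed
  finally show "(\<integral>\<^sup>+x. ennreal (x powr \<sigma> * (1 - x) powr (- r) / (1 - \<tau> * x)) * indicator {0<..<1} x \<partial>lborel)
     \<le> ennreal ((4 / (\<sigma> + 1) + m * (1 / (1 - r) + 1 / r)) * (1 - \<tau>) powr (- r))"
    by (simp add: a_def)
qed

text \<open>On the unit circle \<open>u\<^sup>* = 1 / u\<close>, so the integrand divided by \<open>u\<close> is \<open>f(u) / (u - a)\<close> with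
  \<open>f(v) = 1 / (1 - a\<^sup>* v)\<close>, and the Cauchy formula gives \<open>f(a)\<close>.\<close>

lemma circle_average_kernel:
  assumes a: "cmod a < 1"
  shows "(\<integral>\<^sup>+t. ennreal (1 / (cmod (1 - a * cnj (circle_param t)))\<^sup>2) \<partial>unit_interval) = ennreal (1 / (1 - (cmod a)\<^sup>2))"
proof -
  define g where "g = (\<lambda>u. 1 / (cmod (1 - a * cnj u))\<^sup>2)"
  have nz: "1 - a * cnj u \<noteq> 0" if "cmod u = 1" for u
  proof
    assume "1 - a * cnj u = 0"
    then have "a * cnj u = 1" by simp
    then have "cmod (a * cnj u) = 1" by simp
    then show False using that a by (simp add: norm_mult)
  qed
  define f where "f = (\<lambda>v. 1 / (1 - cnj a * v))"
  have nz2: "1 - cnj a * v \<noteq> 0" if "cmod v \<le> 1" for v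
  proof
    assume "1 - cnj a * v = 0"
    then have "cnj a * v = 1" by simp
    then have "cmod (cnj a * v) = 1" by simp
    moreover have "cmod a * cmod v \<le> cmod a" using that by (simp add: mult_left_le)
    ultimately show False using a by (simp add: norm_mult)
  qed
  have cg: "continuous_on (sphere 0 1) (\<lambda>u. complex_of_real (g u))" unfolding g_def
    by (intro continuous_intros) (use nz in auto)
  have "(LINT t|unit_interval. complex_of_real (g (circle_param t))) = 1 / (1 - (cmod a)\<^sup>2)"
  proof (rule circle_average_contour[where g="\<lambda>u. complex_of_real (g u)", OF cg])
    have "((\<lambda>u. f u / (u - a)) has_contour_integral 2 * of_real pi * \<i> * f a) (circlepath 0 1)"
    proof (rule Cauchy_integral_circlepath)
      show "continuous_on (cball 0 1) f" unfolding f_def by (intro continuous_intros) (use nz2 in auto)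
      show "f holomorphic_on ball 0 1" unfolding f_def by (intro holomorphic_intros) (use nz2 in auto)
    qed (use a in auto)
    moreover have "f a = 1 / (1 - (cmod a)\<^sup>2)"
    proof -
      have "complex_of_real ((cmod a)\<^sup>2) = cnj a * a"
        by (simp only: complex_norm_square mult.commute)
      then show ?thesis by (simp only: f_def of_real_divide of_real_diff of_real_1)
    qed
    ultimately show "((\<lambda>u. complex_of_real (g u) / u) has_contour_integral 2 * of_real pi * \<i> * (1 / (1 - (cmod a)\<^sup>2))) (circlepath 0 1)"
    proof (subst (asm) \<open>f a = 1 / (1 - (cmod a)\<^sup>2)\<close>, elim has_contour_integral_eq)
      fix u assume "u \<in> path_image (circlepath 0 1)"
      then have u: "cmod u = 1" by simp
      then have u0: "u \<noteq> 0" by auto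
      have uu: "u * cnj u = 1" using u by (simp add: complex_norm_square[symmetric])
      have e1: "u - a = u * (1 - a * cnj u)" using uu by (simp add: algebra_simps)
      have e2: "cnj (1 - a * cnj u) = 1 - cnj a * u" by simp
      have "complex_of_real (g u) = 1 / ((1 - a * cnj u) * cnj (1 - a * cnj u))"
        unfolding g_def by (simp only: of_real_divide of_real_1 of_real_power[symmetric] complex_norm_square[symmetric])
      also have "\<dots> / u = f u / (u - a)"
        unfolding e1 e2 f_def using u0 nz[OF u] nz2[of u] u by (simp add: field_simps)
      finally show "f u / (u - a) = complex_of_real (g u) / u" by simp
    qed
  qed
  then have "complex_of_real (LINT t|unit_interval. g (circle_param t)) = complex_of_real (1 / (1 - (cmod a)\<^sup>2))"
    by (subst integral_complex_of_real[symmetric]) simp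
  then have I: "(LINT t|unit_interval. g (circle_param t)) = 1 / (1 - (cmod a)\<^sup>2)" using of_real_eq_iff by blast
  have bound: "g u \<le> 1 / (1 - cmod a)\<^sup>2" if "cmod u = 1" for u
  proof -
    have "1 - cmod a \<le> cmod (1 - a * cnj u)"
      using norm_triangle_ineq2[of 1 "a * cnj u"] that by (simp add: norm_mult)
    then show ?thesis unfolding g_def using a by (intro divide_left_mono power_mono mult_pos_pos) (use nz that in auto)
  qed
  have "integrable unit_interval (\<lambda>t. g (circle_param t))"
  proof (rule unit_interval.integrable_const_bound[where B="1 / (1 - cmod a)\<^sup>2"])
    show "AE t in unit_interval. norm (g (circle_param t)) \<le> 1 / (1 - cmod a)\<^sup>2"
      using bound by (intro AE_I2) (simp add: g_def)
    show "(\<lambda>t. g (circle_param t)) \<in> borel_measurable unit_interval" unfolding g_def by measurable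
  qed
  from nn_integral_eq_integral[OF this] show ?thesis unfolding I by (simp add: g_def)
qed

text \<open>The average over rotations evaluates the angular integral by \<open>circle_average_kernel\<close>, and what remains is
  the radial estimate with \<open>\<tau> = \<bar>w\<bar>\<^sup>2\<close>.\<close>

lemma disc_Schur:
  fixes \<sigma> r :: real
  assumes \<sigma>: "\<sigma> > -1" and r: "0 < r" "r < 1"
  shows "\<exists>C>0. \<forall>w. cmod w < 1 \<longrightarrow>
    (\<integral>\<^sup>+\<eta>. ennreal (((cmod \<eta>)\<^sup>2) powr \<sigma> * (1 - (cmod \<eta>)\<^sup>2) powr (- r) / (cmod (1 - w * cnj \<eta>))\<^sup>2) * indicator (ball 0 1) \<eta> \<partial>lborel) \<le> ennreal (C * (1 - (cmod w)\<^sup>2) powr (- r))"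
proof -
  obtain C where C: "C > 0" "\<And>\<tau>. 0 \<le> \<tau> \<Longrightarrow> \<tau> < 1 \<Longrightarrow>
    (\<integral>\<^sup>+x. ennreal (x powr \<sigma> * (1 - x) powr (- r) / (1 - \<tau> * x)) * indicator {0<..<1} x \<partial>lborel) \<le> ennreal (C * (1 - \<tau>) powr (- r))"
    using radial_Schur[OF assms] by blast
  show ?thesis
  proof (intro exI[of _ "pi * C"] conjI allI impI)
    fix w assume w: "cmod w < 1"
    have "(\<integral>\<^sup>+\<eta>. ennreal (((cmod \<eta>)\<^sup>2) powr \<sigma> * (1 - (cmod \<eta>)\<^sup>2) powr (- r) / (cmod (1 - w * cnj \<eta>))\<^sup>2) * indicator (ball 0 1) \<eta> \<partial>lborel)
      = (\<integral>\<^sup>+\<eta>. (\<integral>\<^sup>+t. ennreal (((cmod (circle_param t * \<eta>))\<^sup>2) powr \<sigma> * (1 - (cmod (circle_param t * \<eta>))\<^sup>2) powr (- r) / (cmod (1 - w * cnj (circle_param t * \<eta>)))\<^sup>2) * indicator (ball 0 1) (circle_param t * \<eta>) \<partial>unit_interval) \<partial>lborel)"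
      by (rule nn_integral_rotation_average) measurable
    also have "\<dots> = (\<integral>\<^sup>+\<eta>. (\<lambda>x. ennreal (x powr \<sigma> * (1 - x) powr (- r) / (1 - (cmod w)\<^sup>2 * x))) ((cmod \<eta>)\<^sup>2) * indicator (ball 0 1) \<eta> \<partial>lborel)"
    proof (rule nn_integral_cong)
      fix \<eta> :: complex
      show "(\<integral>\<^sup>+t. ennreal (((cmod (circle_param t * \<eta>))\<^sup>2) powr \<sigma> * (1 - (cmod (circle_param t * \<eta>))\<^sup>2) powr (- r) / (cmod (1 - w * cnj (circle_param t * \<eta>)))\<^sup>2) * indicator (ball 0 1) (circle_param t * \<eta>) \<partial>unit_interval)
        = (\<lambda>x. ennreal (x powr \<sigma> * (1 - x) powr (- r) / (1 - (cmod w)\<^sup>2 * x))) ((cmod \<eta>)\<^sup>2) * indicator (ball 0 1) \<eta>"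
      proof (cases "cmod \<eta> < 1")
        case True
        define k where "k = ((cmod \<eta>)\<^sup>2) powr \<sigma> * (1 - (cmod \<eta>)\<^sup>2) powr (- r)"
        have k: "k \<ge> 0" by (simp add: k_def)
        have wn: "cmod (w * cnj \<eta>) < 1"
          using w True mult_strict_mono'[of "cmod w" 1 "cmod \<eta>" 1] by (simp add: norm_mult)
        have "(\<integral>\<^sup>+t. ennreal (((cmod (circle_param t * \<eta>))\<^sup>2) powr \<sigma> * (1 - (cmod (circle_param t * \<eta>))\<^sup>2) powr (- r) / (cmod (1 - w * cnj (circle_param t * \<eta>)))\<^sup>2) * indicator (ball 0 1) (circle_param t * \<eta>) \<partial>unit_interval)
           = (\<integral>\<^sup>+t. ennreal k * ennreal (1 / (cmod (1 - (w * cnj \<eta>) * cnj (circle_param t)))\<^sup>2) \<partial>unit_interval)"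
        proof (rule nn_integral_cong)
          fix t
          have e: "w * cnj (circle_param t * \<eta>) = (w * cnj \<eta>) * cnj (circle_param t)" by simp
          show "ennreal (((cmod (circle_param t * \<eta>))\<^sup>2) powr \<sigma> * (1 - (cmod (circle_param t * \<eta>))\<^sup>2) powr (- r) / (cmod (1 - w * cnj (circle_param t * \<eta>)))\<^sup>2) * indicator (ball 0 1) (circle_param t * \<eta>)
             = ennreal k * ennreal (1 / (cmod (1 - (w * cnj \<eta>) * cnj (circle_param t)))\<^sup>2)"
            unfolding e using True k by (simp add: norm_mult k_def ennreal_mult[symmetric])
        qed
        also have "\<dots> = ennreal k * (\<integral>\<^sup>+t. ennreal (1 / (cmod (1 - (w * cnj \<eta>) * cnj (circle_param t)))\<^sup>2) \<partial>unit_interval)"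
          by (rule nn_integral_cmult) measurable
        also have "\<dots> = ennreal k * ennreal (1 / (1 - (cmod (w * cnj \<eta>))\<^sup>2))"
          unfolding circle_average_kernel[OF wn] ..
        also have "\<dots> = ennreal (k / (1 - (cmod w)\<^sup>2 * (cmod \<eta>)\<^sup>2))"
        proof -
          have "(cmod (w * cnj \<eta>))\<^sup>2 < 1" using wn by (simp add: power_less_one_iff abs_square_less_1)
          then show ?thesis using k by (simp add: ennreal_mult[symmetric] norm_mult power_mult_distrib)
        qed
        finally show ?thesis using True by (simp add: k_def)
      qed (simp add: norm_mult)
    qed
    also have "\<dots> = ennreal pi * (\<integral>\<^sup>+x. ennreal (x powr \<sigma> * (1 - x) powr (- r) / (1 - (cmod w)\<^sup>2 * x)) * indicator {0<..<1} x \<partial>lborel)"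
      by (rule nn_integral_disc_radial) measurable
    also have "\<dots> \<le> ennreal pi * ennreal (C * (1 - (cmod w)\<^sup>2) powr (- r))"
      using w by (intro mult_left_mono C(2)) (auto simp: power_less_one_iff abs_square_less_1)
    also have "\<dots> = ennreal (pi * C * (1 - (cmod w)\<^sup>2) powr (- r))"
      using C by (simp add: ennreal_mult[symmetric] mult.assoc)
    finally show "(\<integral>\<^sup>+\<eta>. ennreal (((cmod \<eta>)\<^sup>2) powr \<sigma> * (1 - (cmod \<eta>)\<^sup>2) powr (- r) / (cmod (1 - w * cnj \<eta>))\<^sup>2) * indicator (ball 0 1) \<eta> \<partial>lborel) \<le> ennreal (pi * C * (1 - (cmod w)\<^sup>2) powr (- r))" .
  qed (use C in simp)
qed

section \<open>Integrability of powers and the Schur estimate on the Hartogs triangle\<close>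

text \<open>Each fibre has area \<open>\<pi> \<bar>z\<^sub>2\<bar>\<^sup>2\<close>, so the singularity is that of \<open>\<bar>z\<^sub>2\<bar>\<^sup>2\<^sup>-\<^sup>s\<close> in the plane.\<close>

lemma nn_integral_snd_powr_finite:
  assumes s: "s < 4"
  shows "(\<integral>\<^sup>+z. ennreal (cmod (snd z) powr (- s)) * indicator HT z \<partial>lborel) < \<infinity>"
proof -
  have "(\<integral>\<^sup>+z. ennreal (cmod (snd z) powr (- s)) * indicator HT z \<partial>lborel)
    = (\<integral>\<^sup>+t. \<integral>\<^sup>+w. ennreal (cmod (snd (\<Psi> (w, t))) powr (- s)) * ennreal (\<rho> (w, t)) \<partial>lborel \<partial>lborel)"
    by (rule nn_integral_hartogs) measurable
  also have "\<dots> = (\<integral>\<^sup>+t. \<integral>\<^sup>+w. (ennreal (((cmod t)\<^sup>2) powr ((2 - s) / 2)) * indicator (ball 0 1) t) * indicator (ball (0::complex) 1) w \<partial>lborel \<partial>lborel)"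
  proof (intro nn_integral_cong)
    fix w t :: complex
    show "ennreal (cmod (snd (\<Psi> (w, t))) powr (- s)) * ennreal (\<rho> (w, t)) = (ennreal (((cmod t)\<^sup>2) powr ((2 - s) / 2)) * indicator (ball 0 1) t) * indicator (ball 0 1) w"
    proof (cases "t = 0")
      case False
      have "cmod t powr (- s) * (cmod t)\<^sup>2 = ((cmod t)\<^sup>2) powr ((2 - s) / 2)"
        using False by (simp add: powr_numeral[symmetric] powr_powr powr_add[symmetric] diff_divide_distrib del: powr_numeral)
      then show ?thesis using False by (auto simp: \<Psi>_def \<rho>_def indicator_def ennreal_mult[symmetric])
    qed (simp add: \<rho>_def)
  qed
  also have "\<dots> = (\<integral>\<^sup>+t. (ennreal (((cmod t)\<^sup>2) powr ((2 - s) / 2)) * indicator (ball 0 1) t) * ennreal pi \<partial>(lborel :: complex measure))"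
    by (intro nn_integral_cong) (subst nn_integral_cmult_indicator, auto simp: emeasure_ball unit_ball_vol_2)
  also have "\<dots> = (\<integral>\<^sup>+t. (ennreal (((cmod t)\<^sup>2) powr ((2 - s) / 2)) * indicator (ball 0 1) t) \<partial>(lborel :: complex measure)) * ennreal pi"
    by (rule nn_integral_multc) measurable
  also have "(\<integral>\<^sup>+t. (ennreal (((cmod t)\<^sup>2) powr ((2 - s) / 2)) * indicator (ball 0 1) t) \<partial>(lborel :: complex measure))
      = ennreal pi * (\<integral>\<^sup>+x. ennreal (x powr ((2 - s) / 2)) * indicator {0<..<1} x \<partial>lborel)"
    by (rule nn_integral_disc_radial[where \<phi>="\<lambda>x. ennreal (x powr ((2 - s) / 2))"]) measurable
  also have "(\<integral>\<^sup>+x. ennreal (x powr ((2 - s) / 2)) * indicator {0<..<1} x \<partial>lborel) = ennreal (1 / ((2 - s) / 2 + 1))"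
    using s by (intro nn_integral_powr_unit) auto
  finally show ?thesis by (simp add: ennreal_mult_less_top)
qed

text \<open>The weight for Schur's test. In fibre coordinates it is \<open>(1 - \<bar>w\<bar>\<^sup>2) (1 - \<bar>t\<bar>\<^sup>2) \<bar>t\<bar>\<^sup>4\<close>: the first two factors
  are the usual weights for the disc kernels, and the last one deals with the singular point of the
  boundary.\<close>

definition \<Theta> :: "complex \<times> complex \<Rightarrow> real" where
  "\<Theta> z = ((cmod (snd z))\<^sup>2 - (cmod (fst z))\<^sup>2) * (1 - (cmod (snd z))\<^sup>2) * (cmod (snd z))\<^sup>2"

lemma \<Theta>_measurable[measurable]: "\<Theta> \<in> borel_measurable borel"
  unfolding \<Theta>_def by measurable

lemma \<Theta>_pos: "z \<in> HT \<Longrightarrow> 0 < \<Theta> z"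
  unfolding \<Theta>_def by (intro mult_pos_pos) (auto simp: hartogs_iff power_less_one_iff abs_square_less_1 intro!: power_strict_mono)

lemma Schur_weight_fibre:
  assumes "cmod w < 1" "cmod t < 1" "t \<noteq> 0"
  shows "\<Theta> (\<Psi> (w, t)) powr (- r) = (1 - (cmod w)\<^sup>2) powr (- r) * (1 - (cmod t)\<^sup>2) powr (- r) * cmod t powr (- (4 * r))"
proof -
  have "\<Theta> (\<Psi> (w, t)) = (1 - (cmod w)\<^sup>2) * (1 - (cmod t)\<^sup>2) * (cmod t) powr 4"
    using assms by (simp add: \<Theta>_def \<Psi>_def norm_mult power_mult_distrib powr_numeral algebra_simps power2_eq_square power4_eq_xxxx)
  moreover have "0 \<le> 1 - (cmod w)\<^sup>2" "0 \<le> 1 - (cmod t)\<^sup>2" using assms by (auto simp: power_le_one)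
  ultimately show ?thesis by (simp add: powr_mult powr_powr del: powr_numeral)
qed

text \<open>In fibre coordinates the integral is the product of two disc integrals, the first with exponent
  \<open>\<sigma> = 0\<close> and the second with \<open>\<sigma> = (1 - 4 r) / 2\<close>. The condition \<open>\<sigma> > -1\<close> is \<open>r < 3/4\<close>. The factor \<open>1 / \<bar>z\<^sub>2\<bar>\<close> of the
  kernel is at most \<open>\<bar>z\<^sub>2\<bar>\<^sup>-\<^sup>4\<^sup>r\<close> since \<open>r > 1/4\<close>.\<close>

lemma hartogs_Schur:
  assumes r: "1 / 4 < r" "r < 3 / 4"
  shows "\<exists>C>0. \<forall>z\<in>HT. (\<integral>\<^sup>+\<zeta>. ennreal (cmod (hartogs_kernel z \<zeta>) * \<Theta> \<zeta> powr (- r)) * indicator HT \<zeta> \<partial>lborel) \<le> ennreal (C * \<Theta> z powr (- r))"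
proof -
  have r': "0 < r" "r < 1" using r by auto
  obtain C1 where C1: "C1 > 0" "\<And>w. cmod w < 1 \<Longrightarrow>
    (\<integral>\<^sup>+\<eta>. ennreal (((cmod \<eta>)\<^sup>2) powr 0 * (1 - (cmod \<eta>)\<^sup>2) powr (- r) / (cmod (1 - w * cnj \<eta>))\<^sup>2) * indicator (ball 0 1) \<eta> \<partial>lborel) \<le> ennreal (C1 * (1 - (cmod w)\<^sup>2) powr (- r))"
    using disc_Schur[OF _ r', of 0] by auto
  define \<sigma> where "\<sigma> = (1 - 4 * r) / 2"
  have \<sigma>: "\<sigma> > -1" using r by (simp add: \<sigma>_def)
  obtain C2 where C2: "C2 > 0" "\<And>w. cmod w < 1 \<Longrightarrow>
    (\<integral>\<^sup>+\<eta>. ennreal (((cmod \<eta>)\<^sup>2) powr \<sigma> * (1 - (cmod \<eta>)\<^sup>2) powr (- r) / (cmod (1 - w * cnj \<eta>))\<^sup>2) * indicator (ball 0 1) \<eta> \<partial>lborel) \<le> ennreal (C2 * (1 - (cmod w)\<^sup>2) powr (- r))"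
    using disc_Schur[OF \<sigma> r'] by auto
  show ?thesis
  proof (intro exI[of _ "C1 * C2 / pi\<^sup>2"] conjI ballI)
    show "0 < C1 * C2 / pi\<^sup>2" using C1 C2 by simp
    fix z assume z: "z \<in> HT"
    define w0 where "w0 = fst z / snd z"
    define t0 where "t0 = snd z"
    have t0: "cmod t0 < 1" "t0 \<noteq> 0" using z hartogs_snd_nonzero[OF z] by (auto simp: t0_def hartogs_iff)
    have w0: "cmod w0 < 1" using z t0 by (auto simp: w0_def t0_def hartogs_iff norm_divide)
    have zw: "z = \<Psi> (w0, t0)" using t0 by (auto simp: \<Psi>_def w0_def t0_def prod_eq_iff)
    define A where "A = (\<lambda>w. ennreal (((cmod w)\<^sup>2) powr 0 * (1 - (cmod w)\<^sup>2) powr (- r) / (cmod (1 - w0 * cnj w))\<^sup>2) * indicator (ball 0 1) w)"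
    define B where "B = (\<lambda>t. ennreal (((cmod t)\<^sup>2) powr \<sigma> * (1 - (cmod t)\<^sup>2) powr (- r) / (cmod (1 - t0 * cnj t))\<^sup>2) * indicator (ball 0 1) t)"
    have [measurable]: "A \<in> borel_measurable borel" "B \<in> borel_measurable borel" unfolding A_def B_def by measurable
    have [measurable]: "(\<lambda>\<zeta>. hartogs_kernel z \<zeta>) \<in> borel_measurable borel"
      using measurable_compose[OF measurable_Pair1'[of z borel borel] hartogs_kernel_measurable] by simp
    have "(\<integral>\<^sup>+\<zeta>. ennreal (cmod (hartogs_kernel z \<zeta>) * \<Theta> \<zeta> powr (- r)) * indicator HT \<zeta> \<partial>lborel)
      = (\<integral>\<^sup>+t. \<integral>\<^sup>+w. ennreal (cmod (hartogs_kernel z (\<Psi> (w, t))) * \<Theta> (\<Psi> (w, t)) powr (- r)) * ennreal (\<rho> (w, t)) \<partial>lborel \<partial>lborel)"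
      by (rule nn_integral_hartogs) measurable
    also have "\<dots> = (\<integral>\<^sup>+t. \<integral>\<^sup>+w. (ennreal (1 / (pi\<^sup>2 * cmod t0)) * B t) * A w \<partial>lborel \<partial>lborel)"
    proof (rule nn_integral_cong_AE)
      show "AE t in lborel. (\<integral>\<^sup>+w. ennreal (cmod (hartogs_kernel z (\<Psi> (w, t))) * \<Theta> (\<Psi> (w, t)) powr (- r)) * ennreal (\<rho> (w, t)) \<partial>lborel)
         = (\<integral>\<^sup>+w. (ennreal (1 / (pi\<^sup>2 * cmod t0)) * B t) * A w \<partial>lborel)"
        using AE_lborel_singleton[of "0::complex"]
      proof eventually_elim
        case (elim t)
        show ?case
        proof (rule nn_integral_cong_AE)
          show "AE w in lborel. ennreal (cmod (hartogs_kernel z (\<Psi> (w, t))) * \<Theta> (\<Psi> (w, t)) powr (- r)) * ennreal (\<rho> (w, t)) = (ennreal (1 / (pi\<^sup>2 * cmod t0)) * B t) * A w"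
            using AE_lborel_singleton[of "0::complex"]
          proof eventually_elim
            case (elim w)
            show ?case
            proof (cases "cmod w < 1 \<and> cmod t < 1")
              case True
              then have w: "cmod w < 1" and t: "cmod t < 1" by auto
              have e1: "((cmod t)\<^sup>2) powr \<sigma> = cmod t powr (1 - 4 * r)"
                using \<open>t \<noteq> 0\<close> by (simp add: powr_numeral[symmetric] powr_powr \<sigma>_def diff_divide_distrib del: powr_numeral)
              have e2: "cmod t powr (- (4 * r)) * cmod t = cmod t powr (1 - 4 * r)"
                using \<open>t \<noteq> 0\<close> powr_add[of "cmod t" "- (4 * r)" 1] by simp
              have e3: "((cmod w)\<^sup>2) powr 0 = 1" using \<open>w \<noteq> 0\<close> by simp
              define P where "P = cmod (1 - w0 * cnj w)"
              define Q where "Q = cmod (1 - t0 * cnj t)"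
              have "cmod (hartogs_kernel z (\<Psi> (w, t))) = 1 / (pi\<^sup>2 * cmod t0 * cmod t * P\<^sup>2 * Q\<^sup>2)"
                unfolding \<Psi>_def fst_conv snd_conv hartogs_kernel_fibre[OF z w t \<open>t \<noteq> 0\<close>]
                by (simp add: norm_divide norm_mult norm_power P_def Q_def w0_def t0_def)
              then have "cmod (hartogs_kernel z (\<Psi> (w, t))) * \<Theta> (\<Psi> (w, t)) powr (- r) * \<rho> (w, t)
                = 1 / (pi\<^sup>2 * cmod t0 * cmod t * P\<^sup>2 * Q\<^sup>2) * ((1 - (cmod w)\<^sup>2) powr (- r) * (1 - (cmod t)\<^sup>2) powr (- r) * cmod t powr (- (4 * r))) * (cmod t)\<^sup>2"
                using w t \<open>t \<noteq> 0\<close> by (simp add: Schur_weight_fibre \<rho>_def)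
              also have "\<dots> = 1 / (pi\<^sup>2 * cmod t0) * ((cmod t powr (- (4 * r)) * cmod t) * (1 - (cmod t)\<^sup>2) powr (- r) / Q\<^sup>2) * (1 * (1 - (cmod w)\<^sup>2) powr (- r) / P\<^sup>2)"
                using \<open>t \<noteq> 0\<close> by (simp add: power2_eq_square ac_simps)
              finally have eq: "cmod (hartogs_kernel z (\<Psi> (w, t))) * \<Theta> (\<Psi> (w, t)) powr (- r) * \<rho> (w, t)
                = 1 / (pi\<^sup>2 * cmod t0) * (((cmod t)\<^sup>2) powr \<sigma> * (1 - (cmod t)\<^sup>2) powr (- r) / Q\<^sup>2) * (((cmod w)\<^sup>2) powr 0 * (1 - (cmod w)\<^sup>2) powr (- r) / P\<^sup>2)"
                unfolding e1 e2 e3 .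
              have "ennreal (cmod (hartogs_kernel z (\<Psi> (w, t))) * \<Theta> (\<Psi> (w, t)) powr (- r)) * ennreal (\<rho> (w, t)) = ennreal (cmod (hartogs_kernel z (\<Psi> (w, t))) * \<Theta> (\<Psi> (w, t)) powr (- r) * \<rho> (w, t))"
                by (rule ennreal_mult[symmetric]) (auto simp: \<rho>_nonneg)
              also have "\<dots> = ennreal (1 / (pi\<^sup>2 * cmod t0)) * ennreal (((cmod t)\<^sup>2) powr \<sigma> * (1 - (cmod t)\<^sup>2) powr (- r) / Q\<^sup>2) * ennreal (((cmod w)\<^sup>2) powr 0 * (1 - (cmod w)\<^sup>2) powr (- r) / P\<^sup>2)"
                unfolding eq by (simp add: ennreal_mult[symmetric])
              finally show ?thesis using w t by (simp add: A_def B_def P_def Q_def)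
            qed (auto simp: A_def B_def \<rho>_def indicator_def)
          qed
        qed
      qed
    qed
    also have "\<dots> = (\<integral>\<^sup>+t. (ennreal (1 / (pi\<^sup>2 * cmod t0)) * B t) * (\<integral>\<^sup>+w. A w \<partial>lborel) \<partial>lborel)"
      by (intro nn_integral_cong nn_integral_cmult) measurable
    also have "\<dots> = ennreal (1 / (pi\<^sup>2 * cmod t0)) * (\<integral>\<^sup>+t. B t \<partial>lborel) * (\<integral>\<^sup>+w. A w \<partial>lborel)"
      by (simp add: nn_integral_multc nn_integral_cmult)
    also have "\<dots> \<le> ennreal (1 / (pi\<^sup>2 * cmod t0)) * ennreal (C2 * (1 - (cmod t0)\<^sup>2) powr (- r)) * ennreal (C1 * (1 - (cmod w0)\<^sup>2) powr (- r))"
      unfolding A_def B_def by (intro mult_mono order.refl C1(2)[OF w0] C2(2)[OF t0(1)]) auto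
    also have "\<dots> = ennreal (1 / (pi\<^sup>2 * cmod t0) * (C2 * (1 - (cmod t0)\<^sup>2) powr (- r)) * (C1 * (1 - (cmod w0)\<^sup>2) powr (- r)))"
      using C1 C2 by (simp add: ennreal_mult[symmetric])
    also have "\<dots> \<le> ennreal (C1 * C2 / pi\<^sup>2 * \<Theta> z powr (- r))"
    proof (rule ennreal_leI)
      have "1 / cmod t0 = cmod t0 powr (- 1)" using t0 by (simp add: powr_minus divide_inverse)
      also have "\<dots> \<le> cmod t0 powr (- (4 * r))" using t0 r by (intro powr_mono') auto
      finally have "1 / cmod t0 \<le> cmod t0 powr (- (4 * r))" .
      then have "(C1 * C2 / pi\<^sup>2 * (1 - (cmod t0)\<^sup>2) powr (- r) * (1 - (cmod w0)\<^sup>2) powr (- r)) * (1 / cmod t0)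
          \<le> (C1 * C2 / pi\<^sup>2 * (1 - (cmod t0)\<^sup>2) powr (- r) * (1 - (cmod w0)\<^sup>2) powr (- r)) * cmod t0 powr (- (4 * r))"
        using C1 C2 by (intro mult_left_mono) auto
      then show "1 / (pi\<^sup>2 * cmod t0) * (C2 * (1 - (cmod t0)\<^sup>2) powr (- r)) * (C1 * (1 - (cmod w0)\<^sup>2) powr (- r)) \<le> C1 * C2 / pi\<^sup>2 * \<Theta> z powr (- r)"
        unfolding zw Schur_weight_fibre[OF w0 t0] by (simp add: ac_simps)
    qed
    finally show "(\<integral>\<^sup>+\<zeta>. ennreal (cmod (hartogs_kernel z \<zeta>) * \<Theta> \<zeta> powr (- r)) * indicator HT \<zeta> \<partial>lborel) \<le> ennreal (C1 * C2 / pi\<^sup>2 * \<Theta> z powr (- r))" .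
  qed
qed

section \<open>The reproducing property\<close>

lemma emeasure_hartogs_finite: "emeasure lborel HT < \<infinity>"
proof (rule emeasure_bounded_finite)
  have "HT \<subseteq> ball 0 1 \<times> ball 0 1" by (auto simp: hartogs_iff)
  then show "bounded HT" by (rule bounded_subset[rotated]) (intro bounded_Times bounded_ball)
qed

lemma holomorphic2_continuous_on: "holomorphic2_on g S \<Longrightarrow> continuous_on S g"
  unfolding holomorphic2_on_def by (intro continuous_at_imp_continuous_on ballI) (metis has_derivative_continuous)

text \<open>Borel integrands are integrated over the triangle with respect to Borel measure, to which Fubini's
  theorem and the fibre coordinates apply.\<close>

lemma nn_integral_lebesgue_on:
  assumes f: "f \<in> borel_measurable borel"
  shows "(\<integral>\<^sup>+z. f z \<partial>lebesgue_on HT) = (\<integral>\<^sup>+z. f z * indicator HT z \<partial>lborel)"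
proof -
  have "(\<integral>\<^sup>+z. f z \<partial>lebesgue_on HT) = (\<integral>\<^sup>+z. f z * indicator HT z \<partial>lebesgue)"
    by (subst nn_integral_restrict_space) auto
  also have "\<dots> = (\<integral>\<^sup>+z. f z * indicator HT z \<partial>lborel)"
    using f by (subst nn_integral_completion) auto
  finally show ?thesis .
qed

lemma L2_product_integrable:
  assumes f: "f \<in> L2_space HT" and g: "g \<in> L2_space HT"
  shows "integrable (lebesgue_on HT) (\<lambda>z. f z * g z)"
proof (rule Bochner_Integration.integrable_bound[where f="\<lambda>z. (cmod (f z))\<^sup>2 + (cmod (g z))\<^sup>2"])
  show "integrable (lebesgue_on HT) (\<lambda>z. (cmod (f z))\<^sup>2 + (cmod (g z))\<^sup>2)" using f g by (auto simp: L2_space_def)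
  show "(\<lambda>z. f z * g z) \<in> borel_measurable (lebesgue_on HT)" using f g by (auto simp: L2_space_def)
  show "AE z in lebesgue_on HT. norm (f z * g z) \<le> norm ((cmod (f z))\<^sup>2 + (cmod (g z))\<^sup>2)"
  proof (rule AE_I2)
    fix z
    have "0 \<le> (cmod (f z) - cmod (g z))\<^sup>2" by simp
    then have "2 * (cmod (f z) * cmod (g z)) \<le> (cmod (f z))\<^sup>2 + (cmod (g z))\<^sup>2" by (simp add: power2_diff)
    moreover have "0 \<le> cmod (f z) * cmod (g z)" by simp
    ultimately have "cmod (f z) * cmod (g z) \<le> (cmod (f z))\<^sup>2 + (cmod (g z))\<^sup>2" by linarith
    then show "norm (f z * g z) \<le> norm ((cmod (f z))\<^sup>2 + (cmod (g z))\<^sup>2)" by (simp add: norm_mult)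
  qed
qed

lemma hartogs_kernel_section_measurable[measurable]: "(\<lambda>\<zeta>. hartogs_kernel z \<zeta>) \<in> borel_measurable borel"
  using measurable_compose[OF measurable_Pair1'[of z borel borel] hartogs_kernel_measurable] by simp

lemma hartogs_kernel_cnj_bergman:
  assumes z: "z \<in> HT" shows "(\<lambda>\<zeta>. cnj (hartogs_kernel z \<zeta>)) \<in> bergman_space HT"
proof -
  obtain C where C: "C \<ge> 0" "\<And>\<zeta>. \<zeta> \<in> HT \<Longrightarrow> cmod (kernel_deriv 0 0 z \<zeta>) \<le> C / cmod (snd \<zeta>)"
    using kernel_deriv_bound[of "{z}" 0 0] z by auto
  have sq: "(\<integral>\<^sup>+\<zeta>. ennreal ((cmod (hartogs_kernel z \<zeta>))\<^sup>2) * indicator HT \<zeta> \<partial>lborel) < \<infinity>"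
  proof -
    have "(\<integral>\<^sup>+\<zeta>. ennreal ((cmod (hartogs_kernel z \<zeta>))\<^sup>2) * indicator HT \<zeta> \<partial>lborel) \<le> (\<integral>\<^sup>+\<zeta>. ennreal (C\<^sup>2) * (ennreal (cmod (snd \<zeta>) powr (- 2)) * indicator HT \<zeta>) \<partial>lborel)"
    proof (rule nn_integral_mono)
      fix \<zeta>
      show "ennreal ((cmod (hartogs_kernel z \<zeta>))\<^sup>2) * indicator HT \<zeta> \<le> ennreal (C\<^sup>2) * (ennreal (cmod (snd \<zeta>) powr (- 2)) * indicator HT \<zeta>)"
      proof (cases "\<zeta> \<in> HT")
        case True
        have "(cmod (hartogs_kernel z \<zeta>))\<^sup>2 \<le> (C / cmod (snd \<zeta>))\<^sup>2"
          using C(2)[OF True] hartogs_kernel_eq_kernel_deriv[OF z True] by (intro power_mono) auto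
        also have "\<dots> = C\<^sup>2 * cmod (snd \<zeta>) powr (- 2)"
          using hartogs_snd_nonzero[OF True] by (simp add: power_mult_distrib power_inverse powr_minus divide_inverse powr_numeral)
        finally show ?thesis using True by (simp add: ennreal_mult[symmetric] ennreal_leI)
      qed simp
    qed
    also have "\<dots> = ennreal (C\<^sup>2) * (\<integral>\<^sup>+\<zeta>. (ennreal (cmod (snd \<zeta>) powr (- 2)) * indicator HT \<zeta>) \<partial>lborel)"
      by (rule nn_integral_cmult) measurable
    also have "\<dots> < \<infinity>" using nn_integral_snd_powr_finite[of 2] by (simp add: ennreal_mult_less_top)
    finally show ?thesis .
  qed
  have "integrable (lebesgue_on HT) (\<lambda>\<zeta>. (cmod (hartogs_kernel z \<zeta>))\<^sup>2)"
  proof (rule integrableI_bounded)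
    show "(\<lambda>\<zeta>. (cmod (hartogs_kernel z \<zeta>))\<^sup>2) \<in> borel_measurable (lebesgue_on HT)"
      by (intro measurable_restrict_space1 measurable_completion) measurable
    show "(\<integral>\<^sup>+\<zeta>. ennreal (norm ((cmod (hartogs_kernel z \<zeta>))\<^sup>2)) \<partial>lebesgue_on HT) < \<infinity>"
      using sq by (subst nn_integral_lebesgue_on) auto
  qed
  moreover have "(\<lambda>\<zeta>. cnj (hartogs_kernel z \<zeta>)) \<in> borel_measurable (lebesgue_on HT)"
    by (intro measurable_restrict_space1 measurable_completion) measurable
  moreover have "holomorphic2_on (\<lambda>\<zeta>. cnj (hartogs_kernel z \<zeta>)) HT"
    unfolding holomorphic2_on_def
  proof
    fix \<zeta> assume \<zeta>: "\<zeta> \<in> HT"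
    obtain hx hy where "\<forall>q\<in>HT. has_cderiv base_kernel (hx q) (hy q) q" using kernel_class_derivative[OF kernel_class_base_kernel] by blast
    then have "has_cderiv base_kernel (hx (conj_prod \<zeta> z)) (hy (conj_prod \<zeta> z)) (conj_prod \<zeta> z)" using conj_prod_hartogs[OF \<zeta> z] by blast
    from has_cderiv_imp_conj_prod_left[OF this]
    have "((\<lambda>\<zeta>. cnj (hartogs_kernel z \<zeta>)) has_derivative (\<lambda>v. hx (conj_prod \<zeta> z) * cnj (fst z) * fst v + hy (conj_prod \<zeta> z) * cnj (snd z) * snd v)) (at \<zeta>)"
      by (rule has_derivative_transform_within_open[OF _ open_hartogs \<zeta>]) (auto simp: hartogs_kernel_cnj[symmetric] hartogs_kernel_def z intro: base_kernel_cnj)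
    then show "\<exists>a b. ((\<lambda>\<zeta>. cnj (hartogs_kernel z \<zeta>)) has_derivative (\<lambda>h. a * fst h + b * snd h)) (at \<zeta>)" by blast
  qed
  ultimately show ?thesis by (simp add: bergman_space_def L2_space_def)
qed

lemma L2_integrable_hartogs_kernel:
  assumes "f \<in> L2_space HT" "z \<in> HT" shows "integrable (lebesgue_on HT) (\<lambda>\<zeta>. hartogs_kernel z \<zeta> * f \<zeta>)"
proof -
  have "(\<lambda>\<zeta>. hartogs_kernel z \<zeta>) \<in> L2_space HT"
    using hartogs_kernel_cnj_bergman[OF assms(2)] unfolding bergman_space_def L2_space_def
    by (auto intro!: measurable_restrict_space1 measurable_completion)
  then show ?thesis using L2_product_integrable assms by blast
qed

text \<open>For almost every \<open>t\<close> the fibre \<open>w \<mapsto> g(w t, t)\<close> is square integrable on the disc, and the disc formula in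
  \<open>w\<close> produces \<open>g(w\<^sub>0 t, t)\<close> with \<open>w\<^sub>0 = z\<^sub>1 / z\<^sub>2\<close>. The function \<open>t g(w\<^sub>0 t, t)\<close> that remains is square
  integrable on the punctured disc by the mean value inequality in \<open>w\<close>. Hence it extends to the disc,
  where the disc formula in \<open>t\<close> applies.\<close>

lemma hartogs_kernel_reproducing:
  assumes g: "g \<in> bergman_space HT" and z: "z \<in> HT"
  shows "(LINT \<zeta>|lebesgue_on HT. hartogs_kernel z \<zeta> * g \<zeta>) = g z"
proof -
  have hol: "holomorphic2_on g HT" and gL2: "g \<in> L2_space HT" using g by (auto simp: bergman_space_def)
  define g' where "g' = (\<lambda>\<zeta>. indicator HT \<zeta> *\<^sub>R g \<zeta>)"
  have g'm[measurable]: "g' \<in> borel_measurable borel" unfolding g'_def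
    by (rule borel_measurable_continuous_on_indicator) (auto intro: holomorphic2_continuous_on[OF hol])
  have g'eq: "g' \<zeta> = g \<zeta>" if "\<zeta> \<in> HT" for \<zeta> using that by (simp add: g'_def)
  define I where "I = (\<lambda>\<zeta>. hartogs_kernel z \<zeta> * g' \<zeta>)"
  have Im[measurable]: "I \<in> borel_measurable borel" unfolding I_def by measurable
  have I0: "I \<zeta> = 0" if "\<zeta> \<notin> HT" for \<zeta> using that by (simp add: I_def hartogs_kernel_def)
  have Icong: "(LINT \<zeta>|lebesgue_on HT. hartogs_kernel z \<zeta> * g \<zeta>) = (LINT \<zeta>|lebesgue_on HT. I \<zeta>)"
    by (rule Bochner_Integration.integral_cong) (auto simp: I_def g'eq)
  have "integrable (lebesgue_on HT) I"
    using L2_integrable_hartogs_kernel[OF gL2 z] by (rule Bochner_Integration.integrable_cong[THEN iffD1, rotated 2]) (auto simp: I_def g'eq)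
  then have intI: "integrable lborel I" using integral_lebesgue_on_eq_lborel(2)[OF Im _ I0] by simp
  have L1: "(LINT \<zeta>|lebesgue_on HT. hartogs_kernel z \<zeta> * g \<zeta>) = (LINT t|lborel. LINT w|lborel. \<rho> (w, t) *\<^sub>R I (\<Psi> (w, t)))"
    using Icong integral_lebesgue_on_eq_lborel(1)[OF Im hartogs_measurable(1) I0] integral_hartogs(2)[OF intI I0] by simp
  define w0 where "w0 = fst z / snd z"
  define t0 where "t0 = snd z"
  have t0: "cmod t0 < 1" "t0 \<noteq> 0" using z hartogs_snd_nonzero[OF z] by (auto simp: t0_def hartogs_iff)
  have w0: "cmod w0 < 1" using z t0 by (auto simp: w0_def t0_def hartogs_iff norm_divide)
  have zw: "z = (w0 * t0, t0)" using t0 by (auto simp: w0_def t0_def prod_eq_iff)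
  have in_HT: "(w * t, t) \<in> HT" if "cmod w < 1" "cmod t < 1" "t \<noteq> 0" for w t
    using that by (simp add: hartogs_iff norm_mult)
  have fin: "(\<integral>\<^sup>+t. \<integral>\<^sup>+w. ennreal ((cmod (g' (\<Psi> (w, t))))\<^sup>2) * ennreal (\<rho> (w, t)) \<partial>lborel \<partial>lborel) < \<infinity>"
  proof -
    have "(\<integral>\<^sup>+t. \<integral>\<^sup>+w. ennreal ((cmod (g' (\<Psi> (w, t))))\<^sup>2) * ennreal (\<rho> (w, t)) \<partial>lborel \<partial>lborel) = (\<integral>\<^sup>+\<zeta>. ennreal ((cmod (g' \<zeta>))\<^sup>2) * indicator HT \<zeta> \<partial>lborel)"
      by (rule nn_integral_hartogs[symmetric]) measurable
    also have "\<dots> = (\<integral>\<^sup>+\<zeta>. ennreal ((cmod (g' \<zeta>))\<^sup>2) \<partial>lebesgue_on HT)" by (rule nn_integral_lebesgue_on[symmetric]) measurable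
    also have "\<dots> = (\<integral>\<^sup>+\<zeta>. ennreal (norm ((cmod (g \<zeta>))\<^sup>2)) \<partial>lebesgue_on HT)" by (rule nn_integral_cong) (auto simp: g'eq)
    also have "\<dots> < \<infinity>" using gL2 by (auto simp: L2_space_def integrable_iff_bounded)
    finally show ?thesis .
  qed
  have [measurable]: "\<Psi> \<in> (borel \<Otimes>\<^sub>M borel) \<rightarrow>\<^sub>M borel" "\<rho> \<in> borel_measurable (borel \<Otimes>\<^sub>M borel)"
    using \<Psi>_measurable \<rho>_measurable by (simp_all add: borel_prod)
  have holw: "(\<lambda>w. g (w * t, t)) holomorphic_on ball 0 1" if t: "cmod t < 1" "t \<noteq> 0" for t
  proof -
    have "\<exists>d. ((\<lambda>w. g (w * t, t)) has_field_derivative d) (at w)" if wb: "w \<in> ball 0 1" for w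
    proof -
      obtain a b where ab: "(g has_derivative (\<lambda>h. a * fst h + b * snd h)) (at (w * t, t))"
        using hol in_HT[of w t] wb t unfolding holomorphic2_on_def by auto
      have "((\<lambda>w. (w * t, t)) has_derivative (\<lambda>h. (h * t, 0))) (at w)" by (auto intro!: derivative_eq_intros)
      from has_derivative_compose[OF this ab] have "((\<lambda>w. g (w * t, t)) has_derivative (\<lambda>h. (a * t) * h)) (at w)"
        by (simp add: ac_simps)
      then show ?thesis unfolding has_field_derivative_def by blast
    qed
    then show ?thesis by (simp add: holomorphic_on_open)
  qed
  have holt: "(\<lambda>t. t * g (w0 * t, t)) holomorphic_on ball 0 1 - {0}"
  proof -
    have "\<exists>d. ((\<lambda>t. g (w0 * t, t)) has_field_derivative d) (at t)" if tb: "t \<in> ball 0 1 - {0}" for t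
    proof -
      obtain a b where ab: "(g has_derivative (\<lambda>h. a * fst h + b * snd h)) (at (w0 * t, t))"
        using hol in_HT[of w0 t] tb w0 unfolding holomorphic2_on_def by auto
      have "((\<lambda>t. (w0 * t, t)) has_derivative (\<lambda>h. (w0 * h, h))) (at t)" by (auto intro!: derivative_eq_intros)
      from has_derivative_compose[OF this ab] have "((\<lambda>t. g (w0 * t, t)) has_derivative (\<lambda>h. (a * w0 + b) * h)) (at t)"
        by (simp add: algebra_simps)
      then show ?thesis unfolding has_field_derivative_def by blast
    qed
    then have "(\<lambda>t. g (w0 * t, t)) holomorphic_on ball 0 1 - {0}" by (simp add: holomorphic_on_open open_delete)
    then show ?thesis by (intro holomorphic_intros)
  qed
  have pair_m: "(\<lambda>w. g' (w * t, t)) \<in> borel_measurable borel" "(\<lambda>s. g' (w * s, s)) \<in> borel_measurable borel" for t w :: complex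
    by (auto intro!: measurable_compose[OF borel_measurable_continuous_onI g'm] continuous_intros)
  note [measurable] = pair_m
  have inner: "AE t in lborel. (LINT w|lborel. \<rho> (w, t) *\<^sub>R I (\<Psi> (w, t)))
      = indicator (ball 0 1 - {0}) t *\<^sub>R (t * g (w0 * t, t) / (of_real pi * t0 * (1 - t0 * cnj t)\<^sup>2))"
  proof -
    have "AE t in lborel. (\<integral>\<^sup>+w. ennreal ((cmod (g' (\<Psi> (w, t))))\<^sup>2) * ennreal (\<rho> (w, t)) \<partial>lborel) \<noteq> \<infinity>"
    proof (rule nn_integral_PInf_AE)
      show "(\<lambda>t. \<integral>\<^sup>+w. ennreal ((cmod (g' (\<Psi> (w, t))))\<^sup>2) * ennreal (\<rho> (w, t)) \<partial>lborel) \<in> borel_measurable lborel" by measurable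
    qed (use fin in auto)
    then show ?thesis
    proof eventually_elim
      case (elim t)
      show ?case
      proof (cases "t \<in> ball 0 1 - {0}")
        case False
        then have "\<rho> (w, t) = 0" for w by (auto simp: \<rho>_def indicator_def)
        then show ?thesis using False by (simp add: indicator_def)
      next
        case True
        then have t: "cmod t < 1" "t \<noteq> 0" by auto
        have "integrable lborel (\<lambda>w. indicator (ball 0 1) w *\<^sub>R g' (w * t, t))"
        proof (rule Bochner_Integration.integrable_bound[where f="\<lambda>w. indicator (ball 0 1) w + (1 / (cmod t)\<^sup>2) * ((cmod (g' (\<Psi> (w, t))))\<^sup>2 * \<rho> (w, t))"])
          have "integrable lborel (\<lambda>w. (cmod (g' (\<Psi> (w, t))))\<^sup>2 * \<rho> (w, t))"
          proof (rule integrableI_bounded)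
            have "(\<integral>\<^sup>+w. ennreal (norm ((cmod (g' (\<Psi> (w, t))))\<^sup>2 * \<rho> (w, t))) \<partial>lborel) = (\<integral>\<^sup>+w. ennreal ((cmod (g' (\<Psi> (w, t))))\<^sup>2) * ennreal (\<rho> (w, t)) \<partial>lborel)"
              by (intro nn_integral_cong) (simp add: \<rho>_nonneg ennreal_mult[symmetric])
            then show "(\<integral>\<^sup>+w. ennreal (norm ((cmod (g' (\<Psi> (w, t))))\<^sup>2 * \<rho> (w, t))) \<partial>lborel) < \<infinity>"
              using elim by (simp add: less_top)
          qed measurable
          then show "integrable lborel (\<lambda>w. indicator (ball 0 1) w + (1 / (cmod t)\<^sup>2) * ((cmod (g' (\<Psi> (w, t))))\<^sup>2 * \<rho> (w, t)))"
            by (intro Bochner_Integration.integrable_add integrable_mult_right integrable_real_indicator) (auto simp: emeasure_ball)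
          show "(\<lambda>w. indicator (ball 0 1) w *\<^sub>R g' (w * t, t)) \<in> borel_measurable lborel" by measurable
          show "AE w in lborel. norm (indicator (ball 0 1) w *\<^sub>R g' (w * t, t)) \<le> norm (indicator (ball 0 1) w + (1 / (cmod t)\<^sup>2) * ((cmod (g' (\<Psi> (w, t))))\<^sup>2 * \<rho> (w, t)))"
          proof (rule AE_I2)
            fix w :: complex
            have sq: "x \<le> 1 + x\<^sup>2" for x :: real
            proof -
              have "0 \<le> (x - 1/2)\<^sup>2" by simp
              then show ?thesis by (simp add: power2_diff power_divide)
            qed
            show "norm (indicator (ball 0 1) w *\<^sub>R g' (w * t, t)) \<le> norm (indicator (ball 0 1) w + (1 / (cmod t)\<^sup>2) * ((cmod (g' (\<Psi> (w, t))))\<^sup>2 * \<rho> (w, t)))"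
              using t sq[of "cmod (g' (w * t, t))"] by (auto simp: indicator_def \<rho>_def \<Psi>_def)
          qed
        qed
        also have "(\<lambda>w. indicator (ball 0 1) w *\<^sub>R g' (w * t, t)) = (\<lambda>w. indicator (ball 0 1) w *\<^sub>R g (w * t, t))"
          using in_HT[OF _ t] by (auto simp: fun_eq_iff indicator_def g'eq)
        finally have int: "integrable lborel (\<lambda>w. indicator (ball 0 1) w *\<^sub>R g (w * t, t))" .
        have pt: "\<rho> (w, t) *\<^sub>R I (\<Psi> (w, t)) = (t / (of_real pi * t0 * (1 - t0 * cnj t)\<^sup>2)) * (indicator (ball 0 1) w *\<^sub>R (g (w * t, t) / (of_real pi * (1 - w0 * cnj w)\<^sup>2)))" for w
        proof (cases "cmod w < 1")
          case w: True
          have tt: "complex_of_real ((cmod t)\<^sup>2) = t * cnj t" by (rule complex_norm_square)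
          have "\<rho> (w, t) *\<^sub>R I (\<Psi> (w, t)) = of_real ((cmod t)\<^sup>2) * (1 / ((of_real pi)\<^sup>2 * t0 * cnj t * (1 - w0 * cnj w)\<^sup>2 * (1 - t0 * cnj t)\<^sup>2) * g (w * t, t))"
            using w t in_HT[OF w t] unfolding I_def \<Psi>_def fst_conv snd_conv
            by (simp add: \<rho>_def hartogs_kernel_fibre[OF z w t] g'eq scaleR_conv_of_real w0_def t0_def)
          also have "\<dots> = (t * cnj t) * (1 / ((of_real pi)\<^sup>2 * t0 * cnj t * (1 - w0 * cnj w)\<^sup>2 * (1 - t0 * cnj t)\<^sup>2) * g (w * t, t))"
            unfolding tt ..
          also have "\<dots> = (t / (of_real pi * t0 * (1 - t0 * cnj t)\<^sup>2)) * (g (w * t, t) / (of_real pi * (1 - w0 * cnj w)\<^sup>2))"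
            using t by (simp add: power2_eq_square)
          finally show ?thesis using w by simp
        qed (simp add: \<rho>_def)
        show ?thesis unfolding pt integral_mult_right_zero disc_reproducing[OF holw[OF t] int w0]
          using True by simp
      qed
    qed
  qed
  have fin2: "(\<integral>\<^sup>+t. ennreal (indicator (ball 0 1) t * (cmod (t * g' (w0 * t, t)))\<^sup>2) \<partial>lborel) < \<infinity>"
  proof -
    \<comment> \<open>the disc of radius \<open>R\<close> about \<open>w0\<close> lies in the unit disc, so the fibre integral bounds the value at \<open>w0\<close>\<close>
    define R where "R = 1 - cmod w0"
    have R: "R > 0" using w0 by (simp add: R_def)
    have sub: "ball w0 R \<subseteq> ball 0 1"
    proof
      fix x assume "x \<in> ball w0 R"
      then have "cmod (w0 - x) < 1 - cmod w0" by (simp add: dist_norm R_def)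
      moreover have "cmod x \<le> cmod w0 + cmod (w0 - x)" using norm_triangle_ineq4[of w0 "w0 - x"] by simp
      ultimately show "x \<in> ball 0 1" by simp
    qed
    have "(\<integral>\<^sup>+t. ennreal (indicator (ball 0 1) t * (cmod (t * g' (w0 * t, t)))\<^sup>2) \<partial>lborel)
      \<le> (\<integral>\<^sup>+t. ennreal (1 / (pi * R\<^sup>2)) * (\<integral>\<^sup>+w. ennreal ((cmod (g' (\<Psi> (w, t))))\<^sup>2) * ennreal (\<rho> (w, t)) \<partial>lborel) \<partial>lborel)"
    proof (rule nn_integral_mono)
      fix t :: complex
      show "ennreal (indicator (ball 0 1) t * (cmod (t * g' (w0 * t, t)))\<^sup>2) \<le> ennreal (1 / (pi * R\<^sup>2)) * (\<integral>\<^sup>+w. ennreal ((cmod (g' (\<Psi> (w, t))))\<^sup>2) * ennreal (\<rho> (w, t)) \<partial>lborel)"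
      proof (cases "cmod t < 1 \<and> t \<noteq> 0")
        case True
        then have t: "cmod t < 1" "t \<noteq> 0" by auto
        have "ennreal (pi * R\<^sup>2 * (cmod (g (w0 * t, t)))\<^sup>2) \<le> (\<integral>\<^sup>+w. ennreal (indicator (ball w0 R) w * (cmod (g' (w * t, t)))\<^sup>2) \<partial>lborel)"
        proof (rule area_square_mean_value[where R=R and F="\<lambda>w. g (w * t, t)" and F'="\<lambda>w. g' (w * t, t)"])
          show "g' (x * t, t) = g (x * t, t)" if "x \<in> ball w0 R" for x
            using that sub in_HT[OF _ t, of x] by (intro g'eq) auto
        qed (use R holomorphic_on_subset[OF holw[OF t] sub] in auto)
        then have "ennreal ((cmod t)\<^sup>2 / (pi * R\<^sup>2)) * ennreal (pi * R\<^sup>2 * (cmod (g (w0 * t, t)))\<^sup>2) \<le> ennreal ((cmod t)\<^sup>2 / (pi * R\<^sup>2)) * (\<integral>\<^sup>+w. ennreal (indicator (ball w0 R) w * (cmod (g' (w * t, t)))\<^sup>2) \<partial>lborel)"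
          by (rule mult_left_mono) simp
        also have "ennreal ((cmod t)\<^sup>2 / (pi * R\<^sup>2)) * ennreal (pi * R\<^sup>2 * (cmod (g (w0 * t, t)))\<^sup>2) = ennreal (indicator (ball 0 1) t * (cmod (t * g' (w0 * t, t)))\<^sup>2)"
          using R t in_HT[OF w0 t] by (simp add: ennreal_mult[symmetric] norm_mult power_mult_distrib g'eq)
        also have "ennreal ((cmod t)\<^sup>2 / (pi * R\<^sup>2)) * (\<integral>\<^sup>+w. ennreal (indicator (ball w0 R) w * (cmod (g' (w * t, t)))\<^sup>2) \<partial>lborel)
           = (\<integral>\<^sup>+w. ennreal ((cmod t)\<^sup>2 / (pi * R\<^sup>2)) * ennreal (indicator (ball w0 R) w * (cmod (g' (w * t, t)))\<^sup>2) \<partial>lborel)"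
          by (rule nn_integral_cmult[symmetric]) measurable
        also have "\<dots> \<le> (\<integral>\<^sup>+w. ennreal (1 / (pi * R\<^sup>2)) * (ennreal ((cmod (g' (\<Psi> (w, t))))\<^sup>2) * ennreal (\<rho> (w, t))) \<partial>lborel)"
        proof (rule nn_integral_mono)
          fix w
          have "(cmod t)\<^sup>2 / (pi * R\<^sup>2) * (indicator (ball w0 R) w * (cmod (g' (w * t, t)))\<^sup>2) \<le> 1 / (pi * R\<^sup>2) * ((cmod (g' (\<Psi> (w, t))))\<^sup>2 * \<rho> (w, t))"
            using t sub R by (auto simp: indicator_def \<rho>_def \<Psi>_def mult.commute)
          then show "ennreal ((cmod t)\<^sup>2 / (pi * R\<^sup>2)) * ennreal (indicator (ball w0 R) w * (cmod (g' (w * t, t)))\<^sup>2) \<le> ennreal (1 / (pi * R\<^sup>2)) * (ennreal ((cmod (g' (\<Psi> (w, t))))\<^sup>2) * ennreal (\<rho> (w, t)))"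
            by (simp add: ennreal_mult[symmetric] \<rho>_nonneg ennreal_leI)
        qed
        also have "\<dots> = ennreal (1 / (pi * R\<^sup>2)) * (\<integral>\<^sup>+w. ennreal ((cmod (g' (\<Psi> (w, t))))\<^sup>2) * ennreal (\<rho> (w, t)) \<partial>lborel)"
          by (rule nn_integral_cmult) measurable
        finally show ?thesis .
      qed auto
    qed
    also have "\<dots> = ennreal (1 / (pi * R\<^sup>2)) * (\<integral>\<^sup>+t. (\<integral>\<^sup>+w. ennreal ((cmod (g' (\<Psi> (w, t))))\<^sup>2) * ennreal (\<rho> (w, t)) \<partial>lborel) \<partial>lborel)"
      by (rule nn_integral_cmult) measurable
    also have "\<dots> < \<infinity>" using fin by (simp add: ennreal_mult_less_top)
    finally show ?thesis .
  qed
  obtain G where G: "G holomorphic_on ball 0 1" "\<And>t. t \<in> ball 0 1 - {0} \<Longrightarrow> G t = t * g (w0 * t, t)"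
  proof (rule square_integrable_punctured_extends[OF holt _ _ fin2])
    show "(\<lambda>t. t * g' (w0 * t, t)) \<in> borel_measurable borel" by measurable
    show "x * g' (w0 * x, x) = x * g (w0 * x, x)" if "x \<in> ball 0 1 - {0}" for x
      using that in_HT[OF w0, of x] by (auto simp: g'eq)
  qed (rule that)
  have AE0: "AE t in lborel. t \<noteq> (0::complex)" by (rule AE_lborel_singleton)
  have ind_G_m: "(\<lambda>t. indicator (ball 0 1) t *\<^sub>R G t) \<in> borel_measurable borel"
    by (rule borel_measurable_continuous_on_indicator) (auto intro: holomorphic_on_imp_continuous_on[OF G(1)])
  have intG: "integrable lborel (\<lambda>t. indicator (ball 0 1) t *\<^sub>R G t)"
  proof (rule Bochner_Integration.integrable_bound[where f="\<lambda>t. indicator (ball 0 1) t + indicator (ball 0 1) t * (cmod (t * g' (w0 * t, t)))\<^sup>2"])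
    have "integrable lborel (\<lambda>t. indicator (ball 0 1) t * (cmod (t * g' (w0 * t, t)))\<^sup>2)"
    proof (rule integrableI_bounded)
      show "(\<integral>\<^sup>+t. ennreal (norm (indicator (ball 0 1) t * (cmod (t * g' (w0 * t, t)))\<^sup>2)) \<partial>lborel) < \<infinity>" using fin2 by simp
    qed measurable
    then show "integrable lborel (\<lambda>t. indicator (ball 0 1) t + indicator (ball 0 1) t * (cmod (t * g' (w0 * t, t)))\<^sup>2)"
      by (intro Bochner_Integration.integrable_add integrable_real_indicator) (auto simp: emeasure_ball)
    show "(\<lambda>t. indicator (ball 0 1) t *\<^sub>R G t) \<in> borel_measurable lborel" using ind_G_m by simp
    show "AE t in lborel. norm (indicator (ball 0 1) t *\<^sub>R G t) \<le> norm (indicator (ball 0 1) t + indicator (ball 0 1) t * (cmod (t * g' (w0 * t, t)))\<^sup>2)"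
      using AE0
    proof eventually_elim
      case (elim t)
      have sq: "x \<le> 1 + x\<^sup>2" for x :: real
      proof -
        have "0 \<le> (x - 1/2)\<^sup>2" by simp
        then show ?thesis by (simp add: power2_diff power_divide)
      qed
      show ?case
      proof (cases "cmod t < 1")
        case True
        then have "G t = t * g' (w0 * t, t)" using elim G(2)[of t] in_HT[OF w0 True elim] by (simp add: g'eq)
        then show ?thesis using True sq[of "cmod (t * g' (w0 * t, t))"] by simp
      qed simp
    qed
  qed
  have "(LINT \<zeta>|lebesgue_on HT. hartogs_kernel z \<zeta> * g \<zeta>) = (LINT t|lborel. (1 / t0) * (indicator (ball 0 1) t *\<^sub>R (G t / (of_real pi * (1 - t0 * cnj t)\<^sup>2))))"
    unfolding L1
  proof (rule integral_cong_AE)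
    show "(\<lambda>t. LINT w|lborel. \<rho> (w, t) *\<^sub>R I (\<Psi> (w, t))) \<in> borel_measurable lborel" by measurable
    have "(\<lambda>t. (1 / t0) * ((indicator (ball 0 1) t *\<^sub>R G t) / (of_real pi * (1 - t0 * cnj t)\<^sup>2))) \<in> borel_measurable lborel"
      using ind_G_m by (intro borel_measurable_times borel_measurable_divide) auto
    then show "(\<lambda>t. (1 / t0) * (indicator (ball 0 1) t *\<^sub>R (G t / (of_real pi * (1 - t0 * cnj t)\<^sup>2)))) \<in> borel_measurable lborel"
      by (simp add: scaleR_conv_of_real)
    show "AE t in lborel. (LINT w|lborel. \<rho> (w, t) *\<^sub>R I (\<Psi> (w, t))) = (1 / t0) * (indicator (ball 0 1) t *\<^sub>R (G t / (of_real pi * (1 - t0 * cnj t)\<^sup>2)))"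
      using AE0 inner by eventually_elim (auto simp: indicator_def G(2))
  qed
  also have "\<dots> = (1 / t0) * G t0"
    unfolding integral_mult_right_zero disc_reproducing[OF G(1) intG t0(1)] ..
  also have "\<dots> = g z" using t0 by (simp add: G(2) zw[symmetric])
  finally show ?thesis .
qed

section \<open>Identification of the Bergman kernel\<close>

lemma continuous_AE_zero_hartogs:
  assumes c: "continuous_on HT h" and AE: "AE z in lebesgue_on HT. h z = (0::complex)" and z: "z \<in> HT"
  shows "h z = 0"
proof (rule ccontr)
  assume nz: "h z \<noteq> 0"
  define N where "N = {z \<in> HT. h z \<noteq> 0}"
  have "open N"
  proof -
    have "N = HT \<inter> h -` (- {0})" by (auto simp: N_def)
    then show ?thesis using continuous_open_preimage[OF c open_hartogs, of "- {0}"] by (simp add: open_Compl)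
  qed
  have "AE z in lebesgue. z \<in> HT \<longrightarrow> h z = 0" using AE by (subst (asm) AE_restrict_space_iff) auto
  then have "N \<in> null_sets lebesgue"
    using \<open>open N\<close> by (subst AE_iff_null_sets) (auto simp: N_def elim: eventually_mono)
  then have "negligible N" by (simp add: negligible_iff_null_sets)
  moreover have "z \<in> N" using nz z by (simp add: N_def)
  ultimately show False using open_not_negligible[OF \<open>open N\<close>] by blast
qed

lemma bergman_space_diff:
  assumes f: "f \<in> bergman_space HT" and g: "g \<in> bergman_space HT"
  shows "(\<lambda>z. f z - g z) \<in> bergman_space HT"
proof -
  have m: "f \<in> borel_measurable (lebesgue_on HT)" "g \<in> borel_measurable (lebesgue_on HT)"
    using f g by (auto simp: bergman_space_def L2_space_def)
  have "integrable (lebesgue_on HT) (\<lambda>z. (cmod (f z - g z))\<^sup>2)"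
  proof (rule Bochner_Integration.integrable_bound[where f="\<lambda>z. 2 * (cmod (f z))\<^sup>2 + 2 * (cmod (g z))\<^sup>2"])
    show "integrable (lebesgue_on HT) (\<lambda>z. 2 * (cmod (f z))\<^sup>2 + 2 * (cmod (g z))\<^sup>2)"
      using f g by (auto simp: bergman_space_def L2_space_def)
    show "(\<lambda>z. (cmod (f z - g z))\<^sup>2) \<in> borel_measurable (lebesgue_on HT)" using m by measurable
    show "AE z in lebesgue_on HT. norm ((cmod (f z - g z))\<^sup>2) \<le> norm (2 * (cmod (f z))\<^sup>2 + 2 * (cmod (g z))\<^sup>2)"
    proof (rule AE_I2)
      fix z
      have "(cmod (f z - g z))\<^sup>2 \<le> (cmod (f z) + cmod (g z))\<^sup>2" by (intro power_mono norm_triangle_ineq4) auto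
      moreover have "0 \<le> (cmod (f z) - cmod (g z))\<^sup>2" by simp
      ultimately have "(cmod (f z - g z))\<^sup>2 \<le> 2 * (cmod (f z))\<^sup>2 + 2 * (cmod (g z))\<^sup>2"
        by (simp add: power2_sum power2_diff)
      then show "norm ((cmod (f z - g z))\<^sup>2) \<le> norm (2 * (cmod (f z))\<^sup>2 + 2 * (cmod (g z))\<^sup>2)" by simp
    qed
  qed
  moreover have "holomorphic2_on (\<lambda>z. f z - g z) HT"
    unfolding holomorphic2_on_def
  proof
    fix z assume "z \<in> HT"
    then obtain a b a' b' where "(f has_derivative (\<lambda>h. a * fst h + b * snd h)) (at z)" "(g has_derivative (\<lambda>h. a' * fst h + b' * snd h)) (at z)"
      using f g unfolding bergman_space_def holomorphic2_on_def by blast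
    from has_derivative_diff[OF this] have "((\<lambda>z. f z - g z) has_derivative (\<lambda>h. (a - a') * fst h + (b - b') * snd h)) (at z)"
      by (simp add: algebra_simps)
    then show "\<exists>a b. ((\<lambda>z. f z - g z) has_derivative (\<lambda>h. a * fst h + b * snd h)) (at z)" by blast
  qed
  ultimately show ?thesis using m by (simp add: bergman_space_def L2_space_def)
qed

lemma bergman_self_projection:
  assumes "f \<in> bergman_space HT" shows "is_bergman_orthogonal_projection HT f f"
  using assms by (simp add: is_bergman_orthogonal_projection_def)

text \<open>The explicit kernel has the three defining properties: the difference of \<open>f\<close> and its projection is
  orthogonal to the conjugate kernel, which lies in the Bergman space. Conversely, if \<open>K\<close> is any such kernel
  and \<open>h\<close> is the conjugate of the difference of the two kernels for a fixed \<open>z\<close>, then both kernels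
  reproduce \<open>h(z)\<close>, so the integral of \<open>\<bar>h\<bar>\<^sup>2\<close> is \<open>0\<close>.\<close>

theorem bergman_kernel_hartogs: "bergman_kernel HT = hartogs_kernel"
  unfolding bergman_kernel_def
proof (rule the_equality)
  show "(\<forall>z \<zeta>. z \<notin> HT \<or> \<zeta> \<notin> HT \<longrightarrow> hartogs_kernel z \<zeta> = 0) \<and> (\<forall>z\<in>HT. (\<lambda>\<zeta>. cnj (hartogs_kernel z \<zeta>)) \<in> bergman_space HT) \<and>
     (\<forall>f\<in>L2_space HT. \<forall>g. is_bergman_orthogonal_projection HT f g \<longrightarrow> (\<forall>z\<in>HT. g z = (LINT \<zeta>|lebesgue_on HT. hartogs_kernel z \<zeta> * f \<zeta>)))"
  proof (intro conjI ballI allI impI)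
    show "hartogs_kernel z \<zeta> = 0" if "z \<notin> HT \<or> \<zeta> \<notin> HT" for z \<zeta> using that by (auto simp: hartogs_kernel_def)
    show "(\<lambda>\<zeta>. cnj (hartogs_kernel z \<zeta>)) \<in> bergman_space HT" if "z \<in> HT" for z using hartogs_kernel_cnj_bergman[OF that] .
    fix f g z assume f: "f \<in> L2_space HT" and fg: "is_bergman_orthogonal_projection HT f g" and z: "z \<in> HT"
    have g: "g \<in> bergman_space HT" using fg by (simp add: is_bergman_orthogonal_projection_def)
    then have gL2: "g \<in> L2_space HT" by (simp add: bergman_space_def)
    have "(LINT \<zeta>|lebesgue_on HT. (f \<zeta> - g \<zeta>) * cnj (cnj (hartogs_kernel z \<zeta>))) = 0"
    proof -
      have "\<forall>h\<in>bergman_space HT. (LINT \<zeta>|lebesgue_on HT. (f \<zeta> - g \<zeta>) * cnj (h \<zeta>)) = 0"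
        using fg by (simp add: is_bergman_orthogonal_projection_def)
      from bspec[OF this hartogs_kernel_cnj_bergman[OF z]] show ?thesis .
    qed
    then have "(LINT \<zeta>|lebesgue_on HT. hartogs_kernel z \<zeta> * f \<zeta> - hartogs_kernel z \<zeta> * g \<zeta>) = 0" by (simp add: algebra_simps)
    then have "(LINT \<zeta>|lebesgue_on HT. hartogs_kernel z \<zeta> * f \<zeta>) - (LINT \<zeta>|lebesgue_on HT. hartogs_kernel z \<zeta> * g \<zeta>) = 0"
      by (subst (asm) Bochner_Integration.integral_diff) (auto intro: L2_integrable_hartogs_kernel f gL2 z)
    then show "g z = (LINT \<zeta>|lebesgue_on HT. hartogs_kernel z \<zeta> * f \<zeta>)" using hartogs_kernel_reproducing[OF g z] by simp
  qed
next
  fix K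
  assume K: "(\<forall>z \<zeta>. z \<notin> HT \<or> \<zeta> \<notin> HT \<longrightarrow> K z \<zeta> = 0) \<and> (\<forall>z\<in>HT. (\<lambda>\<zeta>. cnj (K z \<zeta>)) \<in> bergman_space HT) \<and>
     (\<forall>f\<in>L2_space HT. \<forall>g. is_bergman_orthogonal_projection HT f g \<longrightarrow> (\<forall>z\<in>HT. g z = (LINT \<zeta>|lebesgue_on HT. K z \<zeta> * f \<zeta>)))"
  have "K z \<zeta> = hartogs_kernel z \<zeta>" if z: "z \<in> HT" and \<zeta>: "\<zeta> \<in> HT" for z \<zeta>
  proof -
    define h where "h = (\<lambda>\<zeta>. cnj (K z \<zeta>) - cnj (hartogs_kernel z \<zeta>))"
    have Kz: "(\<lambda>\<zeta>. cnj (K z \<zeta>)) \<in> bergman_space HT" using K z by blast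
    have h: "h \<in> bergman_space HT" unfolding h_def by (intro bergman_space_diff Kz hartogs_kernel_cnj_bergman z)
    then have hL2: "h \<in> L2_space HT" by (simp add: bergman_space_def)
    have "h z = (LINT \<zeta>|lebesgue_on HT. K z \<zeta> * h \<zeta>)" using K z hL2 bergman_self_projection[OF h] by blast
    moreover have "h z = (LINT \<zeta>|lebesgue_on HT. hartogs_kernel z \<zeta> * h \<zeta>)" using hartogs_kernel_reproducing[OF h z] by simp
    moreover have "integrable (lebesgue_on HT) (\<lambda>\<zeta>. K z \<zeta> * h \<zeta>)"
    proof -
      have c: "(\<lambda>\<zeta>. cnj (K z \<zeta>)) \<in> borel_measurable (lebesgue_on HT)" using Kz by (simp add: bergman_space_def L2_space_def)
      have "(\<lambda>\<zeta>. K z \<zeta>) \<in> borel_measurable (lebesgue_on HT)"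
        using measurable_compose[OF c cnj_measurable] by simp
      then have "(\<lambda>\<zeta>. K z \<zeta>) \<in> L2_space HT" using Kz by (simp add: bergman_space_def L2_space_def)
      then show ?thesis by (intro L2_product_integrable hL2)
    qed
    ultimately have "(LINT \<zeta>|lebesgue_on HT. K z \<zeta> * h \<zeta> - hartogs_kernel z \<zeta> * h \<zeta>) = 0"
      by (subst Bochner_Integration.integral_diff) (auto intro: L2_integrable_hartogs_kernel hL2 z)
    moreover have "K z \<zeta> * h \<zeta> - hartogs_kernel z \<zeta> * h \<zeta> = of_real ((cmod (h \<zeta>))\<^sup>2)" for \<zeta>
    proof -
      have "K z \<zeta> * h \<zeta> - hartogs_kernel z \<zeta> * h \<zeta> = h \<zeta> * cnj (h \<zeta>)" by (simp add: h_def algebra_simps)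
      then show ?thesis by (simp only: complex_norm_square)
    qed
    ultimately have "(LINT \<zeta>|lebesgue_on HT. complex_of_real ((cmod (h \<zeta>))\<^sup>2)) = 0" by simp
    then have "(LINT \<zeta>|lebesgue_on HT. (cmod (h \<zeta>))\<^sup>2) = 0" by (simp only: integral_complex_of_real of_real_eq_0_iff)
    then have "AE \<zeta> in lebesgue_on HT. (cmod (h \<zeta>))\<^sup>2 = 0"
      using hL2 by (subst (asm) integral_nonneg_eq_0_iff_AE) (auto simp: L2_space_def)
    then have "AE \<zeta> in lebesgue_on HT. h \<zeta> = 0" by eventually_elim simp
    from continuous_AE_zero_hartogs[OF _ this \<zeta>] have "h \<zeta> = 0"
      using h holomorphic2_continuous_on by (auto simp: bergman_space_def)
    then show ?thesis by (simp add: h_def)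
  qed
  then show "K = hartogs_kernel" using K by (auto simp: fun_eq_iff hartogs_kernel_def)
qed

section \<open>Lebesgue measure on the Hartogs triangle\<close>

abbreviation MH :: "(complex \<times> complex) measure" where "MH \<equiv> lebesgue_on HT"

lemma space_MH[simp]: "space MH = HT" by (simp add: space_restrict_space)

lemma finite_measure_MH: "finite_measure MH"
proof
  have "emeasure MH (space MH) = emeasure lebesgue HT" by (simp add: emeasure_restrict_space)
  also have "\<dots> = emeasure lborel HT" by (simp add: emeasure_completion main_part)
  finally show "emeasure MH (space MH) \<noteq> \<infinity>" using emeasure_hartogs_finite by simp
qed

interpretation MH: finite_measure MH by (rule finite_measure_MH)

interpretation MM: pair_sigma_finite MH MH ..

lemma borel_measurable_MH[measurable (raw)]: "f \<in> borel_measurable borel \<Longrightarrow> f \<in> borel_measurable MH"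
  by (intro measurable_restrict_space1 measurable_completion) simp

lemma id_MH_borel: "(\<lambda>x. x) \<in> MH \<rightarrow>\<^sub>M borel"
  by (rule borel_measurable_MH) simp

section \<open>Integrability and uniqueness of weak derivatives\<close>

text \<open>By Young's inequality, since \<open>1 / \<bar>z\<^sub>2\<bar>\<close> is in \<open>L\<^sup>q\<close> for the conjugate exponent \<open>q < 4\<close>. As the derivatives of the
  kernel are bounded by \<open>1 / \<bar>\<zeta>\<^sub>2\<bar>\<close>, the integral formula converges for every \<open>f\<close> in \<open>L\<^sup>p\<close> with \<open>p > 4/3\<close>.\<close>

lemma Lp_div_integrable:
  assumes p: "4 / 3 < p" and f: "f \<in> borel_measurable MH" "(\<integral>\<^sup>+z. ennreal (cmod (f z) powr p) \<partial>MH) < \<infinity>"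
  shows "integrable MH (\<lambda>z. cmod (f z) / cmod (snd z))"
proof -
  define q where "q = p / (p - 1)"
  have p1: "p > 1" using p by simp
  have q: "q > 1" "1 / p + 1 / q = 1" "q < 4" using p p1 by (auto simp: q_def field_simps)
  have ip: "integrable MH (\<lambda>z. cmod (f z) powr p)"
    by (rule integrableI_bounded) (use f in auto)
  have iq: "integrable MH (\<lambda>z. cmod (snd z) powr (- q))"
  proof (rule integrableI_bounded)
    show "(\<lambda>z. cmod (snd z) powr (- q)) \<in> borel_measurable MH" by (rule borel_measurable_MH) measurable
    show "(\<integral>\<^sup>+z. ennreal (norm (cmod (snd z) powr (- q))) \<partial>MH) < \<infinity>"
      using nn_integral_snd_powr_finite[OF q(3)] by (subst nn_integral_lebesgue_on) auto
  qed
  have [measurable]: "snd \<in> borel_measurable MH" by (rule borel_measurable_MH) measurable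
  show ?thesis
  proof (rule Bochner_Integration.integrable_bound[where f="\<lambda>z. cmod (f z) powr p / p + cmod (snd z) powr (- q) / q"])
    show "integrable MH (\<lambda>z. cmod (f z) powr p / p + cmod (snd z) powr (- q) / q)" using ip iq by auto
    show "(\<lambda>z. cmod (f z) / cmod (snd z)) \<in> borel_measurable MH" using f by measurable
    show "AE z in MH. norm (cmod (f z) / cmod (snd z)) \<le> norm (cmod (f z) powr p / p + cmod (snd z) powr (- q) / q)"
    proof (rule AE_I2)
      fix z assume "z \<in> space MH"
      then have z: "snd z \<noteq> 0" using hartogs_snd_nonzero by simp
      have "cmod (f z) * inverse (cmod (snd z)) \<le> cmod (f z) powr p / p + inverse (cmod (snd z)) powr q / q"
        using p1 q by (intro Youngs_inequality) auto
      also have "inverse (cmod (snd z)) powr q = cmod (snd z) powr (- q)"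
        using z by (simp add: powr_minus_divide powr_divide inverse_eq_divide)
      finally show "norm (cmod (f z) / cmod (snd z)) \<le> norm (cmod (f z) powr p / p + cmod (snd z) powr (- q) / q)"
        using p1 q by (simp add: divide_inverse)
    qed
  qed
qed

lemma div_integrable_imp_integrable:
  assumes f: "f \<in> borel_measurable MH" and i: "integrable MH (\<lambda>z. cmod (f z) / cmod (snd z))"
  shows "integrable MH f"
proof (rule Bochner_Integration.integrable_bound[OF i f])
  show "AE z in MH. norm (f z) \<le> norm (cmod (f z) / cmod (snd z))"
  proof (rule AE_I2)
    fix z assume "z \<in> space MH"
    then have z: "0 < cmod (snd z)" "cmod (snd z) < 1" using hartogs_snd_nonzero[of z] by (auto simp: hartogs_iff)
    then have "cmod (f z) * cmod (snd z) \<le> cmod (f z)" by (simp add: mult_left_le)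
    then show "norm (f z) \<le> norm (cmod (f z) / cmod (snd z))" using z by (simp add: field_simps)
  qed
qed

lemma L1_loc_measurable:
  assumes "g \<in> L1_loc HT" shows "g \<in> borel_measurable MH"
proof -
  obtain C where C: "\<And>n. compact (C n)" "\<And>n. C n \<subseteq> HT" "\<And>n. C n \<subseteq> interior (C (Suc n))" "\<Union>(range C) = HT"
    using open_Union_compact_subsets[OF open_hartogs] by metis
  have mono: "C n \<subseteq> C m" if "n \<le> m" for n m
    using that by (rule lift_Suc_mono_le[rotated]) (use C(3) interior_subset in blast)
  have "(\<lambda>z. indicator HT z *\<^sub>R g z) \<in> borel_measurable lebesgue"
  proof (rule borel_measurable_LIMSEQ_metric)
    show "(\<lambda>z. indicator (C n) z *\<^sub>R g z) \<in> borel_measurable lebesgue" for n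
      using assms C(1,2)[of n] by (auto simp: L1_loc_def set_integrable_def)
    fix z
    show "(\<lambda>n. indicator (C n) z *\<^sub>R g z) \<longlonglongrightarrow> indicator HT z *\<^sub>R g z"
    proof (cases "z \<in> HT")
      case True
      then obtain n where "z \<in> C n" using C(4) by blast
      then have "eventually (\<lambda>m. indicator (C m) z *\<^sub>R g z = indicator HT z *\<^sub>R g z) sequentially"
        using mono True by (intro eventually_sequentiallyI[of n]) (auto simp: indicator_def)
      then show ?thesis by (rule tendsto_eventually)
    next
      case False
      then have "z \<notin> C n" for n using C(2) by blast
      then show ?thesis using False by simp
    qed
  qed
  then show ?thesis by (subst borel_measurable_restrict_space_iff) auto
qed

lemma L1_loc_mult_test_integrable:
  assumes g: "g \<in> L1_loc HT" and \<phi>: "test_function HT \<phi>"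
  shows "integrable MH (\<lambda>z. g z * \<phi> z)"
proof -
  obtain K where K: "smooth \<phi>" "compact K" "K \<subseteq> HT" "\<And>z. z \<notin> K \<Longrightarrow> \<phi> z = 0"
    using \<phi> by (auto elim: test_functionE)
  obtain B where B: "B \<ge> 0" "\<And>z. cmod (\<phi> z) \<le> B" using test_function_bounded[OF \<phi>] by blast
  have gi: "set_integrable lebesgue K g" using g K by (auto simp: L1_loc_def)
  have "integrable lebesgue (\<lambda>z. indicator HT z *\<^sub>R (g z * \<phi> z))"
  proof (rule Bochner_Integration.integrable_bound[where f="\<lambda>z. B * norm (indicator K z *\<^sub>R g z)"])
    show "integrable lebesgue (\<lambda>z. B * norm (indicator K z *\<^sub>R g z))"
      using gi unfolding set_integrable_def by (intro integrable_mult_right integrable_norm)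
    have "(\<lambda>z. (indicator K z *\<^sub>R g z) * \<phi> z) \<in> borel_measurable lebesgue"
      by (intro borel_measurable_times measurable_completion borel_measurable_integrable[OF gi[unfolded set_integrable_def]])
         (simp add: test_function_measurable[OF \<phi>])
    also have "(\<lambda>z. (indicator K z *\<^sub>R g z) * \<phi> z) = (\<lambda>z. indicator HT z *\<^sub>R (g z * \<phi> z))"
    proof
      fix z show "(indicator K z *\<^sub>R g z) * \<phi> z = indicator HT z *\<^sub>R (g z * \<phi> z)"
        using K(3,4) by (cases "z \<in> K") (auto simp: indicator_def)
    qed
    finally show "(\<lambda>z. indicator HT z *\<^sub>R (g z * \<phi> z)) \<in> borel_measurable lebesgue" .
    show "AE z in lebesgue. norm (indicator HT z *\<^sub>R (g z * \<phi> z)) \<le> norm (B * norm (indicator K z *\<^sub>R g z))"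
    proof (rule AE_I2)
      fix z
      show "norm (indicator HT z *\<^sub>R (g z * \<phi> z)) \<le> norm (B * norm (indicator K z *\<^sub>R g z))"
      proof (cases "z \<in> K")
        case True
        have "cmod (g z) * cmod (\<phi> z) \<le> cmod (g z) * B" by (intro mult_left_mono B(2)) auto
        then show ?thesis using True K(3) B by (auto simp: norm_mult indicator_def mult.commute)
      next
        case False then show ?thesis using K(4) by simp
      qed
    qed
  qed
  then show ?thesis by (subst integrable_restrict_space) auto
qed

lemma weak_deriv_unique:
  assumes "has_weak_deriv HT \<alpha> f g" "has_weak_deriv HT \<alpha> f g'"
  shows "AE z in MH. g z = g' z"
proof -
  have g: "g \<in> L1_loc HT" "g' \<in> L1_loc HT" using assms by (auto simp: has_weak_deriv_def)
  have "AE z in MH. g z - g' z = 0"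
  proof (rule fundamental_lemma[OF open_hartogs])
    show "(\<lambda>z. g z - g' z) \<in> L1_loc HT" using g by (auto simp: L1_loc_def intro: set_integral_diff)
    fix \<phi> assume \<phi>: "test_function HT \<phi>"
    have "(-1) ^ multi_order \<alpha> * (LINT z|MH. g z * \<phi> z) = (-1) ^ multi_order \<alpha> * (LINT z|MH. g' z * \<phi> z)"
      using assms \<phi> unfolding has_weak_deriv_def by metis
    then have "(LINT z|MH. g z * \<phi> z) = (LINT z|MH. g' z * \<phi> z)" by simp
    then show "(LINT z|MH. (g z - g' z) * \<phi> z) = 0"
      using L1_loc_mult_test_integrable[OF g(1) \<phi>] L1_loc_mult_test_integrable[OF g(2) \<phi>]
      by (simp add: left_diff_distrib)
  qed
  then show ?thesis by eventually_elim simp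
qed

lemma has_weak_deriv_weak_deriv: "has_weak_deriv HT \<alpha> f g \<Longrightarrow> has_weak_deriv HT \<alpha> f (weak_deriv HT \<alpha> f)"
  unfolding weak_deriv_def by (metis someI)

lemma weak_deriv_AE: "has_weak_deriv HT \<alpha> f g \<Longrightarrow> AE z in MH. weak_deriv HT \<alpha> f z = g z"
  by (rule weak_deriv_unique[OF has_weak_deriv_weak_deriv])

section \<open>Derivatives of the projection\<close>

text \<open>The projection and its derivatives, as integrals against derivatives of the kernel. The
  case \<open>a = b = 0\<close> is the projection.\<close>

definition proj_deriv :: "nat \<Rightarrow> nat \<Rightarrow> (complex \<times> complex \<Rightarrow> complex) \<Rightarrow> complex \<times> complex \<Rightarrow> complex" where
  "proj_deriv a b f z = (LINT \<zeta>|MH. kernel_deriv a b z \<zeta> * f \<zeta>)"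

lemma kernel_deriv_measurable_pair:
  assumes "id' \<in> N \<rightarrow>\<^sub>M borel"
  shows "(\<lambda>x. kernel_deriv a b (id' (fst x)) (snd x)) \<in> borel_measurable (N \<Otimes>\<^sub>M MH)"
proof -
  have "(\<lambda>x. (id' (fst x), snd x)) \<in> N \<Otimes>\<^sub>M MH \<rightarrow>\<^sub>M borel \<Otimes>\<^sub>M borel"
    using assms measurable_compose[OF measurable_snd id_MH_borel] by (intro measurable_Pair) (auto intro: measurable_compose[OF measurable_fst])
  from measurable_compose[OF this kernel_deriv_measurable[of a b]] show ?thesis by simp
qed

lemma kernel_deriv_section_measurable: "(\<lambda>\<zeta>. kernel_deriv a b z \<zeta>) \<in> borel_measurable MH"
  using measurable_compose[OF measurable_Pair1'[of z borel borel] kernel_deriv_measurable[of a b]]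
  by (intro borel_measurable_MH) simp

lemma proj_deriv_measurable:
  assumes f[measurable]: "f \<in> borel_measurable MH"
  shows "proj_deriv a b f \<in> borel_measurable borel"
proof -
  have "(\<lambda>(z, \<zeta>). kernel_deriv a b z \<zeta> * f \<zeta>) \<in> borel_measurable (borel \<Otimes>\<^sub>M MH)"
    using kernel_deriv_measurable_pair[of "\<lambda>x. x" borel a b] unfolding split_beta' by measurable
  from MH.borel_measurable_lebesgue_integral[OF this] show ?thesis by (simp add: proj_deriv_def[abs_def])
qed

lemma kernel_deriv_mult_integrable:
  assumes f: "f \<in> borel_measurable MH" and i: "integrable MH (\<lambda>z. cmod (f z) / cmod (snd z))" and z: "z \<in> HT"
  shows "integrable MH (\<lambda>\<zeta>. kernel_deriv a b z \<zeta> * f \<zeta>)"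
proof -
  obtain C where C: "C \<ge> 0" "\<And>\<zeta>. \<zeta> \<in> HT \<Longrightarrow> cmod (kernel_deriv a b z \<zeta>) \<le> C / cmod (snd \<zeta>)"
    using kernel_deriv_bound[of "{z}" a b] z by auto
  show ?thesis
  proof (rule Bochner_Integration.integrable_bound[where f="\<lambda>\<zeta>. C * (cmod (f \<zeta>) / cmod (snd \<zeta>))"])
    show "(\<lambda>\<zeta>. kernel_deriv a b z \<zeta> * f \<zeta>) \<in> borel_measurable MH" using kernel_deriv_section_measurable f by measurable
    show "AE \<zeta> in MH. norm (kernel_deriv a b z \<zeta> * f \<zeta>) \<le> norm (C * (cmod (f \<zeta>) / cmod (snd \<zeta>)))"
    proof (rule AE_I2)
      fix \<zeta> assume "\<zeta> \<in> space MH"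
      then have "cmod (kernel_deriv a b z \<zeta>) * cmod (f \<zeta>) \<le> C / cmod (snd \<zeta>) * cmod (f \<zeta>)"
        by (intro mult_right_mono C) auto
      then show "norm (kernel_deriv a b z \<zeta> * f \<zeta>) \<le> norm (C * (cmod (f \<zeta>) / cmod (snd \<zeta>)))" using C by (simp add: norm_mult)
    qed
  qed (rule integrable_mult_right[OF i])
qed

lemma kernel_deriv_mult_norm_bound:
  assumes f: "f \<in> borel_measurable MH" and i: "integrable MH (\<lambda>z. cmod (f z) / cmod (snd z))" and K: "compact K" "K \<subseteq> HT"
  shows "\<exists>B\<ge>0. \<forall>z\<in>K. (LINT \<zeta>|MH. cmod (kernel_deriv a b z \<zeta> * f \<zeta>)) \<le> B"
proof -
  obtain C where C: "C \<ge> 0" "\<And>z \<zeta>. z \<in> K \<Longrightarrow> \<zeta> \<in> HT \<Longrightarrow> cmod (kernel_deriv a b z \<zeta>) \<le> C / cmod (snd \<zeta>)"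
    using kernel_deriv_bound[OF K, of a b] by auto
  show ?thesis
  proof (intro exI[of _ "C * (LINT z|MH. cmod (f z) / cmod (snd z))"] conjI ballI)
    show "0 \<le> C * (LINT z|MH. cmod (f z) / cmod (snd z))" using C by (intro mult_nonneg_nonneg integral_nonneg_AE) auto
    fix z assume z: "z \<in> K"
    have "(LINT \<zeta>|MH. cmod (kernel_deriv a b z \<zeta> * f \<zeta>)) \<le> (LINT \<zeta>|MH. C * (cmod (f \<zeta>) / cmod (snd \<zeta>)))"
    proof (rule integral_mono)
      show "integrable MH (\<lambda>\<zeta>. cmod (kernel_deriv a b z \<zeta> * f \<zeta>))" using kernel_deriv_mult_integrable[OF f i subsetD[OF K(2) z], of a b] by (rule integrable_norm)
      fix \<zeta> assume "\<zeta> \<in> space MH"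
      then have "cmod (kernel_deriv a b z \<zeta>) * cmod (f \<zeta>) \<le> C / cmod (snd \<zeta>) * cmod (f \<zeta>)"
        by (intro mult_right_mono C z) auto
      then show "cmod (kernel_deriv a b z \<zeta> * f \<zeta>) \<le> C * (cmod (f \<zeta>) / cmod (snd \<zeta>))" by (simp add: norm_mult)
    qed (rule integrable_mult_right[OF i])
    also have "\<dots> = C * (LINT z|MH. cmod (f z) / cmod (snd z))" by (rule integral_mult_right_zero)
    finally show "(LINT \<zeta>|MH. cmod (kernel_deriv a b z \<zeta> * f \<zeta>)) \<le> C * (LINT z|MH. cmod (f z) / cmod (snd z))" .
  qed
qed

lemma proj_deriv_L1_loc:
  assumes f: "f \<in> borel_measurable MH" and i: "integrable MH (\<lambda>z. cmod (f z) / cmod (snd z))"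
  shows "proj_deriv a b f \<in> L1_loc HT"
  unfolding L1_loc_def
proof (intro CollectI allI impI, elim conjE)
  fix K assume K: "compact K" "K \<subseteq> HT"
  obtain B where B: "B \<ge> 0" "\<And>z. z \<in> K \<Longrightarrow> (LINT \<zeta>|MH. cmod (kernel_deriv a b z \<zeta> * f \<zeta>)) \<le> B"
    using kernel_deriv_mult_norm_bound[OF f i K, of a b] by blast
  show "proj_deriv a b f absolutely_integrable_on K"
    unfolding set_integrable_def
  proof (rule Bochner_Integration.integrable_bound[where f="\<lambda>z. indicator K z *\<^sub>R B"])
    show "integrable lebesgue (\<lambda>z. indicator K z *\<^sub>R B)"
    proof (intro integrable_scaleR_left integrable_real_indicator)
      have "emeasure lborel K < \<infinity>" by (intro emeasure_bounded_finite compact_imp_bounded K)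
      then show "emeasure lebesgue K < \<infinity>" using borel_compact[OF K(1)] by simp
    qed (simp add: borel_compact[OF K(1)])
    have "K \<in> sets lebesgue" using borel_compact[OF K(1)] by simp
    then show "(\<lambda>z. indicator K z *\<^sub>R proj_deriv a b f z) \<in> borel_measurable lebesgue"
      using measurable_completion[of "proj_deriv a b f" lborel borel] proj_deriv_measurable[OF f, of a b] by (intro borel_measurable_scaleR) auto
    show "AE z in lebesgue. norm (indicator K z *\<^sub>R proj_deriv a b f z) \<le> norm (indicator K z *\<^sub>R B)"
    proof (rule AE_I2)
      fix z
      have bd: "cmod (proj_deriv a b f z) \<le> (LINT \<zeta>|MH. cmod (kernel_deriv a b z \<zeta> * f \<zeta>))" unfolding proj_deriv_def by (rule integral_norm_bound)
      show "norm (indicator K z *\<^sub>R proj_deriv a b f z) \<le> norm (indicator K z *\<^sub>R B)"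
      proof (cases "z \<in> K")
        case True
        from order.trans[OF bd B(2)[OF True]] show ?thesis using True B(1) by simp
      qed simp
    qed
  qed
qed

lemma kernel_deriv_wirt_parts:
  assumes \<zeta>: "\<zeta> \<in> HT" and \<theta>: "test_function HT \<theta>"
  shows "(LINT z|MH. kernel_deriv a 0 z \<zeta> * wirt 0 \<theta> z) = - (LINT z|MH. kernel_deriv (Suc a) 0 z \<zeta> * \<theta> z)"
    and "(LINT z|MH. kernel_deriv a b z \<zeta> * wirt (Suc 0) \<theta> z) = - (LINT z|MH. kernel_deriv a (Suc b) z \<zeta> * \<theta> z)"
    and "(LINT z|MH. kernel_deriv a b z \<zeta> * wirt 2 \<theta> z) = 0"
    and "(LINT z|MH. kernel_deriv a b z \<zeta> * wirt 3 \<theta> z) = 0"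
proof -
  note ibp = integration_by_parts_wirt[OF open_hartogs smooth_on_kernel_deriv[OF \<zeta>] \<theta>]
  have *: "(LINT z|MH. wirt i (\<lambda>z. kernel_deriv a b z \<zeta>) z * \<theta> z) = (LINT z|MH. F z * \<theta> z)"
    if "\<And>z. z \<in> HT \<Longrightarrow> wirt i (\<lambda>z. kernel_deriv a b z \<zeta>) z = F z" for i F a b
    using that by (intro Bochner_Integration.integral_cong) auto
  show "(LINT z|MH. kernel_deriv a 0 z \<zeta> * wirt 0 \<theta> z) = - (LINT z|MH. kernel_deriv (Suc a) 0 z \<zeta> * \<theta> z)"
    unfolding ibp using *[of 0 a 0 "\<lambda>z. kernel_deriv (Suc a) 0 z \<zeta>"] wirt_kernel_deriv(1)[OF _ \<zeta>] by simp
  show "(LINT z|MH. kernel_deriv a b z \<zeta> * wirt (Suc 0) \<theta> z) = - (LINT z|MH. kernel_deriv a (Suc b) z \<zeta> * \<theta> z)"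
    unfolding ibp using *[of "Suc 0" a b "\<lambda>z. kernel_deriv a (Suc b) z \<zeta>"] wirt_kernel_deriv(2)[OF _ \<zeta>] by simp
  show "(LINT z|MH. kernel_deriv a b z \<zeta> * wirt 2 \<theta> z) = 0"
    unfolding ibp using *[of 2 a b "\<lambda>z. 0"] wirt_kernel_deriv(3)[OF _ \<zeta>] by simp
  show "(LINT z|MH. kernel_deriv a b z \<zeta> * wirt 3 \<theta> z) = 0"
    unfolding ibp using *[of 3 a b "\<lambda>z. 0"] wirt_kernel_deriv(4)[OF _ \<zeta>] by simp
qed

lemma test_function_funpow_wirt: "test_function HT \<theta> \<Longrightarrow> test_function HT ((wirt i ^^ n) \<theta>)"
  by (induction n) (auto intro: test_function_wirt)

lemma kernel_deriv_funpow_parts: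
  assumes \<zeta>: "\<zeta> \<in> HT" and \<theta>: "test_function HT \<theta>"
  shows "(LINT z|MH. kernel_deriv a 0 z \<zeta> * (wirt 0 ^^ n) \<theta> z) = (-1) ^ n * (LINT z|MH. kernel_deriv (a + n) 0 z \<zeta> * \<theta> z)"
    and "(LINT z|MH. kernel_deriv a b z \<zeta> * (wirt (Suc 0) ^^ n) \<theta> z) = (-1) ^ n * (LINT z|MH. kernel_deriv a (b + n) z \<zeta> * \<theta> z)"
proof -
  show "(LINT z|MH. kernel_deriv a 0 z \<zeta> * (wirt 0 ^^ n) \<theta> z) = (-1) ^ n * (LINT z|MH. kernel_deriv (a + n) 0 z \<zeta> * \<theta> z)"
  proof (induction n arbitrary: a)
    case (Suc n)
    show ?case using kernel_deriv_wirt_parts(1)[OF \<zeta> test_function_funpow_wirt[OF \<theta>, where i=0 and n=n], of a] Suc[of "Suc a"] by simp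
  qed simp
  show "(LINT z|MH. kernel_deriv a b z \<zeta> * (wirt (Suc 0) ^^ n) \<theta> z) = (-1) ^ n * (LINT z|MH. kernel_deriv a (b + n) z \<zeta> * \<theta> z)"
  proof (induction n arbitrary: b)
    case (Suc n)
    show ?case using kernel_deriv_wirt_parts(2)[OF \<zeta> test_function_funpow_wirt[OF \<theta>, where i="Suc 0" and n=n], of a b] Suc[of "Suc b"] by simp
  qed simp
qed

text \<open>For fixed \<open>\<zeta>\<close> the kernel is smooth and holomorphic in \<open>z\<close>, so integration by parts moves the derivatives
  onto it one at a time, and any derivative in a conjugate variable kills it.\<close>

lemma kernel_deriv_wirtinger_deriv_parts:
  assumes \<zeta>: "\<zeta> \<in> HT" and \<psi>: "test_function HT \<psi>"
  shows "(LINT z|MH. kernel_deriv 0 0 z \<zeta> * wirtinger_deriv (a1, a2, a3, a4) \<psi> z)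
    = (if a3 = 0 \<and> a4 = 0 then (-1) ^ (a1 + a2) * (LINT z|MH. kernel_deriv a1 a2 z \<zeta> * \<psi> z) else 0)"
proof -
  define \<theta> where "\<theta> = (wirt 2 ^^ a3) ((wirt 3 ^^ a4) \<psi>)"
  have \<theta>: "test_function HT \<theta>" unfolding \<theta>_def by (intro test_function_funpow_wirt \<psi>)
  have "(LINT z|MH. kernel_deriv 0 0 z \<zeta> * wirtinger_deriv (a1, a2, a3, a4) \<psi> z) = (-1) ^ a1 * (LINT z|MH. kernel_deriv a1 0 z \<zeta> * (wirt (Suc 0) ^^ a2) \<theta> z)"
    unfolding wirtinger_deriv_eq_wirt \<theta>_def[symmetric] using kernel_deriv_funpow_parts(1)[OF \<zeta> test_function_funpow_wirt[OF \<theta>], of 0 a1] by simp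
  also have "(LINT z|MH. kernel_deriv a1 0 z \<zeta> * (wirt (Suc 0) ^^ a2) \<theta> z) = (-1) ^ a2 * (LINT z|MH. kernel_deriv a1 a2 z \<zeta> * \<theta> z)"
    using kernel_deriv_funpow_parts(2)[OF \<zeta> \<theta>, of a1 0 a2] by simp
  finally have eq: "(LINT z|MH. kernel_deriv 0 0 z \<zeta> * wirtinger_deriv (a1, a2, a3, a4) \<psi> z) = (-1) ^ (a1 + a2) * (LINT z|MH. kernel_deriv a1 a2 z \<zeta> * \<theta> z)"
    by (simp add: power_add)
  have "(LINT z|MH. kernel_deriv a1 a2 z \<zeta> * \<theta> z) = (if a3 = 0 \<and> a4 = 0 then (LINT z|MH. kernel_deriv a1 a2 z \<zeta> * \<psi> z) else 0)"
  proof (cases a3)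
    case 0
    show ?thesis
    proof (cases a4)
      case (Suc n)
      then show ?thesis using kernel_deriv_wirt_parts(4)[OF \<zeta> test_function_funpow_wirt[OF \<psi>, where i=3 and n=n]] 0 by (simp add: \<theta>_def)
    qed (simp add: 0 \<theta>_def)
  next
    case (Suc n)
    then show ?thesis
      using kernel_deriv_wirt_parts(3)[OF \<zeta> test_function_funpow_wirt[OF test_function_funpow_wirt[OF \<psi>, where i=3 and n=a4], where i=2 and n=n]] by (simp add: \<theta>_def)
  qed
  then show ?thesis unfolding eq by simp
qed

text \<open>On the compact support of \<open>D\<close> the kernel is bounded by a multiple of \<open>1 / \<bar>\<zeta>\<^sub>2\<bar>\<close>, so the double integral converges
  absolutely.\<close>

lemma proj_deriv_test_Fubini:
  assumes f: "f \<in> borel_measurable MH" and i: "integrable MH (\<lambda>z. cmod (f z) / cmod (snd z))" and D: "test_function HT D"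
  shows "(LINT z|MH. proj_deriv a b f z * D z) = (LINT \<zeta>|MH. f \<zeta> * (LINT z|MH. kernel_deriv a b z \<zeta> * D z))"
proof -
  note [measurable] = f
  obtain K where K: "smooth D" "compact K" "K \<subseteq> HT" "\<And>z. z \<notin> K \<Longrightarrow> D z = 0"
    using D by (auto elim: test_functionE)
  obtain BD where BD: "BD \<ge> 0" "\<And>z. cmod (D z) \<le> BD" using test_function_bounded[OF D] by blast
  obtain B where B: "B \<ge> 0" "\<And>z. z \<in> K \<Longrightarrow> (LINT \<zeta>|MH. cmod (kernel_deriv a b z \<zeta> * f \<zeta>)) \<le> B"
    using kernel_deriv_mult_norm_bound[OF f i K(2,3), of a b] by blast
  have Dm[measurable]: "D \<in> borel_measurable MH" by (intro borel_measurable_MH test_function_measurable[OF D])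
  have m: "(\<lambda>(z, \<zeta>). kernel_deriv a b z \<zeta> * f \<zeta> * D z) \<in> borel_measurable (MH \<Otimes>\<^sub>M MH)"
    using kernel_deriv_measurable_pair[OF id_MH_borel, of a b] unfolding split_beta' by measurable
  have int: "integrable (MH \<Otimes>\<^sub>M MH) (\<lambda>(z, \<zeta>). kernel_deriv a b z \<zeta> * f \<zeta> * D z)"
  proof (rule MM.Fubini_integrable[OF m])
    show "AE z in MH. integrable MH (\<lambda>\<zeta>. case (z, \<zeta>) of (z, \<zeta>) \<Rightarrow> kernel_deriv a b z \<zeta> * f \<zeta> * D z)"
      using kernel_deriv_mult_integrable[OF f i] by (intro AE_I2) auto
    show "integrable MH (\<lambda>z. LINT \<zeta>|MH. norm (case (z, \<zeta>) of (z, \<zeta>) \<Rightarrow> kernel_deriv a b z \<zeta> * f \<zeta> * D z))"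
    proof (rule MH.integrable_const_bound[where B="B * BD"])
      show "(\<lambda>z. LINT \<zeta>|MH. norm (case (z, \<zeta>) of (z, \<zeta>) \<Rightarrow> kernel_deriv a b z \<zeta> * f \<zeta> * D z)) \<in> borel_measurable MH"
        using m by (intro MH.borel_measurable_lebesgue_integral) (simp add: split_beta')
      show "AE z in MH. norm (LINT \<zeta>|MH. norm (case (z, \<zeta>) of (z, \<zeta>) \<Rightarrow> kernel_deriv a b z \<zeta> * f \<zeta> * D z)) \<le> B * BD"
      proof (rule AE_I2)
        fix z
        have e: "(LINT \<zeta>|MH. norm (case (z, \<zeta>) of (z, \<zeta>) \<Rightarrow> kernel_deriv a b z \<zeta> * f \<zeta> * D z)) = (LINT \<zeta>|MH. cmod (kernel_deriv a b z \<zeta> * f \<zeta>)) * cmod (D z)"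
          by (simp only: prod.case norm_mult integral_mult_left_zero)
        show "norm (LINT \<zeta>|MH. norm (case (z, \<zeta>) of (z, \<zeta>) \<Rightarrow> kernel_deriv a b z \<zeta> * f \<zeta> * D z)) \<le> B * BD"
        proof (cases "z \<in> K")
          case True
          have "(LINT \<zeta>|MH. cmod (kernel_deriv a b z \<zeta> * f \<zeta>)) * cmod (D z) \<le> B * BD"
            using B BD True by (intro mult_mono) auto
          moreover have "0 \<le> (LINT \<zeta>|MH. cmod (kernel_deriv a b z \<zeta> * f \<zeta>))" by (rule integral_nonneg_AE) auto
          ultimately show ?thesis unfolding e by simp
        next
          case False then show ?thesis unfolding e using K(4) B BD by simp
        qed
      qed
    qed
  qed
  have "(LINT z|MH. proj_deriv a b f z * D z) = (LINT z|MH. LINT \<zeta>|MH. kernel_deriv a b z \<zeta> * f \<zeta> * D z)"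
    unfolding proj_deriv_def by (simp add: integral_mult_left_zero)
  also have "\<dots> = (LINT \<zeta>|MH. LINT z|MH. kernel_deriv a b z \<zeta> * f \<zeta> * D z)"
    by (rule MM.Fubini_integral[OF int, symmetric])
  also have "\<dots> = (LINT \<zeta>|MH. f \<zeta> * (LINT z|MH. kernel_deriv a b z \<zeta> * D z))"
  proof (rule Bochner_Integration.integral_cong[OF refl])
    fix \<zeta>
    have "(\<lambda>z. kernel_deriv a b z \<zeta> * f \<zeta> * D z) = (\<lambda>z. f \<zeta> * (kernel_deriv a b z \<zeta> * D z))" by (simp add: ac_simps)
    then show "(LINT z|MH. kernel_deriv a b z \<zeta> * f \<zeta> * D z) = f \<zeta> * (LINT z|MH. kernel_deriv a b z \<zeta> * D z)" by simp
  qed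
  finally show ?thesis .
qed

lemma L1_loc_zero: "(\<lambda>z. 0) \<in> L1_loc HT"
  by (auto simp: L1_loc_def set_integrable_def)

text \<open>The derivatives fall on the kernel: exchange the integrals, integrate by parts in \<open>z\<close> for fixed \<open>\<zeta>\<close>,
  and exchange back.\<close>

theorem projection_weak_deriv:
  assumes f: "f \<in> borel_measurable MH" and i: "integrable MH (\<lambda>z. cmod (f z) / cmod (snd z))"
  shows "has_weak_deriv HT (a1, a2, a3, a4) (proj_deriv 0 0 f) (if a3 = 0 \<and> a4 = 0 then proj_deriv a1 a2 f else (\<lambda>z. 0))"
  unfolding has_weak_deriv_def
proof (intro conjI allI impI)
  show "(if a3 = 0 \<and> a4 = 0 then proj_deriv a1 a2 f else (\<lambda>z. 0)) \<in> L1_loc HT"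
    using proj_deriv_L1_loc[OF f i] L1_loc_zero by simp
  fix \<psi> assume \<psi>: "test_function HT \<psi>"
  have D: "test_function HT (wirtinger_deriv (a1, a2, a3, a4) \<psi>)"
    unfolding wirtinger_deriv_eq_wirt by (intro test_function_funpow_wirt \<psi>)
  have "(LINT z|MH. proj_deriv 0 0 f z * wirtinger_deriv (a1, a2, a3, a4) \<psi> z)
      = (LINT \<zeta>|MH. f \<zeta> * (LINT z|MH. kernel_deriv 0 0 z \<zeta> * wirtinger_deriv (a1, a2, a3, a4) \<psi> z))"
    by (rule proj_deriv_test_Fubini[OF f i D])
  also have "\<dots> = (LINT \<zeta>|MH. f \<zeta> * (if a3 = 0 \<and> a4 = 0 then (-1) ^ (a1 + a2) * (LINT z|MH. kernel_deriv a1 a2 z \<zeta> * \<psi> z) else 0))"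
  proof (rule Bochner_Integration.integral_cong[OF refl])
    fix \<zeta> assume "\<zeta> \<in> space MH"
    then have "\<zeta> \<in> HT" by simp
    from kernel_deriv_wirtinger_deriv_parts[OF this \<psi>]
    show "f \<zeta> * (LINT z|MH. kernel_deriv 0 0 z \<zeta> * wirtinger_deriv (a1, a2, a3, a4) \<psi> z) = f \<zeta> * (if a3 = 0 \<and> a4 = 0 then (-1) ^ (a1 + a2) * (LINT z|MH. kernel_deriv a1 a2 z \<zeta> * \<psi> z) else 0)"
      by simp
  qed
  also have "\<dots> = (-1) ^ multi_order (a1, a2, a3, a4) * (LINT z|MH. (if a3 = 0 \<and> a4 = 0 then proj_deriv a1 a2 f else (\<lambda>z. 0)) z * \<psi> z)"
  proof (cases "a3 = 0 \<and> a4 = 0")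
    case True
    have "(\<lambda>\<zeta>. f \<zeta> * ((-1) ^ (a1 + a2) * (LINT z|MH. kernel_deriv a1 a2 z \<zeta> * \<psi> z))) = (\<lambda>\<zeta>. (-1) ^ (a1 + a2) * (f \<zeta> * (LINT z|MH. kernel_deriv a1 a2 z \<zeta> * \<psi> z)))"
      by (simp add: ac_simps)
    then show ?thesis using True proj_deriv_test_Fubini[OF f i \<psi>, of a1 a2] by simp
  qed auto
  finally show "(LINT z|MH. proj_deriv 0 0 f z * wirtinger_deriv (a1, a2, a3, a4) \<psi> z)
      = (-1) ^ multi_order (a1, a2, a3, a4) * (LINT z|MH. (if a3 = 0 \<and> a4 = 0 then proj_deriv a1 a2 f else (\<lambda>z. 0)) z * \<psi> z)" .
qed

lemma bergman_projection_eq_proj_deriv: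
  assumes "z \<in> HT" shows "bergman_projection HT f z = proj_deriv 0 0 f z"
  unfolding bergman_projection_def bergman_kernel_hartogs proj_deriv_def
  using assms by (intro Bochner_Integration.integral_cong) (auto simp: hartogs_kernel_eq_kernel_deriv)

section \<open>Rotational vector fields\<close>

definition coord :: "nat \<Rightarrow> complex \<times> complex \<Rightarrow> complex" where
  "coord j = (if j = 0 then fst else snd)"

text \<open>The vector field \<open>\<zeta>\<^sub>j \<partial>\<^sub>j - \<zeta>\<^sub>j\<^sup>* \<partial>\<^sub>j\<^sup>*\<close>, which is \<open>- \<i>\<close> times the derivative along the rotations of the
  \<open>j\<close>-th coordinate.\<close>

definition rot :: "nat \<Rightarrow> (complex \<times> complex \<Rightarrow> complex) \<Rightarrow> complex \<times> complex \<Rightarrow> complex" where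
  "rot j \<psi> z = coord j z * wirt j \<psi> z - cnj (coord j z) * wirt (j + 2) \<psi> z"

lemma smooth_coord: "smooth (coord j)" "smooth (\<lambda>z. cnj (coord j z))"
  unfolding coord_def by (auto intro: smooth_intros)

lemma wirt_coord:
  assumes "j < 2" "i < 4"
  shows "wirt i (coord j) z = (if i = j then 1 else 0)" "wirt i (\<lambda>z. cnj (coord j z)) z = (if i = j + 2 then 1 else 0)"
proof -
  have i: "i = 0 \<or> i = Suc 0 \<or> i = 2 \<or> i = 3" and j: "j = 0 \<or> j = Suc 0" using assms by auto
  have 1: "(fst has_derivative (\<lambda>h. 1 * fst h + 0 * snd h)) (at z)" "(snd has_derivative (\<lambda>h. 0 * fst h + 1 * snd h)) (at z)" for z :: "complex \<times> complex"
    by (auto intro!: derivative_eq_intros)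
  have 2: "((\<lambda>z. cnj (fst z)) has_derivative (\<lambda>h. 1 * cnj (fst h) + 0 * cnj (snd h))) (at z)"
    "((\<lambda>z. cnj (snd z)) has_derivative (\<lambda>h. 0 * cnj (fst h) + 1 * cnj (snd h))) (at z)" for z :: "complex \<times> complex"
    by (auto intro!: derivative_eq_intros)
  show "wirt i (coord j) z = (if i = j then 1 else 0)"
    using i j wirt_holomorphic[OF 1(1)[of z]] wirt_holomorphic[OF 1(2)[of z]] by (auto simp: coord_def)
  show "wirt i (\<lambda>z. cnj (coord j z)) z = (if i = j + 2 then 1 else 0)"
    using i j wirt_antiholomorphic[OF 2(1)[of z]] wirt_antiholomorphic[OF 2(2)[of z]] by (auto simp: coord_def)
qed

lemma rot_smooth: "smooth \<psi> \<Longrightarrow> smooth (rot j \<psi>)"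
  unfolding rot_def[abs_def] by (intro smooth_intros smooth_coord wirt_smooth)

lemma wirt_lincomb:
  assumes "f differentiable (at z)" "g differentiable (at z)"
  shows "wirt i (\<lambda>z. a * f z + b * g z) z = a * wirt i f z + b * wirt i g z"
proof -
  have "(f has_derivative frechet_derivative f (at z)) (at z)" "(g has_derivative frechet_derivative g (at z)) (at z)"
    using assms frechet_derivative_works by blast+
  from has_derivative_imp_wirt[OF this has_derivative_add[OF has_derivative_mult_right[OF this(1), of a] has_derivative_mult_right[OF this(2), of b]]]
  show ?thesis by simp
qed

lemma rot_lincomb:
  assumes "f differentiable (at z)" "g differentiable (at z)"
  shows "rot j (\<lambda>z. a * f z + b * g z) z = a * rot j f z + b * rot j g z"
  by (simp add: rot_def wirt_lincomb[OF assms] algebra_simps)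

lemma rot_mult:
  assumes "f differentiable (at z)" "g differentiable (at z)"
  shows "rot j (\<lambda>z. f z * g z) z = rot j f z * g z + f z * rot j g z"
  using assms by (simp add: rot_def wirt_mult algebra_simps)

text \<open>The divergences of the two coefficient functions are both \<open>1\<close> and cancel. In this form only
  Wirtinger derivatives act on products with \<open>\<psi>\<close>, so weak derivatives of \<open>f\<close> can take them over.\<close>

lemma rot_divergence:
  assumes j: "j < 2" and \<psi>: "smooth \<psi>"
  shows "rot j \<psi> z = wirt j (\<lambda>z. coord j z * \<psi> z) z - wirt (j + 2) (\<lambda>z. cnj (coord j z) * \<psi> z) z"
  using j by (simp add: wirt_mult smooth_differentiable smooth_coord \<psi> wirt_coord rot_def)

text \<open>Commuting with a Wirtinger derivative only produces a multiple of that derivative, because the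
  coefficients of the field are linear.\<close>

lemma rot_wirt:
  assumes j: "j < 2" and i: "i < 4" and \<phi>: "smooth \<phi>"
  shows "rot j (wirt i \<phi>) z = wirt i (rot j \<phi>) z + ((if i = j + 2 then 1 else 0) - (if i = j then 1 else 0)) * wirt i \<phi> z"
proof -
  have d: "f differentiable (at z)" if "smooth f" for f :: "complex \<times> complex \<Rightarrow> complex" using smooth_differentiable[OF that] .
  have s: "smooth (\<lambda>z. coord j z * wirt j \<phi> z)" "smooth (\<lambda>z. cnj (coord j z) * wirt (j + 2) \<phi> z)"
    by (intro smooth_mult smooth_coord wirt_smooth \<phi>)+
  have "wirt i (rot j \<phi>) z = wirt i (\<lambda>z. 1 * (coord j z * wirt j \<phi> z) + (-1) * (cnj (coord j z) * wirt (j + 2) \<phi> z)) z"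
    by (simp add: rot_def[abs_def])
  also have "\<dots> = wirt i (\<lambda>z. coord j z * wirt j \<phi> z) z - wirt i (\<lambda>z. cnj (coord j z) * wirt (j + 2) \<phi> z) z"
    by (subst wirt_lincomb[OF d[OF s(1)] d[OF s(2)]]) simp
  also have "wirt i (\<lambda>z. coord j z * wirt j \<phi> z) z = (if i = j then 1 else 0) * wirt j \<phi> z + coord j z * wirt i (wirt j \<phi>) z"
    by (subst wirt_mult) (auto intro!: d smooth_coord wirt_smooth \<phi> simp: wirt_coord[OF j i])
  also have "wirt i (\<lambda>z. cnj (coord j z) * wirt (j + 2) \<phi> z) z = (if i = j + 2 then 1 else 0) * wirt (j + 2) \<phi> z + cnj (coord j z) * wirt i (wirt (j + 2) \<phi>) z"
    by (subst wirt_mult) (auto intro!: d smooth_coord wirt_smooth \<phi> simp: wirt_coord[OF j i])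
  finally have e: "wirt i (rot j \<phi>) z = ((if i = j then 1 else 0) * wirt j \<phi> z + coord j z * wirt i (wirt j \<phi>) z) - ((if i = j + 2 then 1 else 0) * wirt (j + 2) \<phi> z + cnj (coord j z) * wirt i (wirt (j + 2) \<phi>) z)" .
  show ?thesis
    unfolding e by (simp add: rot_def wirt_commute[OF \<phi>, of i])
qed

lemma rot_wirt_word:
  assumes j: "j < 2"
  shows "set l \<subseteq> {..<4} \<Longrightarrow> \<exists>m::complex. \<forall>\<psi> z. smooth \<psi> \<longrightarrow> rot j (wirt_word l \<psi>) z = wirt_word l (rot j \<psi>) z + m * wirt_word l \<psi> z"
proof (induction l)
  case Nil
  then show ?case by (intro exI[of _ 0]) simp
next
  case (Cons i l)
  then obtain m :: complex where m: "\<And>\<psi> z. smooth \<psi> \<Longrightarrow> rot j (wirt_word l \<psi>) z = wirt_word l (rot j \<psi>) z + m * wirt_word l \<psi> z" by auto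
  from Cons have i: "i < 4" by simp
  define c where "c = (if i = j + 2 then 1 else 0) - (if i = j then 1 else (0::complex))"
  show ?case
  proof (intro exI[of _ "m + c"] allI impI)
    fix \<psi> z assume \<psi>: "smooth (\<psi> :: complex \<times> complex \<Rightarrow> complex)"
    have "rot j (wirt_word (i # l) \<psi>) z = wirt i (rot j (wirt_word l \<psi>)) z + c * wirt i (wirt_word l \<psi>) z"
      using rot_wirt[OF j i smooth_wirt_word[OF \<psi>]] by (simp add: c_def)
    also have "rot j (wirt_word l \<psi>) = (\<lambda>z. wirt_word l (rot j \<psi>) z + m * wirt_word l \<psi> z)" using m[OF \<psi>] by auto
    also have "wirt i (\<lambda>z. wirt_word l (rot j \<psi>) z + m * wirt_word l \<psi> z) z = wirt i (wirt_word l (rot j \<psi>)) z + m * wirt i (wirt_word l \<psi>) z"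
      using wirt_lincomb[OF smooth_differentiable[OF smooth_wirt_word[OF rot_smooth[OF \<psi>]]] smooth_differentiable[OF smooth_wirt_word[OF \<psi>]], where i=i and a=1 and b=m]
      by simp
    finally show "rot j (wirt_word (i # l) \<psi>) z = wirt_word (i # l) (rot j \<psi>) z + (m + c) * wirt_word (i # l) \<psi> z"
      by (simp add: algebra_simps)
  qed
qed

lemma rot_cong_open:
  assumes "open S" "z \<in> S" "\<And>x. x \<in> S \<Longrightarrow> f x = g x" shows "rot j f z = rot j g z"
  using wirt_cong_open[OF assms] by (simp add: rot_def)

lemma test_function_rot: "test_function \<Omega> \<psi> \<Longrightarrow> test_function \<Omega> (rot j \<psi>)"
proof -
  assume \<psi>: "test_function \<Omega> \<psi>"
  have "test_function \<Omega> (\<lambda>z. coord j z * wirt j \<psi> z + (- cnj (coord j z)) * wirt (j + 2) \<psi> z)"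
    using smooth_cmult[OF smooth_coord(2), of "-1" j] by (intro test_function_add test_function_mult test_function_wirt \<psi> smooth_coord) simp
  then show ?thesis by (simp add: rot_def[abs_def])
qed

text \<open>Compositions of operators \<open>T\<^sub>j + c\<close>; the head of the list is applied last.\<close>

fun rot_word :: "(nat \<times> complex) list \<Rightarrow> (complex \<times> complex \<Rightarrow> complex) \<Rightarrow> complex \<times> complex \<Rightarrow> complex" where
  "rot_word [] \<psi> = \<psi>"
| "rot_word ((j, c) # w) \<psi> = (\<lambda>z. rot j (rot_word w \<psi>) z + c * rot_word w \<psi> z)"

lemma rot_word_smooth: "smooth \<psi> \<Longrightarrow> smooth (rot_word w \<psi>)"
  by (induction w \<psi> rule: rot_word.induct) (auto intro!: smooth_intros rot_smooth)

lemma rot_word_append: "rot_word (w @ w') \<psi> = rot_word w (rot_word w' \<psi>)"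
  by (induction w \<psi> rule: rot_word.induct) auto

lemma rot_word_lincomb:
  assumes "smooth f" "smooth g"
  shows "rot_word w (\<lambda>z. a * f z + b * g z) = (\<lambda>z. a * rot_word w f z + b * rot_word w g z)"
proof (induction w)
  case (Cons x w)
  obtain j c where x: "x = (j, c)" by (cases x)
  show ?case
    unfolding x rot_word.simps Cons
    by (rule ext, subst rot_lincomb) (auto intro!: smooth_differentiable rot_word_smooth assms simp: algebra_simps)
qed simp

lemma test_function_rot_word: "test_function \<Omega> \<psi> \<Longrightarrow> test_function \<Omega> (rot_word w \<psi>)"
proof (induction w)
  case (Cons x w)
  obtain j c where x: "x = (j, c)" by (cases x)
  show ?case unfolding x rot_word.simps
    by (intro test_function_add test_function_rot test_function_mult smooth_const Cons)
qed simp

section \<open>Moving rotational fields onto Sobolev functions\<close>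

definition Lp_norm_pow :: "real \<Rightarrow> (complex \<times> complex \<Rightarrow> complex) \<Rightarrow> ennreal" where
  "Lp_norm_pow p f = (\<integral>\<^sup>+z. ennreal (cmod (f z) powr p) \<partial>MH)"

lemma powr_sum3_le:
  fixes x y z p :: real
  assumes "p > 0" "0 \<le> x" "0 \<le> y" "0 \<le> z"
  shows "(x + y + z) powr p \<le> 3 powr p * (x powr p + y powr p + z powr p)"
proof -
  define m where "m = max x (max y z)"
  have "(x + y + z) powr p \<le> (3 * m) powr p" using assms by (intro powr_mono2) (auto simp: m_def)
  also have "\<dots> = 3 powr p * m powr p" using assms by (simp add: powr_mult m_def le_max_iff_disj)
  also have "m powr p \<le> x powr p + y powr p + z powr p" by (auto simp: m_def max_def)
  finally show ?thesis by simp
qed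

lemma Lp_integrable:
  assumes "4 / 3 < p" "f \<in> borel_measurable MH" "Lp_norm_pow p f < \<infinity>"
  shows "integrable MH f"
  using div_integrable_imp_integrable[OF assms(2) Lp_div_integrable[OF assms(1,2)]] assms(3) by (simp add: Lp_norm_pow_def)

lemma integrable_mult_test:
  assumes "integrable MH f" "test_function HT \<psi>" shows "integrable MH (\<lambda>z. f z * \<psi> z)"
proof -
  obtain B where B: "B \<ge> 0" "\<And>z. cmod (\<psi> z) \<le> B" using test_function_bounded[OF assms(2)] by blast
  show ?thesis
  proof (rule Bochner_Integration.integrable_bound[where f="\<lambda>z. B * norm (f z)"])
    show "integrable MH (\<lambda>z. B * norm (f z))" by (intro integrable_mult_right integrable_norm assms)
    show "(\<lambda>z. f z * \<psi> z) \<in> borel_measurable MH"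
      using assms by (intro borel_measurable_times borel_measurable_integrable borel_measurable_MH test_function_measurable)
    show "AE z in MH. norm (f z * \<psi> z) \<le> norm (B * norm (f z))"
    proof (rule AE_I2)
      fix z
      have "cmod (f z) * cmod (\<psi> z) \<le> cmod (f z) * B" by (intro mult_left_mono B) auto
      then show "norm (f z * \<psi> z) \<le> norm (B * norm (f z))" using B by (simp add: norm_mult mult.commute)
    qed
  qed
qed

text \<open>The part of the membership of \<open>f\<close> in the Sobolev space that enters the estimates, with an upper bound
  \<open>I\<close> for the \<open>p\<close>-th powers of the norms. The weak derivatives \<open>g\<close> and the bound are parameters, so that
  constants can be chosen before \<open>f\<close>.\<close>

definition sobolev_data :: "nat \<Rightarrow> real \<Rightarrow> (complex \<times> complex \<Rightarrow> complex) \<Rightarrow> (multi_index \<Rightarrow> complex \<times> complex \<Rightarrow> complex) \<Rightarrow> ennreal \<Rightarrow> bool" where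
  "sobolev_data k p f g I \<longleftrightarrow> f \<in> borel_measurable MH \<and> Lp_norm_pow p f \<le> I \<and> I < \<infinity> \<and>
     (\<forall>\<alpha>. multi_order \<alpha> \<le> k \<longrightarrow> g \<alpha> \<in> borel_measurable MH \<and> Lp_norm_pow p (g \<alpha>) \<le> I \<and>
        (\<forall>\<phi>. test_function HT \<phi> \<longrightarrow> (LINT z|MH. f z * wirtinger_deriv \<alpha> \<phi> z) = (-1) ^ multi_order \<alpha> * (LINT z|MH. g \<alpha> z * \<phi> z)))"

lemma coord_measurable[measurable]: "coord j \<in> borel_measurable MH"
  by (intro borel_measurable_MH borel_measurable_continuous_onI smooth_continuous smooth_coord)

lemma coord_le_1: "z \<in> HT \<Longrightarrow> cmod (coord j z) \<le> 1"
  by (auto simp: coord_def hartogs_iff)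

text \<open>This is integration by parts for rotational fields against a Sobolev function. The induction takes the
  innermost field off the word: it commutes with the Wirtinger word \<open>l\<close> up to a multiple of it, and in
  divergence form it turns into one further Wirtinger derivative of \<open>\<zeta>\<^sub>j \<psi>\<close> and of \<open>\<zeta>\<^sub>j\<^sup>* \<psi>\<close>. In the end no
  field is left and the definition of weak derivatives applies; the coordinates become
  bounded coefficients of \<open>G\<close>.\<close>

theorem rotational_transfer:
  assumes p: "4 / 3 < p"
  shows "set l \<subseteq> {..<4} \<Longrightarrow> fst ` set w \<subseteq> {..<2} \<Longrightarrow> length w + length l \<le> k \<Longrightarrow>
    \<exists>C\<ge>0. \<forall>f g I. sobolev_data k p f g I \<longrightarrow> (\<exists>G. G \<in> borel_measurable MH \<and> Lp_norm_pow p G \<le> ennreal C * I \<and>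
      (\<forall>\<psi>. test_function HT \<psi> \<longrightarrow> (LINT z|MH. f z * rot_word w (wirt_word l \<psi>) z) = (LINT z|MH. G z * \<psi> z)))"
proof (induction w arbitrary: l rule: rev_induct)
  case Nil
  show ?case
  proof (intro exI[of _ 1] conjI allI impI)
    fix f g I assume s: "sobolev_data k p f g I"
    have o: "multi_order (multi_index_of l) = length l" using Nil by (intro multi_order_multi_index_of) auto
    then have le: "multi_order (multi_index_of l) \<le> k" using Nil by simp
    from s le have "g (multi_index_of l) \<in> borel_measurable MH \<and> Lp_norm_pow p (g (multi_index_of l)) \<le> I \<and>
      (\<forall>\<phi>. test_function HT \<phi> \<longrightarrow> (LINT z|MH. f z * wirtinger_deriv (multi_index_of l) \<phi> z) = (-1) ^ multi_order (multi_index_of l) * (LINT z|MH. g (multi_index_of l) z * \<phi> z))"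
      unfolding sobolev_data_def by blast
    then have g: "g (multi_index_of l) \<in> borel_measurable MH" "Lp_norm_pow p (g (multi_index_of l)) \<le> I"
      "\<And>\<phi>. test_function HT \<phi> \<Longrightarrow> (LINT z|MH. f z * wirtinger_deriv (multi_index_of l) \<phi> z) = (-1) ^ length l * (LINT z|MH. g (multi_index_of l) z * \<phi> z)"
      unfolding o by blast+
    define G where "G = (\<lambda>z. (-1) ^ length l * g (multi_index_of l) z)"
    show "\<exists>G. G \<in> borel_measurable MH \<and> Lp_norm_pow p G \<le> ennreal 1 * I \<and>
      (\<forall>\<psi>. test_function HT \<psi> \<longrightarrow> (LINT z|MH. f z * rot_word [] (wirt_word l \<psi>) z) = (LINT z|MH. G z * \<psi> z))"
    proof (intro exI[of _ G] conjI allI impI)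
      show "G \<in> borel_measurable MH" unfolding G_def using g(1) by measurable
      show "Lp_norm_pow p G \<le> ennreal 1 * I" using g(2) by (simp add: Lp_norm_pow_def G_def norm_mult norm_power)
      fix \<psi> assume \<psi>: "test_function HT \<psi>"
      show "(LINT z|MH. f z * rot_word [] (wirt_word l \<psi>) z) = (LINT z|MH. G z * \<psi> z)"
        using g(3)[OF \<psi>] Nil wirt_word_eq_wirtinger_deriv[OF test_function_smooth[OF \<psi>], of l] by (simp add: G_def mult.assoc)
    qed
  qed auto
next
  case (snoc x w)
  obtain j c where x: "x = (j, c)" by (cases x)
  have j: "j < 2" and w: "fst ` set w \<subseteq> {..<2}" using snoc.prems by (auto simp: x)
  obtain m :: complex where m: "\<And>\<psi> z. smooth \<psi> \<Longrightarrow> rot j (wirt_word l \<psi>) z = wirt_word l (rot j \<psi>) z + m * wirt_word l \<psi> z"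
    using rot_wirt_word[OF j snoc.prems(1)] by blast
  obtain C1 where C1: "C1 \<ge> 0" "\<And>f g I. sobolev_data k p f g I \<Longrightarrow> \<exists>G. G \<in> borel_measurable MH \<and> Lp_norm_pow p G \<le> ennreal C1 * I \<and>
      (\<forall>\<psi>. test_function HT \<psi> \<longrightarrow> (LINT z|MH. f z * rot_word w (wirt_word (l @ [j]) \<psi>) z) = (LINT z|MH. G z * \<psi> z))"
    using snoc.IH[of "l @ [j]"] snoc.prems j w by auto
  obtain C2 where C2: "C2 \<ge> 0" "\<And>f g I. sobolev_data k p f g I \<Longrightarrow> \<exists>G. G \<in> borel_measurable MH \<and> Lp_norm_pow p G \<le> ennreal C2 * I \<and>
      (\<forall>\<psi>. test_function HT \<psi> \<longrightarrow> (LINT z|MH. f z * rot_word w (wirt_word (l @ [j + 2]) \<psi>) z) = (LINT z|MH. G z * \<psi> z))"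
    using snoc.IH[of "l @ [j + 2]"] snoc.prems j w by auto
  obtain C3 where C3: "C3 \<ge> 0" "\<And>f g I. sobolev_data k p f g I \<Longrightarrow> \<exists>G. G \<in> borel_measurable MH \<and> Lp_norm_pow p G \<le> ennreal C3 * I \<and>
      (\<forall>\<psi>. test_function HT \<psi> \<longrightarrow> (LINT z|MH. f z * rot_word w (wirt_word l \<psi>) z) = (LINT z|MH. G z * \<psi> z))"
    using snoc.IH[of l] snoc.prems w by auto
  define e where "e = m + c"
  have decomp: "rot_word (w @ [x]) (wirt_word l \<psi>) = (\<lambda>z. rot_word w (wirt_word (l @ [j]) (\<lambda>z. coord j z * \<psi> z)) z
      - rot_word w (wirt_word (l @ [j + 2]) (\<lambda>z. cnj (coord j z) * \<psi> z)) z + e * rot_word w (wirt_word l \<psi>) z)" if \<psi>: "smooth \<psi>" for \<psi>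
  proof -
    define A where "A = wirt_word (l @ [j]) (\<lambda>z. coord j z * \<psi> z)"
    define B where "B = wirt_word (l @ [j + 2]) (\<lambda>z. cnj (coord j z) * \<psi> z)"
    have sA: "smooth A" and sB: "smooth B" unfolding A_def B_def by (intro smooth_wirt_word smooth_mult smooth_coord \<psi>)+
    have wirt_word_lin: "wirt_word l (\<lambda>z. 1 * f z + (-1) * g z) = (\<lambda>z. 1 * wirt_word l f z + (-1) * wirt_word l g z)" if "smooth f" "smooth g" for f g :: "complex \<times> complex \<Rightarrow> complex" and l
    proof (induction l)
      case (Cons i l)
      show ?case unfolding wirt_word_simps Cons
        by (rule ext) (rule wirt_lincomb[OF smooth_differentiable[OF smooth_wirt_word[OF that(1)]] smooth_differentiable[OF smooth_wirt_word[OF that(2)]]])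
    qed simp
    have "rot j \<psi> = (\<lambda>z. 1 * wirt j (\<lambda>z. coord j z * \<psi> z) z + (-1) * wirt (j + 2) (\<lambda>z. cnj (coord j z) * \<psi> z) z)"
      using rot_divergence[OF j \<psi>] by auto
    then have "wirt_word l (rot j \<psi>) = (\<lambda>z. 1 * A z + (-1) * B z)"
      using wirt_word_lin[of "wirt j (\<lambda>z. coord j z * \<psi> z)" "wirt (j + 2) (\<lambda>z. cnj (coord j z) * \<psi> z)" l]
      by (simp add: A_def B_def wirt_smooth smooth_mult smooth_coord \<psi>)
    then have "rot_word [x] (wirt_word l \<psi>) = (\<lambda>z. 1 * (1 * A z + (-1) * B z) + e * wirt_word l \<psi> z)"
      using m[OF \<psi>] by (auto simp: x e_def algebra_simps)
    then have "rot_word (w @ [x]) (wirt_word l \<psi>) = rot_word w (\<lambda>z. 1 * (1 * A z + (-1) * B z) + e * wirt_word l \<psi> z)"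
      by (simp only: rot_word_append)
    also have "\<dots> = (\<lambda>z. 1 * rot_word w (\<lambda>z. 1 * A z + (-1) * B z) z + e * rot_word w (wirt_word l \<psi>) z)"
      using smooth_add[OF smooth_cmult[OF sA, of 1] smooth_cmult[OF sB, of "-1"]] by (intro rot_word_lincomb smooth_wirt_word \<psi>)
    also have "rot_word w (\<lambda>z. 1 * A z + (-1) * B z) = (\<lambda>z. 1 * rot_word w A z + (-1) * rot_word w B z)"
      by (intro rot_word_lincomb sA sB)
    finally show ?thesis by (simp add: A_def B_def)
  qed
  show ?case
  proof (intro exI[of _ "3 powr p * (C1 + C2 + cmod e powr p * C3)"] conjI allI impI)
    show "0 \<le> 3 powr p * (C1 + C2 + cmod e powr p * C3)" using C1 C2 C3 by simp
    fix f g I assume s: "sobolev_data k p f g I"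
    have fm: "f \<in> borel_measurable MH" "Lp_norm_pow p f < \<infinity>" and I: "I < \<infinity>" using s by (auto simp: sobolev_data_def)
    have fi: "integrable MH f" by (rule Lp_integrable[OF p fm])
    obtain G1 where G1: "G1 \<in> borel_measurable MH" "Lp_norm_pow p G1 \<le> ennreal C1 * I"
      "\<And>\<psi>. test_function HT \<psi> \<Longrightarrow> (LINT z|MH. f z * rot_word w (wirt_word (l @ [j]) \<psi>) z) = (LINT z|MH. G1 z * \<psi> z)"
      using C1(2)[OF s] by blast
    obtain G2 where G2: "G2 \<in> borel_measurable MH" "Lp_norm_pow p G2 \<le> ennreal C2 * I"
      "\<And>\<psi>. test_function HT \<psi> \<Longrightarrow> (LINT z|MH. f z * rot_word w (wirt_word (l @ [j + 2]) \<psi>) z) = (LINT z|MH. G2 z * \<psi> z)"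
      using C2(2)[OF s] by blast
    obtain G3 where G3: "G3 \<in> borel_measurable MH" "Lp_norm_pow p G3 \<le> ennreal C3 * I"
      "\<And>\<psi>. test_function HT \<psi> \<Longrightarrow> (LINT z|MH. f z * rot_word w (wirt_word l \<psi>) z) = (LINT z|MH. G3 z * \<psi> z)"
      using C3(2)[OF s] by blast
    note [measurable] = G1(1) G2(1) G3(1)
    have fin: "ennreal C * I < \<infinity>" for C using I by (simp add: ennreal_mult_less_top)
    have Gi: "integrable MH G1" "integrable MH G2" "integrable MH G3"
      using G1 G2 G3 fin by (auto intro!: Lp_integrable[OF p] intro: le_less_trans)
    define G where "G = (\<lambda>z. coord j z * G1 z - cnj (coord j z) * G2 z + e * G3 z)"
    show "\<exists>G. G \<in> borel_measurable MH \<and> Lp_norm_pow p G \<le> ennreal (3 powr p * (C1 + C2 + cmod e powr p * C3)) * I \<and>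
      (\<forall>\<psi>. test_function HT \<psi> \<longrightarrow> (LINT z|MH. f z * rot_word (w @ [x]) (wirt_word l \<psi>) z) = (LINT z|MH. G z * \<psi> z))"
    proof (intro exI[of _ G] conjI allI impI)
      have [measurable]: "(\<lambda>z. cnj (coord j z)) \<in> borel_measurable MH"
        by (rule measurable_compose[OF coord_measurable cnj_measurable])
      show "G \<in> borel_measurable MH" unfolding G_def by measurable
      have "Lp_norm_pow p G \<le> (\<integral>\<^sup>+z. ennreal (3 powr p) * (ennreal (cmod (G1 z) powr p) + ennreal (cmod (G2 z) powr p) + ennreal (cmod e powr p) * ennreal (cmod (G3 z) powr p)) \<partial>MH)"
        unfolding Lp_norm_pow_def
      proof (rule nn_integral_mono)
        fix z assume "z \<in> space MH"
        then have z: "z \<in> HT" by simp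
        have "cmod (G z) \<le> cmod (coord j z) * cmod (G1 z) + cmod (coord j z) * cmod (G2 z) + cmod e * cmod (G3 z)"
          unfolding G_def by (intro order.trans[OF norm_triangle_ineq] add_mono order.trans[OF norm_triangle_ineq4]) (auto simp: norm_mult)
        also have "\<dots> \<le> 1 * cmod (G1 z) + 1 * cmod (G2 z) + cmod e * cmod (G3 z)"
          using coord_le_1[OF z, of j] by (intro add_mono mult_right_mono) auto
        finally have "cmod (G z) powr p \<le> (cmod (G1 z) + cmod (G2 z) + cmod e * cmod (G3 z)) powr p"
          using p by (intro powr_mono2) auto
        also have "\<dots> \<le> 3 powr p * (cmod (G1 z) powr p + cmod (G2 z) powr p + (cmod e * cmod (G3 z)) powr p)"
          using p by (intro powr_sum3_le) auto
        also have "(cmod e * cmod (G3 z)) powr p = cmod e powr p * cmod (G3 z) powr p" by (simp add: powr_mult)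
        finally have "ennreal (cmod (G z) powr p) \<le> ennreal (3 powr p * (cmod (G1 z) powr p + cmod (G2 z) powr p + cmod e powr p * cmod (G3 z) powr p))"
          by (rule ennreal_leI)
        then show "ennreal (cmod (G z) powr p) \<le> ennreal (3 powr p) * (ennreal (cmod (G1 z) powr p) + ennreal (cmod (G2 z) powr p) + ennreal (cmod e powr p) * ennreal (cmod (G3 z) powr p))"
          by (simp add: ennreal_mult)
      qed
      also have "\<dots> = ennreal (3 powr p) * (Lp_norm_pow p G1 + Lp_norm_pow p G2 + ennreal (cmod e powr p) * Lp_norm_pow p G3)"
        unfolding Lp_norm_pow_def by (simp add: nn_integral_cmult nn_integral_add)
      also have "\<dots> \<le> ennreal (3 powr p) * (ennreal C1 * I + ennreal C2 * I + ennreal (cmod e powr p) * (ennreal C3 * I))"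
        by (intro mult_left_mono add_mono G1 G2 G3) auto
      also have "\<dots> = ennreal (3 powr p * (C1 + C2 + cmod e powr p * C3)) * I"
        using C1(1) C2(1) C3(1) by (simp add: ennreal_mult algebra_simps)
      finally show "Lp_norm_pow p G \<le> ennreal (3 powr p * (C1 + C2 + cmod e powr p * C3)) * I" .
      fix \<psi> assume \<psi>: "test_function HT \<psi>"
      have t1: "test_function HT (\<lambda>z. coord j z * \<psi> z)" and t2: "test_function HT (\<lambda>z. cnj (coord j z) * \<psi> z)"
        by (intro test_function_mult smooth_coord \<psi>)+
      have "(LINT z|MH. f z * rot_word (w @ [x]) (wirt_word l \<psi>) z)
        = (LINT z|MH. f z * rot_word w (wirt_word (l @ [j]) (\<lambda>z. coord j z * \<psi> z)) z - f z * rot_word w (wirt_word (l @ [j + 2]) (\<lambda>z. cnj (coord j z) * \<psi> z)) z + e * (f z * rot_word w (wirt_word l \<psi>) z))"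
        unfolding decomp[OF test_function_smooth[OF \<psi>]] by (simp add: algebra_simps)
      also have "\<dots> = (LINT z|MH. f z * rot_word w (wirt_word (l @ [j]) (\<lambda>z. coord j z * \<psi> z)) z) - (LINT z|MH. f z * rot_word w (wirt_word (l @ [j + 2]) (\<lambda>z. cnj (coord j z) * \<psi> z)) z) + e * (LINT z|MH. f z * rot_word w (wirt_word l \<psi>) z)"
        using integrable_mult_test[OF fi test_function_rot_word[OF test_function_wirt_word[OF t1, of "l @ [j]"], of w]]
          integrable_mult_test[OF fi test_function_rot_word[OF test_function_wirt_word[OF t2, of "l @ [j + 2]"], of w]]
          integrable_mult_test[OF fi test_function_rot_word[OF test_function_wirt_word[OF \<psi>, of l], of w]]
        by (simp del: wirt_word_simps)
      also have "\<dots> = (LINT z|MH. G1 z * (coord j z * \<psi> z)) - (LINT z|MH. G2 z * (cnj (coord j z) * \<psi> z)) + e * (LINT z|MH. G3 z * \<psi> z)"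
        unfolding G1(3)[OF t1] G2(3)[OF t2] G3(3)[OF \<psi>] ..
      also have "\<dots> = (LINT z|MH. G1 z * (coord j z * \<psi> z) - G2 z * (cnj (coord j z) * \<psi> z) + e * (G3 z * \<psi> z))"
        using integrable_mult_test[OF Gi(1) t1] integrable_mult_test[OF Gi(2) t2] integrable_mult_test[OF Gi(3) \<psi>] by simp
      also have "\<dots> = (LINT z|MH. G z * \<psi> z)" by (simp add: G_def algebra_simps)
      finally show "(LINT z|MH. f z * rot_word (w @ [x]) (wirt_word l \<psi>) z) = (LINT z|MH. G z * \<psi> z)" .
    qed
  qed
qed

section \<open>Rotation invariant cutoffs\<close>

text \<open>The velocity of the rotation of the \<open>j\<close>-th coordinate.\<close>

definition rot_field :: "nat \<Rightarrow> complex \<times> complex \<Rightarrow> complex \<times> complex" where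
  "rot_field j z = (if j = 0 then (\<i> * fst z, 0) else (0, \<i> * snd z))"

lemma real_linear_pair:
  assumes L: "linear (L :: complex \<times> complex \<Rightarrow> complex)"
  shows "L (a, 0) = of_real (Re a) * L (1, 0) + of_real (Im a) * L (\<i>, 0)"
    and "L (0, a) = of_real (Re a) * L (0, 1) + of_real (Im a) * L (0, \<i>)"
proof -
  have "(a, 0) = Re a *\<^sub>R (1, 0) + Im a *\<^sub>R (\<i>, 0 :: complex)" by (simp add: complex_eq_iff)
  then show "L (a, 0) = of_real (Re a) * L (1, 0) + of_real (Im a) * L (\<i>, 0)"
    by (simp only: linear_add[OF L] linear_scale[OF L] scaleR_conv_of_real)
  have "(0, a) = Re a *\<^sub>R (0 :: complex, 1) + Im a *\<^sub>R (0, \<i>)" by (simp add: complex_eq_iff)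
  then show "L (0, a) = of_real (Re a) * L (0, 1) + of_real (Im a) * L (0, \<i>)"
    by (simp only: linear_add[OF L] linear_scale[OF L] scaleR_conv_of_real)
qed

text \<open>A real-linear map splits into a complex-linear and an antilinear part; inserting \<open>\<i> \<zeta>\<^sub>j\<close> changes the relative
  sign of the two.\<close>

lemma rot_eq_rot_field:
  assumes j: "j < 2" and f: "f differentiable (at z)"
  shows "rot j f z = - \<i> * frechet_derivative f (at z) (rot_field j z)"
proof -
  define L where "L = frechet_derivative f (at z)"
  have L: "linear L" unfolding L_def using f by (rule linear_frechet_derivative)
  have cc: "c = of_real (Re c) + \<i> * of_real (Im c)" "cnj c = of_real (Re c) - \<i> * of_real (Im c)" for c by (auto simp: complex_eq_iff)
  have key: "c * ((X - \<i> * Y) / 2) - cnj c * ((X + \<i> * Y) / 2) = - \<i> * (of_real (- Im c) * X + of_real (Re c) * Y)" for c X Y :: complex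
    by (subst cc(1), subst cc(2)) (simp add: field_simps)
  from j have "j = 0 \<or> j = Suc 0" by auto
  then show ?thesis
  proof
    assume j0: "j = 0"
    have "rot j f z = fst z * ((L (1, 0) - \<i> * L (\<i>, 0)) / 2) - cnj (fst z) * ((L (1, 0) + \<i> * L (\<i>, 0)) / 2)"
      by (simp add: j0 rot_def wirt_def wirtinger_def wirtinger_bar_def coord_def L_def)
    also have "\<dots> = - \<i> * L (\<i> * fst z, 0)"
      unfolding key real_linear_pair(1)[OF L, of "\<i> * fst z"] by simp
    finally show ?thesis by (simp add: j0 rot_field_def L_def)
  next
    assume j1: "j = Suc 0"
    have "rot j f z = snd z * ((L (0, 1) - \<i> * L (0, \<i>)) / 2) - cnj (snd z) * ((L (0, 1) + \<i> * L (0, \<i>)) / 2)"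
      by (simp add: j1 rot_def wirt_def wirtinger_def wirtinger_bar_def coord_def L_def)
    also have "\<dots> = - \<i> * L (0, \<i> * snd z)"
      unfolding key real_linear_pair(2)[OF L, of "\<i> * snd z"] by simp
    finally show ?thesis by (simp add: j1 rot_field_def L_def)
  qed
qed

lemma rot_invariant_eq_0:
  assumes j: "j < 2" and f: "f differentiable (at z)"
    and inv: "\<And>\<theta>. f (if j = 0 then (cis \<theta> * fst z, snd z) else (fst z, cis \<theta> * snd z)) = f z"
  shows "rot j f z = 0"
proof -
  define \<gamma> where "\<gamma> = (\<lambda>\<theta>. if j = 0 then (cis \<theta> * fst z, snd z) else (fst z, cis \<theta> * snd z))"
  have \<gamma>0: "\<gamma> 0 = z" by (simp add: \<gamma>_def)
  have c: "(cis has_derivative (\<lambda>h. of_real h * \<i>)) (at 0)"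
  proof -
    have "((\<lambda>z. exp (\<i> * z)) has_field_derivative \<i> * cis 0) (at (of_real 0))"
      by (auto intro!: derivative_eq_intros)
    from has_vector_derivative_real_field[OF this]
    have "(cis has_vector_derivative (\<i> * cis 0)) (at 0)" by (simp add: cis_conv_exp[abs_def])
    then show ?thesis by (simp add: has_vector_derivative_def scaleR_conv_of_real)
  qed
  have "(\<gamma> has_derivative (\<lambda>h. h *\<^sub>R rot_field j z)) (at 0)"
  proof (cases "j = 0")
    case True
    have "((\<lambda>\<theta>. (cis \<theta> * fst z, snd z)) has_derivative (\<lambda>h. (of_real h * \<i> * fst z, 0))) (at 0)"
      by (intro has_derivative_Pair has_derivative_mult_left c has_derivative_const)
    then show ?thesis using True by (simp add: \<gamma>_def[abs_def] rot_field_def scaleR_conv_of_real mult.assoc)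
  next
    case False
    have "((\<lambda>\<theta>. (fst z, cis \<theta> * snd z)) has_derivative (\<lambda>h. (0, of_real h * \<i> * snd z))) (at 0)"
      by (intro has_derivative_Pair has_derivative_mult_left c has_derivative_const)
    then show ?thesis using False by (simp add: \<gamma>_def[abs_def] rot_field_def scaleR_conv_of_real mult.assoc)
  qed
  moreover have fz: "(f has_derivative frechet_derivative f (at z)) (at (\<gamma> 0))"
    using f unfolding frechet_derivative_works \<gamma>0 .
  ultimately have "((\<lambda>\<theta>. f (\<gamma> \<theta>)) has_derivative (\<lambda>h. frechet_derivative f (at z) (h *\<^sub>R rot_field j z))) (at 0)"
    by (rule has_derivative_compose)
  moreover have "(\<lambda>\<theta>. f (\<gamma> \<theta>)) = (\<lambda>\<theta>. f z)" using inv by (simp add: \<gamma>_def fun_eq_iff)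
  ultimately have "((\<lambda>\<theta>::real. f z) has_derivative (\<lambda>h. frechet_derivative f (at z) (h *\<^sub>R rot_field j z))) (at 0)" by simp
  from has_derivative_unique[OF this has_derivative_const]
  have "frechet_derivative f (at z) (1 *\<^sub>R rot_field j z) = 0" by metis
  then show ?thesis using rot_eq_rot_field[OF j f] by simp
qed

text \<open>The cutoff functions depend on the moduli only. The shift by \<open>1\<close> inside the flat functions puts the support
  into the compact set where \<open>\<bar>z\<^sub>2\<bar>\<^sup>2 - \<bar>z\<^sub>1\<bar>\<^sup>2\<close> and \<open>1 - \<bar>z\<^sub>2\<bar>\<^sup>2\<close> are at least \<open>1 / (n + 1)\<close>.\<close>

definition cutoff :: "nat \<Rightarrow> complex \<times> complex \<Rightarrow> complex" where
  "cutoff n z = of_real (flat 1 (real (Suc n) * ((cmod (snd z))\<^sup>2 - (cmod (fst z))\<^sup>2) - 1)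
     * flat 1 (real (Suc n) * (1 - (cmod (snd z))\<^sup>2) - 1))"

lemma smooth_norm_square:
  assumes "smooth f" shows "smooth (\<lambda>z. (cmod (f z))\<^sup>2)"
proof -
  have "(\<lambda>z. (cmod (f z))\<^sup>2) = (\<lambda>z. Re (f z * cnj (f z)))"
    by (rule ext) (simp only: complex_norm_square[symmetric] Re_complex_of_real)
  then show ?thesis by (simp only:) (intro smooth_Re smooth_mult smooth_cnj assms)
qed

lemma test_function_cutoff: "test_function HT (cutoff n)"
proof (rule test_functionI)
  define K where "K = {z::complex \<times> complex. 1 / real (Suc n) \<le> (cmod (snd z))\<^sup>2 - (cmod (fst z))\<^sup>2 \<and> 1 / real (Suc n) \<le> 1 - (cmod (snd z))\<^sup>2}"
  show "smooth (cutoff n)" unfolding cutoff_def[abs_def]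
    by (intro smooth_of_real smooth_mult smooth_flat_compose smooth_diff smooth_const smooth_norm_square smooth_fst smooth_snd)
  have sub: "K \<subseteq> HT"
  proof
    fix z assume z: "z \<in> K"
    have pos: "0 < 1 / real (Suc n)" by simp
    have b: "1 / real (Suc n) \<le> (cmod (snd z))\<^sup>2 - (cmod (fst z))\<^sup>2" "1 / real (Suc n) \<le> 1 - (cmod (snd z))\<^sup>2"
      using z unfolding K_def by blast+
    have "(cmod (fst z))\<^sup>2 < (cmod (snd z))\<^sup>2" "(cmod (snd z))\<^sup>2 < 1\<^sup>2"
      using less_le_trans[OF pos b(1)] less_le_trans[OF pos b(2)] by simp_all
    then show "z \<in> HT" by (auto simp: hartogs_iff intro: power2_less_imp_less)
  qed
  have cl: "closed K" unfolding K_def by (intro closed_Collect_conj closed_Collect_le continuous_intros)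
  have "K \<subseteq> cball 0 1 \<times> cball 0 1" using sub by (auto simp: hartogs_iff)
  then have "bounded K" by (rule bounded_subset[rotated]) (intro bounded_Times bounded_cball)
  with cl show "compact K" by (simp add: compact_eq_bounded_closed)
  show "K \<subseteq> HT" by (rule sub)
  show "cutoff n z = 0" if "z \<notin> K" for z
  proof -
    have "real (Suc n) * ((cmod (snd z))\<^sup>2 - (cmod (fst z))\<^sup>2) - 1 < 0 \<or> real (Suc n) * (1 - (cmod (snd z))\<^sup>2) - 1 < 0"
      using that unfolding K_def by (auto simp: field_simps not_le)
    then show ?thesis by (auto simp: cutoff_def flat_def)
  qed
qed

lemma rot_cutoff: "j < 2 \<Longrightarrow> rot j (cutoff n) z = 0"
  by (rule rot_invariant_eq_0) (auto intro!: smooth_differentiable test_function_smooth[OF test_function_cutoff] simp: cutoff_def norm_mult)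

lemma cutoff_tendsto: "z \<in> HT \<Longrightarrow> (\<lambda>n. cutoff n z) \<longlonglongrightarrow> 1"
proof -
  assume z: "z \<in> HT"
  have 1: "0 < (cmod (snd z))\<^sup>2 - (cmod (fst z))\<^sup>2" "0 < 1 - (cmod (snd z))\<^sup>2"
    using z power_strict_mono[of "cmod (fst z)" "cmod (snd z)" 2] by (auto simp: hartogs_iff power_less_one_iff abs_square_less_1)
  have "(\<lambda>n. cutoff n z) \<longlonglongrightarrow> of_real (1 * 1)" unfolding cutoff_def
    by (intro tendsto_of_real tendsto_mult LIMSEQ_Suc[OF flat_1_tendsto] 1)
  then show ?thesis by simp
qed

lemma cutoff_norm_le: "cmod (cutoff n z) \<le> 1"
  by (simp only: cutoff_def norm_of_real) (simp add: abs_mult flat_1_bounds mult_le_one)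

section \<open>Rotational words acting on the kernel\<close>

text \<open>The derivative \<open>z\<^sub>1\<^sup>a z\<^sub>2\<^sup>b \<partial>\<^sub>1\<^sup>a \<partial>\<^sub>2\<^sup>b\<close> of the kernel. In contrast to \<open>kernel_deriv\<close> it depends on the products
  \<open>z\<^sub>j \<zeta>\<^sub>j\<^sup>*\<close> only.\<close>

definition scaled_kernel_deriv :: "nat \<Rightarrow> nat \<Rightarrow> complex \<times> complex \<Rightarrow> complex \<times> complex \<Rightarrow> complex" where
  "scaled_kernel_deriv a b z \<zeta> = fst z ^ a * snd z ^ b * kernel_deriv a b z \<zeta>"

lemma scaled_kernel_deriv_eq: "scaled_kernel_deriv a b z \<zeta> = fst (conj_prod z \<zeta>) ^ a * snd (conj_prod z \<zeta>) ^ b * base_kernel_d a b (conj_prod z \<zeta>)"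
  by (simp add: scaled_kernel_deriv_def kernel_deriv_def power_mult_distrib)

lemma has_cderiv_fst: "has_cderiv fst 1 0 q" and has_cderiv_snd: "has_cderiv snd 0 1 q"
  unfolding has_cderiv_def by (auto intro!: derivative_eq_intros)

lemma scaled_kernel_deriv_derivative:
  assumes z: "z \<in> HT" and \<zeta>: "\<zeta> \<in> HT"
  shows "\<exists>A B. has_cderiv (\<lambda>q. fst q ^ a * snd q ^ b * base_kernel_d a b q) A B (conj_prod z \<zeta>)
     \<and> (b = 0 \<longrightarrow> fst (conj_prod z \<zeta>) * A = of_nat a * scaled_kernel_deriv a 0 z \<zeta> + scaled_kernel_deriv (Suc a) 0 z \<zeta>)
     \<and> snd (conj_prod z \<zeta>) * B = of_nat b * scaled_kernel_deriv a b z \<zeta> + scaled_kernel_deriv a (Suc b) z \<zeta>"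
proof -
  define q where "q = conj_prod z \<zeta>"
  have q: "q \<in> HT" unfolding q_def by (rule conj_prod_hartogs[OF z \<zeta>])
  obtain c where c: "has_cderiv (base_kernel_d a b) (c q) (base_kernel_d a (Suc b) q) q" using base_kernel_d_derivative_snd[of a b] q by blast
  obtain c' where c': "has_cderiv (base_kernel_d a 0) (base_kernel_d (Suc a) 0 q) (c' q) q" using base_kernel_d_derivative_fst[of a] q by blast
  have pw: "x * (of_nat n * x ^ (n - 1)) = of_nat n * x ^ n" for x :: complex and n by (cases n) auto
  define P where "P = (if b = 0 then base_kernel_d (Suc a) 0 q else c q)"
  have k: "has_cderiv (base_kernel_d a b) P (base_kernel_d a (Suc b) q) q"
  proof (cases "b = 0")
    case True
    have "(\<lambda>v. c q * fst v + base_kernel_d a (Suc b) q * snd v) = (\<lambda>v. base_kernel_d (Suc a) 0 q * fst v + c' q * snd v)"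
      using has_derivative_unique[OF c[unfolded has_cderiv_def]] c'[unfolded has_cderiv_def] True by simp
    from fun_cong[OF this, of "(1, 0)"] have "c q = base_kernel_d (Suc a) 0 q" by simp
    then show ?thesis using c True by (simp add: P_def)
  qed (use c in \<open>simp add: P_def\<close>)
  note D = has_cderiv_mult[OF has_cderiv_mult[OF has_cderiv_power[OF has_cderiv_fst, of a q] has_cderiv_power[OF has_cderiv_snd, of b q]] k]
  show ?thesis
    unfolding scaled_kernel_deriv_eq q_def[symmetric]
  proof (intro exI conjI impI, rule D)
    assume "b = 0"
    then show "fst q * ((of_nat a * fst q ^ (a - 1) * 1 * snd q ^ b + fst q ^ a * (of_nat b * snd q ^ (b - 1) * 0)) * base_kernel_d a b q + fst q ^ a * snd q ^ b * P)
      = of_nat a * (fst q ^ a * snd q ^ 0 * base_kernel_d a 0 q) + fst q ^ Suc a * snd q ^ 0 * base_kernel_d (Suc a) 0 q"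
      using pw[of "fst q" a] by (auto simp: P_def algebra_simps simp del: base_kernel_d.simps)
  next
    show "snd q * ((of_nat a * fst q ^ (a - 1) * 0 * snd q ^ b + fst q ^ a * (of_nat b * snd q ^ (b - 1) * 1)) * base_kernel_d a b q + fst q ^ a * snd q ^ b * base_kernel_d a (Suc b) q)
      = of_nat b * (fst q ^ a * snd q ^ b * base_kernel_d a b q) + fst q ^ a * snd q ^ Suc b * base_kernel_d a (Suc b) q"
      using pw[of "snd q" b] by (auto simp: algebra_simps simp del: base_kernel_d.simps)
  qed
qed

text \<open>As functions of \<open>\<zeta>\<close> these are antiholomorphic, so \<open>T\<^sub>j\<close> reduces to \<open>- \<zeta>\<^sub>j\<^sup>* \<partial>\<^sub>j\<^sup>*\<close>, the Euler field in
  the \<open>j\<close>-th product up to sign: \<open>x \<partial>\<^sub>x (x\<^sup>a k) = a x\<^sup>a k + x\<^sup>a\<^sup>+\<^sup>1 \<partial>\<^sub>x k\<close>.\<close>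

lemma rot_scaled_kernel_deriv:
  assumes z: "z \<in> HT" and \<zeta>: "\<zeta> \<in> HT"
  shows "rot 0 (\<lambda>\<zeta>. scaled_kernel_deriv a 0 z \<zeta>) \<zeta> = - (of_nat a * scaled_kernel_deriv a 0 z \<zeta> + scaled_kernel_deriv (Suc a) 0 z \<zeta>)"
    and "rot (Suc 0) (\<lambda>\<zeta>. scaled_kernel_deriv a b z \<zeta>) \<zeta> = - (of_nat b * scaled_kernel_deriv a b z \<zeta> + scaled_kernel_deriv a (Suc b) z \<zeta>)"
    and "(\<lambda>\<zeta>. scaled_kernel_deriv a b z \<zeta>) differentiable (at \<zeta>)"
proof -
  have D: "((\<lambda>\<zeta>. scaled_kernel_deriv a b z \<zeta>) has_derivative (\<lambda>v. A * fst z * cnj (fst v) + B * snd z * cnj (snd v))) (at \<zeta>)"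
    if "has_cderiv (\<lambda>q. fst q ^ a * snd q ^ b * base_kernel_d a b q) A B (conj_prod z \<zeta>)" for a b A B
    using has_cderiv_imp_conj_prod_right[OF that] by (simp only: scaled_kernel_deriv_eq)
  obtain A B where AB: "has_cderiv (\<lambda>q. fst q ^ a * snd q ^ 0 * base_kernel_d a 0 q) A B (conj_prod z \<zeta>)"
    "fst (conj_prod z \<zeta>) * A = of_nat a * scaled_kernel_deriv a 0 z \<zeta> + scaled_kernel_deriv (Suc a) 0 z \<zeta>"
    using scaled_kernel_deriv_derivative[OF z \<zeta>, of a 0] by auto
  show "rot 0 (\<lambda>\<zeta>. scaled_kernel_deriv a 0 z \<zeta>) \<zeta> = - (of_nat a * scaled_kernel_deriv a 0 z \<zeta> + scaled_kernel_deriv (Suc a) 0 z \<zeta>)"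
    unfolding AB(2)[symmetric] using wirt_antiholomorphic[OF D[OF AB(1)]] by (simp add: rot_def coord_def numeral_2_eq_2)
  obtain A B where AB: "has_cderiv (\<lambda>q. fst q ^ a * snd q ^ b * base_kernel_d a b q) A B (conj_prod z \<zeta>)"
    "snd (conj_prod z \<zeta>) * B = of_nat b * scaled_kernel_deriv a b z \<zeta> + scaled_kernel_deriv a (Suc b) z \<zeta>"
    using scaled_kernel_deriv_derivative[OF z \<zeta>, of a b] by auto
  show "rot (Suc 0) (\<lambda>\<zeta>. scaled_kernel_deriv a b z \<zeta>) \<zeta> = - (of_nat b * scaled_kernel_deriv a b z \<zeta> + scaled_kernel_deriv a (Suc b) z \<zeta>)"
    unfolding AB(2)[symmetric] using wirt_antiholomorphic[OF D[OF AB(1)]] by (simp add: rot_def coord_def numeral_3_eq_3)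
  show "(\<lambda>\<zeta>. scaled_kernel_deriv a b z \<zeta>) differentiable (at \<zeta>)" using D[OF AB(1)] unfolding differentiable_def by blast
qed

primrec word_fst :: "nat \<Rightarrow> (nat \<times> complex) list" where
  "word_fst 0 = []" | "word_fst (Suc a) = (0, of_nat a) # word_fst a"

text \<open>Up to sign this composes the operators that raise \<open>a\<close> and \<open>b\<close> step by step: \<open>T\<^sub>1 + a\<close>
  sends the scaled derivative of order \<open>a\<close> to minus the one of order \<open>a + 1\<close>.\<close>

primrec word_both :: "nat \<Rightarrow> nat \<Rightarrow> (nat \<times> complex) list" where
  "word_both a 0 = word_fst a" | "word_both a (Suc b) = (Suc 0, of_nat b) # word_both a b"

lemma length_word_both: "length (word_both a b) = a + b"
proof -
  have "length (word_fst a) = a" by (induction a) auto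
  then show ?thesis by (induction b) auto
qed

lemma fst_word_both: "fst ` set (word_both a b) \<subseteq> {..<2}"
proof -
  have "fst ` set (word_fst a) \<subseteq> {..<2}" by (induction a) auto
  then show ?thesis by (induction b) auto
qed

lemma rot_cutoff_mult:
  assumes "j < 2" "h differentiable (at \<zeta>)"
  shows "rot j (\<lambda>\<zeta>. cutoff n \<zeta> * h \<zeta>) \<zeta> = cutoff n \<zeta> * rot j h \<zeta>"
  using rot_mult[OF smooth_differentiable[OF test_function_smooth[OF test_function_cutoff]] assms(2)] rot_cutoff[OF assms(1)] by simp

text \<open>The fields do not see the cutoff function and act on the kernel only.\<close>

lemma rot_word_word_both_kernel:
  assumes z: "z \<in> HT"
  shows "\<zeta> \<in> HT \<Longrightarrow> rot_word (word_both a b) (\<lambda>\<zeta>. cutoff n \<zeta> * base_kernel (conj_prod z \<zeta>)) \<zeta> = (-1) ^ (a + b) * (cutoff n \<zeta> * scaled_kernel_deriv a b z \<zeta>)"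
proof (induction b arbitrary: \<zeta>)
  case 0
  have "\<zeta> \<in> HT \<Longrightarrow> rot_word (word_fst a) (\<lambda>\<zeta>. cutoff n \<zeta> * base_kernel (conj_prod z \<zeta>)) \<zeta> = (-1) ^ a * (cutoff n \<zeta> * scaled_kernel_deriv a 0 z \<zeta>)" for \<zeta>
  proof (induction a arbitrary: \<zeta>)
    case 0 then show ?case by (simp add: scaled_kernel_deriv_def kernel_deriv_def)
  next
    case (Suc a)
    define F where "F = (\<lambda>\<zeta>. cutoff n \<zeta> * scaled_kernel_deriv a 0 z \<zeta>)"
    have Fd: "F differentiable (at \<zeta>)" unfolding F_def
      by (intro differentiable_mult smooth_differentiable[OF test_function_smooth[OF test_function_cutoff]] rot_scaled_kernel_deriv(3)[OF z Suc.prems])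
    have "rot 0 (rot_word (word_fst a) (\<lambda>\<zeta>. cutoff n \<zeta> * base_kernel (conj_prod z \<zeta>))) \<zeta> = rot 0 (\<lambda>\<zeta>. (-1) ^ a * F \<zeta> + 0 * F \<zeta>) \<zeta>"
      by (rule rot_cong_open[OF open_hartogs Suc.prems]) (simp add: Suc.IH F_def)
    also have "\<dots> = (-1) ^ a * rot 0 F \<zeta>" by (subst rot_lincomb[OF Fd Fd]) simp
    also have "rot 0 F \<zeta> = cutoff n \<zeta> * - (of_nat a * scaled_kernel_deriv a 0 z \<zeta> + scaled_kernel_deriv (Suc a) 0 z \<zeta>)"
      unfolding F_def using rot_cutoff_mult[OF _ rot_scaled_kernel_deriv(3)[OF z Suc.prems], of 0] rot_scaled_kernel_deriv(1)[OF z Suc.prems] by simp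
    finally show ?case using Suc.IH[OF Suc.prems] by (simp add: algebra_simps)
  qed
  then show ?case using 0 by simp
next
  case (Suc b)
  define F where "F = (\<lambda>\<zeta>. cutoff n \<zeta> * scaled_kernel_deriv a b z \<zeta>)"
  have Fd: "F differentiable (at \<zeta>)" unfolding F_def
    by (intro differentiable_mult smooth_differentiable[OF test_function_smooth[OF test_function_cutoff]] rot_scaled_kernel_deriv(3)[OF z Suc.prems])
  have "rot (Suc 0) (rot_word (word_both a b) (\<lambda>\<zeta>. cutoff n \<zeta> * base_kernel (conj_prod z \<zeta>))) \<zeta> = rot (Suc 0) (\<lambda>\<zeta>. (-1) ^ (a + b) * F \<zeta> + 0 * F \<zeta>) \<zeta>"
    by (rule rot_cong_open[OF open_hartogs Suc.prems]) (simp add: Suc.IH F_def)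
  also have "\<dots> = (-1) ^ (a + b) * rot (Suc 0) F \<zeta>" by (subst rot_lincomb[OF Fd Fd]) simp
  also have "rot (Suc 0) F \<zeta> = cutoff n \<zeta> * - (of_nat b * scaled_kernel_deriv a b z \<zeta> + scaled_kernel_deriv a (Suc b) z \<zeta>)"
    unfolding F_def using rot_cutoff_mult[OF _ rot_scaled_kernel_deriv(3)[OF z Suc.prems], of "Suc 0"] rot_scaled_kernel_deriv(2)[OF z Suc.prems] by simp
  finally show ?case using Suc.IH[OF Suc.prems] by (simp add: algebra_simps)
qed

text \<open>The scaled derivative of the kernel, cut off, is a rotational word applied to a test function. The
  transfer lemma moves the word onto \<open>f\<close>, and the cutoff is removed by dominated convergence on
  both sides.\<close>

theorem weighted_derivative_eq_projection:
  assumes p: "4 / 3 < p" and k: "a + b \<le> k"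
  shows "\<exists>C\<ge>0. \<forall>f g I. sobolev_data k p f g I \<longrightarrow> (\<exists>G. G \<in> borel_measurable MH \<and> Lp_norm_pow p G \<le> ennreal C * I \<and>
      (\<forall>z\<in>HT. fst z ^ a * snd z ^ b * proj_deriv a b f z = proj_deriv 0 0 G z))"
proof -
  obtain C where C: "C \<ge> 0" "\<And>f g I. sobolev_data k p f g I \<Longrightarrow> \<exists>G. G \<in> borel_measurable MH \<and> Lp_norm_pow p G \<le> ennreal C * I \<and>
      (\<forall>\<psi>. test_function HT \<psi> \<longrightarrow> (LINT z|MH. f z * rot_word (word_both a b) (wirt_word [] \<psi>) z) = (LINT z|MH. G z * \<psi> z))"
    using rotational_transfer[OF p, of "[]" "word_both a b" k] k fst_word_both length_word_both by auto
  show ?thesis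
  proof (intro exI[of _ C] conjI allI impI)
    show "0 \<le> C" by fact
    fix f g I assume s: "sobolev_data k p f g I"
    have fm: "f \<in> borel_measurable MH" "Lp_norm_pow p f < \<infinity>" and I: "I < \<infinity>" using s by (auto simp: sobolev_data_def)
    have fd: "integrable MH (\<lambda>z. cmod (f z) / cmod (snd z))" using Lp_div_integrable[OF p fm(1)] fm(2) by (simp add: Lp_norm_pow_def)
    obtain G where G: "G \<in> borel_measurable MH" "Lp_norm_pow p G \<le> ennreal C * I"
      "\<And>\<psi>. test_function HT \<psi> \<Longrightarrow> (LINT z|MH. f z * rot_word (word_both a b) \<psi> z) = (LINT z|MH. G z * \<psi> z)"
      using C(2)[OF s] by auto
    have "Lp_norm_pow p G < \<infinity>" using G(2) I by (auto intro: le_less_trans simp: ennreal_mult_less_top)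
    then have Gd: "integrable MH (\<lambda>z. cmod (G z) / cmod (snd z))" using Lp_div_integrable[OF p G(1)] by (simp add: Lp_norm_pow_def)
    define H where "H = (\<lambda>z. (-1) ^ (a + b) * G z)"
    show "\<exists>G. G \<in> borel_measurable MH \<and> Lp_norm_pow p G \<le> ennreal C * I \<and> (\<forall>z\<in>HT. fst z ^ a * snd z ^ b * proj_deriv a b f z = proj_deriv 0 0 G z)"
    proof (intro exI[of _ H] conjI ballI)
      show "H \<in> borel_measurable MH" unfolding H_def using G(1) by measurable
      show "Lp_norm_pow p H \<le> ennreal C * I" using G(2) by (simp add: Lp_norm_pow_def H_def norm_mult norm_power)
      fix z assume z: "z \<in> HT"
      have cm: "cutoff n \<in> borel_measurable MH" for n by (intro borel_measurable_MH test_function_measurable[OF test_function_cutoff])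
      have ti: "test_function HT (\<lambda>\<zeta>. cutoff n \<zeta> * base_kernel (conj_prod z \<zeta>))" for n
        by (intro test_function_mult_local open_hartogs test_function_cutoff smooth_on_conj_prod_right[OF kernel_class_base_kernel z])
      have lim: "(\<lambda>n. LINT \<zeta>|MH. cutoff n \<zeta> * F \<zeta>) \<longlonglongrightarrow> (LINT \<zeta>|MH. F \<zeta>)" if F: "integrable MH F" for F
      proof (rule integral_dominated_convergence[where w="\<lambda>\<zeta>. norm (F \<zeta>)"])
        show "AE \<zeta> in MH. (\<lambda>n. cutoff n \<zeta> * F \<zeta>) \<longlonglongrightarrow> F \<zeta>"
        proof (rule AE_I2)
          fix \<zeta> assume "\<zeta> \<in> space MH"
          then have "(\<lambda>n. cutoff n \<zeta> * F \<zeta>) \<longlonglongrightarrow> 1 * F \<zeta>" by (intro tendsto_mult cutoff_tendsto tendsto_const) simp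
          then show "(\<lambda>n. cutoff n \<zeta> * F \<zeta>) \<longlonglongrightarrow> F \<zeta>" by simp
        qed
        show "AE \<zeta> in MH. norm (cutoff n \<zeta> * F \<zeta>) \<le> norm (F \<zeta>)" for n
          using cutoff_norm_le[of n] by (intro AE_I2) (simp add: norm_mult mult_left_le_one_le)
      qed (use F cm in auto)
      have i1: "integrable MH (\<lambda>\<zeta>. scaled_kernel_deriv a b z \<zeta> * f \<zeta>)"
        using integrable_mult_right[OF kernel_deriv_mult_integrable[OF fm(1) fd z, of a b], of "fst z ^ a * snd z ^ b"]
        by (simp add: scaled_kernel_deriv_def mult.assoc)
      have i2: "integrable MH (\<lambda>\<zeta>. kernel_deriv 0 0 z \<zeta> * G \<zeta>)" by (rule kernel_deriv_mult_integrable[OF G(1) Gd z])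
      have eq: "(-1) ^ (a + b) * (LINT \<zeta>|MH. cutoff n \<zeta> * (scaled_kernel_deriv a b z \<zeta> * f \<zeta>)) = (LINT \<zeta>|MH. cutoff n \<zeta> * (kernel_deriv 0 0 z \<zeta> * G \<zeta>))" for n
      proof -
        have "(-1) ^ (a + b) * (LINT \<zeta>|MH. cutoff n \<zeta> * (scaled_kernel_deriv a b z \<zeta> * f \<zeta>)) = (LINT \<zeta>|MH. (-1) ^ (a + b) * (cutoff n \<zeta> * (scaled_kernel_deriv a b z \<zeta> * f \<zeta>)))"
          by (rule integral_mult_right_zero[symmetric])
        also have "\<dots> = (LINT \<zeta>|MH. f \<zeta> * rot_word (word_both a b) (\<lambda>\<zeta>. cutoff n \<zeta> * base_kernel (conj_prod z \<zeta>)) \<zeta>)"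
          by (rule Bochner_Integration.integral_cong[OF refl]) (simp add: rot_word_word_both_kernel[OF z])
        also have "\<dots> = (LINT \<zeta>|MH. G \<zeta> * (cutoff n \<zeta> * base_kernel (conj_prod z \<zeta>)))" by (rule G(3)[OF ti])
        also have "\<dots> = (LINT \<zeta>|MH. cutoff n \<zeta> * (kernel_deriv 0 0 z \<zeta> * G \<zeta>))"
          by (rule Bochner_Integration.integral_cong[OF refl]) (simp add: kernel_deriv_def)
        finally show ?thesis .
      qed
      have "(\<lambda>n. (-1) ^ (a + b) * (LINT \<zeta>|MH. cutoff n \<zeta> * (scaled_kernel_deriv a b z \<zeta> * f \<zeta>))) \<longlonglongrightarrow> (-1) ^ (a + b) * (LINT \<zeta>|MH. scaled_kernel_deriv a b z \<zeta> * f \<zeta>)"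
        by (intro tendsto_mult tendsto_const lim[OF i1])
      then have "(-1) ^ (a + b) * (LINT \<zeta>|MH. scaled_kernel_deriv a b z \<zeta> * f \<zeta>) = (LINT \<zeta>|MH. kernel_deriv 0 0 z \<zeta> * G \<zeta>)"
        unfolding eq using lim[OF i2] by (rule LIMSEQ_unique)
      then have "(-1) ^ (a + b) * ((-1) ^ (a + b) * (LINT \<zeta>|MH. scaled_kernel_deriv a b z \<zeta> * f \<zeta>)) = (-1) ^ (a + b) * (LINT \<zeta>|MH. kernel_deriv 0 0 z \<zeta> * G \<zeta>)" by simp
      then have "(LINT \<zeta>|MH. scaled_kernel_deriv a b z \<zeta> * f \<zeta>) = (-1) ^ (a + b) * (LINT \<zeta>|MH. kernel_deriv 0 0 z \<zeta> * G \<zeta>)"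
        by (simp add: power_mult_distrib[symmetric] flip: mult.assoc)
      moreover have "(LINT \<zeta>|MH. scaled_kernel_deriv a b z \<zeta> * f \<zeta>) = fst z ^ a * snd z ^ b * proj_deriv a b f z"
        unfolding proj_deriv_def scaled_kernel_deriv_def by (simp only: mult.assoc integral_mult_right_zero)
      moreover have "(-1) ^ (a + b) * (LINT \<zeta>|MH. kernel_deriv 0 0 z \<zeta> * G \<zeta>) = proj_deriv 0 0 H z"
        unfolding proj_deriv_def H_def by (simp only: mult.left_commute[of "kernel_deriv 0 0 z _"] integral_mult_right_zero)
      ultimately show "fst z ^ a * snd z ^ b * proj_deriv a b f z = proj_deriv 0 0 H z" by simp
    qed
  qed
qed

section \<open>Boundedness of the projection on \<open>L\<^sup>p\<close>\<close>

text \<open>Schur's test with the exponents \<open>1/p\<close> and \<open>1/q\<close>; both lie between \<open>1/4\<close> and \<open>3/4\<close>.\<close>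

lemma projection_Lp_bound:
  assumes p: "4 / 3 < p" "p < 4"
  shows "\<exists>C\<ge>0. \<forall>G. G \<in> borel_measurable MH \<longrightarrow> Lp_norm_pow p (proj_deriv 0 0 G) \<le> ennreal C * Lp_norm_pow p G"
proof -
  define q where "q = p / (p - 1)"
  have pq: "p > 1" "q > 1" "1 / p + 1 / q = 1" using p by (auto simp: q_def field_simps)
  have r1: "1 / 4 < 1 / p" "1 / p < 3 / 4" using p by (auto simp: field_simps)
  have r2: "1 / 4 < 1 / q" "1 / q < 3 / 4" using r1 pq(3) by linarith+
  obtain C1 where C1: "C1 > 0" "\<And>z. z \<in> HT \<Longrightarrow> (\<integral>\<^sup>+\<zeta>. ennreal (cmod (hartogs_kernel z \<zeta>) * \<Theta> \<zeta> powr (- (1 / p))) * indicator HT \<zeta> \<partial>lborel) \<le> ennreal (C1 * \<Theta> z powr (- (1 / p)))"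
    using hartogs_Schur[OF r1] by blast
  obtain C2 where C2: "C2 > 0" "\<And>z. z \<in> HT \<Longrightarrow> (\<integral>\<^sup>+\<zeta>. ennreal (cmod (hartogs_kernel z \<zeta>) * \<Theta> \<zeta> powr (- (1 / q))) * indicator HT \<zeta> \<partial>lborel) \<le> ennreal (C2 * \<Theta> z powr (- (1 / q)))"
    using hartogs_Schur[OF r2] by blast
  define C where "C = max C1 C2"
  have C: "C > 0" using C1 by (simp add: C_def less_max_iff_disj)
  have s: "(\<integral>\<^sup>+\<zeta>. ennreal (cmod (hartogs_kernel z \<zeta>) * \<Theta> \<zeta> powr (- r)) \<partial>MH) \<le> ennreal (C * \<Theta> z powr (- r))"
    if "(\<integral>\<^sup>+\<zeta>. ennreal (cmod (hartogs_kernel z \<zeta>) * \<Theta> \<zeta> powr (- r)) * indicator HT \<zeta> \<partial>lborel) \<le> ennreal (D * \<Theta> z powr (- r))" "D \<le> C" for D z r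
  proof -
    have "(\<integral>\<^sup>+\<zeta>. ennreal (cmod (hartogs_kernel z \<zeta>) * \<Theta> \<zeta> powr (- r)) \<partial>MH) = (\<integral>\<^sup>+\<zeta>. ennreal (cmod (hartogs_kernel z \<zeta>) * \<Theta> \<zeta> powr (- r)) * indicator HT \<zeta> \<partial>lborel)"
      by (rule nn_integral_lebesgue_on) measurable
    also have "\<dots> \<le> ennreal (D * \<Theta> z powr (- r))" by fact
    also have "\<dots> \<le> ennreal (C * \<Theta> z powr (- r))" using that(2) by (intro ennreal_leI mult_right_mono) auto
    finally show ?thesis .
  qed
  have sym: "cmod (hartogs_kernel x y) = cmod (hartogs_kernel y x)" for x y by (subst hartogs_kernel_cnj) simp
  show ?thesis
  proof (intro exI[of _ "C powr p"] conjI allI impI)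
    fix G :: "complex \<times> complex \<Rightarrow> complex" assume G[measurable]: "G \<in> borel_measurable MH"
    have "(\<integral>\<^sup>+x. ennreal (cmod (proj_deriv 0 0 G x) powr p) \<partial>MH) \<le> ennreal (C powr p) * (\<integral>\<^sup>+x. ennreal (cmod (G x) powr p) \<partial>MH)"
    proof (rule Schur_test[where k="\<lambda>x y. cmod (hartogs_kernel x y)" and \<Theta>=\<Theta> and q=q])
      show "sigma_finite_measure MH" by unfold_locales
      have "(\<lambda>x. (fst x, snd x)) \<in> MH \<Otimes>\<^sub>M MH \<rightarrow>\<^sub>M borel \<Otimes>\<^sub>M borel"
        using measurable_compose[OF measurable_snd id_MH_borel] measurable_compose[OF measurable_fst id_MH_borel] by (intro measurable_Pair) auto
      from measurable_compose[OF this hartogs_kernel_measurable] show "(\<lambda>x. cmod (hartogs_kernel (fst x) (snd x))) \<in> borel_measurable (MH \<Otimes>\<^sub>M MH)"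
        by simp
      show "\<Theta> \<in> borel_measurable MH" by (rule borel_measurable_MH) measurable
      show "(\<integral>\<^sup>+y. ennreal (cmod (hartogs_kernel x y) * \<Theta> y powr (- 1 / p)) \<partial>MH) \<le> ennreal (C * \<Theta> x powr (- 1 / p))" if "x \<in> space MH" for x
        using s[OF C1(2)[of x]] that by (simp add: C_def)
      show "(\<integral>\<^sup>+x. ennreal (cmod (hartogs_kernel x y) * \<Theta> x powr (- 1 / q)) \<partial>MH) \<le> ennreal (C * \<Theta> y powr (- 1 / q))" if "y \<in> space MH" for y
        using s[OF C2(2)[of y]] that by (simp add: C_def sym[of _ y])
      show "ennreal (cmod (proj_deriv 0 0 G x)) \<le> (\<integral>\<^sup>+y. ennreal (cmod (hartogs_kernel x y) * cmod (G y)) \<partial>MH)" if x: "x \<in> space MH" for x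
      proof -
        have e: "(\<integral>\<^sup>+y. ennreal (norm (kernel_deriv 0 0 x y * G y)) \<partial>MH) = (\<integral>\<^sup>+y. ennreal (cmod (hartogs_kernel x y) * cmod (G y)) \<partial>MH)"
          using x by (intro nn_integral_cong) (simp add: hartogs_kernel_eq_kernel_deriv norm_mult)
        show ?thesis unfolding e[symmetric] proj_deriv_def
          by (cases "integrable MH (\<lambda>y. kernel_deriv 0 0 x y * G y)")
             (auto intro: integral_norm_bound_ennreal simp: not_integrable_integral_eq)
      qed
    qed (use pq C \<Theta>_pos in auto)
    then show "Lp_norm_pow p (proj_deriv 0 0 G) \<le> ennreal (C powr p) * Lp_norm_pow p G" by (simp add: Lp_norm_pow_def)
  qed simp
qed

section \<open>Division by the fibre coordinate\<close>

text \<open>Here \<open>\<bar>\<eta>\<bar> > 1/2\<close>, and \<open>\<bar>\<eta> - w\<bar> > 1/4\<close> whenever \<open>\<bar>w\<bar> < 1/4\<close>, so that both \<open>1 / \<bar>\<eta>\<bar>\<close> and \<open>1 / \<bar>\<eta> - w\<bar>\<close> are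
  bounded.\<close>

definition annulus :: "complex set" where "annulus = ball 0 (3/4) - cball 0 (1/2)"

lemma annulus_measurable[measurable]: "annulus \<in> sets borel" by (simp add: annulus_def)

lemma annulus_iff: "z \<in> annulus \<longleftrightarrow> 1/2 < cmod z \<and> cmod z < 3/4" by (auto simp: annulus_def)

lemma emeasure_annulus: "emeasure lborel annulus = ennreal (5 * pi / 16)"
proof -
  have "emeasure lborel annulus = emeasure lborel (ball (0::complex) (3/4)) - emeasure lborel (cball (0::complex) (1/2))"
    unfolding annulus_def by (intro emeasure_Diff) (auto simp: emeasure_cball)
  also have "\<dots> = ennreal (pi * (3/4)\<^sup>2 - pi * (1/2)\<^sup>2)"
    by (subst ennreal_minus[symmetric]) (auto simp: emeasure_ball emeasure_cball unit_ball_vol_2)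
  also have "pi * (3/4)\<^sup>2 - pi * (1/2)\<^sup>2 = 5 * pi / 16" by (simp add: power2_eq_square)
  finally show ?thesis .
qed

text \<open>The Cauchy formula, averaged over the circles that make up the annulus. Integrating over an area
  instead of one circle lets \<open>L\<^sup>p\<close> norms on the disc control the right side. The factor \<open>5 \<pi> / 16\<close> is the area of
  the annulus.\<close>

lemma annulus_reproducing:
  assumes h: "h holomorphic_on ball 0 1" and w: "cmod w < 1/4"
  shows "(LINT \<eta>|lborel. indicator annulus \<eta> *\<^sub>R (h \<eta> * (\<eta> / (\<eta> - w)))) = of_real (5 * pi / 16) * h w"
proof -
  define F where "F = (\<lambda>\<eta>. indicator annulus \<eta> *\<^sub>R (h \<eta> * (\<eta> / (\<eta> - w))))"
  define A' where "A' = cball 0 (3/4) - ball (0::complex) (1/2)"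
  have A': "compact A'" unfolding A'_def by (rule compact_diff) auto
  have nw: "\<eta> - w \<noteq> 0" if "1/2 \<le> cmod \<eta>" for \<eta> using that w by auto
  have "continuous_on A' (\<lambda>\<eta>. h \<eta> * (\<eta> / (\<eta> - w)))"
    by (intro continuous_intros continuous_on_subset[OF holomorphic_on_imp_continuous_on[OF h]])
       (use nw in \<open>auto simp: A'_def\<close>)
  note bi = borel_integrable_compact[OF A' this]
  have "integrable lborel (\<lambda>\<eta>. indicator annulus \<eta> *\<^sub>R (indicator A' \<eta> *\<^sub>R (h \<eta> * (\<eta> / (\<eta> - w)))))"
    by (rule integrable_mult_indicator[OF _ bi]) simp
  also have "(\<lambda>\<eta>. indicator annulus \<eta> *\<^sub>R (indicator A' \<eta> *\<^sub>R (h \<eta> * (\<eta> / (\<eta> - w))))) = F"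
    by (auto simp: F_def fun_eq_iff indicator_def annulus_iff A'_def)
  finally have intF: "integrable lborel F" .
  have avg: "(LINT t|unit_interval. F (circle_param t * \<eta>)) = indicator annulus \<eta> *\<^sub>R h w" for \<eta>
  proof (cases "\<eta> \<in> annulus")
    case False
    then have "circle_param t * \<eta> \<notin> annulus" for t by (simp add: annulus_iff norm_mult)
    then show ?thesis using False by (simp add: F_def)
  next
    case True
    then have \<eta>: "1/2 < cmod \<eta>" "cmod \<eta> < 3/4" by (auto simp: annulus_iff)
    then have \<eta>0: "\<eta> \<noteq> 0" by auto
    have sub: "u * \<eta> \<in> ball 0 1" if "cmod u \<le> 1" for u
      using mult_right_mono[OF that norm_ge_zero[of \<eta>]] \<eta> by (simp add: norm_mult)
    have sub2: "(\<lambda>u. u * \<eta>) ` ball 0 1 \<subseteq> ball 0 1" using sub by auto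
    have hol: "(\<lambda>u. h (u * \<eta>)) holomorphic_on ball 0 1"
      by (intro holomorphic_on_compose_gen[OF _ h sub2, unfolded o_def] holomorphic_intros)
    have cont: "continuous_on (cball 0 1) (\<lambda>u. h (u * \<eta>))"
      by (intro continuous_on_compose2[OF holomorphic_on_imp_continuous_on[OF h]] continuous_intros) (use sub in auto)
    have w\<eta>: "w / \<eta> \<in> ball 0 1" using w \<eta> \<eta>0 by (simp add: norm_divide field_simps)
    have nz: "u * \<eta> - w \<noteq> 0" if "cmod u = 1" for u using that \<eta> by (intro nw) (simp add: norm_mult)
    have "(LINT t|unit_interval. h (circle_param t * \<eta>) * ((circle_param t * \<eta>) / (circle_param t * \<eta> - w))) = h w"
    proof (rule circle_average_contour[where g="\<lambda>u. h (u * \<eta>) * ((u * \<eta>) / (u * \<eta> - w))"])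
      show "continuous_on (sphere 0 1) (\<lambda>u. h (u * \<eta>) * ((u * \<eta>) / (u * \<eta> - w)))"
        by (intro continuous_intros continuous_on_subset[OF cont]) (use nz in auto)
      have "((\<lambda>u. h (u * \<eta>) / (u - w / \<eta>)) has_contour_integral 2 * of_real pi * \<i> * h (w / \<eta> * \<eta>)) (circlepath 0 1)"
        by (rule Cauchy_integral_circlepath[OF cont hol]) (use w\<eta> in simp)
      then have ci: "((\<lambda>u. h (u * \<eta>) / (u - w / \<eta>)) has_contour_integral 2 * of_real pi * \<i> * h w) (circlepath 0 1)"
        using \<eta>0 by simp
      show "((\<lambda>u. h (u * \<eta>) * ((u * \<eta>) / (u * \<eta> - w)) / u) has_contour_integral 2 * of_real pi * \<i> * h w) (circlepath 0 1)"
      proof (rule has_contour_integral_eq[OF ci])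
        fix u assume "u \<in> path_image (circlepath 0 1)"
        then have u: "cmod u = 1" by simp
        then have "u \<noteq> 0" by auto
        moreover have "u - w / \<eta> = (u * \<eta> - w) / \<eta>" using \<eta>0 by (simp add: field_simps)
        ultimately show "h (u * \<eta>) / (u - w / \<eta>) = h (u * \<eta>) * ((u * \<eta>) / (u * \<eta> - w)) / u" by simp
      qed
    qed
    moreover have "circle_param t * \<eta> \<in> annulus" for t using \<eta> by (simp add: annulus_iff norm_mult)
    ultimately show ?thesis using True by (simp add: F_def)
  qed
  have "(LINT \<eta>|lborel. F \<eta>) = (LINT \<eta>|lborel. indicator annulus \<eta> *\<^sub>R h w)"
    unfolding integral_rotation_average[OF intF] avg ..
  also have "\<dots> = measure lborel annulus *\<^sub>R h w"
    by (subst integral_scaleR_left) (auto simp: emeasure_annulus intro!: integrable_real_indicator)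
  also have "measure lborel annulus = 5 * pi / 16" by (simp add: measure_def emeasure_annulus)
  finally show ?thesis by (simp add: F_def scaleR_conv_of_real)
qed

text \<open>For \<open>\<bar>w\<bar> \<ge> 1/4\<close> the factor \<open>w\<^sup>a\<close> is bounded below. For \<open>\<bar>w\<bar> < 1/4\<close> the formula on the annulus and Hoelder's
  inequality bound \<open>V(w)\<close> pointwise, since \<open>\<bar>\<eta>\<bar>\<^sup>a \<ge> 2\<^sup>-\<^sup>a\<close> there. Instead of holomorphy only the formula is
  assumed, which passes through integrals in a parameter.\<close>

lemma fibre_division:
  assumes p: "p > 1"
  shows "\<exists>C\<ge>0. \<forall>V. V \<in> borel_measurable borel \<longrightarrow>
     (\<forall>w. cmod w < 1/4 \<longrightarrow> of_real (5 * pi / 16) * V w = (LINT \<eta>|lborel. indicator annulus \<eta> *\<^sub>R (V \<eta> * (\<eta> / (\<eta> - w))))) \<longrightarrow>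
     (\<integral>\<^sup>+w. ennreal (cmod (V w) powr p) * indicator (ball 0 1) w \<partial>lborel) \<le> ennreal C * (\<integral>\<^sup>+w. ennreal (cmod (w ^ a * V w) powr p) * indicator (ball 0 1) w \<partial>lborel)"
proof -
  define q where "q = p / (p - 1)"
  have pq: "p > 1" "q > 1" "1 / p + 1 / q = 1" using p by (auto simp: q_def field_simps)
  define m where "m = 5 * pi / 16"
  have m: "m > 0" by (simp add: m_def)
  define B where "B = m powr (1 / q)"
  have B: "B > 0" "B powr q = m" using m pq by (auto simp: B_def powr_powr)
  \<comment> \<open>\<open>3\<close> bounds \<open>\<bar>\<eta>\<bar> / \<bar>\<eta> - w\<bar>\<close> and \<open>2 ^ a\<close> bounds \<open>\<bar>\<eta>\<bar> powr - a\<close> on the annulus\<close>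
  define s where "s = m / (3 * 2 ^ a)"
  have s: "s > 0" using m by (simp add: s_def)
  define C where "C = (B / s) powr p"
  show ?thesis
  proof (intro exI[of _ "C * pi + (4 ^ a) powr p"] conjI allI impI)
    show "0 \<le> C * pi + (4 ^ a) powr p" by (simp add: C_def)
    fix V :: "complex \<Rightarrow> complex" assume V[measurable]: "V \<in> borel_measurable borel"
      and rep: "\<forall>w. cmod w < 1/4 \<longrightarrow> of_real (5 * pi / 16) * V w = (LINT \<eta>|lborel. indicator annulus \<eta> *\<^sub>R (V \<eta> * (\<eta> / (\<eta> - w))))"
    define J where "J = (\<integral>\<^sup>+w. ennreal (cmod (w ^ a * V w) powr p) * indicator (ball 0 1) w \<partial>lborel)"
    have near: "ennreal (cmod (V w) powr p) \<le> ennreal C * J" if w: "cmod w < 1/4" for w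
    proof -
      define f where "f = (\<lambda>\<eta>. cmod (\<eta> ^ a * V \<eta>) * indicator (ball 0 1) \<eta>)"
      have [measurable]: "f \<in> borel_measurable borel" unfolding f_def by measurable
      have "ennreal (m * cmod (V w)) = ennreal (norm (LINT \<eta>|lborel. indicator annulus \<eta> *\<^sub>R (V \<eta> * (\<eta> / (\<eta> - w)))))"
        unfolding rep[rule_format, OF w, symmetric] norm_mult norm_of_real m_def by simp
      also have "\<dots> \<le> (\<integral>\<^sup>+\<eta>. ennreal (norm (indicator annulus \<eta> *\<^sub>R (V \<eta> * (\<eta> / (\<eta> - w))))) \<partial>lborel)"
      proof (cases "integrable lborel (\<lambda>\<eta>. indicator annulus \<eta> *\<^sub>R (V \<eta> * (\<eta> / (\<eta> - w))))")
        case True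
        then show ?thesis by (rule integral_norm_bound_ennreal)
      next
        case False
        show ?thesis unfolding not_integrable_integral_eq[OF False] by simp
      qed
      also have "\<dots> \<le> (\<integral>\<^sup>+\<eta>. ennreal (3 * 2 ^ a) * ennreal (f \<eta> * indicator annulus \<eta>) \<partial>lborel)"
      proof (rule nn_integral_mono)
        fix \<eta> :: complex
        show "ennreal (norm (indicator annulus \<eta> *\<^sub>R (V \<eta> * (\<eta> / (\<eta> - w))))) \<le> ennreal (3 * 2 ^ a) * ennreal (f \<eta> * indicator annulus \<eta>)"
        proof (cases "\<eta> \<in> annulus")
          case True
          then have \<eta>: "1/2 < cmod \<eta>" "cmod \<eta> < 3/4" by (auto simp: annulus_iff)
          have "cmod \<eta> - cmod w \<le> cmod (\<eta> - w)" by (rule norm_triangle_ineq2)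
          then have d: "1/4 < cmod (\<eta> - w)" using \<eta> w by linarith
          have "cmod \<eta> / cmod (\<eta> - w) \<le> (3/4) / (1/4)" using d \<eta> by (intro frac_le) auto
          then have e1: "cmod (V \<eta>) * (cmod \<eta> / cmod (\<eta> - w)) \<le> cmod (V \<eta>) * 3" by (intro mult_left_mono) auto
          have "(1/2) ^ a \<le> cmod \<eta> ^ a" using \<eta> by (intro power_mono) auto
          then have "1 \<le> 2 ^ a * cmod \<eta> ^ a" by (simp add: power_divide field_simps)
          then have "cmod (V \<eta>) * 3 * 1 \<le> cmod (V \<eta>) * 3 * (2 ^ a * cmod \<eta> ^ a)" by (intro mult_left_mono) auto
          with e1 have "cmod (V \<eta>) * (cmod \<eta> / cmod (\<eta> - w)) \<le> (3 * 2 ^ a) * (cmod \<eta> ^ a * cmod (V \<eta>))" by (simp add: ac_simps)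
          then show ?thesis using True \<eta>
            by (simp add: f_def norm_mult norm_divide norm_power ennreal_mult[symmetric] ennreal_leI)
        qed simp
      qed
      also have "\<dots> = ennreal (3 * 2 ^ a) * (\<integral>\<^sup>+\<eta>. ennreal (f \<eta> * indicator annulus \<eta>) \<partial>lborel)"
        by (rule nn_integral_cmult) measurable
      finally have "ennreal (1 / (3 * 2 ^ a)) * ennreal (m * cmod (V w)) \<le> ennreal (1 / (3 * 2 ^ a)) * (ennreal (3 * 2 ^ a) * (\<integral>\<^sup>+\<eta>. ennreal (f \<eta> * indicator annulus \<eta>) \<partial>lborel))"
        by (rule mult_left_mono) simp
      moreover have "ennreal (1 / (3 * 2 ^ a)) * ennreal (3 * 2 ^ a) = 1" by (simp add: ennreal_mult[symmetric])
      moreover have "ennreal (1 / (3 * 2 ^ a)) * ennreal (m * cmod (V w)) = ennreal (s * cmod (V w))"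
        using m by (simp add: ennreal_mult[symmetric] s_def)
      ultimately have le: "ennreal (s * cmod (V w)) \<le> (\<integral>\<^sup>+\<eta>. ennreal (f \<eta> * indicator annulus \<eta>) \<partial>lborel)"
        by (simp add: mult.assoc[symmetric])
      have "ennreal ((s * cmod (V w)) powr p) \<le> ennreal (B powr p) * (\<integral>\<^sup>+\<eta>. ennreal (f \<eta> powr p) \<partial>lborel)"
      proof (rule Holder_powr[OF pq, where g="indicator annulus"])
        have "(\<integral>\<^sup>+x. ennreal (indicator annulus x powr q) \<partial>lborel) = (\<integral>\<^sup>+x. indicator annulus x \<partial>(lborel :: complex measure))"
          using pq by (intro nn_integral_cong) (auto simp: indicator_def)
        then show "(\<integral>\<^sup>+x. ennreal (indicator annulus x powr q) \<partial>(lborel :: complex measure)) \<le> ennreal (B powr q)"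
          by (simp add: emeasure_annulus B(2) m_def)
      qed (use B s le in \<open>auto simp: f_def\<close>)
      also have "(\<integral>\<^sup>+\<eta>. ennreal (f \<eta> powr p) \<partial>lborel) = J"
        unfolding J_def f_def using p by (intro nn_integral_cong) (auto simp: indicator_def)
      finally have *: "ennreal ((s * cmod (V w)) powr p) \<le> ennreal (B powr p) * J" .
      have "ennreal (cmod (V w) powr p) = ennreal ((1 / s) powr p) * ennreal ((s * cmod (V w)) powr p)"
        using s by (simp add: ennreal_mult[symmetric] powr_mult[symmetric])
      also have "\<dots> \<le> ennreal ((1 / s) powr p) * (ennreal (B powr p) * J)" by (intro mult_left_mono *) simp
      also have "\<dots> = ennreal C * J"
        using s B by (simp add: C_def mult.assoc[symmetric] ennreal_mult[symmetric] powr_mult[symmetric])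
      finally show ?thesis .
    qed
    have "(\<integral>\<^sup>+w. ennreal (cmod (V w) powr p) * indicator (ball 0 1) w \<partial>lborel)
      \<le> (\<integral>\<^sup>+w. (ennreal C * J) * indicator (ball 0 1) w + ennreal ((4 ^ a) powr p) * (ennreal (cmod (w ^ a * V w) powr p) * indicator (ball 0 1) w) \<partial>lborel)"
    proof (rule nn_integral_mono)
      fix w :: complex
      show "ennreal (cmod (V w) powr p) * indicator (ball 0 1) w \<le> (ennreal C * J) * indicator (ball 0 1) w + ennreal ((4 ^ a) powr p) * (ennreal (cmod (w ^ a * V w) powr p) * indicator (ball 0 1) w)"
      proof (cases "cmod w < 1/4")
        case True
        have "ennreal (cmod (V w) powr p) * indicator (ball 0 1) w \<le> (ennreal C * J) * indicator (ball 0 1) w"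
          by (intro mult_right_mono near[OF True]) simp
        then show ?thesis by (rule order.trans) simp
      next
        case False
        have "(1/4) ^ a \<le> cmod w ^ a" using False by (intro power_mono) auto
        then have "1 \<le> 4 ^ a * cmod w ^ a" by (simp add: power_divide field_simps)
        then have "1 * cmod (V w) \<le> 4 ^ a * cmod w ^ a * cmod (V w)" by (intro mult_right_mono) auto
        then have "cmod (V w) powr p \<le> (4 ^ a * cmod (w ^ a * V w)) powr p"
          using p by (intro powr_mono2) (auto simp: norm_mult norm_power mult.assoc)
        also have "\<dots> = (4 ^ a) powr p * cmod (w ^ a * V w) powr p" by (simp add: powr_mult)
        finally have "ennreal (cmod (V w) powr p) \<le> ennreal ((4 ^ a) powr p) * ennreal (cmod (w ^ a * V w) powr p)"
          by (simp add: ennreal_mult[symmetric] ennreal_leI)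
        then have "ennreal (cmod (V w) powr p) * indicator (ball 0 1) w \<le> (ennreal ((4 ^ a) powr p) * ennreal (cmod (w ^ a * V w) powr p)) * indicator (ball 0 1) w"
          by (rule mult_right_mono) simp
        also have "\<dots> = ennreal ((4 ^ a) powr p) * (ennreal (cmod (w ^ a * V w) powr p) * indicator (ball 0 1) w)" by (simp only: mult.assoc)
        finally show ?thesis by (rule order.trans) simp
      qed
    qed
    also have "\<dots> = (ennreal C * J) * ennreal pi + ennreal ((4 ^ a) powr p) * J"
    proof (subst nn_integral_add)
      have "(\<integral>\<^sup>+w. (ennreal C * J) * indicator (ball (0::complex) 1) w \<partial>lborel) = (ennreal C * J) * ennreal pi"
        by (subst nn_integral_cmult_indicator) (auto simp: emeasure_ball unit_ball_vol_2)
      moreover have "(\<integral>\<^sup>+w. ennreal ((4 ^ a) powr p) * (ennreal (cmod (w ^ a * V w) powr p) * indicator (ball 0 1) w) \<partial>lborel) = ennreal ((4 ^ a) powr p) * J"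
        unfolding J_def by (rule nn_integral_cmult) measurable
      ultimately show "(\<integral>\<^sup>+w. (ennreal C * J) * indicator (ball (0::complex) 1) w \<partial>lborel) + (\<integral>\<^sup>+w. ennreal ((4 ^ a) powr p) * (ennreal (cmod (w ^ a * V w) powr p) * indicator (ball 0 1) w) \<partial>lborel)
        = (ennreal C * J) * ennreal pi + ennreal ((4 ^ a) powr p) * J" by simp
    qed measurable
    also have "\<dots> = ennreal (C * pi + (4 ^ a) powr p) * J"
      by (simp add: C_def ennreal_plus ennreal_mult algebra_simps)
    finally show "(\<integral>\<^sup>+w. ennreal (cmod (V w) powr p) * indicator (ball 0 1) w \<partial>lborel) \<le> ennreal (C * pi + (4 ^ a) powr p) * (\<integral>\<^sup>+w. ennreal (cmod (w ^ a * V w) powr p) * indicator (ball 0 1) w \<partial>lborel)"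
      unfolding J_def .
  qed
qed

lemma kernel_deriv_fibre_holomorphic:
  assumes \<zeta>: "\<zeta> \<in> HT" and t: "cmod t < 1" "t \<noteq> 0"
  shows "(\<lambda>w. kernel_deriv a b (w * t, t) \<zeta>) holomorphic_on ball 0 1"
proof -
  have "\<exists>d. ((\<lambda>w. kernel_deriv a b (w * t, t) \<zeta>) has_field_derivative d) (at w)" if wb: "w \<in> ball 0 1" for w
  proof -
    have z: "(w * t, t) \<in> HT" using wb t by (simp add: hartogs_iff norm_mult)
    obtain c where c: "has_cderiv (base_kernel_d a b) (c (conj_prod (w * t, t) \<zeta>)) (base_kernel_d a (Suc b) (conj_prod (w * t, t) \<zeta>)) (conj_prod (w * t, t) \<zeta>)"
      using base_kernel_d_derivative_snd[of a b] conj_prod_hartogs[OF z \<zeta>] by blast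
    define X where "X = c (conj_prod (w * t, t) \<zeta>)"
    define Y where "Y = base_kernel_d a (Suc b) (conj_prod (w * t, t) \<zeta>)"
    have D: "((\<lambda>z. base_kernel_d a b (conj_prod z \<zeta>)) has_derivative (\<lambda>v. X * cnj (fst \<zeta>) * fst v + Y * cnj (snd \<zeta>) * snd v)) (at (w * t, t))"
      unfolding X_def Y_def by (rule has_cderiv_imp_conj_prod_left[OF c])
    have "((\<lambda>w. (w * t, t)) has_derivative (\<lambda>h. (h * t, 0))) (at w)" by (auto intro!: derivative_eq_intros)
    from has_derivative_compose[OF this D] have "((\<lambda>w. base_kernel_d a b (conj_prod (w * t, t) \<zeta>)) has_derivative (\<lambda>h. (X * cnj (fst \<zeta>) * t) * h)) (at w)"
      by (simp add: ac_simps)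
    then have "((\<lambda>w. base_kernel_d a b (conj_prod (w * t, t) \<zeta>)) has_field_derivative (X * cnj (fst \<zeta>) * t)) (at w)"
      unfolding has_field_derivative_def .
    from DERIV_cmult[OF this, of "cnj (fst \<zeta>) ^ a * cnj (snd \<zeta>) ^ b"]
    show ?thesis unfolding kernel_deriv_def by blast
  qed
  then show ?thesis by (simp add: holomorphic_on_open)
qed

interpretation lM: pair_sigma_finite "lborel :: complex measure" MH ..

text \<open>The formula holds for the kernel, which is holomorphic on the fibre, and Fubini's theorem gives it
  for the integral against \<open>f\<close>.\<close>

lemma proj_deriv_fibre_reproducing:
  assumes f: "f \<in> borel_measurable MH" and i: "integrable MH (\<lambda>z. cmod (f z) / cmod (snd z))"
    and t: "cmod t < 1" "t \<noteq> 0" and w: "cmod w < 1/4"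
  shows "of_real (5 * pi / 16) * proj_deriv a b f (w * t, t) = (LINT \<eta>|lborel. indicator annulus \<eta> *\<^sub>R (proj_deriv a b f (\<eta> * t, t) * (\<eta> / (\<eta> - w))))"
proof -
  note [measurable] = f
  define K where "K = (\<lambda>\<eta>. (\<eta> * t, t)) ` cball 0 (3/4)"
  have K: "compact K" unfolding K_def by (intro compact_continuous_image continuous_intros) auto
  have KH: "K \<subseteq> HT"
  proof
    fix z assume "z \<in> K"
    then obtain \<eta> where "\<eta> \<in> cball 0 (3/4)" and "z = (\<eta> * t, t)" unfolding K_def by blast
    then have e: "z = (\<eta> * t, t)" "cmod \<eta> \<le> 3/4" by simp_all
    have "cmod \<eta> * cmod t \<le> 3/4 * cmod t" using e by (intro mult_right_mono) auto
    also have "\<dots> < 1 * cmod t" using t by (intro mult_strict_right_mono) auto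
    finally show "z \<in> HT" using t by (simp add: e(1) hartogs_iff norm_mult)
  qed
  obtain B where B: "B \<ge> 0" "\<And>z. z \<in> K \<Longrightarrow> (LINT \<zeta>|MH. cmod (kernel_deriv a b z \<zeta> * f \<zeta>)) \<le> B"
    using kernel_deriv_mult_norm_bound[OF f i K KH, of a b] by blast
  define X where "X = (\<lambda>\<eta> \<zeta>. indicator annulus \<eta> *\<^sub>R ((kernel_deriv a b (\<eta> * t, t) \<zeta> * f \<zeta>) * (\<eta> / (\<eta> - w))))"
  have fm: "(\<lambda>\<eta>. (\<eta> * t, t)) \<in> borel \<rightarrow>\<^sub>M borel" by (intro borel_measurable_continuous_onI continuous_intros)
  have Xm: "(\<lambda>(\<eta>, \<zeta>). X \<eta> \<zeta>) \<in> borel_measurable (lborel \<Otimes>\<^sub>M MH)"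
    using kernel_deriv_measurable_pair[of "\<lambda>\<eta>. (\<eta> * t, t)" lborel a b] fm unfolding split_beta' X_def by measurable
  have inK: "(\<eta> * t, t) \<in> K" if "\<eta> \<in> annulus" for \<eta> using that by (auto simp: K_def annulus_iff)
  have q3: "cmod (\<eta> / (\<eta> - w)) \<le> 3" if "\<eta> \<in> annulus" for \<eta>
  proof -
    have \<eta>: "1/2 < cmod \<eta>" "cmod \<eta> < 3/4" using that by (auto simp: annulus_iff)
    have "cmod \<eta> - cmod w \<le> cmod (\<eta> - w)" by (rule norm_triangle_ineq2)
    then have d: "1/4 < cmod (\<eta> - w)" using \<eta> w by linarith
    have "cmod \<eta> / cmod (\<eta> - w) \<le> (3/4) / (1/4)" using d \<eta> by (intro frac_le) auto
    then show ?thesis by (simp add: norm_divide)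
  qed
  have int: "integrable (lborel \<Otimes>\<^sub>M MH) (\<lambda>(\<eta>, \<zeta>). X \<eta> \<zeta>)"
  proof (rule lM.Fubini_integrable[OF Xm])
    show "AE \<eta> in lborel. integrable MH (\<lambda>\<zeta>. case (\<eta>, \<zeta>) of (\<eta>, \<zeta>) \<Rightarrow> X \<eta> \<zeta>)"
    proof (rule AE_I2)
      fix \<eta>
      show "integrable MH (\<lambda>\<zeta>. case (\<eta>, \<zeta>) of (\<eta>, \<zeta>) \<Rightarrow> X \<eta> \<zeta>)"
      proof (cases "\<eta> \<in> annulus")
        case True
        then have "(\<eta> * t, t) \<in> HT" using inK KH by blast
        from kernel_deriv_mult_integrable[OF f i this, of a b] show ?thesis unfolding prod.case X_def by (intro integrable_scaleR_right integrable_mult_left)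
      qed (simp add: X_def)
    qed
    show "integrable lborel (\<lambda>\<eta>. LINT \<zeta>|MH. norm (case (\<eta>, \<zeta>) of (\<eta>, \<zeta>) \<Rightarrow> X \<eta> \<zeta>))"
    proof (rule Bochner_Integration.integrable_bound[where f="\<lambda>\<eta>. (B * 3) * indicator annulus \<eta>"])
      show "integrable lborel (\<lambda>\<eta>. (B * 3) * indicator annulus \<eta>)"
        by (intro integrable_mult_right integrable_real_indicator) (auto simp: emeasure_annulus)
      show "(\<lambda>\<eta>. LINT \<zeta>|MH. norm (case (\<eta>, \<zeta>) of (\<eta>, \<zeta>) \<Rightarrow> X \<eta> \<zeta>)) \<in> borel_measurable lborel"
        using Xm by (intro MH.borel_measurable_lebesgue_integral) (simp add: split_beta')
      show "AE \<eta> in lborel. norm (LINT \<zeta>|MH. norm (case (\<eta>, \<zeta>) of (\<eta>, \<zeta>) \<Rightarrow> X \<eta> \<zeta>)) \<le> norm ((B * 3) * indicator annulus \<eta>)"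
      proof (rule AE_I2)
        fix \<eta>
        show "norm (LINT \<zeta>|MH. norm (case (\<eta>, \<zeta>) of (\<eta>, \<zeta>) \<Rightarrow> X \<eta> \<zeta>)) \<le> norm ((B * 3) * indicator annulus \<eta>)"
        proof (cases "\<eta> \<in> annulus")
          case True
          have e: "(LINT \<zeta>|MH. norm (case (\<eta>, \<zeta>) of (\<eta>, \<zeta>) \<Rightarrow> X \<eta> \<zeta>)) = (LINT \<zeta>|MH. cmod (kernel_deriv a b (\<eta> * t, t) \<zeta> * f \<zeta>)) * cmod (\<eta> / (\<eta> - w))"
            unfolding prod.case X_def norm_scaleR norm_mult[of _ "\<eta> / (\<eta> - w)"] using True by (simp only: indicator_simps abs_one mult_1 integral_mult_left_zero)
          have "(LINT \<zeta>|MH. cmod (kernel_deriv a b (\<eta> * t, t) \<zeta> * f \<zeta>)) * cmod (\<eta> / (\<eta> - w)) \<le> B * 3"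
            using B inK[OF True] q3[OF True] by (intro mult_mono) auto
          moreover have "0 \<le> (LINT \<zeta>|MH. cmod (kernel_deriv a b (\<eta> * t, t) \<zeta> * f \<zeta>))" by (rule integral_nonneg_AE) auto
          ultimately show ?thesis unfolding e using True B by (simp add: abs_mult)
        qed (simp add: X_def)
      qed
    qed
  qed
  have "(LINT \<eta>|lborel. indicator annulus \<eta> *\<^sub>R (proj_deriv a b f (\<eta> * t, t) * (\<eta> / (\<eta> - w)))) = (LINT \<eta>|lborel. LINT \<zeta>|MH. X \<eta> \<zeta>)"
    unfolding proj_deriv_def X_def by (simp only: integral_scaleR_right integral_mult_left_zero)
  also have "\<dots> = (LINT \<zeta>|MH. LINT \<eta>|lborel. X \<eta> \<zeta>)" by (rule lM.Fubini_integral[OF int, symmetric])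
  also have "\<dots> = (LINT \<zeta>|MH. of_real (5 * pi / 16) * (kernel_deriv a b (w * t, t) \<zeta> * f \<zeta>))"
  proof (rule Bochner_Integration.integral_cong[OF refl])
    fix \<zeta> assume "\<zeta> \<in> space MH"
    then have \<zeta>: "\<zeta> \<in> HT" by simp
    have "(\<lambda>\<eta>. X \<eta> \<zeta>) = (\<lambda>\<eta>. f \<zeta> * (indicator annulus \<eta> *\<^sub>R (kernel_deriv a b (\<eta> * t, t) \<zeta> * (\<eta> / (\<eta> - w)))))"
      by (simp add: X_def fun_eq_iff scaleR_conv_of_real)
    then have "(LINT \<eta>|lborel. X \<eta> \<zeta>) = f \<zeta> * (LINT \<eta>|lborel. indicator annulus \<eta> *\<^sub>R (kernel_deriv a b (\<eta> * t, t) \<zeta> * (\<eta> / (\<eta> - w))))"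
      by (simp only: integral_mult_right_zero)
    then show "(LINT \<eta>|lborel. X \<eta> \<zeta>) = of_real (5 * pi / 16) * (kernel_deriv a b (w * t, t) \<zeta> * f \<zeta>)"
      unfolding annulus_reproducing[OF kernel_deriv_fibre_holomorphic[OF \<zeta> t] w] by (simp add: ac_simps)
  qed
  also have "\<dots> = of_real (5 * pi / 16) * proj_deriv a b f (w * t, t)" unfolding proj_deriv_def by (rule integral_mult_right_zero)
  finally show ?thesis by simp
qed

text \<open>On the fibre over \<open>t\<close> both sides are \<open>\<bar>t\<bar>\<close> to the power \<open>(a + b) p + 2\<close> times the two sides of
  \<open>fibre_division\<close>.\<close>

lemma hartogs_fibre_division:
  assumes p: "p > 1"
  shows "\<exists>C\<ge>0. \<forall>f. f \<in> borel_measurable MH \<longrightarrow> integrable MH (\<lambda>z. cmod (f z) / cmod (snd z)) \<longrightarrow>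
     Lp_norm_pow p (\<lambda>z. snd z ^ (a + b) * proj_deriv a b f z) \<le> ennreal C * Lp_norm_pow p (\<lambda>z. fst z ^ a * snd z ^ b * proj_deriv a b f z)"
proof -
  obtain C where C: "C \<ge> 0" "\<And>V. V \<in> borel_measurable borel \<Longrightarrow>
     (\<And>w. cmod w < 1/4 \<Longrightarrow> of_real (5 * pi / 16) * V w = (LINT \<eta>|lborel. indicator annulus \<eta> *\<^sub>R (V \<eta> * (\<eta> / (\<eta> - w))))) \<Longrightarrow>
     (\<integral>\<^sup>+w. ennreal (cmod (V w) powr p) * indicator (ball 0 1) w \<partial>lborel) \<le> ennreal C * (\<integral>\<^sup>+w. ennreal (cmod (w ^ a * V w) powr p) * indicator (ball 0 1) w \<partial>lborel)"
    using fibre_division[OF p, of a] by blast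
  show ?thesis
  proof (intro exI[of _ C] conjI allI impI)
    fix f assume f: "f \<in> borel_measurable MH" and i: "integrable MH (\<lambda>z. cmod (f z) / cmod (snd z))"
    have vm[measurable]: "proj_deriv a b f \<in> borel_measurable borel" by (rule proj_deriv_measurable[OF f])
    have [measurable]: "\<Psi> \<in> (borel \<Otimes>\<^sub>M borel) \<rightarrow>\<^sub>M borel" "\<rho> \<in> borel_measurable (borel \<Otimes>\<^sub>M borel)"
      using \<Psi>_measurable \<rho>_measurable by (simp_all add: borel_prod)
    have fib: "Lp_norm_pow p F = (\<integral>\<^sup>+t. \<integral>\<^sup>+w. ennreal (cmod (F (\<Psi> (w, t))) powr p) * ennreal (\<rho> (w, t)) \<partial>lborel \<partial>lborel)"
      if [measurable]: "F \<in> borel_measurable borel" for F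
    proof -
      have "Lp_norm_pow p F = (\<integral>\<^sup>+z. ennreal (cmod (F z) powr p) * indicator HT z \<partial>lborel)"
        unfolding Lp_norm_pow_def by (rule nn_integral_lebesgue_on) measurable
      also have "\<dots> = (\<integral>\<^sup>+t. \<integral>\<^sup>+w. ennreal (cmod (F (\<Psi> (w, t))) powr p) * ennreal (\<rho> (w, t)) \<partial>lborel \<partial>lborel)"
        by (rule nn_integral_hartogs) measurable
      finally show ?thesis .
    qed
    define F1 where "F1 = (\<lambda>z. snd z ^ (a + b) * proj_deriv a b f z)"
    define F2 where "F2 = (\<lambda>z. fst z ^ a * snd z ^ b * proj_deriv a b f z)"
    have [measurable]: "F1 \<in> borel_measurable borel" "F2 \<in> borel_measurable borel" unfolding F1_def F2_def by measurable
    have "Lp_norm_pow p F1 \<le> (\<integral>\<^sup>+t. ennreal C * (\<integral>\<^sup>+w. ennreal (cmod (F2 (\<Psi> (w, t))) powr p) * ennreal (\<rho> (w, t)) \<partial>lborel) \<partial>lborel)"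
      unfolding fib[of F1, simplified]
    proof (rule nn_integral_mono)
      fix t :: complex
      show "(\<integral>\<^sup>+w. ennreal (cmod (F1 (\<Psi> (w, t))) powr p) * ennreal (\<rho> (w, t)) \<partial>lborel) \<le> ennreal C * (\<integral>\<^sup>+w. ennreal (cmod (F2 (\<Psi> (w, t))) powr p) * ennreal (\<rho> (w, t)) \<partial>lborel)"
      proof (cases "cmod t < 1 \<and> t \<noteq> 0")
        case False
        then have "\<rho> (w, t) = 0" for w by (auto simp: \<rho>_def)
        then show ?thesis by simp
      next
        case True
        then have t: "cmod t < 1" "t \<noteq> 0" by auto
        define V where "V = (\<lambda>w. proj_deriv a b f (w * t, t))"
        have Vm[measurable]: "V \<in> borel_measurable borel" unfolding V_def
          by (rule measurable_compose[OF _ vm]) (intro borel_measurable_continuous_onI continuous_intros)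
        define c where "c = cmod t powr (real (a + b) * p) * (cmod t)\<^sup>2"
        have c: "c \<ge> 0" by (simp add: c_def)
        have tp: "(cmod t ^ (a + b)) powr p = cmod t powr (real (a + b) * p)"
          using t by (simp only: powr_realpow[symmetric] powr_powr zero_less_norm_iff simp_thms)
        have weight: "ennreal (cmod (t ^ (a + b) * v) powr p) * ennreal (\<rho> (w, t)) = ennreal c * (ennreal (cmod v powr p) * indicator (ball 0 1) w)" for v w :: complex
        proof (cases "cmod w < 1")
          case True
          then have r: "\<rho> (w, t) = (cmod t)\<^sup>2" using t by (simp add: \<rho>_def)
          have "cmod (t ^ (a + b) * v) powr p * (cmod t)\<^sup>2 = c * cmod v powr p"
            unfolding norm_mult norm_power[of t "a + b"] c_def by (simp only: powr_mult norm_ge_zero zero_le_power tp ac_simps)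
          then show ?thesis unfolding r using True by (simp add: c ennreal_mult[symmetric])
        qed (simp add: \<rho>_def)
        have e1: "(\<integral>\<^sup>+w. ennreal (cmod (F1 (\<Psi> (w, t))) powr p) * ennreal (\<rho> (w, t)) \<partial>lborel) = ennreal c * (\<integral>\<^sup>+w. ennreal (cmod (V w) powr p) * indicator (ball 0 1) w \<partial>lborel)"
        proof -
          have "(\<integral>\<^sup>+w. ennreal (cmod (F1 (\<Psi> (w, t))) powr p) * ennreal (\<rho> (w, t)) \<partial>lborel) = (\<integral>\<^sup>+w. ennreal c * (ennreal (cmod (V w) powr p) * indicator (ball 0 1) w) \<partial>lborel)"
          proof (rule nn_integral_cong)
            fix w :: complex
            have F1e: "F1 (\<Psi> (w, t)) = t ^ (a + b) * V w"
              by (simp add: F1_def \<Psi>_def V_def)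
            show "ennreal (cmod (F1 (\<Psi> (w, t))) powr p) * ennreal (\<rho> (w, t)) = ennreal c * (ennreal (cmod (V w) powr p) * indicator (ball 0 1) w)"
              unfolding F1e by (rule weight)
          qed
          also have "\<dots> = ennreal c * (\<integral>\<^sup>+w. ennreal (cmod (V w) powr p) * indicator (ball 0 1) w \<partial>lborel)"
            by (rule nn_integral_cmult) measurable
          finally show ?thesis .
        qed
        have e2: "(\<integral>\<^sup>+w. ennreal (cmod (F2 (\<Psi> (w, t))) powr p) * ennreal (\<rho> (w, t)) \<partial>lborel) = ennreal c * (\<integral>\<^sup>+w. ennreal (cmod (w ^ a * V w) powr p) * indicator (ball 0 1) w \<partial>lborel)"
        proof -
          have "(\<integral>\<^sup>+w. ennreal (cmod (F2 (\<Psi> (w, t))) powr p) * ennreal (\<rho> (w, t)) \<partial>lborel) = (\<integral>\<^sup>+w. ennreal c * (ennreal (cmod (w ^ a * V w) powr p) * indicator (ball 0 1) w) \<partial>lborel)"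
          proof (rule nn_integral_cong)
            fix w :: complex
            have F2e: "F2 (\<Psi> (w, t)) = t ^ (a + b) * (w ^ a * V w)"
              by (simp add: F2_def \<Psi>_def V_def power_mult_distrib power_add)
            show "ennreal (cmod (F2 (\<Psi> (w, t))) powr p) * ennreal (\<rho> (w, t)) = ennreal c * (ennreal (cmod (w ^ a * V w) powr p) * indicator (ball 0 1) w)"
              unfolding F2e by (rule weight)
          qed
          also have "\<dots> = ennreal c * (\<integral>\<^sup>+w. ennreal (cmod (w ^ a * V w) powr p) * indicator (ball 0 1) w \<partial>lborel)"
            by (rule nn_integral_cmult) measurable
          finally show ?thesis .
        qed
        have "(\<integral>\<^sup>+w. ennreal (cmod (V w) powr p) * indicator (ball 0 1) w \<partial>lborel) \<le> ennreal C * (\<integral>\<^sup>+w. ennreal (cmod (w ^ a * V w) powr p) * indicator (ball 0 1) w \<partial>lborel)"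
          by (rule C(2)[OF Vm]) (simp only: V_def proj_deriv_fibre_reproducing[OF f i t])
        then have "ennreal c * (\<integral>\<^sup>+w. ennreal (cmod (V w) powr p) * indicator (ball 0 1) w \<partial>lborel) \<le> ennreal c * (ennreal C * (\<integral>\<^sup>+w. ennreal (cmod (w ^ a * V w) powr p) * indicator (ball 0 1) w \<partial>lborel))"
          by (rule mult_left_mono) simp
        then show ?thesis unfolding e1 e2 by (simp add: mult.left_commute)
      qed
    qed
    also have "\<dots> = ennreal C * (\<integral>\<^sup>+t. (\<integral>\<^sup>+w. ennreal (cmod (F2 (\<Psi> (w, t))) powr p) * ennreal (\<rho> (w, t)) \<partial>lborel) \<partial>lborel)"
      by (rule nn_integral_cmult) measurable
    also have "\<dots> = ennreal C * Lp_norm_pow p F2" using fib[of F2] by simp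
    finally show "Lp_norm_pow p (\<lambda>z. snd z ^ (a + b) * proj_deriv a b f z) \<le> ennreal C * Lp_norm_pow p (\<lambda>z. fst z ^ a * snd z ^ b * proj_deriv a b f z)"
      unfolding F1_def F2_def .
  qed (rule C(1))
qed

section \<open>The weighted Sobolev estimate\<close>

text \<open>The chain of estimates: \<open>\<bar>z\<^sub>2\<bar>\<^sup>k \<le> \<bar>z\<^sub>2\<bar>\<^sup>a\<^sup>+\<^sup>b\<close>, division by the fibre coordinate, the identity with a
  projection, and boundedness of the projection.\<close>

lemma weighted_derivative_bound:
  assumes p: "4 / 3 < p" "p < 4" and k: "a + b \<le> k"
  shows "\<exists>C\<ge>0. \<forall>f g I. sobolev_data k p f g I \<longrightarrow>
     (\<integral>\<^sup>+z. ennreal (cmod (proj_deriv a b f z) powr p * cmod (snd z) powr (real k * p)) \<partial>MH) \<le> ennreal C * I"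
proof -
  have p1: "p > 1" using p by simp
  obtain C1 where C1: "C1 \<ge> 0" "\<And>f g I. sobolev_data k p f g I \<Longrightarrow> \<exists>G. G \<in> borel_measurable MH \<and> Lp_norm_pow p G \<le> ennreal C1 * I \<and>
      (\<forall>z\<in>HT. fst z ^ a * snd z ^ b * proj_deriv a b f z = proj_deriv 0 0 G z)"
    using weighted_derivative_eq_projection[OF p(1) k] by blast
  obtain C2 where C2: "C2 \<ge> 0" "\<And>G. G \<in> borel_measurable MH \<Longrightarrow> Lp_norm_pow p (proj_deriv 0 0 G) \<le> ennreal C2 * Lp_norm_pow p G"
    using projection_Lp_bound[OF p] by blast
  obtain C3 where C3: "C3 \<ge> 0" "\<And>f. f \<in> borel_measurable MH \<Longrightarrow> integrable MH (\<lambda>z. cmod (f z) / cmod (snd z)) \<Longrightarrow>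
     Lp_norm_pow p (\<lambda>z. snd z ^ (a + b) * proj_deriv a b f z) \<le> ennreal C3 * Lp_norm_pow p (\<lambda>z. fst z ^ a * snd z ^ b * proj_deriv a b f z)"
    using hartogs_fibre_division[OF p1, of a b] by blast
  show ?thesis
  proof (intro exI[of _ "C3 * (C2 * C1)"] conjI allI impI)
    show "0 \<le> C3 * (C2 * C1)" using C1 C2 C3 by simp
    fix f g I assume s: "sobolev_data k p f g I"
    have fm: "f \<in> borel_measurable MH" "Lp_norm_pow p f < \<infinity>" using s by (auto simp: sobolev_data_def)
    have fd: "integrable MH (\<lambda>z. cmod (f z) / cmod (snd z))" using Lp_div_integrable[OF p(1) fm(1)] fm(2) by (simp add: Lp_norm_pow_def)
    obtain G where G: "G \<in> borel_measurable MH" "Lp_norm_pow p G \<le> ennreal C1 * I"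
      "\<And>z. z \<in> HT \<Longrightarrow> fst z ^ a * snd z ^ b * proj_deriv a b f z = proj_deriv 0 0 G z"
      using C1(2)[OF s] by blast
    have "(\<integral>\<^sup>+z. ennreal (cmod (proj_deriv a b f z) powr p * cmod (snd z) powr (real k * p)) \<partial>MH) \<le> Lp_norm_pow p (\<lambda>z. snd z ^ (a + b) * proj_deriv a b f z)"
      unfolding Lp_norm_pow_def
    proof (intro nn_integral_mono ennreal_leI)
      fix z assume "z \<in> space MH"
      then have z: "0 < cmod (snd z)" "cmod (snd z) < 1" using hartogs_snd_nonzero[of z] by (auto simp: hartogs_iff)
      have "cmod (snd z) powr (real k * p) \<le> cmod (snd z) powr (real (a + b) * p)"
        using z k p1 by (intro powr_mono') auto
      also have "\<dots> = (cmod (snd z) powr real (a + b)) powr p" by (simp add: powr_powr)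
      also have "\<dots> = cmod (snd z ^ (a + b)) powr p" using z by (simp add: powr_realpow norm_power del: of_nat_add)
      finally have "cmod (proj_deriv a b f z) powr p * cmod (snd z) powr (real k * p) \<le> cmod (proj_deriv a b f z) powr p * cmod (snd z ^ (a + b)) powr p"
        by (rule mult_left_mono) simp
      also have "\<dots> = cmod (snd z ^ (a + b) * proj_deriv a b f z) powr p" by (simp add: norm_mult powr_mult)
      finally show "cmod (proj_deriv a b f z) powr p * cmod (snd z) powr (real k * p) \<le> cmod (snd z ^ (a + b) * proj_deriv a b f z) powr p" .
    qed
    also have "\<dots> \<le> ennreal C3 * Lp_norm_pow p (\<lambda>z. fst z ^ a * snd z ^ b * proj_deriv a b f z)" by (rule C3(2)[OF fm(1) fd])
    also have "Lp_norm_pow p (\<lambda>z. fst z ^ a * snd z ^ b * proj_deriv a b f z) = Lp_norm_pow p (proj_deriv 0 0 G)"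
      unfolding Lp_norm_pow_def by (rule nn_integral_cong) (simp add: G(3))
    also have "ennreal C3 * Lp_norm_pow p (proj_deriv 0 0 G) \<le> ennreal C3 * (ennreal C2 * (ennreal C1 * I))"
      using C2(2)[OF G(1)] G(2) by (intro mult_left_mono order.trans[OF C2(2)[OF G(1)]]) auto
    also have "\<dots> = ennreal (C3 * (C2 * C1)) * I" using C1 C2 C3 by (simp add: ennreal_mult mult.assoc)
    finally show "(\<integral>\<^sup>+z. ennreal (cmod (proj_deriv a b f z) powr p * cmod (snd z) powr (real k * p)) \<partial>MH) \<le> ennreal (C3 * (C2 * C1)) * I" .
  qed
qed

text \<open>The function itself is bounded like its derivative of order \<open>0\<close>, which is a weak derivative and
  therefore equal to it only almost everywhere.\<close>

lemma sobolev_space_imp_data: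
  assumes p: "p > 0" and f: "f \<in> sobolev_space HT k p 0"
  shows "sobolev_data k p f (\<lambda>\<alpha>. weak_deriv HT \<alpha> f) (sobolev_integral HT k p 0 f)"
proof -
  have wirt: "has_weak_deriv HT \<alpha> f (weak_deriv HT \<alpha> f)" if "multi_order \<alpha> \<le> k" for \<alpha>
  proof -
    obtain g where "has_weak_deriv HT \<alpha> f g" using f \<open>multi_order \<alpha> \<le> k\<close> unfolding sobolev_space_def by blast
    then show ?thesis by (rule has_weak_deriv_weak_deriv)
  qed
  have f1: "f \<in> L1_loc HT" and fin: "sobolev_integral HT k p 0 f < \<infinity>" using f by (auto simp: sobolev_space_def)
  have bound: "Lp_norm_pow p (weak_deriv HT \<alpha> f) \<le> sobolev_integral HT k p 0 f" if \<alpha>: "multi_order \<alpha> \<le> k" for \<alpha>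
    unfolding Lp_norm_pow_def sobolev_integral_def
  proof (intro nn_integral_mono ennreal_leI)
    fix z assume "z \<in> space MH"
    then have z: "snd z \<noteq> 0" using hartogs_snd_nonzero by simp
    have "cmod (weak_deriv HT \<alpha> f z) powr p \<le> (\<Sum>\<alpha> | multi_order \<alpha> \<le> k. cmod (weak_deriv HT \<alpha> f z) powr p)"
      using \<alpha> by (intro member_le_sum finite_multi_order_le) auto
    then show "cmod (weak_deriv HT \<alpha> f z) powr p \<le> (\<Sum>\<alpha> | multi_order \<alpha> \<le> k. cmod (weak_deriv HT \<alpha> f z) powr p) * cmod (snd z) powr 0"
      using z by simp
  qed
  have ff: "has_weak_deriv HT (0, 0, 0, 0) f f" using f1 by (simp add: has_weak_deriv_def)
  have "AE z in MH. weak_deriv HT (0, 0, 0, 0) f z = f z" by (rule weak_deriv_AE[OF ff])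
  then have "AE z in MH. ennreal (cmod (f z) powr p) = ennreal (cmod (weak_deriv HT (0, 0, 0, 0) f z) powr p)" by eventually_elim simp
  then have "Lp_norm_pow p f = Lp_norm_pow p (weak_deriv HT (0, 0, 0, 0) f)" unfolding Lp_norm_pow_def by (rule nn_integral_cong_AE)
  also have "\<dots> \<le> sobolev_integral HT k p 0 f" by (rule bound) simp
  finally have fb: "Lp_norm_pow p f \<le> sobolev_integral HT k p 0 f" .
  have "weak_deriv HT \<alpha> f \<in> borel_measurable MH" if "multi_order \<alpha> \<le> k" for \<alpha>
    using wirt[OF that] by (intro L1_loc_measurable) (simp add: has_weak_deriv_def)
  moreover have "(LINT z|MH. f z * wirtinger_deriv \<alpha> \<phi> z) = (-1) ^ multi_order \<alpha> * (LINT z|MH. weak_deriv HT \<alpha> f z * \<phi> z)"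
    if "multi_order \<alpha> \<le> k" "test_function HT \<phi>" for \<alpha> \<phi>
    using wirt[OF that(1)] that(2) unfolding has_weak_deriv_def by blast
  ultimately show ?thesis using L1_loc_measurable[OF f1] fb fin bound unfolding sobolev_data_def by blast
qed

lemma L1_loc_cong: "(\<And>z. z \<in> HT \<Longrightarrow> f z = g z) \<Longrightarrow> f \<in> L1_loc HT \<Longrightarrow> g \<in> L1_loc HT"
  unfolding L1_loc_def
proof (intro CollectI allI impI)
  fix K assume eq: "\<And>z. z \<in> HT \<Longrightarrow> f z = g z" and f: "f \<in> {f. \<forall>K. compact K \<and> K \<subseteq> HT \<longrightarrow> f absolutely_integrable_on K}" and K: "compact K \<and> K \<subseteq> HT"
  then have "(\<lambda>z. indicator K z *\<^sub>R f z) = (\<lambda>z. indicator K z *\<^sub>R g z)" by (auto simp: fun_eq_iff indicator_def)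
  with f K show "g absolutely_integrable_on K" unfolding set_integrable_def mem_Collect_eq by metis
qed

theorem theorem1p2:
  fixes k :: nat and p :: real
  assumes "4 / 3 < p" and "p < 4"
  shows "\<exists>C>0. \<forall>f \<in> sobolev_space hartogs_triangle k p 0.
           bergman_projection hartogs_triangle f \<in> sobolev_space hartogs_triangle k p (real k * p) \<and>
           sobolev_norm hartogs_triangle k p (real k * p) (bergman_projection hartogs_triangle f)
             \<le> C * sobolev_norm hartogs_triangle k p 0 f"
proof -
  have p0: "p > 0" using assms by simp
  define D where "D = (\<lambda>f (\<alpha> :: multi_index). case \<alpha> of (a1, a2, a3, a4) \<Rightarrow> if a3 = 0 \<and> a4 = 0 then proj_deriv a1 a2 f else (\<lambda>z. 0))"
  define Q where "Q = (\<lambda>\<alpha> C. 0 \<le> C \<and> (\<forall>f g I. sobolev_data k p f g I \<longrightarrow>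
     (\<integral>\<^sup>+z. ennreal (cmod (D f \<alpha> z) powr p * cmod (snd z) powr (real k * p)) \<partial>MH) \<le> ennreal C * I))"
  have Q: "\<exists>C. multi_order \<alpha> \<le> k \<longrightarrow> Q \<alpha> C" for \<alpha>
  proof (cases "multi_order \<alpha> \<le> k")
    case \<alpha>: True
    obtain a1 a2 a3 a4 where \<alpha>e: "\<alpha> = (a1, a2, a3, a4)" by (cases \<alpha>)
    show ?thesis
    proof (cases "a3 = 0 \<and> a4 = 0")
      case True
      then show ?thesis using weighted_derivative_bound[OF assms, of a1 a2 k] \<alpha> by (simp add: \<alpha>e D_def Q_def)
    next
      case False
      then have "D f \<alpha> = (\<lambda>z. 0)" for f by (auto simp: \<alpha>e D_def)
      then show ?thesis using p0 by (intro exI[of _ 0]) (simp add: Q_def)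
    qed
  qed simp
  obtain c where "\<And>\<alpha>. multi_order \<alpha> \<le> k \<longrightarrow> Q \<alpha> (c \<alpha>)"
    using Q by metis
  then have c: "\<And>\<alpha>. multi_order \<alpha> \<le> k \<Longrightarrow> c \<alpha> \<ge> (0::real)"
    "\<And>\<alpha> f g I. multi_order \<alpha> \<le> k \<Longrightarrow> sobolev_data k p f g I \<Longrightarrow> (\<integral>\<^sup>+z. ennreal (cmod (D f \<alpha> z) powr p * cmod (snd z) powr (real k * p)) \<partial>MH) \<le> ennreal (c \<alpha>) * I"
    unfolding Q_def by blast+
  \<comment> \<open>the summand \<open>1\<close> makes the constant positive\<close>
  define C where "C = (\<Sum>\<alpha> | multi_order \<alpha> \<le> k. c \<alpha>) + 1"
  have C: "C > 0" unfolding C_def using c(1) by (intro add_nonneg_pos sum_nonneg) auto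
  show ?thesis
  proof (intro exI[of _ "C powr (1 / p)"] conjI ballI)
    show "0 < C powr (1 / p)" using C by simp
    fix f assume f: "f \<in> sobolev_space HT k p 0"
    define I where "I = sobolev_integral HT k p 0 f"
    have s: "sobolev_data k p f (\<lambda>\<alpha>. weak_deriv HT \<alpha> f) I" unfolding I_def by (rule sobolev_space_imp_data[OF p0 f])
    have I: "I < \<infinity>" using s by (simp add: sobolev_data_def)
    have fm: "f \<in> borel_measurable MH" "Lp_norm_pow p f < \<infinity>" using s by (auto simp: sobolev_data_def)
    have fd: "integrable MH (\<lambda>z. cmod (f z) / cmod (snd z))" using Lp_div_integrable[OF assms(1) fm(1)] fm(2) by (simp add: Lp_norm_pow_def)
    define u where "u = bergman_projection HT f"
    have uv: "u z = proj_deriv 0 0 f z" if "z \<in> HT" for z unfolding u_def by (rule bergman_projection_eq_proj_deriv[OF that])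
    have u1: "u \<in> L1_loc HT" by (rule L1_loc_cong[OF _ proj_deriv_L1_loc[OF fm(1) fd, of 0 0]]) (simp add: uv)
    have wirt: "has_weak_deriv HT \<alpha> u (D f \<alpha>)" for \<alpha>
    proof -
      obtain a1 a2 a3 a4 where \<alpha>e: "\<alpha> = (a1, a2, a3, a4)" by (cases \<alpha>)
      have "(LINT z|MH. u z * \<phi> z) = (LINT z|MH. proj_deriv 0 0 f z * \<phi> z)" for \<phi>
        by (rule Bochner_Integration.integral_cong) (auto simp: uv)
      then show ?thesis
        using projection_weak_deriv[OF fm(1) fd, of a1 a2 a3 a4] unfolding has_weak_deriv_def \<alpha>e D_def prod.case by simp
    qed
    have Dm: "D f \<alpha> \<in> borel_measurable MH" for \<alpha>
      using wirt[of \<alpha>] by (intro L1_loc_measurable) (simp add: has_weak_deriv_def)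
    have sm: "(\<lambda>z. cmod (snd z) powr (real k * p)) \<in> borel_measurable MH" by (rule borel_measurable_MH) measurable
    have "AE z in MH. \<forall>\<alpha>\<in>{\<alpha>. multi_order \<alpha> \<le> k}. weak_deriv HT \<alpha> u z = D f \<alpha> z"
      by (rule AE_finite_allI[OF finite_multi_order_le]) (rule weak_deriv_AE[OF wirt])
    then have "AE z in MH. ennreal ((\<Sum>\<alpha> | multi_order \<alpha> \<le> k. cmod (weak_deriv HT \<alpha> u z) powr p) * cmod (snd z) powr (real k * p))
       = (\<Sum>\<alpha> | multi_order \<alpha> \<le> k. ennreal (cmod (D f \<alpha> z) powr p * cmod (snd z) powr (real k * p)))"
    proof eventually_elim
      case (elim z)
      have "(\<Sum>\<alpha> | multi_order \<alpha> \<le> k. cmod (weak_deriv HT \<alpha> u z) powr p) = (\<Sum>\<alpha> | multi_order \<alpha> \<le> k. cmod (D f \<alpha> z) powr p)"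
        using elim by (intro sum.cong) auto
      then show ?case by (simp add: sum_distrib_right sum_ennreal)
    qed
    then have "sobolev_integral HT k p (real k * p) u = (\<integral>\<^sup>+z. (\<Sum>\<alpha> | multi_order \<alpha> \<le> k. ennreal (cmod (D f \<alpha> z) powr p * cmod (snd z) powr (real k * p))) \<partial>MH)"
      unfolding sobolev_integral_def by (rule nn_integral_cong_AE)
    also have "\<dots> = (\<Sum>\<alpha> | multi_order \<alpha> \<le> k. (\<integral>\<^sup>+z. ennreal (cmod (D f \<alpha> z) powr p * cmod (snd z) powr (real k * p)) \<partial>MH))"
    proof (rule nn_integral_sum)
      fix \<alpha>
      have [measurable]: "D f \<alpha> \<in> borel_measurable MH" "(\<lambda>z. cmod (snd z) powr (real k * p)) \<in> borel_measurable MH"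
        by (fact Dm sm)+
      show "(\<lambda>z. ennreal (cmod (D f \<alpha> z) powr p * cmod (snd z) powr (real k * p))) \<in> borel_measurable MH"
        by measurable
    qed
    also have "\<dots> \<le> (\<Sum>\<alpha> | multi_order \<alpha> \<le> k. ennreal (c \<alpha>) * I)"
      using c(2)[OF _ s] by (intro sum_mono) auto
    also have "\<dots> = ennreal (\<Sum>\<alpha> | multi_order \<alpha> \<le> k. c \<alpha>) * I"
    proof -
      have "(\<Sum>\<alpha> | multi_order \<alpha> \<le> k. ennreal (c \<alpha>)) = ennreal (\<Sum>\<alpha> | multi_order \<alpha> \<le> k. c \<alpha>)"
        using c(1) by (intro sum_ennreal) auto
      then show ?thesis by (simp only: sum_distrib_right[symmetric])
    qed
    also have "\<dots> \<le> ennreal C * I"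
      by (intro mult_right_mono ennreal_leI) (auto simp: C_def)
    finally have main: "sobolev_integral HT k p (real k * p) u \<le> ennreal C * I" .
    have CI: "ennreal C * I < \<infinity>" using I by (simp add: ennreal_mult_less_top)
    show "bergman_projection HT f \<in> sobolev_space HT k p (real k * p)"
      unfolding sobolev_space_def u_def[symmetric] using u1 wirt le_less_trans[OF main CI] by blast
    have "sobolev_norm HT k p (real k * p) u \<le> enn2real (ennreal C * I) powr (1 / p)"
      unfolding sobolev_norm_def using p0 main CI by (intro powr_mono2 enn2real_mono) auto
    also have "\<dots> = C powr (1 / p) * sobolev_norm HT k p 0 f"
      using C by (simp add: sobolev_norm_def I_def enn2real_mult powr_mult)
    finally show "sobolev_norm HT k p (real k * p) (bergman_projection HT f) \<le> C powr (1 / p) * sobolev_norm HT k p 0 f"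
      by (simp add: u_def)
  qed
qed

end
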